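(* Let $n\ge 2$, $s\in(0,1)$ and $\alpha\in(0,n-1)$. There exists a constant $c_o=c_o(n,\alpha,s)>0$ such that the following holds. If $E_\star\subset\mathbb{R}^n$ is a bounded, volume-constrained critical point of $F$ with smooth boundary such that $$|E_\star|^{\beta}\le c_o\, I(E_\star),$$ where $$\beta:=\frac{n+s-\alpha}{(2n+s+1)\,n}\qquad\text{and}\qquad I(E_\star):=\frac{|E_\star|^{1/n}}{\mathrm{diam}(E_\star)},$$ then $E_\star$ is a ball. Equivalently, for every $\varepsilon>0$, if $E\subset\mathbb{R}^n$ is a bounded, volume-constrained critical point of $F_\varepsilon$ with smooth boundary such that $$|E|=1\qquad\text{and}\qquad \mathrm{diam}(E)\le c_o\,\varepsilon^{-\frac{1}{2n+s+1}},$$ then $E$ is a ball.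
   Context: For a set $E\subset\mathbb{R}^n$, $|E|$ is its Lebesgue measure (volume), $E^c=\mathbb{R}^n\setminus E$, and the fractional perimeter is $$P_s(E):=\iint_{E\times E^c}\frac{dx\,dy}{|x-y|^{n+s}}.$$ The energies are $$F(E):=P_s(E)+\iint_{E\times E}\frac{dx\,dy}{|x-y|^{\alpha}},\qquad F_\varepsilon(E):=P_s(E)+\varepsilon\iint_{E\times E}\frac{dx\,dy}{|x-y|^{\alpha}}\quad(\varepsilon>0).$$ Sets are understood up to null sets; a bounded set with smooth boundary is a nonempty bounded open set whose boundary is a smooth embedded hypersurface (with the set lying locally on one side of it). A volume-constrained critical point of $G\in\{F,F_\varepsilon\}$ is a set $E$ such that $\frac{d}{dt}G(\Phi^t(E))\big|_{t=0}=0$ for every vector field $X\in C_c^\infty(\mathbb{R}^n;\mathbb{R}^n)$ whose flow $\Phi^t$ ($\partial_t\Phi^t=X(\Phi^t)$, $\Phi^0=\mathrm{Id}$) satisfies $|\Phi^t(E)|=|E|$ for all small $t$. For $E$ bounded with smooth boundary, such a critical point of $F_\varepsilon$ satisfies the Euler--Lagrange equation: there is $\lambda\in\mathbb{R}$ with $$\kappa_E(x)+c\,\varepsilon\,V_E(x)=\lambda\quad\text{for all }x\in\partial E,$$ (and with $\varepsilon=1$ for $F$), where $V_E(x):=\int_E\frac{dy}{|x-y|^{\alpha}}$, $\kappa_E(x):=\int_{\mathbb{R}^n}\frac{\chi_{\mathbb{R}^n\setminus E}(y)-\chi_E(y)}{|x-y|^{n+s}}\,dy$ in the principal value sense, and $c>0$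 is a normalizing constant ($c=2$ with the normalizations above). *)

theory Defs
  imports "HOL-Analysis.Analysis"
begin

(* C^k on an open set, by iterated directional derivatives; in finite dimension,
   continuity of all of these is continuity of the iterated Frechet derivatives. *)
primrec Ck_on :: "nat \<Rightarrow> 'a::real_normed_vector set \<Rightarrow> ('a \<Rightarrow> 'b::real_normed_vector) \<Rightarrow> bool" where
  "Ck_on 0 U f \<longleftrightarrow> continuous_on U f"
| "Ck_on (Suc k) U f \<longleftrightarrow>
     (\<forall>x\<in>U. f differentiable (at x)) \<and>
     (\<forall>v. Ck_on k U (\<lambda>x. frechet_derivative f (at x) v))"

definition smooth_on :: "'a::real_normed_vector set \<Rightarrow> ('a \<Rightarrow> 'b::real_normed_vector) \<Rightarrow> bool" where
  "smooth_on U f \<longleftrightarrow> (\<forall>k. Ck_on k U f)"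

definition test_field :: "('a::real_normed_vector \<Rightarrow> 'a) \<Rightarrow> bool" where
  "test_field X \<longleftrightarrow> smooth_on UNIV X \<and> compact (closure {x. X x \<noteq> 0})"

definition flow_of :: "('a::real_normed_vector \<Rightarrow> 'a) \<Rightarrow> (real \<Rightarrow> 'a \<Rightarrow> 'a) \<Rightarrow> bool" where
  "flow_of X \<Phi> \<longleftrightarrow>
     (\<forall>x. \<Phi> 0 x = x) \<and>
     (\<forall>t x. ((\<lambda>\<tau>. \<Phi> \<tau> x) has_vector_derivative X (\<Phi> t x)) (at t))"

(* The boundary is locally the regular zero set of a smooth function which is
   negative exactly on the side occupied by E. *)
definition smooth_boundary :: "'a::euclidean_space set \<Rightarrow> bool" where
  "smooth_boundary E \<longleftrightarrow>
     (\<forall>x\<in>frontier E. \<exists>U (\<rho> :: 'a \<Rightarrow> real).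
        open U \<and> x \<in> U \<and> smooth_on U \<rho> \<and>
        (\<forall>y\<in>U. frechet_derivative \<rho> (at y) \<noteq> (\<lambda>_. 0)) \<and>
        E \<inter> U = {y \<in> U. \<rho> y < 0} \<and>
        frontier E \<inter> U = {y \<in> U. \<rho> y = 0})"

definition bounded_smooth_set :: "'a::euclidean_space set \<Rightarrow> bool" where
  "bounded_smooth_set E \<longleftrightarrow> E \<noteq> {} \<and> bounded E \<and> open E \<and> smooth_boundary E"

definition frac_perimeter :: "real \<Rightarrow> (real ^ 'n) set \<Rightarrow> ennreal" where
  "frac_perimeter s E =
     (\<integral>\<^sup>+ z \<in> E \<times> (- E).
        ennreal (1 / norm (fst z - snd z) powr (real CARD('n) + s)) \<partial>lebesgue)"

(* On the diagonal, a null set, the integrand takes the value 0. *)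
definition riesz_energy :: "real \<Rightarrow> (real ^ 'n) set \<Rightarrow> ennreal" where
  "riesz_energy \<alpha> E =
     (\<integral>\<^sup>+ z \<in> E \<times> E. ennreal (1 / norm (fst z - snd z) powr \<alpha>) \<partial>lebesgue)"

definition F :: "real \<Rightarrow> real \<Rightarrow> (real ^ 'n) set \<Rightarrow> ennreal" where
  "F s \<alpha> E = frac_perimeter s E + riesz_energy \<alpha> E"

definition F_eps :: "real \<Rightarrow> real \<Rightarrow> real \<Rightarrow> (real ^ 'n) set \<Rightarrow> ennreal" where
  "F_eps s \<alpha> \<epsilon> E = frac_perimeter s E + ennreal \<epsilon> * riesz_energy \<alpha> E"

(* For s in (0,1) and 0 < alpha < n, both energies are finite on bounded sets with
   smooth boundary and on their images under the flows considered here, so enn2real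
   loses nothing there. *)
definition vol_critical :: "((real ^ 'n) set \<Rightarrow> ennreal) \<Rightarrow> (real ^ 'n) set \<Rightarrow> bool" where
  "vol_critical G E \<longleftrightarrow>
     (\<forall>X \<Phi>. test_field X \<longrightarrow> flow_of X \<Phi> \<longrightarrow>
        (\<forall>\<^sub>F t in nhds 0. emeasure lebesgue (\<Phi> t ` E) = emeasure lebesgue E) \<longrightarrow>
        ((\<lambda>t. enn2real (G (\<Phi> t ` E))) has_real_derivative 0) (at 0))"

definition iso_ratio :: "(real ^ 'n) set \<Rightarrow> real" where
  "iso_ratio E = measure lebesgue E powr (1 / real CARD('n)) / diameter E"

definition is_ball :: "'a::metric_space set \<Rightarrow> bool" where
  "is_ball E \<longleftrightarrow> (\<exists>x r. 0 < r \<and> E = ball x r)"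

end

theory Submission
  imports Defs
begin

text \<open>If the diameter of \<open>E\<close> is small, the difference \<open>K\<close> of the fractional and the Riesz kernel is
  decreasing at all distances that occur, and the method of moving planes applies. Consider a
  direction \<open>e\<close>, the first plane where the reflection of the cap of \<open>E\<close> stops being contained in \<open>E\<close>, and a
  contact point: an interior one, or one where \<open>e\<close> is tangent to the boundary. Suppose that \<open>E\<close> and its
  mirror image differ. Push the boundary outwards near the contact point, at scale \<open>\<rho>\<close>, and inwards
  symmetrically near the mirror point; the volume is preserved exactly. The two boundary graphs differ by a function
  of Lipschitz constant \<open>L\<close>, so the singular part of the interaction changes, per unit of volume moved,
  by at most \<open>C * L * \<rho> powr (-s)\<close>, whereas the asymmetry of \<open>E\<close> yields a gain proportional to the distance \<open>d\<close>
  to the plane. At an interior contact \<open>L\<close> is of order \<open>\<rho>\<close> and \<open>d\<close> of order \<open>1\<close>, at a tangential one \<open>L\<close> is of order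
  \<open>\<rho>\<^sup>2\<close> (the odd part of the graph vanishes to third order) and \<open>d\<close> of order \<open>\<rho>\<close>; since \<open>s < 1\<close>, both
  contradict criticality for small \<open>\<rho>\<close>. This replaces pointwise derivatives of the
  nonlocal mean curvature. Hence \<open>E\<close> is symmetric in every direction, and all planes of symmetry
  contain its barycentre.\<close>

section \<open>Measure-theoretic preliminaries\<close>

text \<open>The notion of criticality shapes the variation: it speaks only of flows that keep the
  volume exactly constant near time 0. The flow is therefore written in closed form; it translates
  the boundary graph exactly, and on the mirror side the reflected flow runs backwards, so gain and
  loss of volume cancel for every small t and not just to first order.

  Formally the energy is a multiple of the volume minus the self-interaction of \<open>E\<close>
  under r^(-(n+s)) - \<epsilon> r^(-\<alpha>), a kernel decreasing on (0, D] once \<epsilon>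
  \<alpha> D^(n+s-\<alpha>) < n + s; D is twice the diameter, which leaves room around
  \<open>E\<close>. As that multiple is infinite, the singular part of the kernel stays an
  interaction of \<open>E\<close> with its complement, and identities are arranged as equalities
  between sums of nonnegative terms.

  A one-sided estimate suffices: for t > 0 the difference quotient of the energy tends to 0, but it
  is bounded above by an expression whose limit is negative if the gain beats the error. The scale
  \<rho> may depend on \<open>E\<close>; the constant \<open>c\<^sub>o\<close> is fixed by the
  monotonicity of the kernel, not by the analysis of contact points.\<close>

text \<open>The slab \<open>0 \<le> x \<bullet> e < 1\<close> plays the role of the hyperplane orthogonal to \<open>e\<close>:
  this is Fubini without a choice of coordinates on the hyperplane.\<close>

lemma nn_integral_translate:
  fixes c :: "'a::euclidean_space" and \<phi> :: "'a \<Rightarrow> ennreal"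
  assumes [measurable]: "\<phi> \<in> borel_measurable borel"
  shows "(\<integral>\<^sup>+x. \<phi> (x + c) \<partial>lborel) = (\<integral>\<^sup>+x. \<phi> x \<partial>lborel)"
proof -
  have "(\<integral>\<^sup>+x. \<phi> x \<partial>lborel) = (\<integral>\<^sup>+x. \<phi> x \<partial>distr lborel borel ((+) c))"
    by (simp add: lborel_distr_plus)
  also have "\<dots> = (\<integral>\<^sup>+x. \<phi> (c + x) \<partial>lborel)" by (subst nn_integral_distr) auto
  finally show ?thesis by (simp add: add.commute)
qed

lemma slab_nn_integral:
  fixes e :: "'a::euclidean_space" and \<phi> :: "'a \<Rightarrow> ennreal"
  assumes e: "norm e = 1" and [measurable]: "\<phi> \<in> borel_measurable borel"
  shows "(\<integral>\<^sup>+x. \<phi> x \<partial>lborel) =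
    (\<integral>\<^sup>+x. indicator {x. 0 \<le> x \<bullet> e \<and> x \<bullet> e < 1} x * (\<integral>\<^sup>+t. \<phi> (x + t *\<^sub>R e) \<partial>lborel) \<partial>lborel)"
proof -
  define Q where "Q = {x. 0 \<le> x \<bullet> e \<and> x \<bullet> e < 1}"
  have [measurable]: "Q \<in> sets borel" unfolding Q_def by measurable
  have ee: "e \<bullet> e = 1" using e by (simp add: dot_square_norm)
  have "(\<integral>\<^sup>+x. indicator Q x * (\<integral>\<^sup>+t. \<phi> (x + t *\<^sub>R e) \<partial>lborel) \<partial>lborel)
      = (\<integral>\<^sup>+x. (\<integral>\<^sup>+t. indicator Q x * \<phi> (x + t *\<^sub>R e) \<partial>lborel) \<partial>lborel)"
    by (intro nn_integral_cong nn_integral_cmult[symmetric]) measurable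
  also have "\<dots> = (\<integral>\<^sup>+t. (\<integral>\<^sup>+x. indicator Q x * \<phi> (x + t *\<^sub>R e) \<partial>lborel) \<partial>lborel)"
    by (rule lborel_pair.Fubini') measurable
  also have "\<dots> = (\<integral>\<^sup>+t. (\<integral>\<^sup>+x. indicator Q (x - t *\<^sub>R e) * \<phi> x \<partial>lborel) \<partial>lborel)"
  proof (rule nn_integral_cong)
    fix t :: real
    show "(\<integral>\<^sup>+x. indicator Q x * \<phi> (x + t *\<^sub>R e) \<partial>lborel) = (\<integral>\<^sup>+x. indicator Q (x - t *\<^sub>R e) * \<phi> x \<partial>lborel)"
      using nn_integral_translate[of "\<lambda>x. indicator Q (x - t *\<^sub>R e) * \<phi> x" "t *\<^sub>R e"] by simp
  qed
  also have "\<dots> = (\<integral>\<^sup>+x. (\<integral>\<^sup>+t. indicator Q (x - t *\<^sub>R e) * \<phi> x \<partial>lborel) \<partial>lborel)"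
    by (rule lborel_pair.Fubini'[symmetric]) measurable
  also have "\<dots> = (\<integral>\<^sup>+x. \<phi> x \<partial>lborel)"
  proof (rule nn_integral_cong)
    fix x :: 'a
    have "(\<integral>\<^sup>+t. indicator Q (x - t *\<^sub>R e) * \<phi> x \<partial>lborel) = (\<integral>\<^sup>+t. indicator {x \<bullet> e - 1<..x \<bullet> e} t * \<phi> x \<partial>lborel)"
      by (intro nn_integral_cong) (auto simp: Q_def indicator_def inner_diff_left ee)
    also have "\<dots> = \<phi> x" by (subst nn_integral_multc) (auto simp: emeasure_lborel_Ioc)
    finally show "(\<integral>\<^sup>+t. indicator Q (x - t *\<^sub>R e) * \<phi> x \<partial>lborel) = \<phi> x" .
  qed
  finally show ?thesis unfolding Q_def by simp
qed

text \<open>On each line parallel to \<open>e\<close> the shift by \<open>a\<close> is a plain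
  translation, so \<open>slab_nn_integral\<close> reduces the claim to dimension one. It carries the
  layer removed from \<open>E\<close> onto the layer added to it in
  \<open>exchange_gain\<close>.\<close>

lemma nn_integral_shear:
  fixes e :: "'a::euclidean_space" and \<phi> :: "'a \<Rightarrow> ennreal"
  assumes e: "norm e = 1" and [measurable]: "\<phi> \<in> borel_measurable borel" "a \<in> borel_measurable borel"
    and inv: "\<And>x t. a (x + t *\<^sub>R e) = a x"
  shows "(\<integral>\<^sup>+x. \<phi> (x + a x *\<^sub>R e) \<partial>lborel) = (\<integral>\<^sup>+x. \<phi> x \<partial>lborel)"
proof -
  have "(\<integral>\<^sup>+t. \<phi> (x + t *\<^sub>R e + a x *\<^sub>R e) \<partial>lborel) = (\<integral>\<^sup>+t. \<phi> (x + t *\<^sub>R e) \<partial>lborel)" for x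
    using nn_integral_translate[of "\<lambda>t. \<phi> (x + t *\<^sub>R e)" "a x"] by (simp add: algebra_simps)
  then show ?thesis
    by (subst (1 2) slab_nn_integral[OF e]) (simp_all add: inv)
qed

section \<open>Reflections in hyperplanes\<close>

definition refln :: "'a::real_inner \<Rightarrow> real \<Rightarrow> 'a \<Rightarrow> 'a" where
  "refln e l x = x - (2 * (x \<bullet> e - l)) *\<^sub>R e"

lemma refl_measurable [measurable]: "refln e l \<in> borel \<rightarrow>\<^sub>M (borel :: 'a::euclidean_space measure)"
  unfolding refln_def[abs_def] by measurable

lemma nn_integral_refl:
  fixes e :: "'a::euclidean_space" and \<phi> :: "'a \<Rightarrow> ennreal"
  assumes e: "norm e = 1" and [measurable]: "\<phi> \<in> borel_measurable borel"
  shows "(\<integral>\<^sup>+x. \<phi> (refln e l x) \<partial>lborel) = (\<integral>\<^sup>+x. \<phi> x \<partial>lborel)"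
proof -
  have ee: "e \<bullet> e = 1" using e by (simp add: dot_square_norm)
  have eq: "refln e l (x + t *\<^sub>R e) = x + (- (2 * (x \<bullet> e - l)) + (-1) * t) *\<^sub>R e" for x t
  proof -
    have "refln e l (x + t *\<^sub>R e) = x + (t - 2 * (x \<bullet> e + t - l)) *\<^sub>R e"
      by (simp only: refln_def inner_add_left inner_scaleR_left ee mult_1_right
          scaleR_left_diff_distrib[of t "2 * (x \<bullet> e + t - l)" e] add_diff_eq)
    also have "t - 2 * (x \<bullet> e + t - l) = - (2 * (x \<bullet> e - l)) + (-1) * t" by simp
    finally show ?thesis .
  qed
  have "(\<integral>\<^sup>+t. \<phi> (refln e l (x + t *\<^sub>R e)) \<partial>lborel) = (\<integral>\<^sup>+t. \<phi> (x + t *\<^sub>R e) \<partial>lborel)" for x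
    unfolding eq using nn_integral_real_affine[of "\<lambda>t. \<phi> (x + t *\<^sub>R e)" "-1" "- (2 * (x \<bullet> e - l))"] by simp
  then show ?thesis
    by (subst (1 2) slab_nn_integral[OF e]) (simp_all)
qed

text \<open>\<open>refln e 0\<close> is the linear part of every \<open>refln e l\<close>: the
  former acts on displacements, the latter on points.\<close>

lemma refl_0: "refln e 0 (x + y) = refln e 0 x + refln e 0 y" "refln e 0 (c *\<^sub>R x) = c *\<^sub>R refln e 0 x"
   "refln e 0 (x - y) = refln e 0 x - refln e 0 y" "refln e 0 (- x) = - refln e 0 x"
  by (auto simp: refln_def algebra_simps)

lemma refl_add: "refln e l (x + h) = refln e l x + refln e 0 h"
  by (simp add: refln_def algebra_simps)

lemma refl_diff: "refln e l x - refln e l y = refln e 0 (x - y)"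
  by (simp add: refln_def algebra_simps)

lemma inner_refl_0:
  assumes "norm e = 1" shows "refln e 0 x \<bullet> refln e 0 y = x \<bullet> y"
proof -
  have ee: "e \<bullet> e = 1" using assms by (simp add: dot_square_norm)
  show ?thesis by (simp add: refln_def inner_diff_left inner_diff_right ee inner_commute algebra_simps)
qed

lemma norm_refl_0: "norm e = 1 \<Longrightarrow> norm (refln e 0 x) = norm x"
  by (simp add: norm_eq_sqrt_inner inner_refl_0)

lemma refl_refl [simp]: "norm e = 1 \<Longrightarrow> refln e l (refln e l x) = x"
  by (simp add: refln_def inner_diff_left dot_square_norm algebra_simps)

lemma refl_inner_self: "norm e = 1 \<Longrightarrow> refln e l x \<bullet> e = 2 * l - x \<bullet> e"
  by (simp add: refln_def inner_diff_left dot_square_norm algebra_simps)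

lemma dist_refl: "norm e = 1 \<Longrightarrow> dist (refln e l x) (refln e l y) = dist x y"
  by (simp add: dist_norm refl_diff norm_refl_0)

text \<open>The source of monotonicity under reflection: a point is nearer than its mirror image to
  every \<open>y\<close> on its own side of the plane, with an excess proportional to both distances
  from the plane.\<close>

lemma refl_dist_sq:
  assumes "norm e = 1"
  shows "(norm (refln e l x - y))\<^sup>2 - (norm (x - y))\<^sup>2 = 4 * (l - x \<bullet> e) * (l - y \<bullet> e)"
proof -
  have ee: "e \<bullet> e = 1" using assms by (simp add: dot_square_norm)
  show ?thesis unfolding power2_norm_eq_inner refln_def
    by (simp add: inner_diff_left inner_diff_right ee inner_commute algebra_simps power2_eq_square)
qed

lemma emeasure_refl_vimage:
  fixes e :: "'a::euclidean_space"
  assumes e: "norm e = 1" and [measurable]: "A \<in> sets borel"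
  shows "emeasure lborel {x. refln e l x \<in> A} = emeasure lborel A"
proof -
  have "emeasure lborel {x. refln e l x \<in> A} = (\<integral>\<^sup>+x. indicator A (refln e l x) \<partial>lborel)"
  proof -
    have "indicator A (refln e l x) = (indicator {x. refln e l x \<in> A} x :: ennreal)" for x by (simp add: indicator_def)
    then show ?thesis by simp
  qed
  also have "\<dots> = emeasure lborel A" by (subst nn_integral_refl[OF e]) auto
  finally show ?thesis .
qed

text \<open>A line parallel to \<open>e\<close> over \<open>T\<close> meets the set in an interval
  of length \<open>max 0 (b x - a x)\<close>, and \<open>slab_nn_integral\<close> integrates these
  lengths. Volumes between boundary graphs are computed this way throughout.\<close>

lemma emeasure_graph_layer:
  fixes e :: "'a::euclidean_space"
  assumes e: "norm e = 1"
    and [measurable]: "a \<in> borel_measurable borel" "b \<in> borel_measurable borel" "T \<in> sets borel"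
    and inv: "\<And>x t. a (x + t *\<^sub>R e) = a x" "\<And>x t. b (x + t *\<^sub>R e) = b x" "\<And>x t. x + t *\<^sub>R e \<in> T \<longleftrightarrow> x \<in> T"
  shows "emeasure lborel {x \<in> T. a x \<le> x \<bullet> e \<and> x \<bullet> e < b x} =
     (\<integral>\<^sup>+x. indicator {x. 0 \<le> x \<bullet> e \<and> x \<bullet> e < 1} x * (indicator T x * ennreal (max 0 (b x - a x))) \<partial>lborel)"
proof -
  have ee: "e \<bullet> e = 1" using e by (simp add: dot_square_norm)
  have "emeasure lborel {x \<in> T. a x \<le> x \<bullet> e \<and> x \<bullet> e < b x} =
     (\<integral>\<^sup>+x. indicator {x \<in> T. a x \<le> x \<bullet> e \<and> x \<bullet> e < b x} x \<partial>lborel)"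
    by (subst nn_integral_indicator) measurable
  also have "\<dots> = (\<integral>\<^sup>+x. indicator {x. 0 \<le> x \<bullet> e \<and> x \<bullet> e < 1} x *
     (\<integral>\<^sup>+t. indicator {x \<in> T. a x \<le> x \<bullet> e \<and> x \<bullet> e < b x} (x + t *\<^sub>R e) \<partial>lborel) \<partial>lborel)"
    by (rule slab_nn_integral[OF e]) measurable
  also have "\<dots> = (\<integral>\<^sup>+x. indicator {x. 0 \<le> x \<bullet> e \<and> x \<bullet> e < 1} x * (indicator T x * ennreal (max 0 (b x - a x))) \<partial>lborel)"
  proof (rule nn_integral_cong, rule arg_cong2[where f="(*)"], rule HOL.refl)
    fix x
    have "(\<integral>\<^sup>+t. indicator {x \<in> T. a x \<le> x \<bullet> e \<and> x \<bullet> e < b x} (x + t *\<^sub>R e) \<partial>lborel)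
       = (\<integral>\<^sup>+t. indicator T x * indicator {a x - x \<bullet> e ..< b x - x \<bullet> e} t \<partial>lborel)"
      by (intro nn_integral_cong) (auto simp: indicator_def inner_add_left ee inv)
    also have "\<dots> = indicator T x * emeasure lborel {a x - x \<bullet> e ..< b x - x \<bullet> e}"
      by (subst nn_integral_cmult) auto
    also have "emeasure lborel {a x - x \<bullet> e ..< b x - x \<bullet> e} = ennreal (max 0 (b x - a x))"
      by (cases "a x \<le> b x") (auto simp: max_def)
    finally show "(\<integral>\<^sup>+t. indicator {x \<in> T. a x \<le> x \<bullet> e \<and> x \<bullet> e < b x} (x + t *\<^sub>R e) \<partial>lborel)
        = indicator T x * ennreal (max 0 (b x - a x))" .
  qed
  finally show ?thesis .
qed

section \<open>Projection along a unit vector, and discs orthogonal to it\<close>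

definition perp :: "'a::real_inner \<Rightarrow> 'a \<Rightarrow> 'a" where "perp e x = x - (x \<bullet> e) *\<^sub>R e"

lemma perp_measurable [measurable]: "perp e \<in> borel \<rightarrow>\<^sub>M (borel :: 'a::euclidean_space measure)"
  unfolding perp_def[abs_def] by measurable

lemma perp_lin: "perp e (x + y) = perp e x + perp e y" "perp e (x - y) = perp e x - perp e y"
  "perp e (c *\<^sub>R x) = c *\<^sub>R perp e x" "perp e (- x) = - perp e x"
  by (auto simp: perp_def algebra_simps)

lemma perp_self: "norm e = 1 \<Longrightarrow> perp e e = 0" by (simp add: perp_def dot_square_norm)

lemma perp_inner: "norm e = 1 \<Longrightarrow> perp e x \<bullet> e = 0"
  by (simp add: perp_def inner_diff_left dot_square_norm)

lemma perp_decomp: "x = perp e x + (x \<bullet> e) *\<^sub>R e" by (simp add: perp_def)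

lemma norm_perp_sq: "norm e = 1 \<Longrightarrow> (norm x)\<^sup>2 = (norm (perp e x))\<^sup>2 + (x \<bullet> e)\<^sup>2"
proof -
  assume "norm e = 1"
  then have ee: "e \<bullet> e = 1" by (simp add: dot_square_norm)
  show ?thesis unfolding power2_norm_eq_inner perp_def
    by (simp add: inner_diff_left inner_diff_right ee inner_commute algebra_simps power2_eq_square)
qed

lemma norm_perp_le: "norm e = 1 \<Longrightarrow> norm (perp e x) \<le> norm x"
  by (rule power2_le_imp_le) (use norm_perp_sq[of e x] in simp_all)

lemma inner_le_norm1: "norm e = 1 \<Longrightarrow> \<bar>x \<bullet> e\<bar> \<le> norm (x::'a::real_inner)"
  using Cauchy_Schwarz_ineq2[of x e] by simp

lemma norm_le_perp: "norm e = 1 \<Longrightarrow> norm x \<le> norm (perp e x) + \<bar>x \<bullet> e\<bar>"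
  using norm_triangle_ineq[of "perp e x" "(x \<bullet> e) *\<^sub>R e"] by (simp add: perp_decomp[symmetric])

text \<open>The \<open>(n - 1)\<close>-dimensional measure of a ball in the hyperplane orthogonal to \<open>e\<close>.\<close>

definition disc :: "'a::euclidean_space \<Rightarrow> 'a \<Rightarrow> real \<Rightarrow> ennreal" where
  "disc e c r = emeasure lborel {x. (0 \<le> x \<bullet> e \<and> x \<bullet> e < 1) \<and> norm (perp e (x - c)) < r}"

text \<open>Trades the measure of a disc for the volume of a cylinder of height r, which the next
  two lemmas compare with a ball of radius 2r outside and one of radius r/2 inside. Only the order
  r^(n-1) matters later.\<close>

lemma disc_eq:
  fixes e c :: "'a::euclidean_space"
  assumes e: "norm e = 1" and r: "0 < r"
  shows "ennreal r * disc e c r = emeasure lborel {x. c \<bullet> e \<le> x \<bullet> e \<and> x \<bullet> e < c \<bullet> e + r \<and> norm (perp e (x - c)) < r}"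
proof -
  define T where "T = {x. norm (perp e (x - c)) < r}"
  have [measurable]: "T \<in> sets borel" unfolding T_def by measurable
  have "emeasure lborel {x\<in>T. c \<bullet> e \<le> x \<bullet> e \<and> x \<bullet> e < c \<bullet> e + r} =
    (\<integral>\<^sup>+x. indicator {x. 0 \<le> x \<bullet> e \<and> x \<bullet> e < 1} x * (indicator T x * ennreal (max 0 (c \<bullet> e + r - c \<bullet> e))) \<partial>lborel)"
    by (rule emeasure_graph_layer[OF e, of "\<lambda>_. c \<bullet> e" "\<lambda>_. c \<bullet> e + r"])
      (auto simp: T_def perp_lin perp_self e)
  also have "\<dots> = (\<integral>\<^sup>+x. ennreal r * indicator {x. (0 \<le> x \<bullet> e \<and> x \<bullet> e < 1) \<and> norm (perp e (x - c)) < r} x \<partial>lborel)"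
    using r by (intro nn_integral_cong) (auto simp: indicator_def T_def)
  also have "\<dots> = ennreal r * disc e c r"
    unfolding disc_def by (rule nn_integral_cmult_indicator) measurable
  finally show ?thesis unfolding T_def by (simp add: conj_ac)
qed

lemma disc_upper:
  fixes e c :: "'a::euclidean_space"
  assumes e: "norm e = 1" and r: "0 < r"
  shows "disc e c r \<le> ennreal (unit_ball_vol DIM('a) * 2 ^ DIM('a) * r ^ (DIM('a) - 1))"
proof -
  have "ennreal r * disc e c r \<le> emeasure lborel (ball c (2*r))"
  proof (subst disc_eq[OF e r], rule emeasure_mono)
    show "{x. c \<bullet> e \<le> x \<bullet> e \<and> x \<bullet> e < c \<bullet> e + r \<and> norm (perp e (x - c)) < r} \<subseteq> ball c (2 * r)"
    proof
      fix x assume "x \<in> {x. c \<bullet> e \<le> x \<bullet> e \<and> x \<bullet> e < c \<bullet> e + r \<and> norm (perp e (x - c)) < r}"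
      then show "x \<in> ball c (2*r)" using norm_le_perp[OF e, of "x - c"]
        by (auto simp: dist_norm norm_minus_commute inner_diff_left)
    qed
  qed auto
  also have "\<dots> = ennreal (unit_ball_vol DIM('a) * (2*r) ^ DIM('a))"
    using r by (simp add: emeasure_ball)
  also have "(2*r) ^ DIM('a) = r * (2 ^ DIM('a) * r ^ (DIM('a) - 1))"
    using power_minus_mult[of "DIM('a)" r] by (simp add: power_mult_distrib mult.commute)
  also have "ennreal (unit_ball_vol DIM('a) * (r * (2 ^ DIM('a) * r ^ (DIM('a) - 1)))) =
     ennreal r * ennreal (unit_ball_vol DIM('a) * 2 ^ DIM('a) * r ^ (DIM('a) - 1))"
    using r by (subst ennreal_mult[symmetric]) (auto simp: mult_ac)
  finally show ?thesis
    by (rule iffD1[OF ennreal_mult_le_mult_iff, rotated 2]) (use r in auto)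
qed

lemma disc_lower:
  fixes e c :: "'a::euclidean_space"
  assumes e: "norm e = 1" and r: "0 < r"
  shows "ennreal (unit_ball_vol DIM('a) / 2 ^ DIM('a) * r ^ (DIM('a) - 1)) \<le> disc e c r"
proof -
  have ee: "e \<bullet> e = 1" using e by (simp add: dot_square_norm)
  let ?m = "c + (r/2) *\<^sub>R e"
  have "emeasure lborel (ball ?m (r/2)) \<le> ennreal r * disc e c r"
  proof (subst disc_eq[OF e r], rule emeasure_mono)
    show "ball ?m (r / 2) \<subseteq> {x. c \<bullet> e \<le> x \<bullet> e \<and> x \<bullet> e < c \<bullet> e + r \<and> norm (perp e (x - c)) < r}"
    proof
      fix x assume "x \<in> ball ?m (r/2)"
      then have x: "norm (x - ?m) < r/2" by (simp add: dist_norm norm_minus_commute)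
      have "\<bar>(x - ?m) \<bullet> e\<bar> < r/2" using inner_le_norm1[OF e, of "x - ?m"] x by simp
      moreover have "perp e (x - ?m) = perp e (x - c)" by (simp add: perp_lin perp_self e)
      then have "norm (perp e (x - c)) \<le> norm (x - ?m)" using norm_perp_le[OF e, of "x - ?m"] by simp
      ultimately show "x \<in> {x. c \<bullet> e \<le> x \<bullet> e \<and> x \<bullet> e < c \<bullet> e + r \<and> norm (perp e (x - c)) < r}"
        using x r by (simp add: inner_diff_left inner_add_left ee) (smt (verit) field_sum_of_halves)
    qed
  qed measurable
  moreover have "emeasure lborel (ball ?m (r/2)) = ennreal (unit_ball_vol DIM('a) * (r/2) ^ DIM('a))"
    using r by (simp add: emeasure_ball)
  moreover have "(r/2) ^ DIM('a) = r * (1 / 2 ^ DIM('a) * r ^ (DIM('a) - 1))"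
    using power_minus_mult[of "DIM('a)" r] by (simp add: power_divide mult.commute)
  moreover have "ennreal (unit_ball_vol DIM('a) * (r * (1 / 2 ^ DIM('a) * r ^ (DIM('a) - 1)))) =
     ennreal r * ennreal (unit_ball_vol DIM('a) / 2 ^ DIM('a) * r ^ (DIM('a) - 1))"
    using r by (subst ennreal_mult[symmetric]) (auto simp: mult_ac)
  ultimately have "ennreal r * ennreal (unit_ball_vol DIM('a) / 2 ^ DIM('a) * r ^ (DIM('a) - 1)) \<le> ennreal r * disc e c r"
    by metis
  then show ?thesis
    by (rule iffD1[OF ennreal_mult_le_mult_iff, rotated 2]) (use r in auto)
qed

text \<open>Layer-cake formula: r^(-a) = r0^(-a) + integral of a t^(-a-1) over [r, r0], then Fubini
  and the growth bound on sublevel sets; a < b gives convergence at 0. The measure is general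
  because the bound is applied to Lebesgue measure and to its restriction to a thin set.\<close>

lemma nn_integral_powr_small:
  fixes r :: "'b \<Rightarrow> real" and a b C r0 :: real
  assumes sf: "sigma_finite_measure M" and [measurable]: "r \<in> borel_measurable M"
    and nn: "\<And>x. x \<in> space M \<Longrightarrow> 0 \<le> r x"
    and ab: "0 < a" "a < b" and r0: "0 < r0" and C: "0 \<le> C"
    and le: "\<And>t. 0 < t \<Longrightarrow> t \<le> r0 \<Longrightarrow> emeasure M {x\<in>space M. r x < t} \<le> ennreal (C * t powr b)"
  shows "(\<integral>\<^sup>+x. ennreal (r x powr (-a)) * indicator {x. r x < r0} x \<partial>M) \<le> ennreal (C * (b / (b - a)) * r0 powr (b - a))"
proof -
  interpret sigma_finite_measure M by fact
  interpret pair_sigma_finite lborel M ..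
  have eq: "ennreal (r x powr (-a)) * indicator {x. r x < r0} x \<le>
     ennreal (r0 powr (-a)) * indicator {x\<in>space M. r x < r0} x +
     (\<integral>\<^sup>+t. ennreal (a * t powr (-a-1)) * indicator {0..r0} t * (if r x < t then 1 else 0) \<partial>lborel)" if x: "x \<in> space M" for x
  proof (cases "0 < r x \<and> r x < r0")
    case True
    have "(\<integral>\<^sup>+t. ennreal (a * t powr (-a-1)) * indicator {r x..r0} t \<partial>lborel) = ennreal (- (r0 powr (-a)) - (- (r x powr (-a))))"
    proof (rule nn_integral_FTC_Icc)
      show "((\<lambda>t. - (t powr (-a))) has_real_derivative a * t powr (-a-1)) (at t)" if "t \<in> {r x..r0}" for t
        using that True by (auto intro!: derivative_eq_intros)
      show "0 \<le> a * t powr (-a-1)" for t using ab by simp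
      show "r x \<le> r0" using True by simp
    qed measurable
    moreover have "(\<integral>\<^sup>+t. ennreal (a * t powr (-a-1)) * indicator {r x..r0} t \<partial>lborel) \<le>
      (\<integral>\<^sup>+t. ennreal (a * t powr (-a-1)) * indicator {0..r0} t * (if r x < t then 1 else 0) \<partial>lborel)"
    proof (rule nn_integral_mono_AE)
      have "AE t in lborel. t \<noteq> r x" by (rule AE_lborel_singleton)
      then show "AE t in lborel. ennreal (a * t powr (-a-1)) * indicator {r x..r0} t \<le>
         ennreal (a * t powr (-a-1)) * indicator {0..r0} t * (if r x < t then 1 else 0)"
        by eventually_elim (use True x in \<open>auto simp: indicator_def\<close>)
    qed
    moreover have "ennreal (r x powr (-a)) = ennreal (r0 powr (-a)) + ennreal (- (r0 powr (-a)) - (- (r x powr (-a))))"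
      using True ab by (subst ennreal_plus[symmetric]) (auto simp: powr_mono2')
    ultimately show ?thesis using True x by (simp add: indicator_def)
  next
    case False
    \<comment> \<open>Where r vanishes the integrand is 0, by the convention
      \<open>0 powr (- a) = 0\<close>.\<close>
    then show ?thesis using nn[OF x] by (cases "r x = 0") (auto simp: indicator_def)
  qed
  have "(\<integral>\<^sup>+x. (\<integral>\<^sup>+t. ennreal (a * t powr (-a-1)) * indicator {0..r0} t * (if r x < t then 1 else 0) \<partial>lborel) \<partial>M)
     = (\<integral>\<^sup>+t. (\<integral>\<^sup>+x. ennreal (a * t powr (-a-1)) * indicator {0..r0} t * (if r x < t then 1 else 0) \<partial>M) \<partial>lborel)"
    by (rule Fubini') measurable
  also have "\<dots> = (\<integral>\<^sup>+t. ennreal (a * t powr (-a-1)) * indicator {0..r0} t * emeasure M {x\<in>space M. r x < t} \<partial>lborel)"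
  proof (rule nn_integral_cong)
    fix t :: real
    have "(\<integral>\<^sup>+x. c * (if r x < t then 1 else 0) \<partial>M) = (\<integral>\<^sup>+x. c * indicator {x\<in>space M. r x < t} x \<partial>M)" for c :: ennreal
      by (intro nn_integral_cong) (auto simp: indicator_def)
    then show "(\<integral>\<^sup>+x. ennreal (a * t powr (-a-1)) * indicator {0..r0} t * (if r x < t then 1 else 0) \<partial>M) =
       ennreal (a * t powr (-a-1)) * indicator {0..r0} t * emeasure M {x\<in>space M. r x < t}"
      by (simp add: nn_integral_cmult_indicator)
  qed
  also have "\<dots> \<le> (\<integral>\<^sup>+t. ennreal (a * C * t powr (b-a-1)) * indicator {0..r0} t \<partial>lborel)"
  proof (rule nn_integral_mono)
    fix t :: real
    show "ennreal (a * t powr (-a-1)) * indicator {0..r0} t * emeasure M {x\<in>space M. r x < t}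
       \<le> ennreal (a * C * t powr (b-a-1)) * indicator {0..r0} t"
    proof (cases "0 < t \<and> t \<le> r0")
      case True
      then have "ennreal (a * t powr (-a-1)) * emeasure M {x\<in>space M. r x < t} \<le> ennreal (a * t powr (-a-1)) * ennreal (C * t powr b)"
        by (intro mult_left_mono le) auto
      also have "\<dots> = ennreal (a * C * (t powr (-a-1) * t powr b))"
        using ab C by (subst ennreal_mult[symmetric]) (auto simp: mult_ac)
      also have "t powr (-a-1) * t powr b = t powr (b-a-1)" using True by (simp add: powr_add[symmetric] algebra_simps)
      finally show ?thesis using True by simp
    qed (auto simp: indicator_def)
  qed
  also have "\<dots> = ennreal (a * C * (r0 powr (b - a) / (b - a)))"
  proof (rule nn_integral_has_integral_lebesgue')
    show "((\<lambda>t. a * C * t powr (b-a-1)) has_integral a * C * (r0 powr (b-a) / (b-a))) {0..r0}"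
      using has_integral_mult_right[OF has_integral_powr_from_0[of "b-a-1" r0], of "a * C"] ab r0 by simp
  qed (use ab C in auto)
  finally have I2: "(\<integral>\<^sup>+x. (\<integral>\<^sup>+t. ennreal (a * t powr (-a-1)) * indicator {0..r0} t * (if r x < t then 1 else 0) \<partial>lborel) \<partial>M) \<le> ennreal (a * C * (r0 powr (b - a) / (b - a)))" .
  have "ennreal (r0 powr (-a)) * emeasure M {x\<in>space M. r x < r0} \<le> ennreal (r0 powr (-a)) * ennreal (C * r0 powr b)"
    using r0 by (intro mult_left_mono le) auto
  also have "\<dots> = ennreal (C * (r0 powr (-a) * r0 powr b))" using C by (subst ennreal_mult[symmetric]) (auto simp: mult_ac)
  also have "r0 powr (-a) * r0 powr b = r0 powr (b - a)" by (simp add: powr_add[symmetric])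
  finally have I1: "ennreal (r0 powr (-a)) * emeasure M {x\<in>space M. r x < r0} \<le> ennreal (C * r0 powr (b-a))" .
  have "(\<integral>\<^sup>+x. ennreal (r x powr (-a)) * indicator {x. r x < r0} x \<partial>M) \<le>
    (\<integral>\<^sup>+x. ennreal (r0 powr (-a)) * indicator {x\<in>space M. r x < r0} x +
     (\<integral>\<^sup>+t. ennreal (a * t powr (-a-1)) * indicator {0..r0} t * (if r x < t then 1 else 0) \<partial>lborel) \<partial>M)"
    by (rule nn_integral_mono) (rule eq)
  also have "\<dots> = ennreal (r0 powr (-a)) * emeasure M {x\<in>space M. r x < r0} +
    (\<integral>\<^sup>+x. (\<integral>\<^sup>+t. ennreal (a * t powr (-a-1)) * indicator {0..r0} t * (if r x < t then 1 else 0) \<partial>lborel) \<partial>M)"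
  proof (subst nn_integral_add)
    show "(\<lambda>x. ennreal (r0 powr (-a)) * indicator {x\<in>space M. r x < r0} x) \<in> borel_measurable M" by measurable
    show "(\<lambda>x. \<integral>\<^sup>+t. ennreal (a * t powr (-a-1)) * indicator {0..r0} t * (if r x < t then 1 else 0) \<partial>lborel) \<in> borel_measurable M"
      by (rule lborel.borel_measurable_nn_integral) measurable
    have "(\<integral>\<^sup>+x. ennreal (r0 powr (-a)) * indicator {x\<in>space M. r x < r0} x \<partial>M) = ennreal (r0 powr (-a)) * emeasure M {x\<in>space M. r x < r0}"
      by (rule nn_integral_cmult_indicator) measurable
    then show "integral\<^sup>N M (\<lambda>x. ennreal (r0 powr (-a)) * indicator {x\<in>space M. r x < r0} x) +
       (\<integral>\<^sup>+x. (\<integral>\<^sup>+t. ennreal (a * t powr (-a-1)) * indicator {0..r0} t * (if r x < t then 1 else 0) \<partial>lborel) \<partial>M) =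
       ennreal (r0 powr (-a)) * emeasure M {x\<in>space M. r x < r0} +
       (\<integral>\<^sup>+x. (\<integral>\<^sup>+t. ennreal (a * t powr (-a-1)) * indicator {0..r0} t * (if r x < t then 1 else 0) \<partial>lborel) \<partial>M)"
      by (rule arg_cong)
  qed
  also have "\<dots> \<le> ennreal (C * r0 powr (b-a)) + ennreal (a * C * (r0 powr (b - a) / (b - a)))"
    by (rule add_mono[OF I1 I2])
  also have "\<dots> = ennreal (C * r0 powr (b-a) + a * C * (r0 powr (b - a) / (b - a)))"
    using ab C by (subst ennreal_plus) auto
  also have "C * r0 powr (b-a) + a * C * (r0 powr (b - a) / (b - a)) = C * (1 + a / (b - a)) * r0 powr (b - a)"
    by (simp add: algebra_simps)
  also have "1 + a / (b - a) = b / (b - a)" using ab by (simp add: divide_simps)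
  finally show ?thesis .
qed

text \<open>The layer-cake formula from infinity: r^(-a) is the integral of a t^(-a-1) over [r,
  infinity), and b < a gives convergence there.\<close>

lemma nn_integral_powr_tail:
  fixes r :: "'b \<Rightarrow> real" and a b C r0 :: real
  assumes sf: "sigma_finite_measure M" and [measurable]: "r \<in> borel_measurable M"
    and ab: "0 < b" "b < a" and r0: "0 < r0" and C: "0 \<le> C"
    and le: "\<And>t. r0 \<le> t \<Longrightarrow> emeasure M {x\<in>space M. r x < t} \<le> ennreal (C * t powr b)"
  shows "(\<integral>\<^sup>+x. ennreal (r x powr (-a)) * indicator {x. r0 \<le> r x} x \<partial>M) \<le> ennreal (C * (a / (a - b)) * r0 powr (b - a))"
proof -
  interpret sigma_finite_measure M by fact
  interpret pair_sigma_finite lborel M ..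
  have eq: "ennreal (r x powr (-a)) * indicator {x. r0 \<le> r x} x \<le>
     (\<integral>\<^sup>+t. ennreal (a * t powr (-a-1)) * indicator {r0..} t * (if r x < t then 1 else 0) \<partial>lborel)" if x: "x \<in> space M" for x
  proof (cases "r0 \<le> r x")
    case True
    have "(\<integral>\<^sup>+t. ennreal (a * t powr (-a-1)) * indicator {r x..} t \<partial>lborel) = ennreal (0 - (- (r x powr (-a))))"
    proof (rule nn_integral_FTC_atLeast)
      show "((\<lambda>t. - (t powr (-a))) has_real_derivative a * t powr (-a-1)) (at t)" if "r x \<le> t" for t
        using that True r0 by (auto intro!: derivative_eq_intros)
      show "0 \<le> a * t powr (-a-1)" for t using ab by simp
      show "((\<lambda>t. - (t powr - a)) \<longlongrightarrow> 0) at_top"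
        using tendsto_neg_powr[of "-a" "\<lambda>x::real. x" at_top] ab tendsto_minus[of "\<lambda>t::real. t powr -a" 0 at_top]
        by (auto simp: filterlim_ident)
    qed measurable
    moreover have "(\<integral>\<^sup>+t. ennreal (a * t powr (-a-1)) * indicator {r x..} t \<partial>lborel) \<le>
      (\<integral>\<^sup>+t. ennreal (a * t powr (-a-1)) * indicator {r0..} t * (if r x < t then 1 else 0) \<partial>lborel)"
    proof (rule nn_integral_mono_AE)
      have "AE t in lborel. t \<noteq> r x" by (rule AE_lborel_singleton)
      then show "AE t in lborel. ennreal (a * t powr (-a-1)) * indicator {r x..} t \<le>
         ennreal (a * t powr (-a-1)) * indicator {r0..} t * (if r x < t then 1 else 0)"
        by eventually_elim (use True x in \<open>auto simp: indicator_def\<close>)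
    qed
    ultimately show ?thesis using True x by (simp add: indicator_def)
  qed (auto simp: indicator_def)
  have "(\<integral>\<^sup>+x. ennreal (r x powr (-a)) * indicator {x. r0 \<le> r x} x \<partial>M) \<le>
    (\<integral>\<^sup>+x. (\<integral>\<^sup>+t. ennreal (a * t powr (-a-1)) * indicator {r0..} t * (if r x < t then 1 else 0) \<partial>lborel) \<partial>M)"
    by (rule nn_integral_mono) (rule eq)
  also have "\<dots> = (\<integral>\<^sup>+t. (\<integral>\<^sup>+x. ennreal (a * t powr (-a-1)) * indicator {r0..} t * (if r x < t then 1 else 0) \<partial>M) \<partial>lborel)"
    by (rule Fubini') measurable
  also have "\<dots> = (\<integral>\<^sup>+t. ennreal (a * t powr (-a-1)) * indicator {r0..} t * emeasure M {x\<in>space M. r x < t} \<partial>lborel)"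
  proof (rule nn_integral_cong)
    fix t :: real
    have "(\<integral>\<^sup>+x. c * (if r x < t then 1 else 0) \<partial>M) = (\<integral>\<^sup>+x. c * indicator {x\<in>space M. r x < t} x \<partial>M)" for c :: ennreal
      by (intro nn_integral_cong) (auto simp: indicator_def)
    then show "(\<integral>\<^sup>+x. ennreal (a * t powr (-a-1)) * indicator {r0..} t * (if r x < t then 1 else 0) \<partial>M) =
       ennreal (a * t powr (-a-1)) * indicator {r0..} t * emeasure M {x\<in>space M. r x < t}"
      by (simp add: nn_integral_cmult_indicator)
  qed
  also have "\<dots> \<le> (\<integral>\<^sup>+t. ennreal (a * C * t powr (b-a-1)) * indicator {r0..} t \<partial>lborel)"
  proof (rule nn_integral_mono)
    fix t :: real
    show "ennreal (a * t powr (-a-1)) * indicator {r0..} t * emeasure M {x\<in>space M. r x < t}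
       \<le> ennreal (a * C * t powr (b-a-1)) * indicator {r0..} t"
    proof (cases "r0 \<le> t")
      case True
      then have "ennreal (a * t powr (-a-1)) * emeasure M {x\<in>space M. r x < t} \<le> ennreal (a * t powr (-a-1)) * ennreal (C * t powr b)"
        by (intro mult_left_mono le) auto
      also have "\<dots> = ennreal (a * C * (t powr (-a-1) * t powr b))"
        using ab C by (subst ennreal_mult[symmetric]) (auto simp: mult_ac)
      also have "t powr (-a-1) * t powr b = t powr (b-a-1)" using True r0 by (simp add: powr_add[symmetric] algebra_simps)
      finally show ?thesis using True by simp
    qed (auto simp: indicator_def)
  qed
  also have "\<dots> = ennreal (0 - (- (a * C / (a - b) * r0 powr (b - a))))"
  proof (rule nn_integral_FTC_atLeast)
    show "((\<lambda>t. - (a * C / (a - b) * t powr (b - a))) has_real_derivative a * C * t powr (b-a-1)) (at t)" if "r0 \<le> t" for t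
    proof -
      have "((\<lambda>t. - (a * C / (a - b) * t powr (b - a))) has_real_derivative - (a * C / (a - b) * ((b - a) * t powr (b - a - 1)))) (at t)"
        using that r0 ab by (auto intro!: derivative_eq_intros)
      moreover have key: "- (k * ((b - a) * p)) = a * C * p" if "k * (a - b) = a * C" for k p
        using that by (metis minus_diff_eq mult.assoc mult_minus_left mult_minus_right)
      have "- (a * C / (a - b) * ((b - a) * t powr (b - a - 1))) = a * C * t powr (b-a-1)"
        by (rule key) (use ab in simp)
      ultimately show ?thesis by simp
    qed
    show "0 \<le> a * C * t powr (b-a-1)" for t using ab C by simp
    have "((\<lambda>t::real. t powr (b-a)) \<longlongrightarrow> 0) at_top"
      using tendsto_neg_powr[of "b-a" "\<lambda>x::real. x" at_top] ab by (auto simp: filterlim_ident)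
    from tendsto_minus[OF tendsto_mult_right_zero[OF this, of "a * C / (a - b)"]]
    show "((\<lambda>t. - (a * C / (a - b) * t powr (b - a))) \<longlongrightarrow> 0) at_top" by simp
  qed measurable
  finally show ?thesis by (simp add: mult_ac)
qed

section \<open>Smooth cut-off functions and a one-dimensional flow\<close>

lemma Ck_on_SucI:
  assumes "\<And>x. (f has_derivative f' x) (at x)" and "\<And>v. Ck_on k UNIV (\<lambda>x. f' x v)"
  shows "Ck_on (Suc k) UNIV f"
proof -
  have "frechet_derivative f (at x) = f' x" for x
    using frechet_derivative_at[OF assms(1)[of x]] by simp
  then show ?thesis using assms by (auto simp: differentiable_def)
qed

lemma Ck_on_SucD: "Ck_on (Suc k) U f \<Longrightarrow> Ck_on k U f"
proof (induction k arbitrary: f)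
  case 0
  then show ?case by (auto intro!: differentiable_imp_continuous_on simp: differentiable_on_def differentiable_at_withinI)
next
  case (Suc k)
  then show ?case by (metis Ck_on.simps(2))
qed

lemma Ck_on_SucE:
  assumes "Ck_on (Suc k) UNIV f"
  shows "(f has_derivative frechet_derivative f (at x)) (at x)" "Ck_on k UNIV (\<lambda>x. frechet_derivative f (at x) v)"
  using assms by (auto simp: frechet_derivative_works)

lemma Ck_on_const: "Ck_on k UNIV (\<lambda>x. c)"
proof (induction k arbitrary: c)
  case (Suc k) show ?case by (rule Ck_on_SucI[of _ "\<lambda>_ _. 0"]) (auto simp: Suc)
qed auto

lemma Ck_on_bounded_linear: "bounded_linear f \<Longrightarrow> Ck_on k UNIV f"
proof (cases k)
  case 0 then show "bounded_linear f \<Longrightarrow> ?thesis" by (auto intro: linear_continuous_on)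
next
  case (Suc j) then show "bounded_linear f \<Longrightarrow> ?thesis"
    by (simp only:) (rule Ck_on_SucI[of _ "\<lambda>_. f"], auto simp: Ck_on_const intro: bounded_linear_imp_has_derivative)
qed

lemma Ck_on_add: "Ck_on k UNIV f \<Longrightarrow> Ck_on k UNIV g \<Longrightarrow> Ck_on k UNIV (\<lambda>x. f x + g x)"
proof (induction k arbitrary: f g)
  case (Suc k)
  show ?case
    by (rule Ck_on_SucI[of _ "\<lambda>x v. frechet_derivative f (at x) v + frechet_derivative g (at x) v"])
      (auto intro!: has_derivative_add Ck_on_SucE Suc)
qed (auto intro: continuous_on_add)

lemma Ck_on_scaleR:
  fixes f :: "'a::real_normed_vector \<Rightarrow> real"
  shows "Ck_on k UNIV f \<Longrightarrow> Ck_on k UNIV g \<Longrightarrow> Ck_on k UNIV (\<lambda>x. f x *\<^sub>R g x)"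
proof (induction k arbitrary: f g)
  case (Suc k)
  show ?case
  proof (rule Ck_on_SucI)
    show "((\<lambda>x. f x *\<^sub>R g x) has_derivative (\<lambda>v. f x *\<^sub>R frechet_derivative g (at x) v + frechet_derivative f (at x) v *\<^sub>R g x)) (at x)" for x
      by (rule has_derivative_scaleR) (use Suc Ck_on_SucE in blast)+
    show "Ck_on k UNIV (\<lambda>x. f x *\<^sub>R frechet_derivative g (at x) v + frechet_derivative f (at x) v *\<^sub>R g x)" for v
      by (intro Ck_on_add Suc.IH Ck_on_SucE Ck_on_SucD[OF Suc.prems(1)] Ck_on_SucD[OF Suc.prems(2)] Suc.prems)
  qed
qed (auto intro: continuous_on_scaleR)

lemma Ck_on_mult:
  fixes f g :: "'a::real_normed_vector \<Rightarrow> real"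
  shows "Ck_on k UNIV f \<Longrightarrow> Ck_on k UNIV g \<Longrightarrow> Ck_on k UNIV (\<lambda>x. f x * g x)"
  using Ck_on_scaleR[of k f g] by simp

lemma Ck_on_inverse:
  fixes f :: "'a::real_normed_vector \<Rightarrow> real"
  assumes nz: "\<And>x. f x \<noteq> 0"
  shows "Ck_on k UNIV f \<Longrightarrow> Ck_on k UNIV (\<lambda>x. inverse (f x))"
proof (induction k)
  case (Suc k)
  show ?case
  proof (rule Ck_on_SucI)
    show "((\<lambda>x. inverse (f x)) has_derivative (\<lambda>v. - 1 * (inverse (f x) * frechet_derivative f (at x) v * inverse (f x)))) (at x)" for x
      using Deriv.has_derivative_inverse[OF nz Ck_on_SucE(1)[OF Suc.prems]] by simp
    show "Ck_on k UNIV (\<lambda>x. - 1 * (inverse (f x) * frechet_derivative f (at x) v * inverse (f x)))" for v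
      by (intro Ck_on_mult Ck_on_const Ck_on_SucE Suc.prems Suc.IH Ck_on_SucD[OF Suc.prems])
  qed
qed (auto intro!: continuous_on_inverse simp: nz)

text \<open>The outer function is assumed smooth of every order so that the induction can pass to
  its derivative \<open>g'\<close>, which has the same property.\<close>

lemma Ck_on_compose:
  fixes g :: "real \<Rightarrow> real"
  shows "(\<And>j. Ck_on j UNIV g) \<Longrightarrow> Ck_on k UNIV f \<Longrightarrow> Ck_on k UNIV (\<lambda>x. g (f x))"
proof (induction k arbitrary: g)
  case 0
  have "continuous_on UNIV g" using 0(1)[of 0] by simp
  then have "continuous_on (f ` UNIV) g" by (rule continuous_on_subset) simp
  then show ?case using 0(2) by (auto intro: continuous_on_compose2)
next
  case (Suc k)
  define g' where "g' y = frechet_derivative g (at y) 1" for y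
  have dg: "(g has_derivative frechet_derivative g (at y)) (at y)" for y
    using Ck_on_SucE(1)[OF Suc.prems(1)] .
  have g1: "frechet_derivative g (at y) u = g' y * u" for y u
    using linear_cmul[OF has_derivative_linear[OF dg], of y u 1] by (simp add: g'_def mult.commute)
  have g'C: "Ck_on j UNIV g'" for j
    unfolding g'_def[abs_def] using Ck_on_SucE(2)[OF Suc.prems(1)[of "Suc j"], of 1] by simp
  show ?case
  proof (rule Ck_on_SucI)
    show "((\<lambda>x. g (f x)) has_derivative (\<lambda>v. g' (f x) * frechet_derivative f (at x) v)) (at x)" for x
      using has_derivative_compose[OF Ck_on_SucE(1)[OF Suc.prems(2)] dg, of x] by (simp add: g1)
    show "Ck_on k UNIV (\<lambda>x. g' (f x) * frechet_derivative f (at x) v)" for v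
      by (rule Ck_on_mult[OF Suc.IH[OF g'C Ck_on_SucD[OF Suc.prems(2)]] Ck_on_SucE(2)[OF Suc.prems(2)]])
  qed
qed

lemma Ck_on_affine:
  assumes L: "bounded_linear L"
  shows "Ck_on k UNIV f \<Longrightarrow> Ck_on k UNIV (\<lambda>x. f (L x + c))"
proof (induction k arbitrary: f)
  case 0
  then have "continuous_on UNIV f" by simp
  then have "continuous_on ((\<lambda>x. L x + c) ` UNIV) f" by (rule continuous_on_subset) simp
  moreover have "continuous_on UNIV (\<lambda>x. L x + c)" by (intro continuous_intros linear_continuous_on L)
  ultimately show ?case by (auto intro: continuous_on_compose2)
next
  case (Suc k)
  show ?case
  proof (rule Ck_on_SucI)
    have "((\<lambda>x. L x + c) has_derivative L) (at x)" for x
      using has_derivative_add[OF bounded_linear_imp_has_derivative[OF L] has_derivative_const] by simp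
    then show "((\<lambda>x. f (L x + c)) has_derivative (\<lambda>v. frechet_derivative f (at (L x + c)) (L v))) (at x)" for x
      using has_derivative_compose[OF _ Ck_on_SucE(1)[OF Suc.prems]] by blast
    show "Ck_on k UNIV (\<lambda>x. frechet_derivative f (at (L x + c)) (L v))" for v
      using Suc.IH[OF Ck_on_SucE(2)[OF Suc.prems, of "L v"]] .
  qed
qed

text \<open>The derivative of each member of the family x^(-m) exp(-1/x), extended by 0, is a
  combination of two further members (\<open>flat_deriv\<close>). Smoothness of exp(-1/x) thus
  becomes an induction on the order, for all m at once.\<close>

definition flat :: "nat \<Rightarrow> real \<Rightarrow> real" where
  "flat m x = (if 0 < x then inverse x ^ m * exp (- inverse x) else 0)"

lemma flat_tendsto_0: "(flat m \<longlongrightarrow> 0) (at 0)"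
proof -
  have "((\<lambda>x. inverse x ^ m / exp (inverse x)) \<longlongrightarrow> 0) (at_right (0::real))"
    by (rule filterlim_compose[OF tendsto_power_div_exp_0 filterlim_inverse_at_top_right])
  then have "(flat m \<longlongrightarrow> 0) (at_right 0)"
    by (rule Lim_transform_eventually)
      (auto simp: flat_def eventually_at_filter exp_minus divide_inverse)
  moreover have "(flat m \<longlongrightarrow> 0) (at_left 0)"
    by (rule tendsto_eventually) (auto simp: flat_def eventually_at_filter)
  ultimately show ?thesis by (simp add: filterlim_split_at)
qed

lemma flat_deriv:
  "(flat m has_real_derivative - real m * flat (m + 1) x + flat (m + 2) x) (at x)"
proof -
  consider "x < 0" | "x = 0" | "0 < x" by linarith
  then show ?thesis
  proof cases
    case 1
    have "((\<lambda>x. 0) has_real_derivative 0) (at x)" by simp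
    then have "(flat m has_real_derivative 0) (at x)"
      by (rule has_field_derivative_transform_within_open[of _ _ _ "{..<0}"]) (use 1 in \<open>auto simp: flat_def\<close>)
    then show ?thesis using 1 by (simp add: flat_def)
  next
    case 2
    have "(flat m has_real_derivative 0) (at 0)"
      unfolding has_field_derivative_iff
    \<comment> \<open>Dividing by x raises the index by one, so the difference quotient at 0 is
      \<open>flat (m + 1)\<close>, which tends to 0.\<close>
    proof (rule Lim_transform_eventually[OF flat_tendsto_0[of "m+1"]])
      show "\<forall>\<^sub>F x in at 0. flat (m + 1) x = (flat m x - flat m 0) / (x - 0)"
        unfolding eventually_at_filter by (auto simp: flat_def divide_inverse)
    qed
    then show ?thesis using 2 by (simp add: flat_def)
  next
    case 3
    have 1: "(inverse has_real_derivative - (inverse x ^ 2)) (at x)"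
      using 3 DERIV_inverse[of x] by (simp add: numeral_2_eq_2)
    have "((\<lambda>x. inverse x ^ m * exp (- inverse x)) has_real_derivative
       real m * (- (inverse x ^ 2) * inverse x ^ (m - Suc 0)) * exp (- inverse x) + exp (- inverse x) * (- (- (inverse x ^ 2))) * inverse x ^ m) (at x)"
      by (intro DERIV_mult DERIV_power[OF 1, of m] DERIV_fun_exp DERIV_minus 1)
    moreover have "real m * (- (inverse x ^ 2) * inverse x ^ (m - Suc 0)) * exp (- inverse x) + exp (- inverse x) * (- (- (inverse x ^ 2))) * inverse x ^ m
      = - real m * flat (m + 1) x + flat (m + 2) x"
      using 3 by (cases m) (simp_all add: flat_def power2_eq_square algebra_simps)
    ultimately have "((\<lambda>x. inverse x ^ m * exp (- inverse x)) has_real_derivative - real m * flat (m + 1) x + flat (m + 2) x) (at x)"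
      by simp
    then show ?thesis
      by (rule has_field_derivative_transform_within_open[of _ _ _ "{0<..}"]) (use 3 in \<open>auto simp: flat_def\<close>)
  qed
qed

lemma Ck_on_real_SucI:
  fixes f :: "real \<Rightarrow> real"
  assumes "\<And>x. (f has_real_derivative f' x) (at x)" "Ck_on k UNIV f'"
  shows "Ck_on (Suc k) UNIV f"
proof (rule Ck_on_SucI)
  show "(f has_derivative (\<lambda>v. f' x * v)) (at x)" for x
    using assms(1)[of x] by (simp add: has_field_derivative_def)
  show "Ck_on k UNIV (\<lambda>x. f' x * v)" for v by (intro Ck_on_mult assms Ck_on_const)
qed

lemma Ck_on_flat: "Ck_on k UNIV (flat m)"
proof (induction k arbitrary: m)
  case 0
  show ?case by (auto intro!: continuous_at_imp_continuous_on DERIV_isCont flat_deriv)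
next
  case (Suc k)
  show ?case
    by (rule Ck_on_real_SucI[OF flat_deriv]) (intro Ck_on_add Ck_on_mult Ck_on_const Suc)
qed

definition smooth_step :: "real \<Rightarrow> real" where
  "smooth_step u = flat 0 u * inverse (flat 0 u + flat 0 (1 - u))"

lemma flat_denominator: "0 < flat 0 u + flat 0 (1 - u)"
  by (auto simp: flat_def intro: add_pos_nonneg)

lemma Ck_on_smooth_step: "Ck_on k UNIV smooth_step"
proof -
  have "bounded_linear (\<lambda>u::real. - u)" by (rule bounded_linear_minus) (rule bounded_linear_ident)
  from Ck_on_affine[OF this Ck_on_flat, of k 0 1] have "Ck_on k UNIV (\<lambda>u. flat 0 (1 - u))"
    by (simp add: algebra_simps)
  moreover have "flat 0 u + flat 0 (1 - u) \<noteq> 0" for u using flat_denominator[of u] by simp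
  ultimately show ?thesis
    unfolding smooth_step_def[abs_def] by (intro Ck_on_mult Ck_on_inverse Ck_on_add Ck_on_flat)
qed

text \<open>An even bump, equal to 1 on [-1, 1] and positive exactly on (-2, 2). The value 1 makes
  its flow an exact translation near the boundary graph; the positivity lets the flow be obtained by
  separation of variables.\<close>

definition plateau :: "real \<Rightarrow> real" where
  "plateau s = smooth_step (2 - s) * smooth_step (2 + s)"

lemma Ck_on_plateau: "Ck_on k UNIV plateau"
proof -
  have "Ck_on k UNIV (\<lambda>s. smooth_step (- s + 2))" "Ck_on k UNIV (\<lambda>s. smooth_step (s + 2))"
    by (rule Ck_on_affine[OF _ Ck_on_smooth_step]; simp add: bounded_linear_minus bounded_linear_ident)+
  then show ?thesis unfolding plateau_def[abs_def] by (auto intro!: Ck_on_mult simp: add.commute)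
qed

lemma smooth_step_props:
  "0 \<le> smooth_step u" "smooth_step u \<le> 1" "1 \<le> u \<Longrightarrow> smooth_step u = 1"
  "u \<le> 0 \<Longrightarrow> smooth_step u = 0" "0 < u \<Longrightarrow> 0 < smooth_step u"
  using flat_denominator[of u]
  by (auto simp: smooth_step_def flat_def divide_inverse[symmetric] divide_simps)

lemma plateau_props:
  "0 \<le> plateau s" "plateau s \<le> 1" "\<bar>s\<bar> \<le> 1 \<Longrightarrow> plateau s = 1"
  "2 \<le> \<bar>s\<bar> \<Longrightarrow> plateau s = 0" "\<bar>s\<bar> < 2 \<Longrightarrow> 0 < plateau s" "plateau (- s) = plateau s"
  by (auto simp: plateau_def smooth_step_props mult_le_one abs_if mult.commute split: if_splits)

lemma plateau_deriv: obtains p' where "\<And>x. (plateau has_real_derivative p' x) (at x)" "continuous_on UNIV p'"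
proof
  show "(plateau has_real_derivative frechet_derivative plateau (at x) 1) (at x)" for x
  proof -
    have d: "(plateau has_derivative frechet_derivative plateau (at x)) (at x)"
      using Ck_on_SucE(1)[OF Ck_on_plateau] .
    have "frechet_derivative plateau (at x) u = frechet_derivative plateau (at x) 1 * u" for u
      using linear_cmul[OF has_derivative_linear[OF d], of u 1] by (metis mult.commute mult.right_neutral real_scaleR_def)
    then have "frechet_derivative plateau (at x) = (*) (frechet_derivative plateau (at x) 1)" by (rule ext)
    then show ?thesis using d by (simp add: has_field_derivative_def)
  qed
  show "continuous_on UNIV (\<lambda>x. frechet_derivative plateau (at x) 1)"
    using Ck_on_SucE(2)[OF Ck_on_plateau[of "Suc 0"]] by simp
qed

lemma plateau_lipschitz: obtains L where "0 < L" "\<And>x y. \<bar>plateau x - plateau y\<bar> \<le> L * \<bar>x - y\<bar>"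
proof -
  obtain p' where p': "\<And>x. (plateau has_real_derivative p' x) (at x)" "continuous_on UNIV p'"
    by (rule plateau_deriv, rule that)
  have "bounded (p' ` {-3..3})"
    by (intro compact_imp_bounded compact_continuous_image continuous_on_subset[OF p'(2)]) auto
  then obtain B where B: "\<forall>x\<in>{-3..3}. \<bar>p' x\<bar> \<le> B" unfolding bounded_iff by auto
  define L where "L = max B 1"
  have in3: "\<bar>plateau x - plateau y\<bar> \<le> L * \<bar>x - y\<bar>" if "x \<in> {-3..3}" "y \<in> {-3..3}" for x y
  proof -
    have "norm (plateau x - plateau y) \<le> L * norm (x - y)"
    proof (rule field_differentiable_bound[of "{-3..3}" plateau p'])
      show "norm (p' z) \<le> L" if "z \<in> {-3..3}" for z using bspec[OF B that] by (simp add: L_def)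
    qed (use that in \<open>auto intro: has_field_derivative_at_within[OF p'(1)]\<close>)
    then show ?thesis by simp
  qed
  define cl where "cl x = max (-3) (min 3 x)" for x :: real
  have cl: "plateau x = plateau (cl x)" "cl x \<in> {-3..3}" for x
    by (auto simp: cl_def plateau_props max_def min_def)
  show thesis
  proof
    show "0 < L" by (simp add: L_def)
    show "\<bar>plateau x - plateau y\<bar> \<le> L * \<bar>x - y\<bar>" for x y
    proof -
      have "\<bar>plateau x - plateau y\<bar> \<le> L * \<bar>cl x - cl y\<bar>" using in3[OF cl(2) cl(2), of x y] by (simp only: cl(1)[symmetric])
      also have "\<dots> \<le> L * \<bar>x - y\<bar>" by (intro mult_left_mono) (auto simp: cl_def L_def)
      finally show ?thesis .
    qed
  qed
qed

text \<open>Travel time from 0 to s for the equation s' = plateau s. Its inverse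
  \<open>bump_pos\<close> gives the flow explicitly and for all times.\<close>

definition bump_time :: "real \<Rightarrow> real" where
  "bump_time s = (LBINT y=0..s. 1 / plateau y)"

lemma bump_time_deriv:
  assumes "\<bar>s\<bar> < 2" shows "(bump_time has_real_derivative 1 / plateau s) (at s)"
proof -
  define b where "b = (\<bar>s\<bar> + 2) / 2"
  have b: "\<bar>s\<bar> < b" "b < 2" "0 \<le> b" using assms by (auto simp: b_def)
  have "continuous_on {-b..b} plateau" using Ck_on_plateau[of 0] continuous_on_subset by auto
  then have c: "continuous_on {-b..b} (\<lambda>y. 1 / plateau y)"
  proof (intro continuous_on_divide continuous_on_const ballI)
    show "plateau y \<noteq> 0" if "y \<in> {-b..b}" for y
      using plateau_props(5)[of y] that b by (auto simp: abs_less_iff)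
  qed
  have "(bump_time has_vector_derivative 1 / plateau s) (at s within {-b..b})"
    unfolding bump_time_def[abs_def]
    using interval_integral_FTC2[of "-b" 0 b "\<lambda>y. 1 / plateau y" s] b c by (simp add: zero_ereal_def)
  moreover have "at s within {-b..b} = at s" using b by (intro at_within_interior) auto
  ultimately show ?thesis by (simp add: has_real_derivative_iff_has_vector_derivative)
qed

lemma bump_time_0: "bump_time 0 = 0" by (simp add: bump_time_def zero_ereal_def[symmetric])

lemma bump_time_id:
  assumes "\<bar>s\<bar> \<le> 1" shows "bump_time s = s"
proof -
  have "\<exists>c. \<forall>x\<in>{-1..1}. bump_time x - x = c"
  proof (rule has_field_derivative_zero_constant)
    show "((\<lambda>x. bump_time x - x) has_real_derivative 0) (at x within {-1..1})" if "x \<in> {-1..1}" for x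
    proof -
      have "(bump_time has_real_derivative 1) (at x)"
        using that bump_time_deriv[of x] by (simp add: plateau_props abs_le_iff abs_less_iff)
      from DERIV_diff[OF this DERIV_ident] show ?thesis by (simp add: has_field_derivative_at_within)
    qed
  qed auto
  then obtain c where c: "\<And>x. x \<in> {-1..1} \<Longrightarrow> bump_time x - x = c" by blast
  show ?thesis using c[of 0] c[of s] assms bump_time_0 by (auto simp: abs_le_iff)
qed

lemma bump_time_odd:
  assumes "\<bar>s\<bar> < 2" shows "bump_time (- s) = - bump_time s"
proof -
  have "\<exists>c. \<forall>x\<in>{-2<..<2}. bump_time x + bump_time (- x) = c"
  proof (rule has_field_derivative_zero_constant)
    show "((\<lambda>x. bump_time x + bump_time (- x)) has_real_derivative 0) (at x within {-2<..<2})" if "x \<in> {-2<..<2}" for x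
    proof -
      have "\<bar>x\<bar> < 2" "\<bar>- x\<bar> < 2" using that by auto
      have "((\<lambda>x. bump_time (- x)) has_real_derivative 1 / plateau (- x) * (- 1)) (at x)"
      proof (rule DERIV_chain2[where f=bump_time and g="\<lambda>x. - x"])
        show "((\<lambda>x::real. - x) has_real_derivative - 1) (at x)" by (rule DERIV_minus[OF DERIV_ident])
      qed (rule bump_time_deriv, fact)
      from DERIV_add[OF bump_time_deriv[OF \<open>\<bar>x\<bar> < 2\<close>] this]
      have "((\<lambda>x. bump_time x + bump_time (- x)) has_real_derivative 1 / plateau x + 1 / plateau (- x) * (- 1)) (at x)" .
      then show ?thesis by (simp add: plateau_props(6) has_field_derivative_at_within)
    qed
  qed auto
  then obtain c where c: "\<And>x. x \<in> {-2<..<2} \<Longrightarrow> bump_time x + bump_time (- x) = c" by blast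
  show ?thesis using c[of 0] c[of s] assms bump_time_0 by (auto simp: abs_less_iff)
qed

lemma bump_time_strict_mono:
  assumes "- 2 < s" "s < t" "t < 2" shows "bump_time s < bump_time t"
proof (rule DERIV_pos_imp_increasing[OF assms(2)])
  show "\<exists>y. (bump_time has_real_derivative y) (at x) \<and> 0 < y" if "s \<le> x" "x \<le> t" for x
    using bump_time_deriv[of x] plateau_props(5)[of x] that assms by (intro exI[of _ "1 / plateau x"]) auto
qed

lemma bump_time_iso: "s \<in> {-2<..<2} \<Longrightarrow> t \<in> {-2<..<2} \<Longrightarrow> bump_time s < bump_time t \<longleftrightarrow> s < t"
  using bump_time_strict_mono[of s t] bump_time_strict_mono[of t s]
  by (cases s t rule: linorder_cases) auto

lemma bump_time_inj: "s \<in> {-2<..<2} \<Longrightarrow> t \<in> {-2<..<2} \<Longrightarrow> bump_time s = bump_time t \<Longrightarrow> s = t"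
  using bump_time_iso[of s t] bump_time_iso[of t s] by (cases s t rule: linorder_cases) simp_all

text \<open>\<open>plateau\<close> is Lipschitz and vanishes at 2, so 1 / plateau is at least 1 / (L
  (2 - s)) and the travel time diverges logarithmically at both ends. This makes the flow global in
  time, as \<open>flow_of\<close> demands.\<close>

lemma bump_time_surj: "\<exists>s\<in>{-2<..<2}. bump_time s = y"
proof -
  obtain L where L: "0 < L" "\<And>x y. \<bar>plateau x - plateau y\<bar> \<le> L * \<bar>x - y\<bar>" by (rule plateau_lipschitz, rule that)
  have lower: "bump_time 1 - ln (2 - s) / L \<le> bump_time s" if s: "1 \<le> s" "s < 2" for s
  proof -
    have "bump_time 1 + ln (2 - 1) / L \<le> bump_time s + ln (2 - s) / L"
    proof (rule DERIV_nonneg_imp_nondecreasing[OF s(1)])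
      fix x assume x: "1 \<le> x" "x \<le> s"
      have "((\<lambda>x. bump_time x + ln (2 - x) / L) has_real_derivative 1 / plateau x + (-1 / (2 - x)) / L) (at x)"
      proof (rule DERIV_add)
        show "(bump_time has_real_derivative 1 / plateau x) (at x)" using x s by (intro bump_time_deriv) auto
        show "((\<lambda>x. ln (2 - x) / L) has_real_derivative (-1 / (2 - x)) / L) (at x)"
          using x s L by (auto intro!: derivative_eq_intros)
      qed
      moreover have "plateau x \<le> L * (2 - x)" using L(2)[of x 2] plateau_props(4)[of 2] x s by simp
      then have "0 \<le> 1 / plateau x + (-1 / (2 - x)) / L"
        using x s L plateau_props(5)[of x] by (simp add: divide_simps mult.commute)
      ultimately show "\<exists>y. ((\<lambda>x. bump_time x + ln (2 - x) / L) has_real_derivative y) (at x) \<and> 0 \<le> y" by blast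
    qed
    then show ?thesis by simp
  qed
  define M where "M = \<bar>y\<bar> + 1"
  \<comment> \<open>Chosen so that - ln (2 - s) / L equals M.\<close>
  define s where "s = 2 - exp (- L * M)"
  have s: "1 \<le> s" "s < 2" using L by (auto simp: s_def M_def)
  have "M \<le> bump_time s" using lower[OF s] L bump_time_id[of 1] by (simp add: s_def)
  then have "bump_time (- s) \<le> y" "y \<le> bump_time s" using bump_time_odd[of s] s by (auto simp: M_def)
  moreover have "continuous_on {-s..s} bump_time"
    by (intro continuous_at_imp_continuous_on ballI) (use s in \<open>auto intro!: DERIV_isCont[OF bump_time_deriv]\<close>)
  ultimately obtain x where "- s \<le> x" "x \<le> s" "bump_time x = y"
    using IVT'[of bump_time "-s" y s] s by auto
  then show ?thesis using s by (intro bexI[of _ x]) auto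
qed

definition bump_pos :: "real \<Rightarrow> real" where
  "bump_pos y = (THE s. s \<in> {-2<..<2} \<and> bump_time s = y)"

lemma bump_pos: "bump_pos y \<in> {-2<..<2}" "bump_time (bump_pos y) = y"
proof -
  have "\<exists>!s. s \<in> {-2<..<2} \<and> bump_time s = y"
    by (metis bump_time_inj bump_time_surj)
  from theI'[OF this] show "bump_pos y \<in> {-2<..<2}" "bump_time (bump_pos y) = y" unfolding bump_pos_def by auto
qed

lemma bump_pos_time: "s \<in> {-2<..<2} \<Longrightarrow> bump_pos (bump_time s) = s"
  by (rule bump_time_inj) (rule bump_pos, assumption, rule bump_pos)

lemma bump_pos_deriv: "(bump_pos has_real_derivative plateau (bump_pos y)) (at y)"
proof -
  have pos: "0 < plateau (bump_pos y)" using bump_pos(1)[of y] by (intro plateau_props) auto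
  have d: "(bump_time has_derivative (*) (1 / plateau (bump_pos y))) (at (bump_pos y))"
    using bump_time_deriv[of "bump_pos y"] bump_pos(1)[of y] by (auto simp: has_field_derivative_def)
  have "(bump_pos has_derivative (*) (plateau (bump_pos y))) (at (bump_time (bump_pos y)))"
  proof (rule has_derivative_inverse_strong[where S="{-2<..<2}", OF _ _ _ _ d])
    show "continuous_on {-2<..<2} bump_time"
      by (intro continuous_at_imp_continuous_on ballI) (auto intro!: DERIV_isCont[OF bump_time_deriv])
  qed (use pos bump_pos bump_pos_time in \<open>auto simp: fun_eq_iff\<close>)
  then show ?thesis by (simp add: bump_pos(2) has_field_derivative_def)
qed

definition bump_flow :: "real \<Rightarrow> real \<Rightarrow> real" where
  "bump_flow t s = (if \<bar>s\<bar> < 2 then bump_pos (bump_time s + t) else s)"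

lemma bump_flow_0 [simp]: "bump_flow 0 s = s"
  by (auto simp: bump_flow_def intro!: bump_pos_time)

lemma bump_flow_inside: "\<bar>bump_flow t s\<bar> < 2 \<longleftrightarrow> \<bar>s\<bar> < 2"
  using bump_pos(1)[of "bump_time s + t"] by (auto simp: bump_flow_def)

lemma bump_flow_outside: "2 \<le> \<bar>s\<bar> \<Longrightarrow> bump_flow t s = s"
  by (auto simp: bump_flow_def)

lemma bump_flow_deriv: "((\<lambda>t. bump_flow t s) has_real_derivative plateau (bump_flow t s)) (at t)"
proof (cases "\<bar>s\<bar> < 2")
  case True
  have "((\<lambda>t. bump_pos (bump_time s + t)) has_real_derivative plateau (bump_pos (bump_time s + t)) * 1) (at t)"
    by (rule DERIV_chain2[OF bump_pos_deriv]) (auto intro!: derivative_eq_intros)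
  then show ?thesis using True by (simp add: bump_flow_def)
next
  case False
  then show ?thesis by (simp add: bump_flow_def plateau_props)
qed

lemma bump_flow_add: "bump_flow t (bump_flow u s) = bump_flow (u + t) s"
  using bump_pos(1)[of "bump_time s + u"]
  by (auto simp: bump_flow_def bump_pos(2) add.assoc)

lemma bump_flow_less_iff: "bump_flow t s < bump_flow t s' \<longleftrightarrow> s < s'"
proof -
  have *: "bump_flow t s < bump_flow t s'" if "s < s'" for s s'
  proof (cases "\<bar>s\<bar> < 2 \<and> \<bar>s'\<bar> < 2")
    case True
    have "bump_time (bump_pos (bump_time s + t)) < bump_time (bump_pos (bump_time s' + t))"
      using that True bump_time_iso[of s s'] by (simp add: bump_pos(2) abs_less_iff)
    then show ?thesis using True bump_time_iso[OF bump_pos(1) bump_pos(1)] by (simp add: bump_flow_def)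
  next
    case False
    then have "\<bar>s\<bar> < 2 \<and> 2 \<le> s' \<or> \<bar>s'\<bar> < 2 \<and> s \<le> - 2 \<or> 2 \<le> \<bar>s\<bar> \<and> 2 \<le> \<bar>s'\<bar>"
      using that by arith
    then show ?thesis
      using that bump_flow_inside[of t s] bump_flow_outside[of s' t] bump_flow_inside[of t s'] bump_flow_outside[of s t]
      by (elim disjE) linarith+
  qed
  show ?thesis using *[of s s'] *[of s' s] by (cases s s' rule: linorder_cases) auto
qed

text \<open>\<open>plateau\<close> is 1 on [-1, 1], so the travel time is the identity there. This
  is what moves a graph of height g exactly to height g + t f.\<close>

lemma bump_flow_shift:
  assumes "\<bar>s\<bar> \<le> 1" "\<bar>s + t\<bar> \<le> 1" shows "bump_flow t s = s + t"
  using assms bump_pos_time[of "s + t"] by (auto simp: bump_flow_def bump_time_id abs_le_iff)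

section \<open>The boundary as a graph\<close>

abbreviation fd :: "('a::real_normed_vector \<Rightarrow> real) \<Rightarrow> 'a \<Rightarrow> 'a \<Rightarrow> real" where
  "fd \<rho> z \<equiv> frechet_derivative \<rho> (at z)"

section \<open>Taylor estimates for a defining function\<close>

lemma locally_lipschitz_at:
  fixes f :: "'a::real_normed_vector \<Rightarrow> real"
  assumes "f differentiable (at q)"
  obtains M r where "0 \<le> M" "0 < r" "\<And>z. z \<in> ball q r \<Longrightarrow> \<bar>f z - f q\<bar> \<le> M * norm (z - q)"
proof -
  obtain f' where f': "(f has_derivative f') (at q)" using assms by (auto simp: differentiable_def)
  then have bl: "bounded_linear f'" by (rule has_derivative_bounded_linear)
  from f' obtain d where d: "0 < d" "\<And>y. norm (y - q) < d \<Longrightarrow> norm (f y - f q - f' (y - q)) \<le> 1 * norm (y - q)"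
    unfolding has_derivative_at_alt using zero_less_one by blast
  show thesis
  proof
    show "0 \<le> onorm f' + 1" using onorm_pos_le[OF bl] by simp
    show "0 < d" by fact
    show "\<bar>f z - f q\<bar> \<le> (onorm f' + 1) * norm (z - q)" if "z \<in> ball q d" for z
    proof -
      have "\<bar>f z - f q - f' (z - q)\<bar> \<le> norm (z - q)" using d(2)[of z] that by (simp add: dist_norm norm_minus_commute)
      moreover have "\<bar>f' (z - q)\<bar> \<le> onorm f' * norm (z - q)" using onorm[OF bl, of "z - q"] by simp
      ultimately show ?thesis unfolding distrib_right by linarith
    qed
  qed
qed

lemma fd_basis_sum:
  fixes \<rho> :: "'a::euclidean_space \<Rightarrow> real"
  assumes "\<rho> differentiable (at z)"
  shows "fd \<rho> z w = (\<Sum>b\<in>Basis. (w \<bullet> b) * fd \<rho> z b)"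
proof -
  have l: "linear (fd \<rho> z)" using assms by (rule linear_frechet_derivative)
  have "fd \<rho> z w = fd \<rho> z (\<Sum>b\<in>Basis. (w \<bullet> b) *\<^sub>R b)" by (simp add: euclidean_representation)
  also have "\<dots> = (\<Sum>b\<in>Basis. (w \<bullet> b) * fd \<rho> z b)" by (simp add: linear_sum[OF l] linear_cmul[OF l])
  finally show ?thesis .
qed

lemma basis_sum_bound:
  fixes w :: "'a::euclidean_space" and u :: "'a \<Rightarrow> real"
  assumes "\<And>b. b \<in> Basis \<Longrightarrow> \<bar>u b\<bar> \<le> M b * c"
  shows "\<bar>\<Sum>b\<in>Basis. (w \<bullet> b) * u b\<bar> \<le> (\<Sum>b\<in>Basis. M b) * c * norm w"
proof -
  have "\<bar>\<Sum>b\<in>Basis. (w \<bullet> b) * u b\<bar> \<le> (\<Sum>b\<in>Basis. \<bar>w \<bullet> b\<bar> * \<bar>u b\<bar>)"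
    by (rule order_trans[OF sum_abs]) (simp add: abs_mult)
  also have "\<dots> \<le> (\<Sum>b\<in>Basis. norm w * (M b * c))"
    by (intro sum_mono mult_mono Basis_le_norm assms) auto
  also have "\<dots> = (\<Sum>b\<in>Basis. M b) * c * norm w"
    unfolding sum_distrib_right by (intro sum.cong) (auto simp: mult_ac)
  finally show ?thesis .
qed

lemma common_radius:
  fixes P :: "'b \<Rightarrow> real \<Rightarrow> bool"
  assumes "finite A" "\<And>b. b \<in> A \<Longrightarrow> \<exists>r>0. P b r" "\<And>b r r'. P b r \<Longrightarrow> 0 < r' \<Longrightarrow> r' \<le> r \<Longrightarrow> P b r'"
  shows "\<exists>r>0. \<forall>b\<in>A. P b r"
  using assms(1,2)
proof (induction A rule: finite_induct)
  case empty then show ?case by (auto intro: exI[of _ 1])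
next
  case (insert b A)
  have "\<exists>r>0. \<forall>b\<in>A. P b r" using insert.prems by (intro insert.IH) auto
  then obtain r1 where r1: "0 < r1" "\<And>b. b \<in> A \<Longrightarrow> P b r1" by blast
  obtain r2 where r2: "0 < r2" "P b r2" using insert.prems by blast
  have "P c (min r1 r2)" if "c \<in> insert b A" for c
    using that r1 r2 assms(3)[of c r1 "min r1 r2"] assms(3)[of c r2 "min r1 r2"] by auto
  then show ?case using r1 r2 by (intro exI[of _ "min r1 r2"]) auto
qed

text \<open>Each of the finitely many partial derivatives is differentiable at q, hence Lipschitz at
  q; summing over the basis makes the bound uniform in the direction w.\<close>

lemma fd_first_order:
  fixes \<rho> :: "'a::euclidean_space \<Rightarrow> real"
  assumes U: "open U" "q \<in> U" and C: "Ck_on (Suc (Suc 0)) U \<rho>"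
  obtains M r where "0 \<le> M" "0 < r" "ball q r \<subseteq> U"
    "\<And>z w. z \<in> ball q r \<Longrightarrow> \<bar>fd \<rho> z w - fd \<rho> q w\<bar> \<le> M * norm (z - q) * norm w"
proof -
  obtain r0 where r0: "0 < r0" "ball q r0 \<subseteq> U" using U open_contains_ball by blast
  have "\<exists>M r. 0 \<le> M \<and> 0 < r \<and> (\<forall>z\<in>ball q r. \<bar>fd \<rho> z b - fd \<rho> q b\<bar> \<le> M * norm (z - q))" for b
  proof -
    have "(\<lambda>z. fd \<rho> z b) differentiable (at q)" using C U(2) unfolding Ck_on.simps(2) by blast
    then show ?thesis by (rule locally_lipschitz_at) blast
  qed
  then have "\<forall>b. \<exists>M. 0 \<le> M \<and> (\<exists>r>0. \<forall>z\<in>ball q r. \<bar>fd \<rho> z b - fd \<rho> q b\<bar> \<le> M * norm (z - q))" by blast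
  from choice[OF this] obtain M where M: "\<And>b. 0 \<le> M b"
    "\<And>b. \<exists>r>0. (\<forall>z\<in>ball q r. \<bar>fd \<rho> z b - fd \<rho> q b\<bar> \<le> M b * norm (z - q))" by blast
  have "\<exists>r>0. \<forall>b\<in>Basis. (\<forall>z\<in>ball q r. \<bar>fd \<rho> z b - fd \<rho> q b\<bar> \<le> M b * norm (z - q))"
    by (rule common_radius) (use M(2) in auto)
  then obtain r where r: "r > 0" "\<And>b z. b \<in> Basis \<Longrightarrow> z \<in> ball q r \<Longrightarrow> \<bar>fd \<rho> z b - fd \<rho> q b\<bar> \<le> M b * norm (z - q)" by blast
  show thesis
  proof
    show "0 \<le> (\<Sum>b\<in>Basis. M b)" by (simp add: M sum_nonneg)
    show "0 < min r r0" "ball q (min r r0) \<subseteq> U" using r r0 by auto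
    fix z w assume z: "z \<in> ball q (min r r0)"
    then have d: "\<rho> differentiable (at z)" "\<rho> differentiable (at q)" using C r0 U by auto
    have "fd \<rho> z w - fd \<rho> q w = (\<Sum>b\<in>Basis. (w \<bullet> b) * (fd \<rho> z b - fd \<rho> q b))"
      by (subst fd_basis_sum[OF d(1)], subst fd_basis_sum[OF d(2)]) (simp add: sum_subtractf right_diff_distrib)
    then show "\<bar>fd \<rho> z w - fd \<rho> q w\<bar> \<le> (\<Sum>b\<in>Basis. M b) * norm (z - q) * norm w"
      using basis_sum_bound[of "\<lambda>b. fd \<rho> z b - fd \<rho> q b" M "norm (z - q)" w] r(2) z by simp
  qed
qed

lemma taylor_first_order:
  fixes f :: "'a::euclidean_space \<Rightarrow> real"
  assumes d: "\<And>z. z \<in> ball q r \<Longrightarrow> f differentiable (at z)"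
    and M: "\<And>z w. z \<in> ball q r \<Longrightarrow> \<bar>fd f z w - fd f q w\<bar> \<le> M * norm (z - q) * norm w"
    and z: "z \<in> ball q r" and M0: "0 \<le> M"
  shows "\<bar>f z - f q - fd f q (z - q)\<bar> \<le> M * (norm (z - q))\<^sup>2"
proof -
  define s where "s = norm (z - q)"
  have sub: "cball q s \<subseteq> ball q r" using z by (auto simp: s_def dist_norm norm_minus_commute)
  have q: "q \<in> ball q r" using z by (auto intro: le_less_trans[OF zero_le_dist])
  have lq: "bounded_linear (fd f q)" using d[OF q] frechet_derivative_works has_derivative_bounded_linear by blast
  have "norm ((f z - fd f q (z - q)) - (f q - fd f q (q - q))) \<le> (M * s) * norm (z - q)"
  proof (rule differentiable_bound[of "cball q s" "\<lambda>x. f x - fd f q (x - q)" "\<lambda>x v. fd f x v - fd f q v" "M * s" z q])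
    fix x assume x: "x \<in> cball q s"
    have 1: "((\<lambda>x. fd f q (x - q)) has_derivative (\<lambda>v. fd f q v)) (at x)"
      by (rule has_derivative_compose[of "\<lambda>x. x - q" "\<lambda>v. v", OF _ bounded_linear_imp_has_derivative[OF lq]])
        (auto intro!: derivative_eq_intros)
    have "(f has_derivative fd f x) (at x)" using d x sub frechet_derivative_works by blast
    from has_derivative_diff[OF this 1] show "((\<lambda>x. f x - fd f q (x - q)) has_derivative (\<lambda>v. fd f x v - fd f q v)) (at x within cball q s)"
      by (rule has_derivative_at_withinI)
    show "onorm (\<lambda>v. fd f x v - fd f q v) \<le> M * s"
    proof (rule onorm_bound)
      show "0 \<le> M * s" using M0 by (simp add: s_def)
      fix v
      have "norm (fd f x v - fd f q v) \<le> M * norm (x - q) * norm v" using M[of x v] x sub by auto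
      also have "\<dots> \<le> M * s * norm v" using x M0
        by (intro mult_right_mono mult_left_mono) (auto simp: dist_norm norm_minus_commute)
      finally show "norm (fd f x v - fd f q v) \<le> M * s * norm v" .
    qed
  qed (auto simp: s_def dist_norm norm_minus_commute)
  moreover have "fd f q 0 = 0" using linear_simps(3)[OF lq] .
  ultimately show ?thesis by (simp add: s_def power2_eq_square algebra_simps)
qed

text \<open>\<open>B w v\<close> is the second derivative at q, namely the derivative in direction v
  of the derivative in direction w. The remainder is the Taylor estimate applied to each partial
  derivative; the symmetry of \<open>B\<close> is proved separately.\<close>

lemma fd_second_order:
  fixes \<rho> :: "'a::euclidean_space \<Rightarrow> real"
  assumes U: "open U" "q \<in> U" and C: "Ck_on (Suc (Suc (Suc 0))) U \<rho>"
  obtains B M r where "0 \<le> M" "0 < r" "ball q r \<subseteq> U"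
    "\<And>w. linear (B w)" "\<And>v. linear (\<lambda>w. B w v)"
    "\<And>w v. \<bar>B w v\<bar> \<le> M * norm w * norm v"
    "\<And>z w. z \<in> ball q r \<Longrightarrow> \<bar>fd \<rho> z w - fd \<rho> q w - B w (z - q)\<bar> \<le> M * (norm (z - q))\<^sup>2 * norm w"
proof -
  define \<phi> where "\<phi> b z = fd \<rho> z b" for b z
  have C2: "Ck_on (Suc (Suc 0)) U (\<phi> b)" for b using C unfolding \<phi>_def by simp
  have dphi: "\<phi> b differentiable (at q)" for b using C2[of b] U by auto
  define B where "B w v = (\<Sum>b\<in>Basis. (w \<bullet> b) * fd (\<phi> b) q v)" for w v
  obtain r0 where r0: "0 < r0" "ball q r0 \<subseteq> U" using U open_contains_ball by blast
  have "\<exists>M r. 0 \<le> M \<and> 0 < r \<and> (\<forall>z\<in>ball q r. \<bar>\<phi> b z - \<phi> b q - fd (\<phi> b) q (z - q)\<bar> \<le> M * (norm (z - q))\<^sup>2)" for b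
  proof -
    obtain M r where Mr: "0 \<le> M" "0 < r" "ball q r \<subseteq> U"
      "\<And>z w. z \<in> ball q r \<Longrightarrow> \<bar>fd (\<phi> b) z w - fd (\<phi> b) q w\<bar> \<le> M * norm (z - q) * norm w"
      by (rule fd_first_order[OF U C2]) blast
    have "\<bar>\<phi> b z - \<phi> b q - fd (\<phi> b) q (z - q)\<bar> \<le> M * (norm (z - q))\<^sup>2" if "z \<in> ball q r" for z
      by (rule taylor_first_order[OF _ Mr(4) that Mr(1)]) (use C2[of b] Mr(3) in auto)
    then show ?thesis using Mr by blast
  qed
  then have "\<forall>b. \<exists>M. 0 \<le> M \<and> (\<exists>r>0. \<forall>z\<in>ball q r. \<bar>\<phi> b z - \<phi> b q - fd (\<phi> b) q (z - q)\<bar> \<le> M * (norm (z - q))\<^sup>2)" by blast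
  from choice[OF this] obtain M where M: "\<And>b. 0 \<le> M b"
    "\<And>b. \<exists>r>0. (\<forall>z\<in>ball q r. \<bar>\<phi> b z - \<phi> b q - fd (\<phi> b) q (z - q)\<bar> \<le> M b * (norm (z - q))\<^sup>2)" by blast
  have "\<exists>r>0. \<forall>b\<in>Basis. (\<forall>z\<in>ball q r. \<bar>\<phi> b z - \<phi> b q - fd (\<phi> b) q (z - q)\<bar> \<le> M b * (norm (z - q))\<^sup>2)"
    by (rule common_radius) (use M(2) in auto)
  then obtain r where r: "r > 0"
    "\<And>b z. b \<in> Basis \<Longrightarrow> z \<in> ball q r \<Longrightarrow> \<bar>\<phi> b z - \<phi> b q - fd (\<phi> b) q (z - q)\<bar> \<le> M b * (norm (z - q))\<^sup>2" by blast
  have bl: "bounded_linear (fd (\<phi> b) q)" for b using dphi frechet_derivative_works has_derivative_bounded_linear by blast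
  define N where "N = (\<Sum>b\<in>Basis. onorm (fd (\<phi> b) q))"
  have N0: "0 \<le> N" unfolding N_def by (intro sum_nonneg onorm_pos_le bl)
  show thesis
  proof (rule that[of "N + (\<Sum>b\<in>Basis. M b)" "min r r0" B])
    have S0: "0 \<le> (\<Sum>b\<in>Basis. M b)" by (simp add: M sum_nonneg)
    then show "0 \<le> N + (\<Sum>b\<in>Basis. M b)" using N0 by simp
    show "0 < min r r0" "ball q (min r r0) \<subseteq> U" using r r0 by auto
    show "linear (B w)" for w
      unfolding B_def using bounded_linear.linear[OF bl]
      by (intro linearI) (simp_all add: linear_add linear_cmul distrib_left sum.distrib sum_distrib_left mult_ac)
    show "linear (\<lambda>w. B w v)" for v
      unfolding B_def by (rule linearI) (simp_all add: inner_add_left distrib_right sum.distrib sum_distrib_left mult.assoc)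
    show "\<bar>B w v\<bar> \<le> (N + (\<Sum>b\<in>Basis. M b)) * norm w * norm v" for w v
    proof -
      have "\<bar>B w v\<bar> \<le> N * norm v * norm w" unfolding B_def N_def
        by (rule basis_sum_bound) (use onorm[OF bl] in auto)
      also have "\<dots> \<le> (N + (\<Sum>b\<in>Basis. M b)) * norm v * norm w" using S0 by (intro mult_right_mono) auto
      finally show ?thesis by (simp add: mult_ac)
    qed
    fix z w assume z: "z \<in> ball q (min r r0)"
    then have d: "\<rho> differentiable (at z)" "\<rho> differentiable (at q)" using C r0 U by auto
    have "fd \<rho> z w - fd \<rho> q w - B w (z - q) = (\<Sum>b\<in>Basis. (w \<bullet> b) * (\<phi> b z - \<phi> b q - fd (\<phi> b) q (z - q)))"
      unfolding B_def
      by (subst fd_basis_sum[OF d(1)], subst fd_basis_sum[OF d(2)]) (simp add: \<phi>_def sum_subtractf right_diff_distrib)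
    also have "\<bar>\<dots>\<bar> \<le> (\<Sum>b\<in>Basis. M b) * (norm (z - q))\<^sup>2 * norm w"
      by (rule basis_sum_bound) (use r(2) z in auto)
    also have "\<dots> \<le> (N + (\<Sum>b\<in>Basis. M b)) * (norm (z - q))\<^sup>2 * norm w" using N0 by (intro mult_right_mono) auto
    finally show "\<bar>fd \<rho> z w - fd \<rho> q w - B w (z - q)\<bar> \<le> (N + (\<Sum>b\<in>Basis. M b)) * (norm (z - q))\<^sup>2 * norm w" .
  qed
qed

lemma mvt_segment:
  fixes f :: "'a::euclidean_space \<Rightarrow> real"
  assumes "\<And>z. z \<in> closed_segment x y \<Longrightarrow> f differentiable (at z)"
  obtains z where "z \<in> closed_segment x y" "f y - f x = fd f z (y - x)"
proof -
  have d: "((\<lambda>t. f (x + t *\<^sub>R (y - x))) has_derivative (\<lambda>h. fd f (x + t *\<^sub>R (y - x)) (h *\<^sub>R (y - x)))) (at t)"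
    if "0 \<le> t" "t \<le> 1" for t
  proof (rule has_derivative_compose[of "\<lambda>t. x + t *\<^sub>R (y - x)" "\<lambda>h. h *\<^sub>R (y - x)"])
    have "x + t *\<^sub>R (y - x) \<in> closed_segment x y"
      unfolding closed_segment_def using that by (auto intro!: exI[of _ t] simp: algebra_simps)
    then show "(f has_derivative fd f (x + t *\<^sub>R (y - x))) (at (x + t *\<^sub>R (y - x)))"
      using assms frechet_derivative_works by blast
  qed (auto intro!: derivative_eq_intros)
  have "\<exists>t\<in>{0<..<1}. f (x + 1 *\<^sub>R (y - x)) - f (x + 0 *\<^sub>R (y - x)) = fd f (x + t *\<^sub>R (y - x)) ((1 - 0) *\<^sub>R (y - x))"
    by (rule mvt_simple[of 0 1 "\<lambda>t. f (x + t *\<^sub>R (y - x))"]) (auto intro!: has_derivative_at_withinI[OF d])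
  then obtain t where t: "t \<in> {0<..<1}" "f (x + 1 *\<^sub>R (y - x)) - f (x + 0 *\<^sub>R (y - x)) = fd f (x + t *\<^sub>R (y - x)) ((1 - 0) *\<^sub>R (y - x))"
    by blast
  have "x + t *\<^sub>R (y - x) \<in> closed_segment x y"
    unfolding closed_segment_def using t by (auto intro!: exI[of _ t] simp: algebra_simps)
  with t(2) show thesis using that by simp
qed

text \<open>The second difference over the parallelogram spanned by s u and s v is symmetric in u
  and v, and it equals s^2 B v u up to O(s^3). Needed because the tangential contact yields B e t =
  0 directly, while the estimate for the odd part of the graph uses B t e = 0 too.\<close>

lemma second_derivative_sym:
  fixes \<rho> :: "'a::euclidean_space \<Rightarrow> real"
  assumes r: "0 < r" and d: "\<And>z. z \<in> ball q r \<Longrightarrow> \<rho> differentiable (at z)" and M0: "0 \<le> M"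
    and lin: "\<And>w. linear (B w)"
    and M: "\<And>z w. z \<in> ball q r \<Longrightarrow> \<bar>fd \<rho> z w - fd \<rho> q w - B w (z - q)\<bar> \<le> M * (norm (z - q))\<^sup>2 * norm w"
  shows "B u v = B v u"
proof -
  define N where "N = norm u + norm v + 1"
  have N: "0 < N" "norm u \<le> N" "norm v \<le> N" by (auto simp: N_def add_nonneg_pos)
  define \<Delta> where "\<Delta> s = \<rho> (q + s *\<^sub>R u + s *\<^sub>R v) - \<rho> (q + s *\<^sub>R u) - \<rho> (q + s *\<^sub>R v) + \<rho> q" for s
  have est: "\<bar>(\<rho> (q + s *\<^sub>R u + s *\<^sub>R v) - \<rho> (q + s *\<^sub>R u) - \<rho> (q + s *\<^sub>R v) + \<rho> q) - s\<^sup>2 * B v u\<bar> \<le> s\<^sup>2 * (8 * M * s * N ^ 3)"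
    if s: "0 < s" "2 * s * N < r" and uv: "norm u \<le> N" "norm v \<le> N" for s u v
  proof -
    have inb: "q + s *\<^sub>R u + t *\<^sub>R v \<in> ball q r" "q + t *\<^sub>R v \<in> ball q r"
      "norm (s *\<^sub>R u + t *\<^sub>R v) \<le> 2 * s * N" "norm (t *\<^sub>R v) \<le> 2 * s * N" if "0 \<le> t" "t \<le> s" for t
    proof -
      have "s * norm u \<le> s * N" using s uv by simp
      then have "norm (s *\<^sub>R u) \<le> s * N" using s by simp
      moreover have "t * norm v \<le> s * N" using that s uv by (intro mult_mono) auto
      then have "norm (t *\<^sub>R v) \<le> s * N" using that by simp
      moreover have "norm (s *\<^sub>R u + t *\<^sub>R v) \<le> norm (s *\<^sub>R u) + norm (t *\<^sub>R v)" by (rule norm_triangle_ineq)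
      moreover have "0 \<le> s * N" using s N by simp
      ultimately show 1: "norm (s *\<^sub>R u + t *\<^sub>R v) \<le> 2 * s * N" "norm (t *\<^sub>R v) \<le> 2 * s * N"
        by linarith+
      have "dist q (q + s *\<^sub>R u + t *\<^sub>R v) = norm (s *\<^sub>R u + t *\<^sub>R v)" "dist q (q + t *\<^sub>R v) = norm (t *\<^sub>R v)"
        by (subst dist_commute, simp add: dist_norm add.assoc)+
      then show "q + s *\<^sub>R u + t *\<^sub>R v \<in> ball q r" "q + t *\<^sub>R v \<in> ball q r" using 1 s unfolding mem_ball by linarith+
    qed
    \<comment> \<open>The second difference is h s - h 0; the mean value theorem turns it into a
      difference of first derivatives at two points that lie s u apart.\<close>
    define h where "h t = \<rho> (q + s *\<^sub>R u + t *\<^sub>R v) - \<rho> (q + t *\<^sub>R v)" for t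
    have dh: "(h has_derivative (\<lambda>c. fd \<rho> (q + s *\<^sub>R u + t *\<^sub>R v) (c *\<^sub>R v) - fd \<rho> (q + t *\<^sub>R v) (c *\<^sub>R v))) (at t)"
      if "0 \<le> t" "t \<le> s" for t
      unfolding h_def
    proof (rule has_derivative_diff)
      show "((\<lambda>t. \<rho> (q + s *\<^sub>R u + t *\<^sub>R v)) has_derivative (\<lambda>c. fd \<rho> (q + s *\<^sub>R u + t *\<^sub>R v) (c *\<^sub>R v))) (at t)"
        by (rule has_derivative_compose[of "\<lambda>t. q + s *\<^sub>R u + t *\<^sub>R v" "\<lambda>c. c *\<^sub>R v", OF _
              iffD1[OF frechet_derivative_works d[OF inb(1)[OF that]]]]) (auto intro!: derivative_eq_intros)
      show "((\<lambda>t. \<rho> (q + t *\<^sub>R v)) has_derivative (\<lambda>c. fd \<rho> (q + t *\<^sub>R v) (c *\<^sub>R v))) (at t)"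
        by (rule has_derivative_compose[of "\<lambda>t. q + t *\<^sub>R v" "\<lambda>c. c *\<^sub>R v", OF _
              iffD1[OF frechet_derivative_works d[OF inb(2)[OF that]]]]) (auto intro!: derivative_eq_intros)
    qed
    have "\<exists>t\<in>{0<..<s}. h s - h 0 = fd \<rho> (q + s *\<^sub>R u + t *\<^sub>R v) ((s - 0) *\<^sub>R v) - fd \<rho> (q + t *\<^sub>R v) ((s - 0) *\<^sub>R v)"
      by (rule mvt_simple[OF s(1), of h]) (auto intro!: has_derivative_at_withinI[OF dh])
    then obtain t where t: "t \<in> {0<..<s}" "h s - h 0 = fd \<rho> (q + s *\<^sub>R u + t *\<^sub>R v) ((s - 0) *\<^sub>R v) - fd \<rho> (q + t *\<^sub>R v) ((s - 0) *\<^sub>R v)"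
      by blast
    then have t': "0 \<le> t" "t \<le> s" by auto
    note i = inb[OF t']
    have l: "linear (fd \<rho> z)" if "z \<in> ball q r" for z using d[OF that] by (rule linear_frechet_derivative)
    have hs: "h s - h 0 = s * (fd \<rho> (q + s *\<^sub>R u + t *\<^sub>R v) v - fd \<rho> (q + t *\<^sub>R v) v)"
      using t(2) linear_cmul[OF l[OF i(1)], of s v] linear_cmul[OF l[OF i(2)], of s v] by (simp add: algebra_simps)
    have sq: "a\<^sup>2 \<le> (2 * s * N)\<^sup>2" if "0 \<le> a" "a \<le> 2 * s * N" for a using that by (rule power_mono[rotated])
    have bd: "M * (norm x)\<^sup>2 * norm v \<le> M * (2 * s * N)\<^sup>2 * N" if "norm x \<le> 2 * s * N" for x :: 'a
      using M0 that uv N s by (intro mult_mono sq) auto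
    have 1: "\<bar>fd \<rho> (q + s *\<^sub>R u + t *\<^sub>R v) v - fd \<rho> q v - B v (s *\<^sub>R u + t *\<^sub>R v)\<bar> \<le> M * (2 * s * N)\<^sup>2 * N"
      using M[OF i(1), of v] bd[OF i(3)] by (simp add: add.assoc)
    have 2: "\<bar>fd \<rho> (q + t *\<^sub>R v) v - fd \<rho> q v - B v (t *\<^sub>R v)\<bar> \<le> M * (2 * s * N)\<^sup>2 * N"
      using M[OF i(2), of v] bd[OF i(4)] by simp
    have Beq: "B v (s *\<^sub>R u + t *\<^sub>R v) = s * B v u + B v (t *\<^sub>R v)"
      by (simp add: linear_add[OF lin] linear_cmul[OF lin])
    have "\<bar>fd \<rho> (q + s *\<^sub>R u + t *\<^sub>R v) v - fd \<rho> (q + t *\<^sub>R v) v - s * B v u\<bar> \<le> 2 * (M * (2 * s * N)\<^sup>2 * N)"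
      using 1 2 Beq by linarith
    then have "s * \<bar>fd \<rho> (q + s *\<^sub>R u + t *\<^sub>R v) v - fd \<rho> (q + t *\<^sub>R v) v - s * B v u\<bar> \<le> s * (2 * (M * (2 * s * N)\<^sup>2 * N))"
      using s by (intro mult_left_mono) auto
    moreover have "s * \<bar>fd \<rho> (q + s *\<^sub>R u + t *\<^sub>R v) v - fd \<rho> (q + t *\<^sub>R v) v - s * B v u\<bar> = \<bar>h s - h 0 - s\<^sup>2 * B v u\<bar>"
    proof -
      have "s * (a - b) - s\<^sup>2 * c = s * (a - b - s * c)" for a b c by (simp add: power2_eq_square algebra_simps)
      then show ?thesis unfolding hs using s by (simp add: abs_mult)
    qed
    moreover have "s * (2 * (M * (2 * s * N)\<^sup>2 * N)) = s\<^sup>2 * (8 * M * s * N ^ 3)" by (simp add: power2_eq_square power3_eq_cube)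
    ultimately have "\<bar>h s - h 0 - s\<^sup>2 * B v u\<bar> \<le> s\<^sup>2 * (8 * M * s * N ^ 3)" by metis
    then show ?thesis by (simp add: h_def algebra_simps)
  qed
  have key: "\<bar>B v u - B u v\<bar> \<le> s * (16 * M * N ^ 3)" if s: "0 < s" "2 * s * N < r" for s
  proof -
    have "\<bar>\<Delta> s - s\<^sup>2 * B v u\<bar> \<le> s\<^sup>2 * (8 * M * s * N ^ 3)"
      unfolding \<Delta>_def using est[OF s N(2,3)] .
    moreover have "\<bar>\<Delta> s - s\<^sup>2 * B u v\<bar> \<le> s\<^sup>2 * (8 * M * s * N ^ 3)"
      unfolding \<Delta>_def using est[OF s N(3,2)] by (simp add: algebra_simps)
    ultimately have "\<bar>s\<^sup>2 * B v u - s\<^sup>2 * B u v\<bar> \<le> s\<^sup>2 * (s * (16 * M * N ^ 3))" by (simp add: algebra_simps)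
    moreover have "\<bar>s\<^sup>2 * B v u - s\<^sup>2 * B u v\<bar> = s\<^sup>2 * \<bar>B v u - B u v\<bar>"
      by (simp add: right_diff_distrib[symmetric] abs_mult)
    ultimately show ?thesis using s by simp
  qed
  have "\<bar>B v u - B u v\<bar> \<le> 0"
  proof (rule tendsto_lowerbound[of "\<lambda>s. s * (16 * M * N ^ 3)" 0 "at_right 0"])
    show "((\<lambda>s. s * (16 * M * N ^ 3)) \<longlongrightarrow> 0) (at_right 0)" by (auto intro!: tendsto_eq_intros)
    show "\<forall>\<^sub>F s in at_right 0. \<bar>B v u - B u v\<bar> \<le> s * (16 * M * N ^ 3)"
      unfolding eventually_at_right_field using r N
    proof (intro exI[of _ "r / (2 * N)"] conjI allI impI)
      fix s assume "0 < s" "s < r / (2 * N)"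
      then have "2 * s * N < r" using N by (simp add: pos_less_divide_eq mult_ac)
      then show "\<bar>B v u - B u v\<bar> \<le> s * (16 * M * N ^ 3)" using key \<open>0 < s\<close> by blast
    qed (use r N in auto)
  qed simp
  then show ?thesis by simp
qed

text \<open>In this lemma \<open>p + perp \<nu> (x - p) + g x *\<^sub>R \<nu>\<close> is the boundary point on the line through \<open>x\<close> in direction \<open>\<nu>\<close>.\<close>

lemma local_graph:
  fixes \<rho> :: "'a::euclidean_space \<Rightarrow> real"
  assumes nu: "norm \<nu> = 1" and k: "0 < k" and r: "0 < r" and M0: "0 \<le> M"
    and d: "\<And>z. z \<in> ball p r \<Longrightarrow> \<rho> differentiable (at z)"
    and M: "\<And>z w. z \<in> ball p r \<Longrightarrow> \<bar>fd \<rho> z w - fd \<rho> p w\<bar> \<le> M * norm (z - p) * norm w"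
    and grad: "\<And>w. fd \<rho> p w = k * (w \<bullet> \<nu>)" and p0: "\<rho> p = 0"
  obtains \<delta> g C where "0 < \<delta>" "2 * \<delta> < r" "0 \<le> C" "C * \<delta> \<le> 1 / 2" "g \<in> borel_measurable borel"
    "\<And>x t. g (x + t *\<^sub>R \<nu>) = g x"
    "\<And>x. norm (perp \<nu> (x - p)) < \<delta> \<Longrightarrow> \<bar>g x\<bar> \<le> C * (norm (perp \<nu> (x - p)))\<^sup>2"
    "\<And>x. norm (perp \<nu> (x - p)) < \<delta> \<Longrightarrow> \<rho> (p + perp \<nu> (x - p) + g x *\<^sub>R \<nu>) = 0"
    "\<And>x. norm (perp \<nu> (x - p)) < \<delta> \<Longrightarrow> \<bar>(x - p) \<bullet> \<nu>\<bar> < \<delta> \<Longrightarrow> \<rho> x < 0 \<longleftrightarrow> (x - p) \<bullet> \<nu> < g x"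
    "\<And>x y. norm (perp \<nu> (x - p)) < \<delta> \<Longrightarrow> norm (perp \<nu> (y - p)) < \<delta> \<Longrightarrow>
      \<exists>z\<in>closed_segment (p + perp \<nu> (x - p) + g x *\<^sub>R \<nu>) (p + perp \<nu> (y - p) + g y *\<^sub>R \<nu>).
        k / 2 \<le> fd \<rho> z \<nu> \<and> (g y - g x) * fd \<rho> z \<nu> = - fd \<rho> z (perp \<nu> (y - x))"
    "\<And>x y m. norm (perp \<nu> (x - p)) \<le> m \<Longrightarrow> norm (perp \<nu> (y - p)) \<le> m \<Longrightarrow> m < \<delta> \<Longrightarrow>
      \<bar>g y - g x\<bar> \<le> 2 * C * m * norm (perp \<nu> (y - x))"
proof -
  \<comment> \<open>The restriction of the function to the tangent plane is at most M |x|^2, and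
    dividing by the lower bound k/2 of the normal derivative gives C. The choice of \<delta> ensures
    2 M \<delta> \<le> k/2, whence that lower bound holds in the ball of radius 2 \<delta>.\<close>
  define C where "C = 2 * M / k"
  define \<delta> where "\<delta> = min (r / 3) (k / (4 * M + 1) / 2)"
  have C0: "0 \<le> C" using M0 k by (simp add: C_def)
  have dl: "0 < \<delta>" "2 * \<delta> < r" using r k M0 by (auto simp: \<delta>_def min_def divide_simps add_nonneg_pos mult_pos_pos)
  have "\<delta> \<le> k / (4 * M + 1) / 2" by (simp add: \<delta>_def)
  then have "\<delta> * (2 * (4 * M + 1)) \<le> k" using M0 by (simp add: pos_le_divide_eq field_simps)
  moreover have "0 \<le> M * \<delta>" using M0 dl by simp
  ultimately have Md: "4 * M * \<delta> \<le> k" using dl by (simp add: algebra_simps)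
  then have Cd: "C * \<delta> \<le> 1 / 2" using k by (simp add: C_def field_simps)
  have nn: "\<nu> \<bullet> \<nu> = 1" using nu by (simp add: dot_square_norm)
  define b where "b x = p + perp \<nu> (x - p)" for x
  have bshift: "b (x + t *\<^sub>R \<nu>) = b x" for x t using nu by (simp add: b_def perp_lin perp_self)
  have bpt: "x = b x + ((x - p) \<bullet> \<nu>) *\<^sub>R \<nu>" for x
    using perp_decomp[of "x - p" \<nu>] by (simp add: b_def algebra_simps)
  have bnorm: "norm (b x + s *\<^sub>R \<nu> - p) \<le> norm (perp \<nu> (x - p)) + \<bar>s\<bar>" for x s
    using norm_triangle_ineq[of "perp \<nu> (x - p)" "s *\<^sub>R \<nu>"] nu by (simp add: b_def)
  have inb: "b x + s *\<^sub>R \<nu> \<in> ball p (2 * \<delta>)" if "norm (perp \<nu> (x - p)) < \<delta>" "\<bar>s\<bar> < \<delta>" for x s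
    using bnorm[of x s] that by (simp add: dist_norm norm_minus_commute)
  have dd: "k / 2 \<le> fd \<rho> z \<nu>" if "z \<in> ball p (2 * \<delta>)" for z
  proof -
    have "\<bar>fd \<rho> z \<nu> - fd \<rho> p \<nu>\<bar> \<le> M * norm (z - p)" using M[of z \<nu>] that dl nu by simp
    also have "\<dots> \<le> M * (2 * \<delta>)" using that M0 by (intro mult_left_mono) (auto simp: dist_norm norm_minus_commute)
    finally show ?thesis using Md grad[of \<nu>] nn by (simp add: abs_le_iff)
  qed
  have tang: "\<bar>fd \<rho> z w\<bar> \<le> M * norm (z - p) * norm w" if "z \<in> ball p (2 * \<delta>)" "w \<bullet> \<nu> = 0" for z w
    using M[of z w] that dl grad[of w] by simp
  have dsub: "\<rho> differentiable (at z)" if "z \<in> ball p (2 * \<delta>)" for z using d that dl by auto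
  have seg: "closed_segment x y \<subseteq> ball p (2 * \<delta>)" if "x \<in> ball p (2 * \<delta>)" "y \<in> ball p (2 * \<delta>)" for x y
    using that by (simp add: closed_segment_subset)
  have slope: "k / 2 * (t - s) \<le> \<rho> (b x + t *\<^sub>R \<nu>) - \<rho> (b x + s *\<^sub>R \<nu>)"
    if h: "norm (perp \<nu> (x - p)) < \<delta>" "\<bar>s\<bar> < \<delta>" "\<bar>t\<bar> < \<delta>" "s \<le> t" for x s t
  proof -
    have sd: "\<rho> differentiable (at z)" if "z \<in> closed_segment (b x + s *\<^sub>R \<nu>) (b x + t *\<^sub>R \<nu>)" for z
      using seg[OF inb[OF h(1,2)] inb[OF h(1,3)]] dsub that by blast
    obtain z where z: "z \<in> closed_segment (b x + s *\<^sub>R \<nu>) (b x + t *\<^sub>R \<nu>)"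
      "\<rho> (b x + t *\<^sub>R \<nu>) - \<rho> (b x + s *\<^sub>R \<nu>) = fd \<rho> z (b x + t *\<^sub>R \<nu> - (b x + s *\<^sub>R \<nu>))"
      by (rule mvt_segment[OF sd], assumption, rule that)
    have zb: "z \<in> ball p (2 * \<delta>)" using z(1) seg[OF inb[OF h(1,2)] inb[OF h(1,3)]] by blast
    have "b x + t *\<^sub>R \<nu> - (b x + s *\<^sub>R \<nu>) = (t - s) *\<^sub>R \<nu>" by (simp add: algebra_simps)
    then have "\<rho> (b x + t *\<^sub>R \<nu>) - \<rho> (b x + s *\<^sub>R \<nu>) = (t - s) * fd \<rho> z \<nu>"
      using z(2) linear_cmul[OF linear_frechet_derivative[OF dsub[OF zb]], of "t - s" \<nu>] by simp
    moreover have "k / 2 * (t - s) \<le> fd \<rho> z \<nu> * (t - s)" using dd[OF zb] h by (intro mult_right_mono) auto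
    ultimately show ?thesis by (simp add: mult.commute)
  qed
  have base: "\<bar>\<rho> (b x)\<bar> \<le> M * (norm (perp \<nu> (x - p)))\<^sup>2" if "norm (perp \<nu> (x - p)) < \<delta>" for x
  proof -
    have pb: "p \<in> ball p (2 * \<delta>)" "b x \<in> ball p (2 * \<delta>)" using dl inb[OF that, of 0] by auto
    have sd: "\<rho> differentiable (at z)" if "z \<in> closed_segment p (b x)" for z using seg[OF pb] dsub that by blast
    obtain z where z: "z \<in> closed_segment p (b x)" "\<rho> (b x) - \<rho> p = fd \<rho> z (b x - p)"
      by (rule mvt_segment[OF sd], assumption, rule that)
    have "norm (z - p) \<le> norm (perp \<nu> (x - p))" using segment_bound(1)[OF z(1)] by (simp add: b_def)
    moreover have "\<bar>fd \<rho> z (perp \<nu> (x - p))\<bar> \<le> M * norm (z - p) * norm (perp \<nu> (x - p))"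
      using z(1) seg[OF pb] by (intro tang) (auto simp: perp_inner nu)
    ultimately have "\<bar>fd \<rho> z (perp \<nu> (x - p))\<bar> \<le> M * norm (perp \<nu> (x - p)) * norm (perp \<nu> (x - p))"
      using M0 by (meson mult_left_mono mult_right_mono norm_ge_zero order_trans)
    then show ?thesis using z(2) p0 by (simp add: b_def power2_eq_square mult.assoc)
  qed
  have sq: "C * (norm (perp \<nu> (x - p)))\<^sup>2 < \<delta>" if "norm (perp \<nu> (x - p)) < \<delta>" for x
  proof -
    have "C * (norm (perp \<nu> (x - p)))\<^sup>2 \<le> (C * \<delta>) * norm (perp \<nu> (x - p))"
      using that C0 by (simp add: power2_eq_square mult.assoc[symmetric] mult_left_mono mult_right_mono)
    also have "\<dots> \<le> 1 / 2 * norm (perp \<nu> (x - p))" using Cd by (intro mult_right_mono) auto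
    finally show ?thesis using that norm_ge_zero[of "perp \<nu> (x - p)"] by linarith
  qed
  have ex: "\<exists>s. \<bar>s\<bar> \<le> C * (norm (perp \<nu> (x - p)))\<^sup>2 \<and> \<rho> (b x + s *\<^sub>R \<nu>) = 0" if x: "norm (perp \<nu> (x - p)) < \<delta>" for x
  proof -
    define a where "a = C * (norm (perp \<nu> (x - p)))\<^sup>2"
    have a: "0 \<le> a" "a < \<delta>" using C0 sq[OF x] by (auto simp: a_def)
    have Ma: "k / 2 * a = M * (norm (perp \<nu> (x - p)))\<^sup>2" using k by (simp add: a_def C_def)
    have "0 \<le> \<rho> (b x + a *\<^sub>R \<nu>)" using slope[OF x, of 0 a] base[OF x] a Ma dl by (simp add: abs_le_iff)
    moreover have "\<rho> (b x + (- a) *\<^sub>R \<nu>) \<le> 0" using slope[OF x, of "- a" 0] base[OF x] a Ma dl by (simp add: abs_le_iff)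
    moreover have "continuous_on {-a..a} (\<lambda>s. \<rho> (b x + s *\<^sub>R \<nu>))"
    proof (intro continuous_at_imp_continuous_on ballI)
      fix s assume "s \<in> {-a..a}"
      then have "\<bar>s\<bar> < \<delta>" using a by (auto simp: abs_less_iff)
      then have "isCont \<rho> (b x + s *\<^sub>R \<nu>)" using dsub[OF inb[OF x]] differentiable_imp_continuous_within by blast
      moreover have "isCont (\<lambda>s. b x + s *\<^sub>R \<nu>) s" by (intro continuous_intros)
      ultimately show "isCont (\<lambda>s. \<rho> (b x + s *\<^sub>R \<nu>)) s" using isCont_o2[of s "\<lambda>s. b x + s *\<^sub>R \<nu>" \<rho>] by blast
    qed
    ultimately obtain s where "- a \<le> s" "s \<le> a" "\<rho> (b x + s *\<^sub>R \<nu>) = 0"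
      using IVT'[of "\<lambda>s. \<rho> (b x + s *\<^sub>R \<nu>)" "-a" 0 a] a by auto
    then show ?thesis unfolding a_def by (intro exI[of _ s]) (auto simp: abs_le_iff)
  qed
  \<comment> \<open>The choice depends on x only through its projection \<open>b x\<close>, so
    \<open>g\<close> is constant along \<nu>. The value 0 off the cylinder is a default that makes
    \<open>g\<close> a total Borel function.\<close>
  define g where "g x = (if norm (perp \<nu> (x - p)) < \<delta>
     then SOME s. \<bar>s\<bar> \<le> C * (norm (perp \<nu> (x - p)))\<^sup>2 \<and> \<rho> (b x + s *\<^sub>R \<nu>) = 0 else 0)" for x
  have g: "\<bar>g x\<bar> \<le> C * (norm (perp \<nu> (x - p)))\<^sup>2" "\<rho> (b x + g x *\<^sub>R \<nu>) = 0" if "norm (perp \<nu> (x - p)) < \<delta>" for x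
    using someI_ex[OF ex[OF that]] that unfolding g_def by auto
  have gd: "\<bar>g x\<bar> < \<delta>" if "norm (perp \<nu> (x - p)) < \<delta>" for x using g(1)[OF that] sq[OF that] by simp
  have ginv: "g (x + t *\<^sub>R \<nu>) = g x" for x t
    using nu unfolding g_def bshift by (simp add: perp_lin perp_self)
  have sgn: "\<rho> x < 0 \<longleftrightarrow> (x - p) \<bullet> \<nu> < g x" if x: "norm (perp \<nu> (x - p)) < \<delta>" "\<bar>(x - p) \<bullet> \<nu>\<bar> < \<delta>" for x
  proof -
    let ?s = "(x - p) \<bullet> \<nu>"
    have rx: "\<rho> x = \<rho> (b x + ?s *\<^sub>R \<nu>)" using bpt[of x] by simp
    show ?thesis
    proof (cases "?s < g x")
      case True
      then have "0 < k / 2 * (g x - ?s)" using k by simp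
      also have "\<dots> \<le> 0 - \<rho> x" using slope[OF x(1) x(2) gd[OF x(1)]] True g(2)[OF x(1)] rx by simp
      finally show ?thesis using True by simp
    next
      case False
      then have "0 \<le> k / 2 * (?s - g x)" using k by simp
      also have "\<dots> \<le> \<rho> x - 0" using slope[OF x(1) gd[OF x(1)] x(2)] False g(2)[OF x(1)] rx by simp
      finally show ?thesis using False by simp
    qed
  qed
  \<comment> \<open>Implicit differentiation in mean value form. Keeping the intermediate point z,
    instead of a bound only, allows the second-order comparison in
    \<open>graph_odd_lipschitz\<close>.\<close>
  have mvt: "\<exists>z\<in>closed_segment (b x + g x *\<^sub>R \<nu>) (b y + g y *\<^sub>R \<nu>).
        k / 2 \<le> fd \<rho> z \<nu> \<and> (g y - g x) * fd \<rho> z \<nu> = - fd \<rho> z (perp \<nu> (y - x))"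
    if x: "norm (perp \<nu> (x - p)) < \<delta>" and y: "norm (perp \<nu> (y - p)) < \<delta>" for x y
  proof -
    note xb = inb[OF x gd[OF x]] and yb = inb[OF y gd[OF y]]
    have sd: "\<rho> differentiable (at z)" if "z \<in> closed_segment (b x + g x *\<^sub>R \<nu>) (b y + g y *\<^sub>R \<nu>)" for z
      using seg[OF xb yb] dsub that by blast
    obtain z where z: "z \<in> closed_segment (b x + g x *\<^sub>R \<nu>) (b y + g y *\<^sub>R \<nu>)"
      "\<rho> (b y + g y *\<^sub>R \<nu>) - \<rho> (b x + g x *\<^sub>R \<nu>) = fd \<rho> z (b y + g y *\<^sub>R \<nu> - (b x + g x *\<^sub>R \<nu>))"
      by (rule mvt_segment[OF sd], assumption, rule that)
    have zb: "z \<in> ball p (2 * \<delta>)" using z(1) seg[OF xb yb] by blast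
    have l: "linear (fd \<rho> z)" by (rule linear_frechet_derivative[OF dsub[OF zb]])
    have "b y + g y *\<^sub>R \<nu> - (b x + g x *\<^sub>R \<nu>) = perp \<nu> (y - x) + (g y - g x) *\<^sub>R \<nu>"
      by (simp add: b_def perp_lin algebra_simps)
    then have "0 = fd \<rho> z (perp \<nu> (y - x)) + (g y - g x) * fd \<rho> z \<nu>"
      using z(2) g(2)[OF x] g(2)[OF y] linear_add[OF l] linear_cmul[OF l, of "g y - g x" \<nu>] by simp
    then show ?thesis using z(1) dd[OF zb] by (intro bexI[of _ z]) auto
  qed
  have lip: "\<bar>g y - g x\<bar> \<le> 2 * C * m * norm (perp \<nu> (y - x))"
    if x: "norm (perp \<nu> (x - p)) \<le> m" and y: "norm (perp \<nu> (y - p)) \<le> m" and m: "m < \<delta>" for x y m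
  proof -
    have x': "norm (perp \<nu> (x - p)) < \<delta>" and y': "norm (perp \<nu> (y - p)) < \<delta>" using x y m by auto
    have near: "b x + g x *\<^sub>R \<nu> \<in> cball p (2 * m)" if x: "norm (perp \<nu> (x - p)) \<le> m" for x
    proof -
      have x': "norm (perp \<nu> (x - p)) < \<delta>" using x m by simp
      have "\<bar>g x\<bar> \<le> C * (norm (perp \<nu> (x - p)) * norm (perp \<nu> (x - p)))" using g(1)[OF x'] by (simp add: power2_eq_square)
      also have "\<dots> \<le> C * (\<delta> * norm (perp \<nu> (x - p)))" using x' C0 by (intro mult_left_mono mult_right_mono) auto
      also have "\<dots> = (C * \<delta>) * norm (perp \<nu> (x - p))" by simp
      also have "\<dots> \<le> 1 * norm (perp \<nu> (x - p))" using Cd by (intro mult_right_mono) auto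
      finally show ?thesis using bnorm[of x "g x"] x by (simp add: dist_norm norm_minus_commute)
    qed
    obtain z where z: "z \<in> closed_segment (b x + g x *\<^sub>R \<nu>) (b y + g y *\<^sub>R \<nu>)"
      "k / 2 \<le> fd \<rho> z \<nu>" "(g y - g x) * fd \<rho> z \<nu> = - fd \<rho> z (perp \<nu> (y - x))" using mvt[OF x' y'] by blast
    have "z \<in> cball p (2 * m)" using z(1) near[OF x] near[OF y] by (meson closed_segment_subset convex_cball subsetD)
    then have zm: "norm (z - p) \<le> 2 * m" by (simp add: dist_norm norm_minus_commute)
    then have zb: "z \<in> ball p (2 * \<delta>)" using m by (simp add: dist_norm norm_minus_commute)
    have "\<bar>g y - g x\<bar> * (k / 2) \<le> \<bar>g y - g x\<bar> * fd \<rho> z \<nu>" using z(2) by (intro mult_left_mono) auto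
    also have "\<dots> = \<bar>fd \<rho> z (perp \<nu> (y - x))\<bar>"
    proof -
      have "\<bar>g y - g x\<bar> * fd \<rho> z \<nu> = \<bar>(g y - g x) * fd \<rho> z \<nu>\<bar>" using z(2) k by (simp add: abs_mult)
      then show ?thesis unfolding z(3) by simp
    qed
    also have "\<dots> \<le> M * norm (z - p) * norm (perp \<nu> (y - x))" by (rule tang[OF zb]) (simp add: perp_inner nu)
    also have "\<dots> \<le> M * (2 * m) * norm (perp \<nu> (y - x))" using zm M0 by (intro mult_right_mono mult_left_mono) auto
    finally show ?thesis using k by (simp add: C_def field_simps)
  qed
  have meas: "g \<in> borel_measurable borel"
  proof -
    define T where "T = {x. norm (perp \<nu> (x - p)) < \<delta>}"
    have oT: "open T" unfolding T_def perp_def by (intro open_Collect_less continuous_intros)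
    have "continuous_on T g"
    proof (rule continuous_at_imp_continuous_on, rule ballI)
      fix x assume "x \<in> T"
      then have x: "norm (perp \<nu> (x - p)) < \<delta>" by (simp add: T_def)
      define m where "m = (norm (perp \<nu> (x - p)) + \<delta>) / 2"
      have m: "norm (perp \<nu> (x - p)) < m" "m < \<delta>" using x by (auto simp: m_def)
      have "(g \<longlongrightarrow> g x) (at x)"
      proof (rule Lim_null_comparison[THEN LIM_zero_cancel])
        have "open {y. norm (perp \<nu> (y - p)) < m}" unfolding perp_def by (intro open_Collect_less continuous_intros)
        then have "\<forall>\<^sub>F y in at x. norm (perp \<nu> (y - p)) < m" using m(1) eventually_at_topological by blast
        then show "\<forall>\<^sub>F y in at x. norm (g y - g x) \<le> 2 * C * m * norm (perp \<nu> (y - x))"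
          by eventually_elim (use lip[of x m] m in auto)
        have "((\<lambda>y. 2 * C * m * norm (perp \<nu> (y - x))) \<longlongrightarrow> 2 * C * m * norm (perp \<nu> (x - x))) (at x)"
          unfolding perp_def by (intro tendsto_intros)
        then show "((\<lambda>y. 2 * C * m * norm (perp \<nu> (y - x))) \<longlongrightarrow> 0) (at x)" by (simp add: perp_def)
      qed
      then show "isCont g x" by (simp add: isCont_def)
    qed
    then have "(\<lambda>x. indicator T x *\<^sub>R g x) \<in> borel_measurable borel"
      using oT by (intro borel_measurable_continuous_on_indicator) auto
    moreover have "(\<lambda>x. indicator T x *\<^sub>R g x) = g" by (auto simp: T_def g_def indicator_def)
    ultimately show ?thesis by simp
  qed
  show thesis
    by (rule that[of \<delta> C g]) (use dl C0 Cd meas ginv g sgn mvt lip in \<open>auto simp: b_def\<close>)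
qed

section \<open>The odd part of the boundary graph at a tangential contact\<close>

lemma perp_refl_0:
  assumes "e \<bullet> \<nu> = 0" shows "perp \<nu> (refln e 0 v) = refln e 0 (perp \<nu> v)"
  using assms by (simp add: perp_def refln_def inner_diff_left inner_commute algebra_simps)

lemma mem_cball_norm: "z \<in> cball c r \<longleftrightarrow> norm (z - c) \<le> r" for c :: "'a::real_normed_vector"
  by (simp add: dist_norm norm_minus_commute)

text \<open>Subdivide the segment from x to y. The increments are collinear, so their seminorms add
  up exactly and the constant does not grow.\<close>

lemma seminorm_subdivide:
  fixes H :: "'a::real_inner \<Rightarrow> real"
  assumes S: "convex S" and x: "x \<in> S" "y \<in> S" and \<eta>: "0 < \<eta>" and L: "0 \<le> L"
    and loc: "\<And>x y. x \<in> S \<Longrightarrow> y \<in> S \<Longrightarrow> norm (perp \<nu> (y - x)) \<le> \<eta> \<Longrightarrow> \<bar>H y - H x\<bar> \<le> L * norm (perp \<nu> (y - x))"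
  shows "\<bar>H y - H x\<bar> \<le> L * norm (perp \<nu> (y - x))"
proof -
  let ?w = "norm (perp \<nu> (y - x))"
  obtain N :: nat where N: "?w / \<eta> < real N" using reals_Archimedean2 by blast
  have Npos: "0 < N" using N \<eta> by (cases "N = 0") (auto simp: divide_less_0_iff)
  define p where "p i = x + (real i / real N) *\<^sub>R (y - x)" for i
  have pS: "p i \<in> S" if "i \<le> N" for i
  proof -
    have "p i = (1 - real i / real N) *\<^sub>R x + (real i / real N) *\<^sub>R y" by (simp add: p_def algebra_simps)
    then show ?thesis using that Npos x by (auto intro!: convexD[OF S])
  qed
  have step: "p (Suc i) - p i = (1 / real N) *\<^sub>R (y - x)" for i
  proof -
    have "p (Suc i) - p i = (real (Suc i) / real N - real i / real N) *\<^sub>R (y - x)"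
      by (simp only: p_def scaleR_left_diff_distrib) simp
    then show ?thesis using Npos by (simp add: diff_divide_distrib[symmetric])
  qed
  have wN: "norm (perp \<nu> (p (Suc i) - p i)) = ?w / real N" for i
    unfolding step perp_lin using Npos by simp
  have small: "?w / real N \<le> \<eta>" using N \<eta> Npos by (simp add: field_simps)
  have "\<bar>H y - H x\<bar> = \<bar>\<Sum>i<N. H (p (Suc i)) - H (p i)\<bar>"
    using Npos by (subst sum_lessThan_telescope) (simp add: p_def)
  also have "\<dots> \<le> (\<Sum>i<N. \<bar>H (p (Suc i)) - H (p i)\<bar>)" by (rule sum_abs)
  also have "\<dots> \<le> (\<Sum>i<N. L * (?w / real N))"
  proof (rule sum_mono)
    fix i assume "i \<in> {..<N}"
    then have i: "i \<le> N" "Suc i \<le> N" by auto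
    show "\<bar>H (p (Suc i)) - H (p i)\<bar> \<le> L * (?w / real N)"
      using loc[OF pS[OF i(1)] pS[OF i(2)]] wN[of i] small by simp
  qed
  also have "\<dots> = L * ?w" using Npos by simp
  finally show ?thesis .
qed

text \<open>An increment of g is the quotient of the derivatives in directions w and \<nu> at an
  intermediate point. The numerator is B w \<xi> up to O(m^2) |w|, and by \<open>B0\<close> the form
  \<open>B\<close> on the tangent plane is invariant under the reflection; so the leading terms of g
  and of its mirror image cancel and O(m^2) is left as Lipschitz constant.\<close>

lemma graph_odd_lipschitz:
  fixes \<rho> g :: "'a::euclidean_space \<Rightarrow> real"
  assumes nu: "norm \<nu> = 1" and e: "norm e = 1" and en: "e \<bullet> \<nu> = 0" and ql: "q \<bullet> e = l" and k: "0 < k"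
    and M0: "0 \<le> M" and C0: "0 \<le> C" and \<delta>: "0 < \<delta>" "2 * \<delta> < r" "C * \<delta> \<le> 1 / 2"
    and grad: "\<And>w. fd \<rho> q w = k * (w \<bullet> \<nu>)"
    and M1: "\<And>z w. z \<in> ball q r \<Longrightarrow> \<bar>fd \<rho> z w - fd \<rho> q w\<bar> \<le> M * norm (z - q) * norm w"
    and M2: "\<And>z w. z \<in> ball q r \<Longrightarrow> \<bar>fd \<rho> z w - fd \<rho> q w - B w (z - q)\<bar> \<le> M * (norm (z - q))\<^sup>2 * norm w"
    and lin: "\<And>w. linear (B w)" "\<And>v. linear (\<lambda>w. B w v)" and BM: "\<And>w v. \<bar>B w v\<bar> \<le> M * norm w * norm v"
    and B0: "\<And>t. t \<bullet> e = 0 \<Longrightarrow> t \<bullet> \<nu> = 0 \<Longrightarrow> B e t = 0" "\<And>t. t \<bullet> e = 0 \<Longrightarrow> t \<bullet> \<nu> = 0 \<Longrightarrow> B t e = 0"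
    and gq: "\<And>x. norm (perp \<nu> (x - q)) < \<delta> \<Longrightarrow> \<bar>g x\<bar> \<le> C * (norm (perp \<nu> (x - q)))\<^sup>2"
    and mvt: "\<And>x y. norm (perp \<nu> (x - q)) < \<delta> \<Longrightarrow> norm (perp \<nu> (y - q)) < \<delta> \<Longrightarrow>
      \<exists>z\<in>closed_segment (q + perp \<nu> (x - q) + g x *\<^sub>R \<nu>) (q + perp \<nu> (y - q) + g y *\<^sub>R \<nu>).
        k / 2 \<le> fd \<rho> z \<nu> \<and> (g y - g x) * fd \<rho> z \<nu> = - fd \<rho> z (perp \<nu> (y - x))"
  obtains K where "0 \<le> K"
    "\<And>x y m. norm (perp \<nu> (x - q)) \<le> m \<Longrightarrow> norm (perp \<nu> (y - q)) \<le> m \<Longrightarrow> m < \<delta> \<Longrightarrow> m \<le> 1 \<Longrightarrow>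
      \<bar>(g y - g (refln e l y)) - (g x - g (refln e l x))\<bar> \<le> K * m\<^sup>2 * norm (perp \<nu> (y - x))"
proof -
  define K1 where "K1 = M * (10 + C)"
  define K where "K = 4 * K1 / k + 72 * M\<^sup>2 / k\<^sup>2"
  have K1: "0 \<le> K1" using M0 C0 by (simp add: K1_def)
  have K0: "0 \<le> K" using K1 k M0 by (simp add: K_def)
  have Rq: "refln e l x - q = refln e 0 (x - q)" for x
    using ql by (simp add: refln_def inner_diff_left algebra_simps)
  have PR: "perp \<nu> (refln e l x - q) = refln e 0 (perp \<nu> (x - q))" for x
    unfolding Rq by (rule perp_refl_0[OF en])
  have PRd: "perp \<nu> (refln e l y - refln e l x) = refln e 0 (perp \<nu> (y - x))" for x y
    unfolding refl_diff by (rule perp_refl_0[OF en])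
  \<comment> \<open>Split off the components along \<open>e\<close>: the mixed terms vanish by
    \<open>B0\<close>, and the square term in \<open>e\<close> does not see the sign.\<close>
  have BR: "B (refln e 0 w) (refln e 0 v) = B w v" if w: "w \<bullet> \<nu> = 0" and v: "v \<bullet> \<nu> = 0" for w v
  proof -
    define w' where "w' = w - (w \<bullet> e) *\<^sub>R e"
    define v' where "v' = v - (v \<bullet> e) *\<^sub>R e"
    have ee: "e \<bullet> e = 1" using e by (simp add: dot_square_norm)
    have w': "w' \<bullet> e = 0" "w' \<bullet> \<nu> = 0" "w = (w \<bullet> e) *\<^sub>R e + w'" "refln e 0 w = (- (w \<bullet> e)) *\<^sub>R e + w'"
      using w ee en by (auto simp: w'_def inner_diff_left refln_def algebra_simps scaleR_2[symmetric])
    have v': "v' \<bullet> e = 0" "v' \<bullet> \<nu> = 0" "v = (v \<bullet> e) *\<^sub>R e + v'" "refln e 0 v = (- (v \<bullet> e)) *\<^sub>R e + v'"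
      using v ee en by (auto simp: v'_def inner_diff_left refln_def algebra_simps scaleR_2[symmetric])
    have ex: "B (a *\<^sub>R e + w') (b *\<^sub>R e + v') = a * b * B e e + B w' v'" for a b
      using linear_add[OF lin(2)] linear_cmul[OF lin(2)]
      by (simp add: linear_add[OF lin(1)] linear_cmul[OF lin(1)] B0 w' v')
    have "B w v = B ((w \<bullet> e) *\<^sub>R e + w') ((v \<bullet> e) *\<^sub>R e + v')" by (simp only: w'(3)[symmetric] v'(3)[symmetric])
    then show ?thesis unfolding w'(4) v'(4) ex by simp
  qed
  \<comment> \<open>The restriction to increments of length at most m^2 puts the intermediate point
    within O(m^2) of q + perp (x - q), so that B w (z - q) may be replaced by B w (perp (x -
    q)).\<close>
  have half: "\<exists>A d. k / 2 \<le> d \<and> (g y - g x) * d = - A \<and> \<bar>A - B (perp \<nu> (y - x)) (perp \<nu> (x - q))\<bar> \<le> K1 * m\<^sup>2 * norm (perp \<nu> (y - x))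
      \<and> \<bar>A\<bar> \<le> 3 * M * m * norm (perp \<nu> (y - x)) \<and> \<bar>d - k\<bar> \<le> 3 * M * m"
    if x: "norm (perp \<nu> (x - q)) \<le> m" and y: "norm (perp \<nu> (y - q)) \<le> m" and m: "m < \<delta>" "m \<le> 1"
      and xy: "norm (perp \<nu> (y - x)) \<le> m\<^sup>2" for x y m
  proof -
    have m0: "0 \<le> m" by (rule order_trans[OF norm_ge_zero x])
    have x': "norm (perp \<nu> (x - q)) < \<delta>" and y': "norm (perp \<nu> (y - q)) < \<delta>" using x y m by auto
    obtain z where z: "z \<in> closed_segment (q + perp \<nu> (x - q) + g x *\<^sub>R \<nu>) (q + perp \<nu> (y - q) + g y *\<^sub>R \<nu>)"
      "k / 2 \<le> fd \<rho> z \<nu>" "(g y - g x) * fd \<rho> z \<nu> = - fd \<rho> z (perp \<nu> (y - x))" using mvt[OF x' y'] by blast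
    define w where "w = perp \<nu> (y - x)"
    define \<xi> where "\<xi> = perp \<nu> (x - q)"
    have gm: "\<bar>g x\<bar> \<le> C * m\<^sup>2" "\<bar>g y\<bar> \<le> C * m\<^sup>2"
      using gq[OF x'] gq[OF y'] power_mono[OF x, of 2] power_mono[OF y, of 2] C0
      by (meson mult_left_mono norm_ge_zero order_trans)+
    have "q + perp \<nu> (x - q) + g x *\<^sub>R \<nu> \<in> cball (q + \<xi>) ((1 + C) * m\<^sup>2)"
      using gm(1) nu by (simp add: \<xi>_def dist_norm distrib_right) (meson add_increasing zero_le_power2)
    moreover have "q + perp \<nu> (y - q) + g y *\<^sub>R \<nu> \<in> cball (q + \<xi>) ((1 + C) * m\<^sup>2)"
    proof -
      have "q + perp \<nu> (y - q) + g y *\<^sub>R \<nu> - (q + \<xi>) = w + g y *\<^sub>R \<nu>"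
        by (simp add: \<xi>_def w_def perp_lin algebra_simps)
      moreover have "norm (w + g y *\<^sub>R \<nu>) \<le> m\<^sup>2 + C * m\<^sup>2"
        using norm_triangle_ineq[of w "g y *\<^sub>R \<nu>"] gm(2) xy nu by (simp add: w_def)
      ultimately have "norm (q + perp \<nu> (y - q) + g y *\<^sub>R \<nu> - (q + \<xi>)) \<le> (1 + C) * m\<^sup>2"
        by (simp only: distrib_right mult_1_left)
      then show ?thesis by (simp only: mem_cball_norm)
    qed
    ultimately have "z \<in> cball (q + \<xi>) ((1 + C) * m\<^sup>2)"
      using z(1) by (meson closed_segment_subset convex_cball subsetD)
    then have "norm (z - (q + \<xi>)) \<le> (1 + C) * m\<^sup>2" by (simp only: mem_cball_norm)
    then have zx: "norm (z - q - \<xi>) \<le> (1 + C) * m\<^sup>2" by (simp add: diff_diff_add)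
    have "C * m \<le> C * \<delta>" using C0 m by (intro mult_left_mono) auto
    then have Cm: "C * m \<le> 1 / 2" using \<delta> by simp
    have "(1 + C) * m\<^sup>2 = (m + C * m) * m" by (simp add: power2_eq_square algebra_simps)
    also have "\<dots> \<le> 2 * m" using Cm m m0 by (intro mult_right_mono) auto
    finally have zq: "norm (z - q) \<le> 3 * m"
      using norm_triangle_ineq[of "z - q - \<xi>" \<xi>] zx x by (simp add: \<xi>_def)
    have near: "q + perp \<nu> (x - q) + g x *\<^sub>R \<nu> \<in> ball q r" if "norm (perp \<nu> (x - q)) \<le> m" "\<bar>g x\<bar> \<le> C * m\<^sup>2" for x
    proof -
      have "C * m\<^sup>2 = (C * m) * m" by (simp add: power2_eq_square)
      also have "\<dots> \<le> 1 / 2 * m" using Cm m0 by (intro mult_right_mono) auto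
      finally have "norm (perp \<nu> (x - q) + g x *\<^sub>R \<nu>) < r"
        using norm_triangle_ineq[of "perp \<nu> (x - q)" "g x *\<^sub>R \<nu>"] that nu m0 m \<delta> by simp
      moreover have "dist q (q + perp \<nu> (x - q) + g x *\<^sub>R \<nu>) = norm (perp \<nu> (x - q) + g x *\<^sub>R \<nu>)"
        by (subst dist_commute) (simp add: dist_norm add.assoc)
      ultimately show ?thesis by simp
    qed
    have zb: "z \<in> ball q r" using z(1) near[OF x gm(1)] near[OF y gm(2)] by (meson closed_segment_subset convex_ball subsetD)
    have w0: "w \<bullet> \<nu> = 0" "fd \<rho> q w = 0" using grad[of w] by (simp_all add: w_def perp_inner nu)
    have "\<bar>fd \<rho> z w - B w (z - q)\<bar> \<le> M * (norm (z - q))\<^sup>2 * norm w" using M2[OF zb, of w] w0 by simp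
    also have "\<dots> \<le> M * (9 * m\<^sup>2) * norm w"
      using power_mono[OF zq norm_ge_zero, of 2] M0 by (intro mult_right_mono mult_left_mono) (auto simp: power_mult_distrib)
    finally have 1: "\<bar>fd \<rho> z w - B w (z - q)\<bar> \<le> M * (9 * m\<^sup>2) * norm w" .
    have "\<bar>B w (z - q - \<xi>)\<bar> \<le> M * norm w * norm (z - q - \<xi>)" by (rule BM)
    also have "\<dots> \<le> M * norm w * ((1 + C) * m\<^sup>2)" using zx M0 by (intro mult_left_mono) auto
    finally have 2: "\<bar>B w (z - q) - B w \<xi>\<bar> \<le> M * norm w * ((1 + C) * m\<^sup>2)"
      using linear_diff[OF lin(1)[of w], of "z - q" \<xi>] by simp
    have 3: "\<bar>fd \<rho> z w - B w \<xi>\<bar> \<le> K1 * m\<^sup>2 * norm w"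
    proof -
      have "\<bar>fd \<rho> z w - B w \<xi>\<bar> \<le> M * (9 * m\<^sup>2) * norm w + M * norm w * ((1 + C) * m\<^sup>2)" using 1 2 by linarith
      also have "\<dots> = K1 * m\<^sup>2 * norm w" by (simp add: K1_def algebra_simps)
      finally show ?thesis .
    qed
    have "M * norm (z - q) \<le> M * (3 * m)" using zq M0 by (intro mult_left_mono) auto
    then have 4: "\<bar>fd \<rho> z w\<bar> \<le> 3 * M * m * norm w" "\<bar>fd \<rho> z \<nu> - k\<bar> \<le> 3 * M * m"
      using M1[OF zb, of w] M1[OF zb, of \<nu>] w0 nu grad[of \<nu>] mult_right_mono[of "M * norm (z - q)" "M * (3 * m)" "norm w"]
      by (simp_all add: dot_square_norm mult_ac)
    show ?thesis
      using z(2,3) 3 4 unfolding w_def \<xi>_def by (intro exI[of _ "fd \<rho> z (perp \<nu> (y - x))"] exI[of _ "fd \<rho> z \<nu>"]) auto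
  qed
  have loc: "\<bar>(g y - g (refln e l y)) - (g x - g (refln e l x))\<bar> \<le> K * m\<^sup>2 * norm (perp \<nu> (y - x))"
    if x: "norm (perp \<nu> (x - q)) \<le> m" and y: "norm (perp \<nu> (y - q)) \<le> m" and m: "m < \<delta>" "m \<le> 1"
      and xy: "norm (perp \<nu> (y - x)) \<le> m\<^sup>2" for x y m
  proof -
    have m0: "0 \<le> m" by (rule order_trans[OF norm_ge_zero x])
    let ?w = "norm (perp \<nu> (y - x))"
    let ?B = "B (perp \<nu> (y - x)) (perp \<nu> (x - q))"
    obtain A d where A: "k / 2 \<le> d" "(g y - g x) * d = - A" "\<bar>A - ?B\<bar> \<le> K1 * m\<^sup>2 * ?w"
      "\<bar>A\<bar> \<le> 3 * M * m * ?w" "\<bar>d - k\<bar> \<le> 3 * M * m" using half[OF x y m xy] by blast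
    obtain A' d' where A': "k / 2 \<le> d'" "(g (refln e l y) - g (refln e l x)) * d' = - A'" "\<bar>A' - ?B\<bar> \<le> K1 * m\<^sup>2 * ?w"
      "\<bar>A'\<bar> \<le> 3 * M * m * ?w" "\<bar>d' - k\<bar> \<le> 3 * M * m"
      using half[of "refln e l x" m "refln e l y"] x y m xy
      by (simp add: PR PRd norm_refl_0[OF e] BR perp_inner nu) blast
    have dp: "0 < d" "0 < d'" using A(1) A'(1) k by auto
    have AA: "A = - ((g y - g x) * d)" "A' = - ((g (refln e l y) - g (refln e l x)) * d')" using A(2) A'(2) by simp_all
    \<comment> \<open>Difference of two quotients: the numerators agree to order m^2, and the
      denominators differ by order m against a numerator of order m.\<close>
    have "u - u' = - (- (u * d) - - (u' * d')) / d + - (u' * d') * (d - d') / (d * d')" for u u'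
      using dp by (simp add: field_simps)
    from this[of "g y - g x" "g (refln e l y) - g (refln e l x)"]
    have "((g y - g x) - (g (refln e l y) - g (refln e l x))) = - (A - A') / d + A' * (d - d') / (d * d')"
      unfolding AA .
    moreover have "\<bar>- (A - A') / d\<bar> \<le> (2 * K1 * m\<^sup>2 * ?w) / (k / 2)"
    proof -
      have "\<bar>A - A'\<bar> \<le> 2 * K1 * m\<^sup>2 * ?w" using A(3) A'(3) by linarith
      then show ?thesis using A(1) k dp by (simp only: abs_divide abs_minus_cancel) (intro frac_le, auto)
    qed
    moreover have "\<bar>A' * (d - d') / (d * d')\<bar> \<le> (3 * M * m * ?w) * (6 * M * m) / (k / 2 * (k / 2))"
    proof -
      have "\<bar>d - d'\<bar> \<le> 6 * M * m" using A(5) A'(5) by linarith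
      then have "\<bar>A'\<bar> * \<bar>d - d'\<bar> \<le> (3 * M * m * ?w) * (6 * M * m)" using A'(4) M0 m0 by (intro mult_mono) auto
      moreover have "k / 2 * (k / 2) \<le> d * d'" using A(1) A'(1) k by (intro mult_mono) auto
      moreover have "0 \<le> (3 * M * m * ?w) * (6 * M * m)" using M0 m0 by (intro mult_nonneg_nonneg) auto
      ultimately show ?thesis using k dp by (simp only: abs_divide abs_mult) (intro frac_le, auto)
    qed
    ultimately have "\<bar>(g y - g x) - (g (refln e l y) - g (refln e l x))\<bar>
      \<le> (2 * K1 * m\<^sup>2 * ?w) / (k / 2) + (3 * M * m * ?w) * (6 * M * m) / (k / 2 * (k / 2))" by linarith
    also have "\<dots> = K * m\<^sup>2 * ?w" using k by (simp add: K_def field_simps power2_eq_square)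
    finally show ?thesis by (simp add: algebra_simps)
  qed
  show thesis
  proof (rule that[OF K0])
    fix x y m assume x: "norm (perp \<nu> (x - q)) \<le> m" and y: "norm (perp \<nu> (y - q)) \<le> m" and m: "m < \<delta>" "m \<le> 1"
    define H where "H x = g x - g (refln e l x)" for x
    show "\<bar>(g y - g (refln e l y)) - (g x - g (refln e l x))\<bar> \<le> K * m\<^sup>2 * norm (perp \<nu> (y - x))"
    \<comment> \<open>The subdivision has step length m^2, so m = 0 is treated separately; there x
      and y have the same projection.\<close>
    proof (cases "m = 0")
      case True
      then have "perp \<nu> (y - q) - perp \<nu> (x - q) = 0" using x y by simp
      then have "norm (perp \<nu> (y - x)) \<le> m\<^sup>2" by (simp add: perp_lin)
      then show ?thesis by (rule loc[OF x y m])
    next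
      case False
      define S where "S = {x. norm (perp \<nu> (x - q)) \<le> m}"
      have S: "convex S"
      proof -
        have "linear (perp \<nu>)" by (rule linearI) (auto simp: perp_lin)
        then have "convex (perp \<nu> -` cball (perp \<nu> q) m)" by (rule convex_linear_vimage) (rule convex_cball)
        moreover have "perp \<nu> -` cball (perp \<nu> q) m = S" by (auto simp: S_def dist_norm norm_minus_commute perp_lin)
        ultimately show ?thesis by simp
      qed
      have "\<bar>H y - H x\<bar> \<le> K * m\<^sup>2 * norm (perp \<nu> (y - x))"
      proof (rule seminorm_subdivide[OF S, of x y "m\<^sup>2" "K * m\<^sup>2"])
        show "\<bar>H y' - H x'\<bar> \<le> K * m\<^sup>2 * norm (perp \<nu> (y' - x'))"
          if "x' \<in> S" "y' \<in> S" "norm (perp \<nu> (y' - x')) \<le> m\<^sup>2" for x' y'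
          using loc[of x' m y'] that m by (simp add: S_def H_def)
      qed (use x y K0 False in \<open>auto simp: S_def\<close>)
      then show ?thesis by (simp add: H_def)
    qed
  qed
qed

section \<open>Splitting the energy\<close>

lemma emeasure_norm_less:
  "0 < t \<Longrightarrow> emeasure lborel {x::'a::euclidean_space. norm x < t} = ennreal (unit_ball_vol DIM('a) * t powr DIM('a))"
  using emeasure_ball[of t "0::'a"] by (simp add: ball_def powr_realpow)

lemma norm_powr_small:
  fixes a r :: real
  assumes "0 < (a::real)" "a < real DIM('a::euclidean_space)" "0 < r"
  shows "(\<integral>\<^sup>+h. ennreal (norm (h::'a) powr (-a)) * indicator {h. norm h < r} h \<partial>lborel)
    \<le> ennreal (unit_ball_vol DIM('a) * (DIM('a) / (DIM('a) - a)) * r powr (DIM('a) - a))"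
  by (rule nn_integral_powr_small) (use assms in \<open>auto simp: emeasure_norm_less lborel.sigma_finite_measure_axioms\<close>)

lemma norm_powr_tail:
  fixes a r :: real
  assumes "real DIM('a::euclidean_space) < a" "0 < r"
  shows "(\<integral>\<^sup>+h. ennreal (norm (h::'a) powr (-a)) * indicator {h. r \<le> norm h} h \<partial>lborel)
    \<le> ennreal (unit_ball_vol DIM('a) * (a / (a - DIM('a))) * r powr (DIM('a) - a))"
  by (rule nn_integral_powr_tail) (use assms in \<open>auto simp: emeasure_norm_less lborel.sigma_finite_measure_axioms\<close>)

lemma nn_integral_add3:
  "f \<in> borel_measurable M \<Longrightarrow> g \<in> borel_measurable M \<Longrightarrow> h \<in> borel_measurable M \<Longrightarrow>
   (\<integral>\<^sup>+x. f x + g x + h x \<partial>M) = (\<integral>\<^sup>+x. f x \<partial>M) + (\<integral>\<^sup>+x. g x \<partial>M) + (\<integral>\<^sup>+x. h x \<partial>M)"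
  by (simp add: nn_integral_add)

text \<open>Substitute y = x + h and apply Fubini. All energies are handled in this form, since a
  displacement h interacts well with graphs and reflections.\<close>

lemma double_shift:
  fixes A B :: "'a::euclidean_space set" and \<phi> :: "real \<Rightarrow> ennreal"
  assumes [measurable]: "A \<in> sets borel" "B \<in> sets borel" "\<phi> \<in> borel_measurable borel"
  shows "(\<integral>\<^sup>+x. (\<integral>\<^sup>+y. indicator A x * indicator B y * \<phi> (norm (x - y)) \<partial>lborel) \<partial>lborel)
     = (\<integral>\<^sup>+h. \<phi> (norm h) * emeasure lborel {x. x \<in> A \<and> x + h \<in> B} \<partial>lborel)"
proof -
  have "(\<integral>\<^sup>+y. indicator A x * indicator B y * \<phi> (norm (x - y)) \<partial>lborel)
     = (\<integral>\<^sup>+h. indicator A x * indicator B (x + h) * \<phi> (norm h) \<partial>lborel)" for x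
    using nn_integral_translate[of "\<lambda>y. indicator A x * indicator B y * \<phi> (norm (x - y))" x]
    by (simp add: add.commute)
  then have "(\<integral>\<^sup>+x. (\<integral>\<^sup>+y. indicator A x * indicator B y * \<phi> (norm (x - y)) \<partial>lborel) \<partial>lborel)
     = (\<integral>\<^sup>+x. (\<integral>\<^sup>+h. indicator A x * indicator B (x + h) * \<phi> (norm h) \<partial>lborel) \<partial>lborel)" by simp
  also have "\<dots> = (\<integral>\<^sup>+h. (\<integral>\<^sup>+x. indicator A x * indicator B (x + h) * \<phi> (norm h) \<partial>lborel) \<partial>lborel)"
    by (rule lborel_pair.Fubini') measurable
  also have "\<dots> = (\<integral>\<^sup>+h. \<phi> (norm h) * emeasure lborel {x. x \<in> A \<and> x + h \<in> B} \<partial>lborel)"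
  proof (rule nn_integral_cong)
    fix h :: 'a
    have "(\<integral>\<^sup>+x. indicator A x * indicator B (x + h) * \<phi> (norm h) \<partial>lborel)
       = (\<integral>\<^sup>+x. \<phi> (norm h) * indicator {x. x \<in> A \<and> x + h \<in> B} x \<partial>lborel)"
      by (intro nn_integral_cong) (auto simp: indicator_def)
    also have "\<dots> = \<phi> (norm h) * emeasure lborel {x. x \<in> A \<and> x + h \<in> B}"
      by (rule nn_integral_cmult_indicator) measurable
    finally show "(\<integral>\<^sup>+x. indicator A x * indicator B (x + h) * \<phi> (norm h) \<partial>lborel)
       = \<phi> (norm h) * emeasure lborel {x. x \<in> A \<and> x + h \<in> B}" .
  qed
  finally show ?thesis .
qed

lemma double_lebesgue:
  fixes A B :: "'a::euclidean_space set" and \<phi> :: "real \<Rightarrow> ennreal"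
  assumes [measurable]: "A \<in> sets borel" "B \<in> sets borel" "\<phi> \<in> borel_measurable borel"
  shows "(\<integral>\<^sup>+z\<in>A \<times> B. \<phi> (norm (fst z - snd z)) \<partial>lebesgue)
     = (\<integral>\<^sup>+h. \<phi> (norm h) * emeasure lborel {x. x \<in> A \<and> x + h \<in> B} \<partial>lborel)"
proof -
  have "(\<integral>\<^sup>+z\<in>A \<times> B. \<phi> (norm (fst z - snd z)) \<partial>lebesgue)
     = (\<integral>\<^sup>+z. indicator A (fst z) * indicator B (snd z) * \<phi> (norm (fst z - snd z)) \<partial>(lborel \<Otimes>\<^sub>M lborel))"
    by (simp add: nn_integral_completion lborel_prod) (intro nn_integral_cong, auto simp: indicator_def)
  also have "\<dots> = (\<integral>\<^sup>+x. (\<integral>\<^sup>+y. indicator A x * indicator B y * \<phi> (norm (x - y)) \<partial>lborel) \<partial>lborel)"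
    by (subst lborel.nn_integral_fst[symmetric]) auto
  finally show ?thesis by (simp add: double_shift)
qed

text \<open>The minus sign comes from writing an interaction of \<open>E\<close> with its complement
  as a total minus the self-interaction of \<open>E\<close>: formally the energy is a multiple of
  the volume minus the double integral of \<open>ker\<close> over E x E.\<close>

definition ker :: "real \<Rightarrow> real \<Rightarrow> real \<Rightarrow> real \<Rightarrow> real \<Rightarrow> real" where
  "ker n s \<alpha> \<epsilon> r = r powr (- (n + s)) - \<epsilon> * r powr (- \<alpha>)"

text \<open>The singular kernel is split into a bounded Lipschitz part, obtained by freezing \<open>ker\<close> below
  the radius \<open>\<delta>\<close>, and a nonnegative part \<open>ker_sing\<close> supported in the ball of radius \<open>\<delta>\<close>. The additive
  constant in \<open>ker_reg\<close> only makes it nonnegative; it is harmless as the volume is fixed.\<close>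

definition ker_reg :: "real \<Rightarrow> real \<Rightarrow> real \<Rightarrow> real \<Rightarrow> real \<Rightarrow> real \<Rightarrow> real" where
  "ker_reg n s \<alpha> \<epsilon> \<delta> r = ker n s \<alpha> \<epsilon> (max r \<delta>) + \<epsilon> * \<delta> powr (- \<alpha>)"

definition ker_sing :: "real \<Rightarrow> real \<Rightarrow> real \<Rightarrow> real \<Rightarrow> real \<Rightarrow> real \<Rightarrow> real" where
  "ker_sing n s \<alpha> \<epsilon> \<delta> r = (if 0 < r \<and> r < \<delta> then ker n s \<alpha> \<epsilon> r - ker n s \<alpha> \<epsilon> \<delta> else 0)"

text \<open>The singular part is paired with the complement, where the measure of crossing pairs is
  O(|h|) and makes the integral finite. The bounded part is paired with \<open>E\<close> itself in
  \<open>reg_pair\<close>.\<close>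

definition short_energy :: "real \<Rightarrow> real \<Rightarrow> real \<Rightarrow> real \<Rightarrow> 'a::euclidean_space set \<Rightarrow> ennreal" where
  "short_energy s \<alpha> \<epsilon> \<delta> A =
    (\<integral>\<^sup>+h. ennreal (ker_sing DIM('a) s \<alpha> \<epsilon> \<delta> (norm h)) * emeasure lborel {x. x \<in> A \<and> x + h \<notin> A} \<partial>lborel)"

definition reg_pair :: "real \<Rightarrow> real \<Rightarrow> real \<Rightarrow> real \<Rightarrow> 'a::euclidean_space set \<Rightarrow> 'a set \<Rightarrow> ennreal" where
  "reg_pair s \<alpha> \<epsilon> \<delta> A B =
    (\<integral>\<^sup>+x. (\<integral>\<^sup>+y. indicator A x * indicator B y * ennreal (ker_reg DIM('a) s \<alpha> \<epsilon> \<delta> (norm (x - y))) \<partial>lborel) \<partial>lborel)"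

definition reg_potential :: "real \<Rightarrow> real \<Rightarrow> real \<Rightarrow> real \<Rightarrow> 'a::euclidean_space set \<Rightarrow> 'a \<Rightarrow> real" where
  "reg_potential s \<alpha> \<epsilon> \<delta> B x = (LINT y|lborel. indicator B y * ker_reg DIM('a) s \<alpha> \<epsilon> \<delta> (norm (x - y)))"

lemma ker_measurable [measurable]:
  "ker n s \<alpha> \<epsilon> \<in> borel_measurable borel" "ker_reg n s \<alpha> \<epsilon> \<delta> \<in> borel_measurable borel"
  "ker_sing n s \<alpha> \<epsilon> \<delta> \<in> borel_measurable borel"
  unfolding ker_def[abs_def] ker_reg_def[abs_def] ker_sing_def[abs_def] by measurable

text \<open>The derivative of \<open>ker\<close> at r is - r^(-(n+s+1)) (n + s - \<epsilon> \<alpha>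
  r^(n+s-\<alpha>)), so \<open>mono\<close> says that it is negative on (0, D]. \<open>D\<close> is
  to bound every distance that occurs, \<delta> is the radius at which the kernel is split.\<close>

locale kernel =
  fixes n s \<alpha> \<epsilon> D \<delta> :: real
  assumes s: "0 < s" "s < 1" and al: "0 < \<alpha>" "\<alpha> < n" and eps: "0 < \<epsilon>" and n1: "1 \<le> n"
    and dl: "0 < \<delta>" "\<delta> < D"
    and mono: "\<epsilon> * \<alpha> * D powr (n + s - \<alpha>) < n + s"
begin

abbreviation "K \<equiv> ker n s \<alpha> \<epsilon>"
abbreviation "Kr \<equiv> ker_reg n s \<alpha> \<epsilon> \<delta>"
abbreviation "Ks \<equiv> ker_sing n s \<alpha> \<epsilon> \<delta>"

text \<open>A lower bound for minus the derivative of the kernel times r^(n+s+1), uniform on (0,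
  D].\<close>

definition "slope = n + s - \<epsilon> * \<alpha> * D powr (n + s - \<alpha>)"

lemma slope_pos: "0 < slope" using mono by (simp add: slope_def)

lemma ker_diff:
  assumes "0 < a" "a \<le> b" "b \<le> D"
  shows "slope * b powr (- (n + s + 1)) * (b - a) \<le> K a - K b"
    "K a - K b \<le> (n + s) * a powr (- (n + s + 1)) * (b - a)"
proof -
  have "slope * b powr (- (n + s + 1)) * (b - a) \<le> K a - K b \<and> K a - K b \<le> (n + s) * a powr (- (n + s + 1)) * (b - a)"
  proof (cases "a = b")
    case False
    then have ab: "a < b" using assms by simp
    define K' where "K' r = - (n + s) * r powr (- (n + s) - 1) - \<epsilon> * (- \<alpha> * r powr (- \<alpha> - 1))" for r
    have "(K has_real_derivative K' r) (at r)" if "a \<le> r" for r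
      unfolding ker_def[abs_def] K'_def using that assms by (auto intro!: derivative_eq_intros)
    then have "\<exists>z. a < z \<and> z < b \<and> K b - K a = (b - a) * K' z"
      using ab by (intro MVT2) auto
    then obtain z where z: "a < z" "z < b" "K b - K a = (b - a) * K' z" by blast
    define q where "q = (n + s) - \<epsilon> * \<alpha> * z powr (n + s - \<alpha>)"
    have zz: "z powr (- \<alpha> - 1) = z powr (n + s - \<alpha>) * z powr (- (n + s + 1))"
      by (subst powr_add[symmetric]) (rule arg_cong[where f="\<lambda>c. z powr c"], simp)
    have "K' z = - (z powr (- (n + s + 1)) * q)"
    proof -
      have pe: "z powr (- (n + s) - 1) = z powr (- (n + s + 1))" by (rule arg_cong[where f="\<lambda>c. z powr c"]) simp
      have "- (n + s) * w - \<epsilon> * (- \<alpha> * (y * w)) = - (w * (n + s - \<epsilon> * \<alpha> * y))" for w y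
        by (simp add: algebra_simps)
      then show ?thesis unfolding K'_def q_def zz pe .
    qed
    then have Kab: "K a - K b = (z powr (- (n + s + 1)) * q) * (b - a)" using z(3) by (simp add: algebra_simps)
    have "z powr (n + s - \<alpha>) \<le> D powr (n + s - \<alpha>)" using z assms al s by (intro powr_mono2) auto
    then have q1: "slope \<le> q" unfolding slope_def q_def using eps al by (simp add: mult_left_mono)
    have q2: "q \<le> n + s" unfolding q_def using eps al by simp
    have p1: "b powr (- (n + s + 1)) \<le> z powr (- (n + s + 1))" using z assms n1 s by (intro powr_mono2') auto
    have p2: "z powr (- (n + s + 1)) \<le> a powr (- (n + s + 1))" using z assms n1 s by (intro powr_mono2') auto
    have "slope * b powr (- (n + s + 1)) \<le> z powr (- (n + s + 1)) * q"
      using q1 p1 slope_pos by (subst mult.commute) (intro mult_mono, auto)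
    moreover have "z powr (- (n + s + 1)) * q \<le> (n + s) * a powr (- (n + s + 1))"
      using q1 q2 p2 slope_pos by (subst (2) mult.commute) (intro mult_mono, auto)
    ultimately show ?thesis unfolding Kab using ab by (auto intro!: mult_right_mono)
  qed auto
  then show "slope * b powr (- (n + s + 1)) * (b - a) \<le> K a - K b"
    "K a - K b \<le> (n + s) * a powr (- (n + s + 1)) * (b - a)" by auto
qed

lemma ker_antimono: "0 < a \<Longrightarrow> a \<le> b \<Longrightarrow> b \<le> D \<Longrightarrow> K b \<le> K a"
proof -
  assume a: "0 < a" "a \<le> b" "b \<le> D"
  have "0 \<le> slope * b powr (- (n + s + 1)) * (b - a)" using slope_pos a by simp
  then show "K b \<le> K a" using ker_diff(1)[OF a] by linarith
qed

lemma ker_sing_bounds: "0 \<le> Ks r" "Ks r \<le> r powr (- (n + s))"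
proof -
  show "0 \<le> Ks r" using ker_antimono[of r \<delta>] dl by (auto simp: ker_sing_def)
  show "Ks r \<le> r powr (- (n + s))"
  proof (cases "0 < r \<and> r < \<delta>")
    case True
    then have 1: "\<epsilon> * \<delta> powr (- \<alpha>) \<le> \<epsilon> * r powr (- \<alpha>)"
      using eps al by (intro mult_left_mono powr_mono2') auto
    have 2: "0 \<le> \<delta> powr (- (n + s))" by simp
    have "Ks r = K r - K \<delta>" using True by (simp add: ker_sing_def)
    then show ?thesis unfolding ker_def using 1 2 by linarith
  next
    case False then show ?thesis by (auto simp: ker_sing_def)
  qed
qed

lemma ker_reg_bounds: "0 \<le> Kr r" "Kr r \<le> \<delta> powr (- (n + s)) + \<epsilon> * \<delta> powr (- \<alpha>)"
proof -
  have 1: "\<epsilon> * max r \<delta> powr (- \<alpha>) \<le> \<epsilon> * \<delta> powr (- \<alpha>)" using eps al dl by (intro mult_left_mono powr_mono2') auto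
  have 2: "max r \<delta> powr (- (n + s)) \<le> \<delta> powr (- (n + s))" using n1 s dl by (intro powr_mono2') auto
  have 3: "0 \<le> max r \<delta> powr (- (n + s))" "0 \<le> \<epsilon> * max r \<delta> powr (- \<alpha>)" using eps by simp_all
  show "0 \<le> Kr r" "Kr r \<le> \<delta> powr (- (n + s)) + \<epsilon> * \<delta> powr (- \<alpha>)"
    unfolding ker_reg_def ker_def using 1 2 3 by linarith+
qed

text \<open>What is left of the fractional kernel once the singular part is removed. It is
  integrable over the whole space: near 0 because \<alpha> < n, at infinity because 0 < s.\<close>

definition "rest r = r powr (- (n + s)) - Ks r"

lemma rest_nonneg: "0 \<le> rest r" using ker_sing_bounds(2)[of r] unfolding rest_def by linarith

lemma rest_measurable [measurable]: "rest \<in> borel_measurable borel"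
  unfolding rest_def[abs_def] by measurable

lemma rest_eq: "0 < r \<Longrightarrow> \<epsilon> * r powr (- \<alpha>) + Kr r = rest r + \<epsilon> * \<delta> powr (- \<alpha>)"
  by (auto simp: rest_def ker_reg_def ker_sing_def ker_def max_def)

lemma rest_integrable:
  assumes "n = DIM('a::euclidean_space)"
  shows "(\<integral>\<^sup>+h. ennreal (rest (norm (h::'a))) \<partial>lborel) < \<infinity>"
proof -
  let ?c = "\<delta> powr (- (n + s))"
  have "ennreal (rest (norm h)) \<le> ennreal ?c * indicator {h. norm h < \<delta>} h
     + ennreal \<epsilon> * (ennreal (norm h powr (-\<alpha>)) * indicator {h. norm h < \<delta>} h)
     + ennreal (norm h powr (- (n + s))) * indicator {h. \<delta> \<le> norm h} h" for h :: 'a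
  proof (cases "norm h < \<delta>")
    case True
    have "0 \<le> \<epsilon> * \<delta> powr (-\<alpha>)" using eps by simp
    then have "rest (norm h) \<le> ?c + \<epsilon> * norm h powr (-\<alpha>)"
      using True eps by (cases "h = 0") (auto simp: rest_def ker_sing_def ker_def)
    then have "ennreal (rest (norm h)) \<le> ennreal (?c + \<epsilon> * norm h powr (-\<alpha>))" by (rule ennreal_leI)
    also have "\<dots> = ennreal ?c + ennreal \<epsilon> * ennreal (norm h powr (-\<alpha>))"
      using eps by (simp add: ennreal_plus ennreal_mult)
    finally show ?thesis using True by simp
  next
    case False
    then show ?thesis using ker_sing_bounds(1)[of "norm h"] by (auto intro!: ennreal_leI simp: rest_def)
  qed
  then have "(\<integral>\<^sup>+h. ennreal (rest (norm (h::'a))) \<partial>lborel) \<le>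
     (\<integral>\<^sup>+h. ennreal ?c * indicator {h::'a. norm h < \<delta>} h
     + ennreal \<epsilon> * (ennreal (norm h powr (-\<alpha>)) * indicator {h. norm h < \<delta>} h)
     + ennreal (norm h powr (- (n + s))) * indicator {h. \<delta> \<le> norm h} h \<partial>lborel)" by (intro nn_integral_mono)
  also have "\<dots> = ennreal ?c * emeasure lborel {h::'a. norm h < \<delta>}
     + ennreal \<epsilon> * (\<integral>\<^sup>+h. ennreal (norm (h::'a) powr (-\<alpha>)) * indicator {h. norm h < \<delta>} h \<partial>lborel)
     + (\<integral>\<^sup>+h. ennreal (norm (h::'a) powr (- (n + s))) * indicator {h. \<delta> \<le> norm h} h \<partial>lborel)"
  proof -
    have "(\<integral>\<^sup>+h. ennreal ?c * indicator {h::'a. norm h < \<delta>} h \<partial>lborel) = ennreal ?c * emeasure lborel {h::'a. norm h < \<delta>}"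
      by (rule nn_integral_cmult_indicator) measurable
    moreover have "(\<integral>\<^sup>+h. ennreal \<epsilon> * (ennreal (norm (h::'a) powr (-\<alpha>)) * indicator {h. norm h < \<delta>} h) \<partial>lborel)
      = ennreal \<epsilon> * (\<integral>\<^sup>+h. ennreal (norm (h::'a) powr (-\<alpha>)) * indicator {h. norm h < \<delta>} h \<partial>lborel)"
      by (rule nn_integral_cmult) measurable
    ultimately show ?thesis by (subst nn_integral_add3) simp_all
  qed
  also have "\<dots> < \<infinity>"
  proof -
    have "(\<integral>\<^sup>+h. ennreal (norm (h::'a) powr (-\<alpha>)) * indicator {h. norm h < \<delta>} h \<partial>lborel) < \<infinity>"
      by (rule le_less_trans[OF norm_powr_small]) (use al assms dl in auto)
    moreover have "(\<integral>\<^sup>+h. ennreal (norm (h::'a) powr (- (n + s))) * indicator {h. \<delta> \<le> norm h} h \<partial>lborel) < \<infinity>"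
      by (rule le_less_trans[OF norm_powr_tail]) (use s assms dl in auto)
    ultimately show ?thesis using dl by (simp add: emeasure_norm_less ennreal_mult_less_top)
  qed
  finally show ?thesis .
qed

text \<open>For every h the pairs that leave A and the pairs that stay in A together have measure
  |A|. So the integrable kernel \<open>rest\<close>, and likewise the additive constant of
  \<open>Kr\<close>, contribute terms depending on the volume only. The regular part stands on the
  left to avoid subtraction of possibly infinite quantities.\<close>

lemma energy_identity:
  fixes A :: "'a::euclidean_space set"
  assumes nD: "n = DIM('a)" and [measurable]: "A \<in> sets borel" and fin: "emeasure lborel A < \<infinity>"
  shows "(\<integral>\<^sup>+h. ennreal (norm h powr (- (n + s))) * emeasure lborel {x. x \<in> A \<and> x + h \<notin> A} \<partial>lborel)
     + ennreal \<epsilon> * (\<integral>\<^sup>+h. ennreal (norm h powr (- \<alpha>)) * emeasure lborel {x. x \<in> A \<and> x + h \<in> A} \<partial>lborel)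
     + reg_pair s \<alpha> \<epsilon> \<delta> A A
   = short_energy s \<alpha> \<epsilon> \<delta> A + (\<integral>\<^sup>+h. ennreal (rest (norm (h::'a))) \<partial>lborel) * emeasure lborel A
     + ennreal (\<epsilon> * \<delta> powr (- \<alpha>)) * (emeasure lborel A * emeasure lborel A)"
proof -
  define Z where "Z h = emeasure lborel {x. x \<in> A \<and> x + h \<notin> A}" for h
  define W where "W h = emeasure lborel {x. x \<in> A \<and> x + h \<in> A}" for h
  have [measurable]: "Z \<in> borel_measurable borel" "W \<in> borel_measurable borel"
    unfolding Z_def[abs_def] W_def[abs_def] by measurable
  have ZW: "Z h + W h = emeasure lborel A" for h
    unfolding Z_def W_def by (subst plus_emeasure) (auto intro!: arg_cong[where f="emeasure lborel"])
  let ?c = "ennreal (\<epsilon> * \<delta> powr (- \<alpha>))"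
  have cW: "(\<integral>\<^sup>+h. ?c * W h \<partial>lborel) = ?c * (emeasure lborel A * emeasure lborel A)"
  proof -
    have "(\<integral>\<^sup>+h. ?c * W h \<partial>lborel) = (\<integral>\<^sup>+x. (\<integral>\<^sup>+y. indicator A x * indicator A y * ?c \<partial>lborel) \<partial>lborel)"
      unfolding W_def by (rule double_shift[of A A "\<lambda>_. ?c", symmetric]) auto
    also have "\<dots> = (\<integral>\<^sup>+x. indicator A x * (\<integral>\<^sup>+y. indicator A y * ?c \<partial>lborel) \<partial>lborel)"
      by (intro nn_integral_cong) (simp add: nn_integral_cmult[symmetric] mult.assoc)
    also have "\<dots> = ?c * (emeasure lborel A * emeasure lborel A)"
      by (simp add: nn_integral_multc mult_ac)
    finally show ?thesis .
  qed
  have reg: "reg_pair s \<alpha> \<epsilon> \<delta> A A = (\<integral>\<^sup>+h. ennreal (Kr (norm h)) * W h \<partial>lborel)"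
    unfolding reg_pair_def W_def nD by (rule double_shift[of A A "\<lambda>r. ennreal (ker_reg DIM('a) s \<alpha> \<epsilon> \<delta> r)"]) auto
  have short: "short_energy s \<alpha> \<epsilon> \<delta> A = (\<integral>\<^sup>+h. ennreal (Ks (norm h)) * Z h \<partial>lborel)"
    unfolding short_energy_def Z_def nD ..
  \<comment> \<open>\<open>rest_eq\<close> is available for positive radius only, hence the
    exclusion of the null set h = 0.\<close>
  have pw: "AE h in lborel. ennreal (norm h powr (- (n + s))) * Z h + ennreal \<epsilon> * (ennreal (norm h powr (- \<alpha>)) * W h) + ennreal (Kr (norm h)) * W h
     = ennreal (Ks (norm h)) * Z h + ennreal (rest (norm h)) * emeasure lborel A + ?c * W h"
    using AE_lborel_singleton[of "0::'a"]
  proof eventually_elim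
    fix h :: 'a assume h: "h \<noteq> 0"
    have 1: "ennreal (norm h powr (- (n + s))) = ennreal (Ks (norm h)) + ennreal (rest (norm h))"
      using ker_sing_bounds rest_nonneg by (subst ennreal_plus[symmetric]) (auto simp: rest_def)
    have 2: "ennreal \<epsilon> * ennreal (norm h powr (- \<alpha>)) + ennreal (Kr (norm h)) = ennreal (rest (norm h)) + ?c"
      using rest_eq[of "norm h"] h eps ker_reg_bounds rest_nonneg
      by (simp add: ennreal_mult[symmetric] ennreal_plus[symmetric] del: ennreal_plus)
    have "ennreal (norm h powr (- (n + s))) * Z h + ennreal \<epsilon> * (ennreal (norm h powr (- \<alpha>)) * W h) + ennreal (Kr (norm h)) * W h
      = (ennreal (Ks (norm h)) + ennreal (rest (norm h))) * Z h + (ennreal \<epsilon> * ennreal (norm h powr (- \<alpha>)) + ennreal (Kr (norm h))) * W h"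
      unfolding 1 by (simp add: distrib_right mult.assoc add.assoc)
    also have "\<dots> = ennreal (Ks (norm h)) * Z h + ennreal (rest (norm h)) * (Z h + W h) + ?c * W h"
      unfolding 2 by (simp add: distrib_right distrib_left ac_simps)
    finally show "ennreal (norm h powr (- (n + s))) * Z h + ennreal \<epsilon> * (ennreal (norm h powr (- \<alpha>)) * W h) + ennreal (Kr (norm h)) * W h
     = ennreal (Ks (norm h)) * Z h + ennreal (rest (norm h)) * emeasure lborel A + ?c * W h" unfolding ZW .
  qed
  have "(\<integral>\<^sup>+h. ennreal (norm h powr (- (n + s))) * Z h \<partial>lborel) + ennreal \<epsilon> * (\<integral>\<^sup>+h. ennreal (norm h powr (- \<alpha>)) * W h \<partial>lborel)
      + (\<integral>\<^sup>+h. ennreal (Kr (norm h)) * W h \<partial>lborel)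
    = (\<integral>\<^sup>+h. ennreal (norm h powr (- (n + s))) * Z h + ennreal \<epsilon> * (ennreal (norm h powr (- \<alpha>)) * W h) + ennreal (Kr (norm h)) * W h \<partial>lborel)"
  proof -
    have "(\<integral>\<^sup>+h. ennreal \<epsilon> * (ennreal (norm h powr (- \<alpha>)) * W h) \<partial>lborel) = ennreal \<epsilon> * (\<integral>\<^sup>+h. ennreal (norm h powr (- \<alpha>)) * W h \<partial>lborel)"
      by (rule nn_integral_cmult) measurable
    then show ?thesis by (subst nn_integral_add3) simp_all
  qed
  also have "\<dots> = (\<integral>\<^sup>+h. ennreal (Ks (norm h)) * Z h + ennreal (rest (norm h)) * emeasure lborel A + ?c * W h \<partial>lborel)"
    by (rule nn_integral_cong_AE[OF pw])
  also have "\<dots> = (\<integral>\<^sup>+h. ennreal (Ks (norm h)) * Z h \<partial>lborel) + (\<integral>\<^sup>+h. ennreal (rest (norm (h::'a))) \<partial>lborel) * emeasure lborel A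
     + (\<integral>\<^sup>+h. ?c * W h \<partial>lborel)"
  proof -
    have "(\<integral>\<^sup>+h. ennreal (rest (norm (h::'a))) * emeasure lborel A \<partial>lborel) = (\<integral>\<^sup>+h. ennreal (rest (norm (h::'a))) \<partial>lborel) * emeasure lborel A"
      by (rule nn_integral_multc) measurable
    then show ?thesis by (subst nn_integral_add3) simp_all
  qed
  finally show ?thesis unfolding reg short cW by (simp add: Z_def W_def)
qed

lemma reg_pair_finite:
  fixes A B :: "'a::euclidean_space set"
  assumes nD: "n = DIM('a)" and [measurable]: "A \<in> sets borel" "B \<in> sets borel"
  shows "reg_pair s \<alpha> \<epsilon> \<delta> A B \<le> ennreal (\<delta> powr (- (n + s)) + \<epsilon> * \<delta> powr (- \<alpha>)) * (emeasure lborel A * emeasure lborel B)"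
proof -
  let ?b = "ennreal (\<delta> powr (- (n + s)) + \<epsilon> * \<delta> powr (- \<alpha>))"
  have "reg_pair s \<alpha> \<epsilon> \<delta> A B \<le> (\<integral>\<^sup>+x. (\<integral>\<^sup>+y. indicator A x * indicator B y * ?b \<partial>lborel) \<partial>lborel)"
    unfolding reg_pair_def using ker_reg_bounds(2) nD by (intro nn_integral_mono mult_left_mono ennreal_leI) auto
  also have "\<dots> = (\<integral>\<^sup>+x. indicator A x * (\<integral>\<^sup>+y. indicator B y * ?b \<partial>lborel) \<partial>lborel)"
    by (intro nn_integral_cong) (simp add: nn_integral_cmult[symmetric] mult.assoc)
  also have "\<dots> = ?b * (emeasure lborel A * emeasure lborel B)"
    by (simp add: nn_integral_multc mult_ac)
  finally show ?thesis .
qed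

lemma reg_pair_union:
  fixes A B C :: "'a::euclidean_space set"
  assumes [measurable]: "A \<in> sets borel" "B \<in> sets borel" "C \<in> sets borel" and d: "A \<inter> B = {}"
  shows "reg_pair s \<alpha> \<epsilon> \<delta> (A \<union> B) C = reg_pair s \<alpha> \<epsilon> \<delta> A C + reg_pair s \<alpha> \<epsilon> \<delta> B C"
proof -
  have "indicator (A \<union> B) x = (indicator A x + indicator B x :: ennreal)" for x using d by (auto simp: indicator_def)
  then show ?thesis unfolding reg_pair_def
    by (simp add: distrib_right nn_integral_add)
qed

lemma reg_pair_sym:
  fixes A B :: "'a::euclidean_space set"
  assumes [measurable]: "A \<in> sets borel" "B \<in> sets borel"
  shows "reg_pair s \<alpha> \<epsilon> \<delta> A B = reg_pair s \<alpha> \<epsilon> \<delta> B A"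
proof -
  have "reg_pair s \<alpha> \<epsilon> \<delta> A B = (\<integral>\<^sup>+y. (\<integral>\<^sup>+x. indicator A x * indicator B y * ennreal (ker_reg DIM('a) s \<alpha> \<epsilon> \<delta> (norm (x - y))) \<partial>lborel) \<partial>lborel)"
    unfolding reg_pair_def by (rule lborel_pair.Fubini') measurable
  then show ?thesis unfolding reg_pair_def by (simp add: norm_minus_commute mult_ac)
qed

lemma potential_integrable:
  fixes B :: "'a::euclidean_space set"
  assumes nD: "n = DIM('a)" and [measurable]: "B \<in> sets borel" and fin: "emeasure lborel B < \<infinity>"
  shows "integrable lborel (\<lambda>y. indicator B y * ker_reg DIM('a) s \<alpha> \<epsilon> \<delta> (norm (x - y)))"
proof (rule Bochner_Integration.integrable_bound)
  show "integrable lborel (\<lambda>y. indicator B y * (\<delta> powr (- (n + s)) + \<epsilon> * \<delta> powr (- \<alpha>)))"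
    using fin by (intro integrable_mult_left integrable_real_indicator) auto
  show "AE y in lborel. norm (indicator B y * ker_reg DIM('a) s \<alpha> \<epsilon> \<delta> (norm (x - y)))
     \<le> norm (indicator B y * (\<delta> powr (- (n + s)) + \<epsilon> * \<delta> powr (- \<alpha>)))"
    using ker_reg_bounds nD eps by (auto simp: indicator_def abs_mult)
qed measurable

lemma reg_pair_potential:
  fixes A B :: "'a::euclidean_space set"
  assumes nD: "n = DIM('a)" and [measurable]: "A \<in> sets borel" "B \<in> sets borel" and fin: "emeasure lborel B < \<infinity>"
  shows "reg_pair s \<alpha> \<epsilon> \<delta> A B = (\<integral>\<^sup>+x. indicator A x * ennreal (reg_potential s \<alpha> \<epsilon> \<delta> B x) \<partial>lborel)"
    "0 \<le> reg_potential s \<alpha> \<epsilon> \<delta> B x"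
proof -
  have nn: "0 \<le> indicator B y * ker_reg DIM('a) s \<alpha> \<epsilon> \<delta> (norm (x - y))" for x y using ker_reg_bounds nD by (auto simp: indicator_def)
  show "0 \<le> reg_potential s \<alpha> \<epsilon> \<delta> B x" unfolding reg_potential_def using nn by (rule Bochner_Integration.integral_nonneg)
  have "(\<integral>\<^sup>+y. indicator A x * indicator B y * ennreal (ker_reg DIM('a) s \<alpha> \<epsilon> \<delta> (norm (x - y))) \<partial>lborel)
     = indicator A x * ennreal (reg_potential s \<alpha> \<epsilon> \<delta> B x)" for x
  proof -
    have "(\<integral>\<^sup>+y. indicator A x * indicator B y * ennreal (ker_reg DIM('a) s \<alpha> \<epsilon> \<delta> (norm (x - y))) \<partial>lborel)
      = (\<integral>\<^sup>+y. indicator A x * ennreal (indicator B y * ker_reg DIM('a) s \<alpha> \<epsilon> \<delta> (norm (x - y))) \<partial>lborel)"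
      by (intro nn_integral_cong) (auto simp: indicator_def)
    also have "\<dots> = indicator A x * (\<integral>\<^sup>+y. ennreal (indicator B y * ker_reg DIM('a) s \<alpha> \<epsilon> \<delta> (norm (x - y))) \<partial>lborel)"
      by (rule nn_integral_cmult) measurable
    also have "(\<integral>\<^sup>+y. ennreal (indicator B y * ker_reg DIM('a) s \<alpha> \<epsilon> \<delta> (norm (x - y))) \<partial>lborel) = ennreal (reg_potential s \<alpha> \<epsilon> \<delta> B x)"
      unfolding reg_potential_def using nn by (intro nn_integral_eq_integral potential_integrable[OF nD _ fin]) auto
    finally show ?thesis .
  qed
  then show "reg_pair s \<alpha> \<epsilon> \<delta> A B = (\<integral>\<^sup>+x. indicator A x * ennreal (reg_potential s \<alpha> \<epsilon> \<delta> B x) \<partial>lborel)"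
    unfolding reg_pair_def by simp
qed

text \<open>First variation of a quadratic form when N is exchanged for M: the change is twice the
  difference of the interactions with S \<union> N, up to the cross term of M and N, which is of
  second order in the volume moved. A surplus self-interaction of N has the favourable sign and is
  dropped.\<close>

lemma reg_pair_exchange:
  fixes S M N :: "'a::euclidean_space set"
  assumes nD: "n = DIM('a)" and [measurable]: "S \<in> sets borel" "M \<in> sets borel" "N \<in> sets borel"
    and d: "S \<inter> M = {}" "S \<inter> N = {}" and fin: "emeasure lborel (S \<union> N) < \<infinity>"
    and gain: "reg_pair s \<alpha> \<epsilon> \<delta> N (S \<union> N) + a \<le> reg_pair s \<alpha> \<epsilon> \<delta> M (S \<union> N)"
    and b: "b = ennreal (\<delta> powr (- (n + s)) + \<epsilon> * \<delta> powr (- \<alpha>))"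
  shows "reg_pair s \<alpha> \<epsilon> \<delta> (S \<union> N) (S \<union> N) + 2 * a \<le> reg_pair s \<alpha> \<epsilon> \<delta> (S \<union> M) (S \<union> M)
     + 2 * (b * (emeasure lborel M * emeasure lborel N))"
proof -
  let ?r = "reg_pair s \<alpha> \<epsilon> \<delta>"
  have un: "?r (A \<union> B) (A \<union> B) = ?r A A + 2 * ?r B A + ?r B B" if [measurable]: "A \<in> sets borel" "B \<in> sets borel" and "A \<inter> B = {}" for A B :: "'a set"
  proof -
    have "?r (A \<union> B) (A \<union> B) = ?r A (A \<union> B) + ?r B (A \<union> B)" by (rule reg_pair_union) (use that in auto)
    also have "?r A (A \<union> B) = ?r A A + ?r B A" by (subst reg_pair_sym, simp, simp, rule reg_pair_union) (use that in auto)
    also have "?r B (A \<union> B) = ?r A B + ?r B B" by (subst reg_pair_sym, simp, simp, rule reg_pair_union) (use that in auto)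
    also have "?r A B = ?r B A" by (rule reg_pair_sym) auto
    finally show ?thesis by (simp add: mult_2 ac_simps)
  qed
  have cross: "?r B (S \<union> N) = ?r B S + ?r B N" if [measurable]: "B \<in> sets borel" for B :: "'a set"
  proof -
    have "?r B (S \<union> N) = ?r (S \<union> N) B" by (rule reg_pair_sym) auto
    also have "\<dots> = ?r S B + ?r N B" by (rule reg_pair_union) (use d in auto)
    also have "?r S B = ?r B S" by (rule reg_pair_sym) auto
    also have "?r N B = ?r B N" by (rule reg_pair_sym) auto
    finally show ?thesis .
  qed
  have MN: "?r M N \<le> b * (emeasure lborel M * emeasure lborel N)" unfolding b by (rule reg_pair_finite[OF nD]) auto
  have g: "?r N S + ?r N N + a \<le> ?r M S + ?r M N" using gain by (simp add: cross)
  have "?r (S \<union> N) (S \<union> N) + 2 * a = ?r S S + 2 * ?r N S + ?r N N + 2 * a" by (simp add: un d)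
  also have "\<dots> \<le> ?r S S + 2 * (?r N S + ?r N N + a)"
  proof -
    have "?r N N + ?r N N \<ge> ?r N N" by simp
    then have "?r S S + 2 * ?r N S + ?r N N + 2 * a \<le> ?r S S + 2 * ?r N S + (?r N N + ?r N N) + 2 * a"
      by (intro add_mono) auto
    then show ?thesis by (simp add: mult_2 distrib_left ac_simps)
  qed
  also have "\<dots> \<le> ?r S S + 2 * (?r M S + ?r M N)" using g by (intro add_left_mono mult_left_mono) auto
  also have "\<dots> \<le> ?r S S + 2 * (?r M S + b * (emeasure lborel M * emeasure lborel N))"
    using MN by (intro add_left_mono mult_left_mono) auto
  also have "\<dots> \<le> (?r S S + 2 * ?r M S + ?r M M) + 2 * (b * (emeasure lborel M * emeasure lborel N))"
    by (simp add: distrib_left add.assoc)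
  also have "?r S S + 2 * ?r M S + ?r M M = ?r (S \<union> M) (S \<union> M)" by (simp add: un d)
  finally show ?thesis .
qed

end

lemma lborel_refl: "norm e = 1 \<Longrightarrow> distr lborel borel (refln e l) = (lborel :: 'a::euclidean_space measure)"
proof (rule measure_eqI)
  fix A assume "norm e = 1" "A \<in> sets (distr lborel borel (refln e l))"
  then show "emeasure (distr lborel borel (refln e l)) A = emeasure lborel A"
    using emeasure_refl_vimage[of e A l] by (simp add: emeasure_distr vimage_def)
qed simp

lemma integral_refl:
  fixes \<phi> :: "'a::euclidean_space \<Rightarrow> real"
  assumes "norm e = 1" and [measurable]: "\<phi> \<in> borel_measurable borel"
  shows "(LINT x|lborel. \<phi> (refln e l x)) = (LINT x|lborel. \<phi> x)"
proof -
  have "(LINT x|lborel. \<phi> x) = (LINT x|distr lborel borel (refln e l). \<phi> x)" using assms by (simp add: lborel_refl)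
  also have "\<dots> = (LINT x|lborel. \<phi> (refln e l x))" by (rule integral_distr) auto
  finally show ?thesis by simp
qed

section \<open>The regular part: Lipschitz bound and gain under reflection\<close>

context kernel
begin

lemma ker_reg_antimono: "0 \<le> a \<Longrightarrow> a \<le> b \<Longrightarrow> b \<le> D \<Longrightarrow> Kr b \<le> Kr a"
  using ker_antimono[of "max a \<delta>" "max b \<delta>"] dl by (auto simp: ker_reg_def)

text \<open>Radii that differ by at most \<delta>/2 stay comparable to
  \<open>max r \<delta>\<close>, so the derivative bound of \<open>ker_diff\<close> can be taken at
  half of that radius.\<close>

lemma ker_reg_lipschitz:
  assumes "0 \<le> r" "0 \<le> r'" "r \<le> D" "r' \<le> D" "\<bar>r - r'\<bar> \<le> \<delta> / 2"
  shows "\<bar>Kr r - Kr r'\<bar> \<le> (n + s) * (max r \<delta> / 2) powr (- (n + s + 1)) * \<bar>r - r'\<bar>"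
proof -
  have *: "\<bar>Kr a - Kr b\<bar> \<le> (n + s) * (max r \<delta> / 2) powr (- (n + s + 1)) * \<bar>a - b\<bar>"
    if "a \<le> b" "0 \<le> a" "b \<le> D" "max r \<delta> / 2 \<le> max a \<delta>" for a b
  proof -
    have m: "max a \<delta> \<le> max b \<delta>" "0 < max a \<delta>" "max b \<delta> \<le> D" using that dl by auto
    have "\<bar>Kr a - Kr b\<bar> = K (max a \<delta>) - K (max b \<delta>)" using ker_antimono[OF m(2,1,3)] by (simp add: ker_reg_def)
    also have "\<dots> \<le> (n + s) * max a \<delta> powr (- (n + s + 1)) * (max b \<delta> - max a \<delta>)" by (rule ker_diff(2)[OF m(2,1,3)])
    also have "\<dots> \<le> (n + s) * (max r \<delta> / 2) powr (- (n + s + 1)) * \<bar>a - b\<bar>"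
    proof (rule mult_mono)
      show "(n + s) * max a \<delta> powr (- (n + s + 1)) \<le> (n + s) * (max r \<delta> / 2) powr (- (n + s + 1))"
        using that s n1 dl by (intro mult_left_mono powr_mono2') auto
      show "max b \<delta> - max a \<delta> \<le> \<bar>a - b\<bar>" using that by (auto simp: max_def)
    qed (use that s n1 m in auto)
    finally show ?thesis .
  qed
  show ?thesis
  proof (cases "r \<le> r'")
    case True
    have "0 \<le> max r \<delta>" using dl by simp
    then have "max r \<delta> / 2 \<le> max r \<delta>" by linarith
    with True assms show ?thesis by (intro *) simp_all
  next
    case False
    then have "\<bar>Kr r' - Kr r\<bar> \<le> (n + s) * (max r \<delta> / 2) powr (- (n + s + 1)) * \<bar>r' - r\<bar>"
      using assms dl by (intro *) (auto simp: max_def abs_if split: if_splits)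
    then show ?thesis by (simp add: abs_minus_commute)
  qed
qed

text \<open>The factor (n+s) 2^(n+s+1) comes from \<open>ker_reg_lipschitz\<close>; the rest bounds
  \<delta>^(1+s) times the integral of max(|y|, \<delta>)^(-(n+s+1)), with 1 for the ball of radius
  \<delta> and (n+s+1)/(s+1) for its complement.\<close>

definition "lip_const = (n + s) * 2 powr (n + s + 1) * (unit_ball_vol n * (1 + (n + s + 1) / (s + 1)))"

lemma lip_const_nonneg: "0 \<le> lip_const" unfolding lip_const_def using n1 s by (intro mult_nonneg_nonneg) auto

text \<open>The kernel bound is integrated over all of space. Used with \<delta> = \<rho>/2 and
  displacements of order \<rho> L, the power \<delta>^(-(1+s)) produces an error of order L
  \<rho>^(-s).\<close>

lemma potential_lipschitz:
  fixes E :: "'a::euclidean_space set"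
  assumes nD: "n = DIM('a)" and [measurable]: "E \<in> sets borel" and fin: "emeasure lborel E < \<infinity>"
    and near: "norm (x - x') \<le> \<delta> / 2" and D: "\<And>y. y \<in> E \<Longrightarrow> norm (x - y) \<le> D" "\<And>y. y \<in> E \<Longrightarrow> norm (x' - y) \<le> D"
  shows "\<bar>reg_potential s \<alpha> \<epsilon> \<delta> E x - reg_potential s \<alpha> \<epsilon> \<delta> E x'\<bar> \<le> lip_const * \<delta> powr (- (1 + s)) * norm (x - x')"
proof -
  let ?a = "n + s + 1"
  define w where "w = norm (x - x')"
  define c where "c = (n + s) * 2 powr ?a * w"
  have c0: "0 \<le> c" using n1 s by (simp add: c_def w_def)
  have pw: "norm (indicator E y * Kr (norm (x - y)) - indicator E y * Kr (norm (x' - y)))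
     \<le> c * (\<delta> powr (- ?a) * indicator {y. norm (y - x) < \<delta>} y + norm (y - x) powr (- ?a) * indicator {y. \<delta> \<le> norm (y - x)} y)" for y
  proof (cases "y \<in> E")
    case True
    let ?m = "max (norm (x - y)) \<delta>"
    have ww: "\<bar>norm (x - y) - norm (x' - y)\<bar> \<le> w" using norm_triangle_ineq3[of "x - y" "x' - y"] by (simp add: w_def)
    have "\<bar>Kr (norm (x - y)) - Kr (norm (x' - y))\<bar> \<le> (n + s) * (?m / 2) powr (- ?a) * \<bar>norm (x - y) - norm (x' - y)\<bar>"
      using D[OF True] ww near by (intro ker_reg_lipschitz) (auto simp: w_def)
    also have "\<dots> \<le> (n + s) * (?m / 2) powr (- ?a) * w" using ww n1 s by (intro mult_left_mono) auto
    also have "(?m / 2) powr (- ?a) = 2 powr ?a * ?m powr (- ?a)"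
    proof -
      have "(?m / 2) powr (- ?a) = ?m powr (- ?a) / 2 powr (- ?a)" by (rule powr_divide)
      also have "2 powr (- ?a) = inverse (2 powr ?a)" by (rule powr_minus)
      finally show ?thesis by (simp only: divide_inverse inverse_inverse_eq mult.commute)
    qed
    also have "(n + s) * (2 powr ?a * ?m powr (- ?a)) * w = c * ?m powr (- ?a)" by (simp add: c_def)
    also have "?m powr (- ?a) = \<delta> powr (- ?a) * indicator {y. norm (y - x) < \<delta>} y + norm (y - x) powr (- ?a) * indicator {y. \<delta> \<le> norm (y - x)} y"
      by (auto simp: max_def indicator_def norm_minus_commute)
    finally show ?thesis using True by simp
  next
    case False
    have "0 \<le> c * (\<delta> powr (- ?a) * indicator {y. norm (y - x) < \<delta>} y + norm (y - x) powr (- ?a) * indicator {y. \<delta> \<le> norm (y - x)} y)"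
      using c0 by (intro mult_nonneg_nonneg add_nonneg_nonneg) auto
    with False show ?thesis by simp
  qed
  have "ennreal (norm (reg_potential s \<alpha> \<epsilon> \<delta> E x - reg_potential s \<alpha> \<epsilon> \<delta> E x'))
     = ennreal (norm (LINT y|lborel. indicator E y * Kr (norm (x - y)) - indicator E y * Kr (norm (x' - y))))"
    unfolding reg_potential_def using potential_integrable[OF nD _ fin] nD by (subst Bochner_Integration.integral_diff) auto
  also have "\<dots> \<le> (\<integral>\<^sup>+y. ennreal (norm (indicator E y * Kr (norm (x - y)) - indicator E y * Kr (norm (x' - y)))) \<partial>lborel)"
    using potential_integrable[OF nD _ fin] nD by (intro integral_norm_bound_ennreal Bochner_Integration.integrable_diff) auto
  also have "\<dots> \<le> (\<integral>\<^sup>+y. ennreal (c * (\<delta> powr (- ?a) * indicator {y. norm (y - x) < \<delta>} y + norm (y - x) powr (- ?a) * indicator {y. \<delta> \<le> norm (y - x)} y)) \<partial>lborel)"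
    by (intro nn_integral_mono ennreal_leI pw)
  also have "\<dots> = (\<integral>\<^sup>+y. ennreal c * (ennreal (\<delta> powr (- ?a)) * indicator {y. norm y < \<delta>} (y - x) + ennreal (norm (y - x) powr (- ?a)) * indicator {y. \<delta> \<le> norm y} (y - x)) \<partial>lborel)"
    using c0 by (intro nn_integral_cong) (auto simp: indicator_def ennreal_mult)
  also have "\<dots> = (\<integral>\<^sup>+y. ennreal c * (ennreal (\<delta> powr (- ?a)) * indicator {y::'a. norm y < \<delta>} y + ennreal (norm y powr (- ?a)) * indicator {y. \<delta> \<le> norm y} y) \<partial>lborel)"
    using nn_integral_translate[of "\<lambda>y. ennreal c * (ennreal (\<delta> powr (- ?a)) * indicator {y. norm y < \<delta>} y + ennreal (norm y powr (- ?a)) * indicator {y. \<delta> \<le> norm y} y)" "- x"]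
    by simp
  also have "\<dots> = ennreal c * (ennreal (\<delta> powr (- ?a)) * emeasure lborel {y::'a. norm y < \<delta>} + (\<integral>\<^sup>+y. ennreal (norm (y::'a) powr (- ?a)) * indicator {y. \<delta> \<le> norm y} y \<partial>lborel))"
  proof -
    have "(\<integral>\<^sup>+y. ennreal (\<delta> powr (- ?a)) * indicator {y::'a. norm y < \<delta>} y \<partial>lborel) = ennreal (\<delta> powr (- ?a)) * emeasure lborel {y::'a. norm y < \<delta>}"
      by (rule nn_integral_cmult_indicator) measurable
    then have "(\<integral>\<^sup>+y. ennreal (\<delta> powr (- ?a)) * indicator {y::'a. norm y < \<delta>} y + ennreal (norm y powr (- ?a)) * indicator {y. \<delta> \<le> norm y} y \<partial>lborel)
      = ennreal (\<delta> powr (- ?a)) * emeasure lborel {y::'a. norm y < \<delta>} + (\<integral>\<^sup>+y. ennreal (norm (y::'a) powr (- ?a)) * indicator {y. \<delta> \<le> norm y} y \<partial>lborel)"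
      by (subst nn_integral_add) simp_all
    moreover have "(\<integral>\<^sup>+y. ennreal c * (ennreal (\<delta> powr (- ?a)) * indicator {y::'a. norm y < \<delta>} y + ennreal (norm y powr (- ?a)) * indicator {y. \<delta> \<le> norm y} y) \<partial>lborel)
      = ennreal c * (\<integral>\<^sup>+y. ennreal (\<delta> powr (- ?a)) * indicator {y::'a. norm y < \<delta>} y + ennreal (norm y powr (- ?a)) * indicator {y. \<delta> \<le> norm y} y \<partial>lborel)"
      by (rule nn_integral_cmult) measurable
    ultimately show ?thesis by simp
  qed
  also have "\<dots> \<le> ennreal c * (ennreal (\<delta> powr (- ?a)) * ennreal (unit_ball_vol n * \<delta> powr n) + ennreal (unit_ball_vol n * (?a / (?a - n)) * \<delta> powr (n - ?a)))"
    using norm_powr_tail[where 'a='a, of ?a \<delta>] dl s nD by (intro mult_left_mono add_mono) (auto simp: emeasure_norm_less)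
  also have "\<dots> = ennreal (c * (\<delta> powr (- ?a) * (unit_ball_vol n * \<delta> powr n) + unit_ball_vol n * (?a / (?a - n)) * \<delta> powr (n - ?a)))"
  proof -
    have gen: "ennreal u * (ennreal v * ennreal w + ennreal z) = ennreal (u * (v * w + z))"
      if "0 \<le> u" "0 \<le> v" "0 \<le> w" "0 \<le> z" for u v w z :: real
      using that by (simp add: ennreal_mult ennreal_plus)
    show ?thesis by (rule gen) (use c0 n1 s in auto)
  qed
  also have "\<delta> powr (- ?a) * (unit_ball_vol n * \<delta> powr n) = unit_ball_vol n * \<delta> powr (- (1 + s))"
  proof -
    have "\<delta> powr (- ?a) * \<delta> powr n = \<delta> powr (- (1 + s))"
      by (subst powr_add[symmetric]) (rule arg_cong[where f="\<lambda>c. \<delta> powr c"], simp)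
    then show ?thesis by (metis mult.left_commute)
  qed
  also have "n - ?a = - (1 + s)" by simp
  also have "?a - n = s + 1" by simp
  also have "c * (unit_ball_vol n * \<delta> powr (- (1 + s)) + unit_ball_vol n * (?a / (s + 1)) * \<delta> powr (- (1 + s)))
     = lip_const * \<delta> powr (- (1 + s)) * w"
  proof -
    have gen: "(u * v * w) * (z * p + z * q * p) = (u * v * (z * (1 + q))) * p * w" for u v w z p q :: real
      by (simp add: algebra_simps)
    show ?thesis unfolding c_def lip_const_def by (rule gen)
  qed
  finally show ?thesis using lip_const_nonneg by (simp add: w_def)
qed

text \<open>The difference of the two kernels is odd under the reflection in y, so the part of
  \<open>E\<close> whose mirror image lies in \<open>E\<close> cancels. The other part lies on the
  side of x, where the difference is nonnegative, and on \<open>A\<close> it is bounded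
  below.\<close>

lemma potential_gain:
  fixes E :: "'a::euclidean_space set"
  assumes nD: "n = DIM('a)" and e: "norm e = 1" and [measurable]: "E \<in> sets borel" "A \<in> sets borel" and fin: "emeasure lborel E < \<infinity>"
    and half: "\<And>y. y \<in> E \<Longrightarrow> refln e l y \<notin> E \<Longrightarrow> y \<bullet> e \<le> l" and x: "x \<bullet> e \<le> l"
    and D: "\<And>y. y \<in> E \<Longrightarrow> norm (x - y) \<le> D" "\<And>y. y \<in> E \<Longrightarrow> norm (refln e l x - y) \<le> D"
    and A: "\<And>y. y \<in> A \<Longrightarrow> y \<in> E \<and> refln e l y \<notin> E \<and> \<kappa> \<le> l - y \<bullet> e \<and> \<delta> \<le> norm (x - y)" and ka: "0 \<le> \<kappa>"
  shows "slope * D powr (- (n + s + 1)) * (2 * \<kappa> / D) * measure lborel A * (l - x \<bullet> e)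
    \<le> reg_potential s \<alpha> \<epsilon> \<delta> E x - reg_potential s \<alpha> \<epsilon> \<delta> E (refln e l x)"
proof -
  define \<phi> where "\<phi> y = Kr (norm (x - y)) - Kr (norm (refln e l x - y))" for y
  have [measurable]: "\<phi> \<in> borel_measurable borel" unfolding \<phi>_def[abs_def] by measurable
  have D0: "0 < D" using dl by simp
  have odd: "\<phi> (refln e l y) = - \<phi> y" for y
  proof -
    have "norm (x - refln e l y) = norm (refln e l x - y)" "norm (refln e l x - refln e l y) = norm (x - y)"
      using dist_refl[OF e, of l x "refln e l y"] dist_refl[OF e, of l x y] e by (simp_all add: dist_norm)
    then show ?thesis by (simp add: \<phi>_def)
  qed
  have int: "integrable lborel (\<lambda>y. indicator B y * \<phi> y)" if [measurable]: "B \<in> sets borel" and "B \<subseteq> E" for B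
  proof -
    have finB: "emeasure lborel B < \<infinity>" using emeasure_mono[OF that(2), of lborel] fin by (simp add: le_less_trans)
    show ?thesis unfolding \<phi>_def right_diff_distrib using potential_integrable[OF nD _ finB] nD
      by (intro Bochner_Integration.integrable_diff) auto
  qed
  define S where "S = {y \<in> E. refln e l y \<in> E}"
  define B where "B = {y \<in> E. refln e l y \<notin> E}"
  have [measurable]: "S \<in> sets borel" "B \<in> sets borel" unfolding S_def B_def by measurable
  have "(LINT y|lborel. indicator S y * \<phi> y) = (LINT y|lborel. indicator S (refln e l y) * \<phi> (refln e l y))"
    using integral_refl[OF e, of "\<lambda>y. indicator S y * \<phi> y"] by simp
  also have "\<dots> = (LINT y|lborel. - (indicator S y * \<phi> y))"
    using e by (intro Bochner_Integration.integral_cong) (auto simp: odd S_def indicator_def)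
  also have "\<dots> = - (LINT y|lborel. indicator S y * \<phi> y)" by simp
  finally have S0: "(LINT y|lborel. indicator S y * \<phi> y) = 0" by simp
  have geo: "norm (x - y) \<le> norm (refln e l x - y)" if "y \<bullet> e \<le> l" for y
  proof -
    have "0 \<le> 4 * (l - x \<bullet> e) * (l - y \<bullet> e)" using x that by simp
    then have "(norm (x - y))\<^sup>2 \<le> (norm (refln e l x - y))\<^sup>2" using refl_dist_sq[OF e, of l x y] by linarith
    then show ?thesis by (rule power2_le_imp_le) simp
  qed
  let ?c = "slope * D powr (- (n + s + 1)) * (2 * \<kappa> / D) * (l - x \<bullet> e)"
  have low: "indicator A y * ?c \<le> indicator B y * \<phi> y" for y
  proof (cases "y \<in> A")
    case True
    then have y: "y \<in> E" "refln e l y \<notin> E" "\<kappa> \<le> l - y \<bullet> e" "\<delta> \<le> norm (x - y)" using A by auto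
    have ye: "y \<bullet> e \<le> l" using half y by blast
    let ?r = "norm (x - y)" and ?q = "norm (refln e l x - y)"
    have rq: "0 < ?r" "?r \<le> ?q" "?q \<le> D" "\<delta> \<le> ?q" using y dl geo[OF ye] D(2)[OF y(1)] by auto
    \<comment> \<open>Factor \<open>refl_dist_sq\<close> as (q - r)(q + r) with q + r at most 2D;
      this is the origin of the quotient 2 \<kappa> / D.\<close>
    have "4 * (l - x \<bullet> e) * \<kappa> \<le> 4 * (l - x \<bullet> e) * (l - y \<bullet> e)" using x y by (intro mult_left_mono) auto
    also have "\<dots> = (?q - ?r) * (?q + ?r)" using refl_dist_sq[OF e, of l x y] by (simp add: power2_eq_square algebra_simps)
    also have "\<dots> \<le> (?q - ?r) * (2 * D)" using rq by (intro mult_left_mono) auto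
    finally have "2 * \<kappa> / D * (l - x \<bullet> e) \<le> ?q - ?r" using D0 by (simp add: field_simps)
    then have "?c \<le> slope * D powr (- (n + s + 1)) * (?q - ?r)"
      using slope_pos by (simp only: mult.assoc) (intro mult_left_mono, auto)
    also have "\<dots> \<le> slope * ?q powr (- (n + s + 1)) * (?q - ?r)"
      using slope_pos rq n1 s by (intro mult_right_mono mult_left_mono powr_mono2') auto
    also have "\<dots> \<le> K ?r - K ?q" by (rule ker_diff(1)[OF rq(1-3)])
    \<comment> \<open>Both distances are at least \<delta>, so freezing the kernel below \<delta>
      has no effect here.\<close>
    also have "\<dots> = \<phi> y" using y(4) rq(4) by (simp add: \<phi>_def ker_reg_def max_absorb1)
    finally show ?thesis using True y by (simp add: B_def)
  next
    case False
    have "0 \<le> \<phi> y" if "y \<in> B"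
    proof -
      have "y \<in> E" "y \<bullet> e \<le> l" using that half by (auto simp: B_def)
      then show ?thesis unfolding \<phi>_def using ker_reg_antimono[OF _ geo[of y] D(2)[of y]] by simp
    qed
    with False show ?thesis by (auto simp: indicator_def)
  qed
  have AE: "A \<subseteq> E" using A by auto
  have finA: "emeasure lborel A < \<infinity>" using emeasure_mono[OF AE, of lborel] fin by (simp add: le_less_trans)
  have "?c * measure lborel A = (LINT y|lborel. indicator A y * ?c)" using finA by simp
  also have "\<dots> \<le> (LINT y|lborel. indicator B y * \<phi> y)"
  proof (rule Bochner_Integration.integral_mono)
    show "integrable lborel (\<lambda>y. indicator A y * ?c)" using finA by (intro integrable_mult_left integrable_real_indicator) auto
    show "integrable lborel (\<lambda>y. indicator B y * \<phi> y)" by (rule int) (auto simp: B_def)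
  qed (rule low)
  also have "\<dots> = (LINT y|lborel. indicator S y * \<phi> y) + (LINT y|lborel. indicator B y * \<phi> y)" using S0 by simp
  also have "\<dots> = (LINT y|lborel. indicator S y * \<phi> y + indicator B y * \<phi> y)"
    by (subst Bochner_Integration.integral_add) (auto intro!: int simp: S_def B_def)
  also have "\<dots> = (LINT y|lborel. indicator E y * Kr (norm (x - y)) - indicator E y * Kr (norm (refln e l x - y)))"
    by (intro Bochner_Integration.integral_cong) (auto simp: S_def B_def indicator_def \<phi>_def)
  also have "\<dots> = reg_potential s \<alpha> \<epsilon> \<delta> E x - reg_potential s \<alpha> \<epsilon> \<delta> E (refln e l x)"
    unfolding reg_potential_def using potential_integrable[OF nD _ fin] nD
    by (subst Bochner_Integration.integral_diff) auto
  finally show ?thesis by (simp add: mult_ac)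
qed

end

section \<open>The variation\<close>

text \<open>In a cylinder of size 3 \<rho> around \<open>c\<close>, on one side of the plane,
  \<open>E\<close> is the subgraph of \<open>g\<close> and its mirror image is the subgraph of
  \<open>gs\<close>, over the same axis \<nu>. \<open>L\<close> is the Lipschitz constant of the
  difference of the two graphs, the quantity on which the error depends.\<close>

locale patch = kernel n s \<alpha> \<epsilon> D \<delta> for n s \<alpha> \<epsilon> D \<delta> +
  fixes E :: "'a::euclidean_space set" and e \<nu> c :: 'a and l \<rho> L :: real and g gs :: "'a \<Rightarrow> real"
  assumes nD: "n = DIM('a)" and e: "norm e = 1" and nu: "norm \<nu> = 1" and rho: "0 < \<rho>" and del: "\<delta> = \<rho> / 2"
    and E: "open E" "bounded E" and L: "0 < L"
    and half: "\<And>x. norm (perp \<nu> (x - c)) < 3 * \<rho> \<Longrightarrow> \<bar>(x - c) \<bullet> \<nu>\<bar> < 3 * \<rho> \<Longrightarrow> x \<bullet> e < l"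
    and graph: "\<And>x. norm (perp \<nu> (x - c)) < 3 * \<rho> \<Longrightarrow> \<bar>(x - c) \<bullet> \<nu>\<bar> < 3 * \<rho> \<Longrightarrow> x \<in> E \<longleftrightarrow> (x - c) \<bullet> \<nu> < g x"
      "\<And>x. norm (perp \<nu> (x - c)) < 3 * \<rho> \<Longrightarrow> \<bar>(x - c) \<bullet> \<nu>\<bar> < 3 * \<rho> \<Longrightarrow> refln e l x \<in> E \<longleftrightarrow> (x - c) \<bullet> \<nu> < gs x"
    and small: "\<And>x. norm (perp \<nu> (x - c)) < 3 * \<rho> \<Longrightarrow> \<bar>g x\<bar> \<le> \<rho> / 2" "\<And>x. norm (perp \<nu> (x - c)) < 3 * \<rho> \<Longrightarrow> \<bar>gs x\<bar> \<le> \<rho> / 2"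
    and lipG: "\<And>x y. norm (perp \<nu> (x - c)) < 3 * \<rho> \<Longrightarrow> norm (perp \<nu> (y - c)) < 3 * \<rho> \<Longrightarrow>
       \<bar>(g y - gs y) - (g x - gs x)\<bar> \<le> L * norm (perp \<nu> (y - x))"
    and g_meas [measurable]: "g \<in> borel_measurable borel" "gs \<in> borel_measurable borel"
    and g_inv: "\<And>x t. g (x + t *\<^sub>R \<nu>) = g x" "\<And>x t. gs (x + t *\<^sub>R \<nu>) = gs x"
begin

abbreviation "R \<equiv> refln e l"
abbreviation "ht x \<equiv> (x - c) \<bullet> \<nu>"
definition "T = {x. norm (perp \<nu> (x - c)) < 3 * \<rho>}"
definition "W = {x. x \<in> T \<and> \<bar>ht x\<bar> < 3 * \<rho>}"
text \<open>With the square, the argument of \<open>plateau\<close> is a polynomial in x, so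
  smoothness is a matter of composition. The profile is 1 up to distance \<rho> from the axis and
  vanishes from distance 3/2 \<rho> on, because 2 \<le> (3/2)^2.\<close>

definition "f x = plateau ((norm (perp \<nu> (x - c)) / \<rho>)\<^sup>2)"

lemma T_meas [measurable]: "T \<in> sets borel" and W_meas [measurable]: "W \<in> sets borel"
  unfolding W_def T_def by measurable

lemma E_meas [measurable]: "E \<in> sets borel" using E by simp

lemma f_meas [measurable]: "f \<in> borel_measurable borel"
proof -
  have "plateau \<in> borel_measurable borel" using Ck_on_plateau[of 0] by (intro borel_measurable_continuous_onI) simp
  then show ?thesis unfolding f_def[abs_def] by measurable
qed

lemma nunu: "\<nu> \<bullet> \<nu> = 1" using nu by (simp add: dot_square_norm)

lemma perp_c_shift: "perp \<nu> (x + t *\<^sub>R \<nu> - c) = perp \<nu> (x - c)" using nu by (simp add: perp_lin perp_self)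

lemma f_inv: "f (x + t *\<^sub>R \<nu>) = f x" by (simp add: f_def perp_c_shift)

lemma T_inv: "x + t *\<^sub>R \<nu> \<in> T \<longleftrightarrow> x \<in> T" by (simp add: T_def perp_c_shift)

lemma f_bounds: "0 \<le> f x" "f x \<le> 1" by (auto simp: f_def plateau_props)

lemma f_one: "norm (perp \<nu> (x - c)) \<le> \<rho> \<Longrightarrow> f x = 1"
  unfolding f_def using rho by (intro plateau_props(3)) (simp add: abs_square_le_1)

lemma f_support: "f x \<noteq> 0 \<Longrightarrow> norm (perp \<nu> (x - c)) < 3 / 2 * \<rho>"
proof (rule ccontr)
  assume f: "f x \<noteq> 0" and "\<not> norm (perp \<nu> (x - c)) < 3 / 2 * \<rho>"
  then have "3 / 2 \<le> norm (perp \<nu> (x - c)) / \<rho>" using rho by (simp add: pos_le_divide_eq)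
  then have "(3 / 2)\<^sup>2 \<le> (norm (perp \<nu> (x - c)) / \<rho>)\<^sup>2" by (intro power_mono) auto
  moreover have "2 \<le> (3 / 2 :: real)\<^sup>2" by (simp add: power2_eq_square)
  ultimately have "2 \<le> \<bar>(norm (perp \<nu> (x - c)) / \<rho>)\<^sup>2\<bar>" by linarith
  then show False using f plateau_props(4) by (simp add: f_def)
qed

text \<open>The choice involves none of the parameters of the locale, so \<open>lf\<close> can enter
  the constant \<open>patch_const\<close>.\<close>

definition "lf = (SOME K. 0 < K \<and> (\<forall>x y. \<bar>plateau x - plateau y\<bar> \<le> K * \<bar>x - y\<bar>))"

lemma lf: "0 < lf" "\<bar>plateau x - plateau y\<bar> \<le> lf * \<bar>x - y\<bar>"
proof -
  obtain K where "0 < K" "\<And>x y. \<bar>plateau x - plateau y\<bar> \<le> K * \<bar>x - y\<bar>" by (rule plateau_lipschitz, rule that)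
  then have "\<exists>K. 0 < K \<and> (\<forall>x y. \<bar>plateau x - plateau y\<bar> \<le> K * \<bar>x - y\<bar>)" by blast
  from someI_ex[OF this] show "0 < lf" "\<bar>plateau x - plateau y\<bar> \<le> lf * \<bar>x - y\<bar>" unfolding lf_def by auto
qed

lemma f_lip: "\<bar>f y - f x\<bar> \<le> 4 * lf / \<rho> * norm (y - x)"
proof -
  define p where "p x = min 2 (norm (perp \<nu> (x - c)) / \<rho>)" for x
  have fp: "f x = plateau ((p x)\<^sup>2)" for x
  proof (cases "norm (perp \<nu> (x - c)) / \<rho> \<le> 2")
    case False
    then have "2\<^sup>2 \<le> (norm (perp \<nu> (x - c)) / \<rho>)\<^sup>2" by (intro power_mono) auto
    then have "2 \<le> \<bar>(norm (perp \<nu> (x - c)) / \<rho>)\<^sup>2\<bar>" by simp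
    then show ?thesis using False plateau_props(4) by (simp add: f_def p_def min_def)
  qed (simp add: f_def p_def min_def)
  have p02: "0 \<le> p x" "p x \<le> 2" for x using rho by (auto simp: p_def)
  have "\<bar>norm (perp \<nu> (y - c)) - norm (perp \<nu> (x - c))\<bar> \<le> norm (perp \<nu> (y - c) - perp \<nu> (x - c))" by (rule norm_triangle_ineq3)
  also have "perp \<nu> (y - c) - perp \<nu> (x - c) = perp \<nu> (y - x)" by (simp add: perp_lin)
  also have "norm (perp \<nu> (y - x)) \<le> norm (y - x)" by (rule norm_perp_le[OF nu])
  finally have "\<bar>norm (perp \<nu> (y - c)) / \<rho> - norm (perp \<nu> (x - c)) / \<rho>\<bar> \<le> norm (y - x) / \<rho>"
    using rho by (simp add: diff_divide_distrib[symmetric] divide_right_mono)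
  then have pl: "\<bar>p y - p x\<bar> \<le> norm (y - x) / \<rho>" by (auto simp: p_def min_def)
  have "\<bar>f y - f x\<bar> \<le> lf * \<bar>(p y)\<^sup>2 - (p x)\<^sup>2\<bar>" unfolding fp by (rule lf(2))
  also have "\<bar>(p y)\<^sup>2 - (p x)\<^sup>2\<bar> = \<bar>p y + p x\<bar> * \<bar>p y - p x\<bar>"
    by (simp add: abs_mult[symmetric] power2_eq_square algebra_simps)
  also have "lf * (\<bar>p y + p x\<bar> * \<bar>p y - p x\<bar>) \<le> lf * (4 * (norm (y - x) / \<rho>))"
    using p02[of x] p02[of y] pl lf(1) by (intro mult_left_mono mult_mono) auto
  finally show ?thesis by (simp add: mult_ac)
qed

section \<open>Displaced layers and preservation of volume\<close>

definition "layer a b = {x. x \<in> W \<and> a x \<le> ht x \<and> ht x < b x}"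

lemma layer_measure:
  assumes [measurable]: "a \<in> borel_measurable borel" "b \<in> borel_measurable borel"
    and inv: "\<And>x t. a (x + t *\<^sub>R \<nu>) = a x" "\<And>x t. b (x + t *\<^sub>R \<nu>) = b x"
    and bd: "\<And>x. x \<in> T \<Longrightarrow> \<bar>a x\<bar> \<le> \<rho>" "\<And>x. x \<in> T \<Longrightarrow> \<bar>b x\<bar> \<le> \<rho>"
  shows "emeasure lborel (layer a b) =
    (\<integral>\<^sup>+x. indicator {x. 0 \<le> x \<bullet> \<nu> \<and> x \<bullet> \<nu> < 1} x * (indicator T x * ennreal (max 0 (b x - a x))) \<partial>lborel)"
proof -
  have "layer a b = {x \<in> T. c \<bullet> \<nu> + a x \<le> x \<bullet> \<nu> \<and> x \<bullet> \<nu> < c \<bullet> \<nu> + b x}"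
    unfolding layer_def W_def using bd rho by (force simp: inner_diff_left abs_le_iff abs_less_iff)
  then show ?thesis
    by (simp only:) (subst emeasure_graph_layer[OF nu], auto simp: inv T_inv)
qed

text \<open>The deformed set, described without its flow; \<open>flow_image\<close> identifies the
  two. The opposite signs of t make the gained and the lost layer equal in volume.\<close>

definition "Et t = {x. (x \<in> W \<and> ht x < g x + t * f x) \<or> (R x \<in> W \<and> ht (R x) < gs (R x) - t * f (R x))
  \<or> (x \<notin> W \<and> R x \<notin> W \<and> x \<in> E)}"

lemma W_half: "x \<in> W \<Longrightarrow> x \<bullet> e < l" using half by (auto simp: W_def T_def)

lemma RW_half: "R x \<in> W \<Longrightarrow> l < x \<bullet> e" using W_half[of "R x"] by (simp add: refl_inner_self e)

lemma E_W: "x \<in> W \<Longrightarrow> x \<in> E \<longleftrightarrow> ht x < g x" using graph(1) by (auto simp: W_def T_def)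

lemma E_RW: "R x \<in> W \<Longrightarrow> x \<in> E \<longleftrightarrow> ht (R x) < gs (R x)"
  using graph(2)[of "R x"] e by (auto simp: W_def T_def)

lemma Et_0: "Et 0 = E" unfolding Et_def using E_W E_RW W_half RW_half by force

lemma Et_meas [measurable]: "Et t \<in> sets borel" unfolding Et_def by measurable

lemma tf_small: "\<bar>t\<bar> \<le> \<rho> / 2 \<Longrightarrow> \<bar>t * f x\<bar> \<le> \<rho> / 2"
  using f_bounds[of x] mult_mono[of "\<bar>t\<bar>" "\<rho> / 2" "f x" 1] by (simp add: abs_mult)

lemma gt_bound: "\<bar>t\<bar> \<le> \<rho> / 2 \<Longrightarrow> x \<in> T \<Longrightarrow> \<bar>g x + t * f x\<bar> \<le> \<rho>" "\<bar>t\<bar> \<le> \<rho> / 2 \<Longrightarrow> x \<in> T \<Longrightarrow> \<bar>gs x - t * f x\<bar> \<le> \<rho>"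
  using small[of x] tf_small[of t x] by (auto simp: T_def)

lemma g_bound: "x \<in> T \<Longrightarrow> \<bar>g x\<bar> \<le> \<rho>" "x \<in> T \<Longrightarrow> \<bar>gs x\<bar> \<le> \<rho>"
  using small[of x] rho by (auto simp: T_def)

text \<open>The integral of \<open>f\<close> over the hyperplane orthogonal to \<nu>: the rate at
  which volume crosses the boundary on either side.\<close>

definition "flux = (\<integral>\<^sup>+x. indicator {x. 0 \<le> x \<bullet> \<nu> \<and> x \<bullet> \<nu> < 1} x * (indicator T x * ennreal (f x)) \<partial>lborel)"

lemma flux_layers:
  assumes t: "0 \<le> t" "t \<le> \<rho> / 2"
  shows "emeasure lborel (layer g (\<lambda>x. g x + t * f x)) = ennreal t * flux"
    "emeasure lborel (layer (\<lambda>x. gs x - t * f x) gs) = ennreal t * flux"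
    "emeasure lborel (layer (\<lambda>x. g x + (-t) * f x) g) = ennreal t * flux"
    "emeasure lborel (layer gs (\<lambda>x. gs x - (-t) * f x)) = ennreal t * flux"
proof -
  have *: "(\<integral>\<^sup>+x. indicator {x. 0 \<le> x \<bullet> \<nu> \<and> x \<bullet> \<nu> < 1} x * (indicator T x * ennreal (max 0 (t * f x))) \<partial>lborel) = ennreal t * flux"
  proof -
    have "(\<integral>\<^sup>+x. indicator {x. 0 \<le> x \<bullet> \<nu> \<and> x \<bullet> \<nu> < 1} x * (indicator T x * ennreal (max 0 (t * f x))) \<partial>lborel)
      = (\<integral>\<^sup>+x. ennreal t * (indicator {x. 0 \<le> x \<bullet> \<nu> \<and> x \<bullet> \<nu> < 1} x * (indicator T x * ennreal (f x))) \<partial>lborel)"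
      using t f_bounds by (intro nn_integral_cong) (auto simp: ennreal_mult indicator_def)
    also have "\<dots> = ennreal t * flux" unfolding flux_def by (rule nn_integral_cmult) measurable
    finally show ?thesis .
  qed
  have tt: "\<bar>t\<bar> \<le> \<rho> / 2" "\<bar>-t\<bar> \<le> \<rho> / 2" using t by auto
  note m = layer_measure[where a=g and b="\<lambda>x. g x + t * f x"] layer_measure[where a="\<lambda>x. gs x - t * f x" and b=gs]
    layer_measure[where a="\<lambda>x. g x + (-t) * f x" and b=g] layer_measure[where a=gs and b="\<lambda>x. gs x - (-t) * f x"]
  show "emeasure lborel (layer g (\<lambda>x. g x + t * f x)) = ennreal t * flux"
    using m(1) * by (simp add: g_inv f_inv gt_bound[OF tt(1)] g_bound)
  show "emeasure lborel (layer (\<lambda>x. gs x - t * f x) gs) = ennreal t * flux"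
    using m(2) * by (simp add: g_inv f_inv gt_bound[OF tt(1)] g_bound)
  show "emeasure lborel (layer (\<lambda>x. g x + (-t) * f x) g) = ennreal t * flux"
    using m(3) * gt_bound(1)[OF tt(2)] by (simp add: g_inv f_inv g_bound)
  show "emeasure lborel (layer gs (\<lambda>x. gs x - (-t) * f x)) = ennreal t * flux"
    using m(4) * gt_bound(2)[OF tt(2)] by (simp add: g_inv f_inv g_bound)
qed

lemma flux_bounds:
  "disc \<nu> c \<rho> \<le> flux" "flux \<le> disc \<nu> c (3 * \<rho>)"
proof -
  have [measurable]: "{x. (0 \<le> x \<bullet> \<nu> \<and> x \<bullet> \<nu> < 1) \<and> norm (perp \<nu> (x - c)) < r} \<in> sets borel" for r by measurable
  have "disc \<nu> c \<rho> = (\<integral>\<^sup>+x. indicator {x. (0 \<le> x \<bullet> \<nu> \<and> x \<bullet> \<nu> < 1) \<and> norm (perp \<nu> (x - c)) < \<rho>} x \<partial>lborel)"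
    unfolding disc_def by simp
  also have "\<dots> \<le> flux" unfolding flux_def using rho f_one
    by (intro nn_integral_mono) (auto simp: indicator_def T_def)
  finally show "disc \<nu> c \<rho> \<le> flux" .
  have "flux \<le> (\<integral>\<^sup>+x. indicator {x. (0 \<le> x \<bullet> \<nu> \<and> x \<bullet> \<nu> < 1) \<and> norm (perp \<nu> (x - c)) < 3 * \<rho>} x \<partial>lborel)"
    unfolding flux_def using f_bounds by (intro nn_integral_mono) (auto simp: indicator_def T_def)
  also have "\<dots> = disc \<nu> c (3 * \<rho>)" unfolding disc_def by simp
  finally show "flux \<le> disc \<nu> c (3 * \<rho>)" .
qed

definition "Mt t = layer g (\<lambda>x. g x + t * f x)"
definition "Nt t = {x. R x \<in> layer (\<lambda>x. gs x - t * f x) gs}"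

lemma layer_meas [measurable]:
  assumes [measurable]: "a \<in> borel_measurable borel" "b \<in> borel_measurable borel"
  shows "layer a b \<in> sets borel"
  unfolding layer_def by measurable

lemma MN_meas [measurable]: "Mt t \<in> sets borel" "Nt t \<in> sets borel"
  unfolding Mt_def Nt_def by measurable

lemma Et_exchange:
  assumes "0 \<le> t"
  shows "Et t = (E - Nt t) \<union> Mt t" "Nt t \<subseteq> E" "Mt t \<inter> E = {}"
    "Et (-t) = (E - layer (\<lambda>x. g x + (-t) * f x) g) \<union> {x. R x \<in> layer gs (\<lambda>x. gs x - (-t) * f x)}"
    "layer (\<lambda>x. g x + (-t) * f x) g \<subseteq> E" "{x. R x \<in> layer gs (\<lambda>x. gs x - (-t) * f x)} \<inter> E = {}"
proof -
  have tf: "0 \<le> t * f x" for x using assms f_bounds by simp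
  have WR: "x \<in> W \<Longrightarrow> R x \<notin> W" for x using W_half RW_half by fastforce
  show "Nt t \<subseteq> E" using E_RW by (auto simp: Nt_def layer_def)
  show "Mt t \<inter> E = {}" using E_W by (auto simp: Mt_def layer_def)
  show "layer (\<lambda>x. g x + (-t) * f x) g \<subseteq> E" using E_W by (auto simp: layer_def)
  show "{x. R x \<in> layer gs (\<lambda>x. gs x - (-t) * f x)} \<inter> E = {}" using E_RW by (auto simp: layer_def)
  show "Et t = (E - Nt t) \<union> Mt t"
  proof (rule set_eqI)
    fix x
    consider "x \<in> W" "R x \<notin> W" | "x \<notin> W" "R x \<in> W" | "x \<notin> W" "R x \<notin> W" using WR by blast
    then show "x \<in> Et t \<longleftrightarrow> x \<in> (E - Nt t) \<union> Mt t"
      by cases (use tf[of x] tf[of "R x"] E_W[of x] E_RW[of x] in \<open>auto simp: Et_def Mt_def Nt_def layer_def\<close>)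
  qed
  show "Et (-t) = (E - layer (\<lambda>x. g x + (-t) * f x) g) \<union> {x. R x \<in> layer gs (\<lambda>x. gs x - (-t) * f x)}"
  proof (rule set_eqI)
    fix x
    consider "x \<in> W" "R x \<notin> W" | "x \<notin> W" "R x \<in> W" | "x \<notin> W" "R x \<notin> W" using WR by blast
    then show "x \<in> Et (-t) \<longleftrightarrow> x \<in> (E - layer (\<lambda>x. g x + (-t) * f x) g) \<union> {x. R x \<in> layer gs (\<lambda>x. gs x - (-t) * f x)}"
      by cases (use tf[of x] tf[of "R x"] E_W[of x] E_RW[of x] in \<open>auto simp: Et_def layer_def\<close>)
  qed
qed

lemma E_finite: "emeasure lborel E < \<infinity>"
  using emeasure_bounded_finite[OF E(2)] by (simp add: top.not_eq_extremum)

text \<open>Each layer has volume |t| times \<open>flux\<close>, whatever its graph, so an exchange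
  of layers is neutral. Negative t is included because criticality presupposes constant volume on a
  full neighbourhood of 0; the energies are compared for positive t.\<close>

lemma Et_volume:
  assumes t: "\<bar>t\<bar> \<le> \<rho> / 2"
  shows "emeasure lborel (Et t) = emeasure lborel E"
proof -
  have ex: "emeasure lborel ((E - N) \<union> M) = emeasure lborel E"
    if [measurable]: "N \<in> sets borel" "M \<in> sets borel" and N: "N \<subseteq> E" and M: "M \<inter> E = {}" and eq: "emeasure lborel M = emeasure lborel N"
    for N M :: "'a set"
  proof -
    have "emeasure lborel ((E - N) \<union> M) = emeasure lborel (E - N) + emeasure lborel M"
      using M by (intro plus_emeasure[symmetric]) auto
    also have "\<dots> = emeasure lborel ((E - N) \<union> N)" unfolding eq by (intro plus_emeasure) auto
    also have "(E - N) \<union> N = E" using N by auto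
    finally show ?thesis .
  qed
  show ?thesis
  proof (cases "0 \<le> t")
    case True
    have "emeasure lborel (Nt t) = ennreal t * flux"
      unfolding Nt_def using flux_layers(2)[of t] True t by (subst emeasure_refl_vimage[OF e]) auto
    moreover have "emeasure lborel (Mt t) = ennreal t * flux" unfolding Mt_def using flux_layers(1)[of t] True t by auto
    ultimately show ?thesis unfolding Et_exchange(1)[OF True] using Et_exchange(2,3)[OF True] by (intro ex) auto
  next
    case False
    define u where "u = - t"
    have u: "0 \<le> u" "u \<le> \<rho> / 2" "t = - u" using False t by (auto simp: u_def)
    have "emeasure lborel {x. R x \<in> layer gs (\<lambda>x. gs x - (-u) * f x)} = ennreal u * flux"
      using flux_layers(4)[OF u(1,2)] by (subst emeasure_refl_vimage[OF e]) auto
    then show ?thesis unfolding u(3) Et_exchange(4)[OF u(1)] using Et_exchange(5,6)[OF u(1)] flux_layers(3)[OF u(1,2)]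
      by (intro ex) auto
  qed
qed

text \<open>Flow of the field \<open>amp\<close> times \<nu>. As \<open>f\<close> is constant along
  \<nu>, on each line this is the equation s' = plateau s in the variable
  \<open>ht x / \<rho>\<close>, run at speed \<open>f x / \<rho>\<close>.\<close>

definition "push t x = x + (\<rho> * bump_flow (t * f x / \<rho>) (ht x / \<rho>) - ht x) *\<^sub>R \<nu>"
text \<open>Beyond the plane the mirror image of the flow runs backwards in time, which realises the
  opposite signs in \<open>Et\<close>. Near the plane itself nothing moves.\<close>

definition "\<Phi> t x = (if x \<bullet> e < l then push t x else if l < x \<bullet> e then R (push (- t) (R x)) else x)"
definition "amp x = f x * plateau (ht x / \<rho>)"
definition "field x = amp x *\<^sub>R \<nu> - amp (R x) *\<^sub>R refln e 0 \<nu>"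

lemma push_ht: "ht (push t x) = \<rho> * bump_flow (t * f x / \<rho>) (ht x / \<rho>)" "f (push t x) = f x" "g (push t x) = g x" "gs (push t x) = gs x"
  using nunu by (simp_all add: push_def inner_diff_left inner_add_left f_inv g_inv)

lemma push_T: "push t x \<in> T \<longleftrightarrow> x \<in> T" by (simp add: push_def T_inv)

lemma push_outside: "x \<notin> W \<Longrightarrow> push t x = x"
proof -
  assume x: "x \<notin> W"
  show "push t x = x"
  proof (cases "f x = 0")
    case True then show ?thesis using rho by (simp add: push_def)
  next
    case False
    then have "x \<in> T" using f_support[of x] rho by (simp add: T_def)
    then have "3 * \<rho> \<le> \<bar>ht x\<bar>" using x by (simp add: W_def)
    then have "2 \<le> \<bar>ht x / \<rho>\<bar>" using rho by (simp add: abs_divide pos_le_divide_eq)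
    then show ?thesis using rho by (simp add: push_def bump_flow_outside)
  qed
qed

lemma push_W: "push t x \<in> W \<longleftrightarrow> x \<in> W"
proof -
  have "\<bar>\<rho> * bump_flow (t * f x / \<rho>) (ht x / \<rho>)\<bar> < 3 * \<rho> \<longleftrightarrow> \<bar>ht x\<bar> < 3 * \<rho>"
  proof (cases "\<bar>ht x / \<rho>\<bar> < 2")
    case True
    then have "\<bar>bump_flow (t * f x / \<rho>) (ht x / \<rho>)\<bar> < 2" by (simp add: bump_flow_inside)
    then have "\<rho> * \<bar>bump_flow (t * f x / \<rho>) (ht x / \<rho>)\<bar> < \<rho> * 2" using rho by (intro mult_strict_left_mono)
    then have "\<bar>\<rho> * bump_flow (t * f x / \<rho>) (ht x / \<rho>)\<bar> < 2 * \<rho>" using rho by (simp add: abs_mult mult.commute)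
    moreover have "\<bar>ht x\<bar> < 2 * \<rho>" using True rho by (simp add: abs_divide pos_divide_less_eq)
    ultimately show ?thesis using rho by linarith
  next
    case False
    then have "bump_flow (t * f x / \<rho>) (ht x / \<rho>) = ht x / \<rho>" by (intro bump_flow_outside) simp
    then show ?thesis using rho by simp
  qed
  then show ?thesis by (simp add: W_def push_T push_ht)
qed

lemma push_half: "push t x \<bullet> e < l \<longleftrightarrow> x \<bullet> e < l"
  using push_W[of t x] push_outside[of x t] W_half by metis

lemma push_push: "push (- t) (push t x) = x"
proof -
  have "bump_flow (- t * f x / \<rho>) (bump_flow (t * f x / \<rho>) (ht x / \<rho>)) = ht x / \<rho>"
    by (simp add: bump_flow_add)
  moreover have "push (- t) (push t x) = push t x + (\<rho> * bump_flow (- t * f x / \<rho>) (bump_flow (t * f x / \<rho>) (ht x / \<rho>)) - ht (push t x)) *\<^sub>R \<nu>"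
    unfolding push_def[of "- t" "push t x"] push_ht(2) using rho by (simp add: push_ht)
  ultimately have "push (- t) (push t x) = push t x + (ht x - ht (push t x)) *\<^sub>R \<nu>" using rho by simp
  then show ?thesis unfolding push_ht(1) by (simp add: push_def scaleR_left_diff_distrib)
qed

lemma flow_inverse: "\<Phi> (- t) (\<Phi> t x) = x"
proof -
  consider "x \<bullet> e < l" | "l < x \<bullet> e" | "x \<bullet> e = l" by linarith
  then show ?thesis
  proof cases
    case 1 then show ?thesis by (simp add: \<Phi>_def push_half push_push)
  next
    case 2
    then have "R x \<bullet> e < l" by (simp add: refl_inner_self e)
    then have p: "push (- t) (R x) \<bullet> e < l" by (simp add: push_half)
    then have "l < R (push (- t) (R x)) \<bullet> e" by (simp add: refl_inner_self e)
    then show ?thesis using 2 push_push[of "- t" "R x"] e by (simp add: \<Phi>_def)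
  next
    case 3 then show ?thesis by (simp add: \<Phi>_def)
  qed
qed

lemma flow_image:
  assumes t: "\<bar>t\<bar> \<le> \<rho> / 2"
  shows "\<Phi> t ` E = Et t"
proof -
  \<comment> \<open>The heights a and a + u are at most \<rho> in absolute value, where the rescaled
    flow is a translation; monotonicity of the flow then decides the comparison for every y.\<close>
  have level: "\<rho> * bump_flow (- u / \<rho>) (y / \<rho>) < a \<longleftrightarrow> y < a + u" if "\<bar>a\<bar> \<le> \<rho> / 2" "\<bar>u\<bar> \<le> \<rho> / 2" for u y a
  proof -
    have b: "bump_flow (u / \<rho>) (a / \<rho>) = a / \<rho> + u / \<rho>"
    proof (rule bump_flow_shift)
      show "\<bar>a / \<rho>\<bar> \<le> 1" using that rho by (simp add: abs_divide pos_divide_le_eq)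
      have "\<bar>(a + u) / \<rho>\<bar> \<le> 1" using that rho by (simp add: abs_divide pos_divide_le_eq)
      then show "\<bar>a / \<rho> + u / \<rho>\<bar> \<le> 1" by (simp add: add_divide_distrib)
    qed
    have "\<rho> * bump_flow (- u / \<rho>) (y / \<rho>) < a \<longleftrightarrow> bump_flow (- u / \<rho>) (y / \<rho>) < a / \<rho>"
      using rho by (simp add: pos_less_divide_eq mult.commute)
    also have "\<dots> \<longleftrightarrow> bump_flow (u / \<rho>) (bump_flow (- u / \<rho>) (y / \<rho>)) < bump_flow (u / \<rho>) (a / \<rho>)"
      by (simp only: bump_flow_less_iff)
    also have "\<dots> \<longleftrightarrow> y / \<rho> < a / \<rho> + u / \<rho>" by (simp add: bump_flow_add b)
    also have "\<dots> \<longleftrightarrow> y < a + u" using rho by (simp add: add_divide_distrib[symmetric] divide_less_cancel)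
    finally show ?thesis .
  qed
  have "y \<in> \<Phi> t ` E \<longleftrightarrow> \<Phi> (- t) y \<in> E" for y
    using flow_inverse[of t] flow_inverse[of "- t" y] by force
  moreover have "\<Phi> (- t) y \<in> E \<longleftrightarrow> y \<in> Et t" for y
  proof -
    consider "y \<in> W" | "R y \<in> W" | "y \<notin> W" "R y \<notin> W" by blast
    then show ?thesis
    proof cases
      case 1
      have "\<Phi> (- t) y = push (- t) y" using W_half[OF 1] by (simp add: \<Phi>_def)
      moreover have "push (- t) y \<in> E \<longleftrightarrow> ht y < g y + t * f y"
      proof -
        have yT: "norm (perp \<nu> (y - c)) < 3 * \<rho>" using 1 by (simp add: W_def T_def)
        have "push (- t) y \<in> E \<longleftrightarrow> ht (push (- t) y) < g y" using E_W[of "push (- t) y"] 1 push_W push_ht(3) by simp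
        also have "ht (push (- t) y) = \<rho> * bump_flow (- (t * f y) / \<rho>) (ht y / \<rho>)" by (simp add: push_ht(1))
        finally show ?thesis using level[OF small(1)[OF yT] tf_small[OF t, of y], of "ht y"] by simp
      qed
      ultimately show ?thesis using 1 W_half RW_half by (fastforce simp: Et_def)
    next
      case 2
      have "\<Phi> (- t) y = R (push t (R y))" using RW_half[OF 2] by (simp add: \<Phi>_def)
      moreover have "R (push t (R y)) \<in> E \<longleftrightarrow> ht (R y) < gs (R y) - t * f (R y)"
      proof -
        have yT: "norm (perp \<nu> (R y - c)) < 3 * \<rho>" using 2 by (simp add: W_def T_def)
        have RR: "R (R (push t (R y))) = push t (R y)" using e by simp
        have "push t (R y) \<in> W" using 2 push_W by simp
        then have "R (push t (R y)) \<in> E \<longleftrightarrow> ht (push t (R y)) < gs (R y)"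
          using E_RW[of "R (push t (R y))"] push_ht(4)[of t "R y"] unfolding RR by simp
        also have "ht (push t (R y)) = \<rho> * bump_flow (- (- (t * f (R y))) / \<rho>) (ht (R y) / \<rho>)" by (simp add: push_ht(1))
        finally show ?thesis
          using level[OF small(2)[OF yT], of "- (t * f (R y))" "ht (R y)"] tf_small[OF t, of "R y"] by simp
      qed
      ultimately show ?thesis using 2 W_half RW_half by (fastforce simp: Et_def)
    next
      case 3
      then have "\<Phi> (- t) y = y" using e by (simp add: \<Phi>_def push_outside)
      then show ?thesis using 3 by (simp add: Et_def)
    qed
  qed
  ultimately show ?thesis by blast
qed

lemma amp_W: "amp x \<noteq> 0 \<Longrightarrow> x \<in> W"
proof -
  assume a: "amp x \<noteq> 0"
  then have "f x \<noteq> 0" "plateau (ht x / \<rho>) \<noteq> 0" by (auto simp: amp_def)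
  then have "x \<in> T" "\<not> 2 \<le> \<bar>ht x / \<rho>\<bar>" using f_support[of x] rho plateau_props(4) by (auto simp: T_def)
  then show "x \<in> W" using rho by (simp add: W_def abs_divide not_le pos_divide_less_eq)
qed

lemma amp_half: "l \<le> x \<bullet> e \<Longrightarrow> amp x = 0" "x \<bullet> e \<le> l \<Longrightarrow> amp (R x) = 0"
proof -
  have *: "l \<le> x \<bullet> e \<Longrightarrow> amp x = 0" for x using amp_W[of x] W_half[of x] by (meson not_less)
  show "l \<le> x \<bullet> e \<Longrightarrow> amp x = 0" by (rule *)
  show "x \<bullet> e \<le> l \<Longrightarrow> amp (R x) = 0" by (rule *) (simp add: refl_inner_self e)
qed

lemma refl_bounded_linear: "bounded_linear (refln e 0)"
  by (rule bounded_linear_intro[of _ 1]) (auto simp: refl_0 norm_refl_0 e)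

lemma push_deriv: "((\<lambda>t. push t x) has_vector_derivative amp (push t x) *\<^sub>R \<nu>) (at t)"
proof -
  have 1: "((\<lambda>t. bump_flow (t * f x / \<rho>) (ht x / \<rho>)) has_real_derivative plateau (bump_flow (t * f x / \<rho>) (ht x / \<rho>)) * (f x / \<rho>)) (at t)"
    by (rule DERIV_chain2[OF bump_flow_deriv]) (use rho in \<open>auto intro!: derivative_eq_intros\<close>)
  have "((\<lambda>t. \<rho> * bump_flow (t * f x / \<rho>) (ht x / \<rho>) - ht x) has_real_derivative \<rho> * (plateau (bump_flow (t * f x / \<rho>) (ht x / \<rho>)) * (f x / \<rho>)) - 0) (at t)"
    by (intro DERIV_diff DERIV_cmult 1 DERIV_const)
  moreover have "\<rho> * (plateau (bump_flow (t * f x / \<rho>) (ht x / \<rho>)) * (f x / \<rho>)) - 0 = amp (push t x)"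
    using rho by (simp add: amp_def push_ht)
  ultimately have "((\<lambda>t. \<rho> * bump_flow (t * f x / \<rho>) (ht x / \<rho>) - ht x) has_vector_derivative amp (push t x)) (at t)"
    by (simp add: has_real_derivative_iff_has_vector_derivative)
  from has_vector_derivative_scaleR[OF _ has_vector_derivative_const, of _ _ t UNIV \<nu>] this
  have "((\<lambda>t. (\<rho> * bump_flow (t * f x / \<rho>) (ht x / \<rho>) - ht x) *\<^sub>R \<nu>) has_vector_derivative amp (push t x) *\<^sub>R \<nu>) (at t)"
    by (auto simp: has_real_derivative_iff_has_vector_derivative)
  from has_vector_derivative_add[OF has_vector_derivative_const this, of x] show ?thesis by (simp add: push_def)
qed

lemma flow: "flow_of field \<Phi>"
  unfolding flow_of_def
proof (intro conjI allI)
  show "\<Phi> 0 x = x" for x using e rho by (simp add: \<Phi>_def push_def)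
  fix t x
  consider "x \<bullet> e < l" | "l < x \<bullet> e" | "x \<bullet> e = l" by linarith
  then show "((\<lambda>\<tau>. \<Phi> \<tau> x) has_vector_derivative field (\<Phi> t x)) (at t)"
  proof cases
    case 1
    have "amp (R (push t x)) = 0" using push_half[of t x] 1 by (intro amp_half) simp
    then show ?thesis using push_deriv[of x t] 1 by (simp add: \<Phi>_def field_def)
  next
    case 2
    have h: "push (- t) (R x) \<bullet> e < l" using 2 by (simp add: push_half refl_inner_self e)
    have z: "amp (R (push (- t) (R x))) = 0" using h by (intro amp_half) simp
    have m: "((\<lambda>\<tau>::real. - \<tau>) has_vector_derivative - 1) (at t)"
      by (auto intro!: derivative_eq_intros simp: has_real_derivative_iff_has_vector_derivative[symmetric])
    from vector_diff_chain_at[OF m push_deriv]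
    have "((\<lambda>\<tau>. push (- \<tau>) (R x)) has_vector_derivative (- 1) *\<^sub>R (amp (push (- t) (R x)) *\<^sub>R \<nu>)) (at t)"
      by (simp add: o_def)
    from has_vector_derivative_add[OF bounded_linear.has_vector_derivative[OF refl_bounded_linear this] has_vector_derivative_const]
    have "((\<lambda>\<tau>. refln e 0 (push (- \<tau>) (R x)) + (2 * l) *\<^sub>R e) has_vector_derivative refln e 0 ((- 1) *\<^sub>R (amp (push (- t) (R x)) *\<^sub>R \<nu>))) (at t)"
      by simp
    moreover have "R y = refln e 0 y + (2 * l) *\<^sub>R e" for y by (simp add: refln_def algebra_simps)
    ultimately have "((\<lambda>\<tau>. R (push (- \<tau>) (R x))) has_vector_derivative refln e 0 ((- 1) *\<^sub>R (amp (push (- t) (R x)) *\<^sub>R \<nu>))) (at t)"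
      by simp
    moreover have "refln e 0 ((- 1) *\<^sub>R (amp (push (- t) (R x)) *\<^sub>R \<nu>)) = field (R (push (- t) (R x)))"
      using z e by (simp add: field_def refl_0)
    ultimately show ?thesis using 2 by (simp add: \<Phi>_def)
  next
    case 3
    then have "R x = x" by (simp add: refln_def)
    moreover have "amp x = 0" using 3 by (intro amp_half) simp
    ultimately show ?thesis using 3 by (simp add: \<Phi>_def field_def)
  qed
qed

lemma field_smooth: "smooth_on UNIV field"
  unfolding smooth_on_def
proof
  fix k
  have lin: "bounded_linear (\<lambda>x. x \<bullet> v)" for v :: 'a by (rule bounded_linear_inner_left)
  have ip: "Ck_on k UNIV (\<lambda>x::'a. x \<bullet> v + a)" for k v a
    by (intro Ck_on_add Ck_on_bounded_linear[OF lin] Ck_on_const)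
  \<comment> \<open>Writes the squared norm as a sum of products of affine functions, to which the
    closure rules for \<open>Ck_on\<close> apply.\<close>
  have nsq: "(norm (perp \<nu> (x - c)) / \<rho>)\<^sup>2 = (\<Sum>b\<in>Basis. (x \<bullet> perp \<nu> b + (- (c \<bullet> perp \<nu> b))) * (x \<bullet> perp \<nu> b + (- (c \<bullet> perp \<nu> b)))) * (1 / \<rho>\<^sup>2)" for x :: 'a
  proof -
    have "perp \<nu> (x - c) \<bullet> b = x \<bullet> perp \<nu> b + (- (c \<bullet> perp \<nu> b))" for b
      by (simp add: perp_def inner_diff_left inner_diff_right algebra_simps inner_commute)
    then have "(norm (perp \<nu> (x - c)))\<^sup>2 = (\<Sum>b\<in>Basis. (x \<bullet> perp \<nu> b + (- (c \<bullet> perp \<nu> b))) * (x \<bullet> perp \<nu> b + (- (c \<bullet> perp \<nu> b))))"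
      unfolding power2_norm_eq_inner by (subst euclidean_inner) simp
    then show ?thesis by (simp only: power_divide times_divide_eq_right mult_1_right)
  qed
  have sumC: "Ck_on k UNIV (\<lambda>x::'a. \<Sum>b\<in>B. h b x)" if "finite B" "\<And>b. Ck_on k UNIV (h b)" for B :: "'a set" and h :: "'a \<Rightarrow> 'a \<Rightarrow> real" and k
    using that by (induction B rule: finite_induct) (auto intro: Ck_on_const Ck_on_add)
  have fC: "Ck_on k UNIV f" for k
    unfolding f_def[abs_def] nsq
    by (rule Ck_on_compose[OF Ck_on_plateau], rule Ck_on_mult, rule sumC, simp, rule Ck_on_mult, rule ip, rule ip, rule Ck_on_const)
  have "(\<lambda>x. ht x / \<rho>) = (\<lambda>x. (x \<bullet> \<nu> + (- (c \<bullet> \<nu>))) * (1 / \<rho>))" by (auto simp: inner_diff_left)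
  then have hC: "Ck_on k UNIV (\<lambda>x. ht x / \<rho>)" for k
    by (simp only:) (rule Ck_on_mult, rule ip, rule Ck_on_const)
  have aC: "Ck_on k UNIV amp" for k
    unfolding amp_def[abs_def] by (rule Ck_on_mult, rule fC, rule Ck_on_compose[OF Ck_on_plateau], rule hC)
  have R: "R x = refln e 0 x + (2 * l) *\<^sub>R e" for x by (simp add: refln_def algebra_simps)
  have aRC: "Ck_on k UNIV (\<lambda>x. amp (R x))" for k unfolding R by (rule Ck_on_affine[OF refl_bounded_linear aC])
  have "field = (\<lambda>x. amp x *\<^sub>R \<nu> + amp (R x) *\<^sub>R (- refln e 0 \<nu>))" by (auto simp: field_def)
  then show "Ck_on k UNIV field"
    by (simp only:) (rule Ck_on_add, rule Ck_on_scaleR, rule aC, rule Ck_on_const, rule Ck_on_scaleR, rule aRC, rule Ck_on_const)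
qed

lemma field_test: "test_field field"
proof -
  have Wb: "W \<subseteq> cball c (6 * \<rho>)"
  proof
    fix x assume "x \<in> W"
    then have "norm (x - c) \<le> 6 * \<rho>" using norm_le_perp[OF nu, of "x - c"] by (simp add: W_def T_def)
    then show "x \<in> cball c (6 * \<rho>)" by (simp only: mem_cball_norm)
  qed
  have "{x. field x \<noteq> 0} \<subseteq> cball c (6 * \<rho>) \<union> cball (R c) (6 * \<rho>)"
  proof
    fix x assume "x \<in> {x. field x \<noteq> 0}"
    then have "amp x \<noteq> 0 \<or> amp (R x) \<noteq> 0" by (auto simp: field_def)
    then have "x \<in> W \<or> R x \<in> W" using amp_W by blast
    then have "x \<in> cball c (6 * \<rho>) \<or> R x \<in> cball c (6 * \<rho>)" using Wb by blast
    moreover have "dist (R c) x = dist c (R x)" using dist_refl[OF e, of l c "R x"] e by simp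
    ultimately show "x \<in> cball c (6 * \<rho>) \<union> cball (R c) (6 * \<rho>)" by simp
  qed
  then have "bounded {x. field x \<noteq> 0}" by (rule bounded_subset[rotated]) simp
  then show ?thesis unfolding test_field_def using field_smooth by simp
qed

end

section \<open>First variation of the singular part\<close>

context patch
begin

text \<open>For the graph of \<gamma>: the measure of the points below it that the displacement h
  carries above it, line by line along \<nu>, counting the pairs with an end over the support of
  \<open>f\<close>. \<open>graph_jump_measure\<close> proves this reading.\<close>

definition "Lam \<gamma> h = (\<integral>\<^sup>+x. indicator {x. 0 \<le> x \<bullet> \<nu> \<and> x \<bullet> \<nu> < 1} x *
   (if x \<in> T \<and> x + h \<in> T \<and> (f x \<noteq> 0 \<or> f (x + h) \<noteq> 0) then ennreal (max 0 (\<gamma> x - \<gamma> (x + h) + h \<bullet> \<nu>)) else 0) \<partial>lborel)"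

lemma Lam_meas [measurable]:
  assumes [measurable]: "\<gamma> \<in> borel_measurable borel"
  shows "Lam \<gamma> \<in> borel_measurable borel"
  unfolding Lam_def[abs_def] by measurable

text \<open>Since the graph has height at most \<rho> and |h| < \<rho>/2, the height condition in
  \<open>W\<close> holds automatically for pairs that cross the graph, so the set is a layer between
  two graphs.\<close>

lemma graph_jump_measure:
  assumes [measurable]: "\<gamma> \<in> borel_measurable borel" and inv: "\<And>x t. \<gamma> (x + t *\<^sub>R \<nu>) = \<gamma> x"
    and bd: "\<And>x. x \<in> T \<Longrightarrow> \<bar>\<gamma> x\<bar> \<le> \<rho>" and h: "norm h < \<rho> / 2"
    and A: "\<And>x. x \<in> W \<Longrightarrow> x \<in> A \<longleftrightarrow> ht x < \<gamma> x"
  shows "emeasure lborel {x. (x \<in> W \<and> x + h \<in> W \<and> (f x \<noteq> 0 \<or> f (x + h) \<noteq> 0)) \<and> x \<in> A \<and> x + h \<notin> A} = Lam \<gamma> h"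
proof -
  define S where "S = {x. x \<in> T \<and> x + h \<in> T \<and> (f x \<noteq> 0 \<or> f (x + h) \<noteq> 0)}"
  have [measurable]: "S \<in> sets borel" unfolding S_def by measurable
  have hn: "\<bar>h \<bullet> \<nu>\<bar> < \<rho> / 2" using inner_le_norm1[OF nu, of h] h by simp
  have hth: "ht (x + h) = ht x + h \<bullet> \<nu>" for x by (simp add: inner_diff_left inner_add_left)
  have sh: "x + t *\<^sub>R \<nu> + h = (x + h) + t *\<^sub>R \<nu>" for x t by simp
  have sets: "{x. (x \<in> W \<and> x + h \<in> W \<and> (f x \<noteq> 0 \<or> f (x + h) \<noteq> 0)) \<and> x \<in> A \<and> x + h \<notin> A}
     = {x \<in> S. c \<bullet> \<nu> + \<gamma> (x + h) - h \<bullet> \<nu> \<le> x \<bullet> \<nu> \<and> x \<bullet> \<nu> < c \<bullet> \<nu> + \<gamma> x}"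
  proof (intro set_eqI iffI)
    fix x assume "x \<in> {x. (x \<in> W \<and> x + h \<in> W \<and> (f x \<noteq> 0 \<or> f (x + h) \<noteq> 0)) \<and> x \<in> A \<and> x + h \<notin> A}"
    then show "x \<in> {x \<in> S. c \<bullet> \<nu> + \<gamma> (x + h) - h \<bullet> \<nu> \<le> x \<bullet> \<nu> \<and> x \<bullet> \<nu> < c \<bullet> \<nu> + \<gamma> x}"
      using A[of x] A[of "x + h"] hth[of x] by (simp add: W_def S_def inner_diff_left)
  next
    fix x assume x: "x \<in> {x \<in> S. c \<bullet> \<nu> + \<gamma> (x + h) - h \<bullet> \<nu> \<le> x \<bullet> \<nu> \<and> x \<bullet> \<nu> < c \<bullet> \<nu> + \<gamma> x}"
    then have S: "x \<in> T" "x + h \<in> T" "f x \<noteq> 0 \<or> f (x + h) \<noteq> 0" and i: "\<gamma> (x + h) \<le> ht x + h \<bullet> \<nu>" "ht x < \<gamma> x"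
      by (simp_all add: S_def inner_diff_left)
    have b: "- \<rho> \<le> \<gamma> (x + h)" "\<gamma> x \<le> \<rho>" "- (\<rho> / 2) < h \<bullet> \<nu>" "h \<bullet> \<nu> < \<rho> / 2"
      using bd[OF S(1)] bd[OF S(2)] hn by (simp_all add: abs_le_iff abs_less_iff)
    have "ht x < 3 * \<rho>" "- (3 * \<rho>) < ht x" "ht x + h \<bullet> \<nu> < 3 * \<rho>" "- (3 * \<rho>) < ht x + h \<bullet> \<nu>"
      using i b rho by linarith+
    then have "\<bar>ht x\<bar> < 3 * \<rho>" "\<bar>ht (x + h)\<bar> < 3 * \<rho>"
      unfolding abs_less_iff hth[of x] by linarith+
    then have w: "x \<in> W" "x + h \<in> W" using S by (simp_all only: W_def mem_Collect_eq)
    have xA: "x \<in> A" by (rule iffD2[OF A[OF w(1)] i(2)])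
    have "\<not> ht (x + h) < \<gamma> (x + h)" unfolding hth[of x] not_less by (rule i(1))
    then have xhA: "x + h \<notin> A" using A[OF w(2)] by (simp only:) simp
    show "x \<in> {x. (x \<in> W \<and> x + h \<in> W \<and> (f x \<noteq> 0 \<or> f (x + h) \<noteq> 0)) \<and> x \<in> A \<and> x + h \<notin> A}"
      by (rule CollectI, intro conjI, rule w(1), rule w(2), rule S(3), rule xA, rule xhA)
  qed
  have "emeasure lborel {x \<in> S. c \<bullet> \<nu> + \<gamma> (x + h) - h \<bullet> \<nu> \<le> x \<bullet> \<nu> \<and> x \<bullet> \<nu> < c \<bullet> \<nu> + \<gamma> x} = (\<integral>\<^sup>+x. indicator {x. 0 \<le> x \<bullet> \<nu> \<and> x \<bullet> \<nu> < 1} x *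
     (indicator S x * ennreal (max 0 ((c \<bullet> \<nu> + \<gamma> x) - (c \<bullet> \<nu> + \<gamma> (x + h) - h \<bullet> \<nu>)))) \<partial>lborel)"
  proof (rule emeasure_graph_layer[OF nu])
    show "x + t *\<^sub>R \<nu> \<in> S \<longleftrightarrow> x \<in> S" for x t by (simp only: S_def mem_Collect_eq sh T_inv f_inv)
    show "c \<bullet> \<nu> + \<gamma> (x + t *\<^sub>R \<nu>) = c \<bullet> \<nu> + \<gamma> x" for x t by (simp only: inv)
    show "c \<bullet> \<nu> + \<gamma> (x + t *\<^sub>R \<nu> + h) - h \<bullet> \<nu> = c \<bullet> \<nu> + \<gamma> (x + h) - h \<bullet> \<nu>" for x t by (simp only: inv sh)
    show "(\<lambda>x. c \<bullet> \<nu> + \<gamma> x) \<in> borel_measurable borel" by measurable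
    show "(\<lambda>x. c \<bullet> \<nu> + \<gamma> (x + h) - h \<bullet> \<nu>) \<in> borel_measurable borel" by measurable
    show "S \<in> sets borel" by fact
  qed
  also have "\<dots> = Lam \<gamma> h" unfolding Lam_def
  proof (rule nn_integral_cong)
    fix x
    have "(c \<bullet> \<nu> + \<gamma> x) - (c \<bullet> \<nu> + \<gamma> (x + h) - h \<bullet> \<nu>) = \<gamma> x - \<gamma> (x + h) + h \<bullet> \<nu>" by simp
    note eq = this
    show "indicator {x. 0 \<le> x \<bullet> \<nu> \<and> x \<bullet> \<nu> < 1} x * (indicator S x * ennreal (max 0 ((c \<bullet> \<nu> + \<gamma> x) - (c \<bullet> \<nu> + \<gamma> (x + h) - h \<bullet> \<nu>))))
      = indicator {x. 0 \<le> x \<bullet> \<nu> \<and> x \<bullet> \<nu> < 1} x * (if x \<in> T \<and> x + h \<in> T \<and> (f x \<noteq> 0 \<or> f (x + h) \<noteq> 0) then ennreal (max 0 (\<gamma> x - \<gamma> (x + h) + h \<bullet> \<nu>)) else 0)"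
      unfolding eq by (simp add: S_def indicator_def)
  qed
  finally show ?thesis unfolding sets .
qed

definition "inner_pair h x \<longleftrightarrow> x \<in> W \<and> x + h \<in> W \<and> (f x \<noteq> 0 \<or> f (x + h) \<noteq> 0)"

text \<open>Pairs that the deformation does not affect; their contribution involves \<open>E\<close>
  and no t.\<close>

definition "Out h = emeasure lborel {x. \<not> inner_pair h x \<and> \<not> inner_pair (refln e 0 h) (R x) \<and> x \<in> E \<and> x + h \<notin> E}"

lemma Out_meas [measurable]: "Out \<in> borel_measurable borel"
  unfolding Out_def[abs_def] inner_pair_def by measurable

lemma WR_disjoint: "x \<in> W \<Longrightarrow> R x \<notin> W" using W_half RW_half by fastforce

lemma Et_eq_E:
  assumes t: "\<bar>t\<bar> \<le> \<rho> / 2" and 1: "x \<in> W \<Longrightarrow> f x = 0 \<or> \<rho> < \<bar>ht x\<bar>" and 2: "R x \<in> W \<Longrightarrow> f (R x) = 0 \<or> \<rho> < \<bar>ht (R x)\<bar>"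
  shows "x \<in> Et t \<longleftrightarrow> x \<in> E"
proof -
  consider "x \<in> W" "R x \<notin> W" | "x \<notin> W" "R x \<in> W" | "x \<notin> W" "R x \<notin> W" using WR_disjoint by blast
  then show ?thesis
  proof cases
    case 1
    then have "\<bar>g x + t * f x\<bar> \<le> \<rho>" "\<bar>g x\<bar> \<le> \<rho>" using gt_bound(1)[OF t, of x] g_bound(1)[of x] by (auto simp: W_def)
    then have "ht x < g x + t * f x \<longleftrightarrow> ht x < g x" using assms(2)[OF 1(1)] by (auto simp: abs_le_iff abs_if split: if_splits)
    then show ?thesis using 1 E_W[OF 1(1)] by (simp add: Et_def)
  next
    case 2
    then have "\<bar>gs (R x) - t * f (R x)\<bar> \<le> \<rho>" "\<bar>gs (R x)\<bar> \<le> \<rho>" using gt_bound(2)[OF t, of "R x"] g_bound(2)[of "R x"] by (auto simp: W_def)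
    then have "ht (R x) < gs (R x) - t * f (R x) \<longleftrightarrow> ht (R x) < gs (R x)" using assms(3)[OF 2(2)]
      by (auto simp: abs_le_iff abs_if split: if_splits)
    then show ?thesis using 2 E_RW[OF 2(2)] by (simp add: Et_def)
  qed (simp add: Et_def)
qed

lemma pair_far:
  assumes h: "norm h < \<rho> / 2" and x: "x \<in> W" and np: "\<not> (x \<in> W \<and> x + h \<in> W \<and> (f x \<noteq> 0 \<or> f (x + h) \<noteq> 0))"
  shows "f x = 0 \<or> \<rho> < \<bar>ht x\<bar>"
proof (rule ccontr)
  assume "\<not> ?thesis"
  then have fx: "f x \<noteq> 0" and hx: "\<bar>ht x\<bar> \<le> \<rho>" by auto
  have "perp \<nu> (x + h - c) = perp \<nu> (x - c) + perp \<nu> h" by (simp add: perp_lin)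
  then have "norm (perp \<nu> (x + h - c)) \<le> norm (perp \<nu> (x - c)) + norm h"
    using norm_triangle_ineq[of "perp \<nu> (x - c)" "perp \<nu> h"] norm_perp_le[OF nu, of h] by simp
  then have "x + h \<in> T" using f_support[OF fx] h rho by (simp add: T_def)
  moreover have "\<bar>ht (x + h)\<bar> < 3 * \<rho>"
    using hx inner_le_norm1[OF nu, of h] h rho by (simp add: inner_diff_left inner_add_left)
  ultimately have "x + h \<in> W" by (simp add: W_def)
  then show False using np x fx by simp
qed

text \<open>Pairs at distance below \<rho>/2 fall into three disjoint classes: those over the
  cylinder, those over its mirror image, and those whose end points are unaffected by
  \<open>pair_far\<close>. Reflecting the second class turns it into a graph term for
  \<open>gs\<close> with displacement \<open>refln e 0 h\<close>.\<close>

lemma jump_split: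
  assumes t: "\<bar>t\<bar> \<le> \<rho> / 2" and h: "norm h < \<rho> / 2"
  shows "emeasure lborel {x. x \<in> Et t \<and> x + h \<notin> Et t}
    = Out h + Lam (\<lambda>x. g x + t * f x) h + Lam (\<lambda>x. gs x - t * f x) (refln e 0 h)"
proof -
  let ?h = "refln e 0 h"
  have h': "norm ?h < \<rho> / 2" "norm (- h) < \<rho> / 2" "norm (- ?h) < \<rho> / 2" using h e by (simp_all add: norm_refl_0)
  have Rh: "R (x + h) = R x + ?h" for x by (rule refl_add)
  have same: "(x \<in> Et t \<longleftrightarrow> x \<in> E) \<and> (x + h \<in> Et t \<longleftrightarrow> x + h \<in> E)"
    if "\<not> inner_pair h x" "\<not> inner_pair ?h (R x)" for x
  proof
    show "x \<in> Et t \<longleftrightarrow> x \<in> E"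
      using that pair_far[OF h, of x] pair_far[OF h'(1), of "R x"] by (intro Et_eq_E[OF t]) (auto simp: inner_pair_def)
    show "x + h \<in> Et t \<longleftrightarrow> x + h \<in> E"
      using that pair_far[OF h'(2), of "x + h"] pair_far[OF h'(3), of "R (x + h)"]
      by (intro Et_eq_E[OF t]) (auto simp: inner_pair_def Rh)
  qed
  define A where "A = {x. \<not> inner_pair h x \<and> \<not> inner_pair ?h (R x) \<and> x \<in> E \<and> x + h \<notin> E}"
  define B where "B = {x. inner_pair h x \<and> x \<in> Et t \<and> x + h \<notin> Et t}"
  define C where "C = {y. inner_pair ?h y \<and> y \<in> {y. R y \<in> Et t} \<and> y + ?h \<notin> {y. R y \<in> Et t}}"
  have [measurable]: "A \<in> sets borel" "B \<in> sets borel" "C \<in> sets borel"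
    unfolding A_def B_def C_def inner_pair_def by measurable
  have RC: "x \<in> {x. R x \<in> C} \<longleftrightarrow> inner_pair ?h (R x) \<and> x \<in> Et t \<and> x + h \<notin> Et t" for x
    using e by (simp add: C_def Rh[symmetric])
  have sets: "{x. x \<in> Et t \<and> x + h \<notin> Et t} = A \<union> B \<union> {x. R x \<in> C}"
    using same RC by (auto simp: A_def B_def)
  have "emeasure lborel (A \<union> B \<union> {x. R x \<in> C}) = emeasure lborel A + emeasure lborel B + emeasure lborel {x. R x \<in> C}"
  proof -
    have d: "(A \<union> B) \<inter> {x. R x \<in> C} = {}" "A \<inter> B = {}"
      using WR_disjoint RC by (auto simp: A_def B_def inner_pair_def)
    have "{x. R x \<in> C} \<in> sets borel" by measurable
    then have "emeasure lborel (A \<union> B \<union> {x. R x \<in> C}) = emeasure lborel (A \<union> B) + emeasure lborel {x. R x \<in> C}"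
      using d by (intro plus_emeasure[symmetric]) simp_all
    moreover have "emeasure lborel (A \<union> B) = emeasure lborel A + emeasure lborel B"
      using d by (intro plus_emeasure[symmetric]) simp_all
    ultimately show ?thesis by simp
  qed
  also have "emeasure lborel A = Out h" by (simp add: A_def Out_def)
  also have "emeasure lborel B = Lam (\<lambda>x. g x + t * f x) h"
    unfolding B_def inner_pair_def
    by (rule graph_jump_measure) (use h gt_bound[OF t] WR_disjoint in \<open>auto simp: g_inv f_inv Et_def\<close>)
  also have "emeasure lborel {x. R x \<in> C} = emeasure lborel C" by (rule emeasure_refl_vimage[OF e]) measurable
  also have "emeasure lborel C = Lam (\<lambda>x. gs x - t * f x) ?h"
    unfolding C_def inner_pair_def
  proof (rule graph_jump_measure)
    show "x \<in> {y. R y \<in> Et t} \<longleftrightarrow> ht x < gs x - t * f x" if "x \<in> W" for x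
      using that WR_disjoint[OF that] e by (auto simp: Et_def)
  qed (use h' gt_bound[OF t] in \<open>auto simp: g_inv f_inv\<close>)
  finally show ?thesis unfolding sets .
qed

text \<open>The Lipschitz constant of \<open>f\<close> from \<open>f_lip\<close>.
  \<open>Lt t\<close> adds t times this to the Lipschitz constant of g - gs.\<close>

definition "Fl = 4 * lf / \<rho>"
definition "Lt t = L + t * Fl"

lemma Fl_pos: "0 < Fl" using lf(1) rho by (simp add: Fl_def)

text \<open>Bounds the growth of the two graph terms together. The indicator retains the lines on
  which the crossing length is nearly zero, which for fixed x is a thin set of displacements
  h.\<close>

definition "Err t h = (\<integral>\<^sup>+x. (indicator {x. 0 \<le> x \<bullet> \<nu> \<and> x \<bullet> \<nu> < 1} x * indicator T x) *
   (ennreal (2 * t * Fl * norm h) * (if \<bar>h \<bullet> \<nu> + g x - g (x + h)\<bar> \<le> Lt t * norm h then 1 else 0)) \<partial>lborel)"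

lemma Err_meas [measurable]: "Err t \<in> borel_measurable borel"
  unfolding Err_def[abs_def] by measurable

text \<open>On a line, max(0, a) + max(0, b) changes to max(0, a + u) + max(0, b - u). The positive
  part is linear away from 0, so the opposite changes cancel unless 0 is crossed, which forces |a|
  \<le> |a - b| + |u|; here |a - b| is controlled by \<open>L\<close>. This cancellation keeps the
  error proportional to L + O(t).\<close>

lemma Lam_pair:
  assumes t: "0 \<le> t"
  shows "Lam (\<lambda>x. g x + t * f x) h + Lam (\<lambda>x. gs x - t * f x) h \<le> Lam g h + Lam gs h + Err t h"
proof -
  let ?Q = "{x. 0 \<le> x \<bullet> \<nu> \<and> x \<bullet> \<nu> < 1}"
  let ?P = "\<lambda>x. x \<in> T \<and> x + h \<in> T \<and> (f x \<noteq> 0 \<or> f (x + h) \<noteq> 0)"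
  have pw: "ennreal (max 0 (a + u)) + ennreal (max 0 (b - u)) \<le> ennreal (max 0 a) + ennreal (max 0 b) + ennreal (2 * v) * (if \<bar>a\<bar> \<le> w then 1 else 0)"
    if "\<bar>u\<bar> \<le> v" "\<bar>a - b\<bar> + v \<le> w" for a b u v w :: real
  proof -
    have "max 0 (a + u) + max 0 (b - u) \<le> max 0 a + max 0 b + 2 * v * (if \<bar>a\<bar> \<le> w then 1 else 0)"
      using that by (auto simp: max_def abs_if split: if_splits)
    then have "ennreal (max 0 (a + u) + max 0 (b - u)) \<le> ennreal (max 0 a + max 0 b + 2 * v * (if \<bar>a\<bar> \<le> w then 1 else 0))"
      by (rule ennreal_leI)
    then show ?thesis using that by (auto simp: ennreal_plus[symmetric] simp del: ennreal_plus split: if_splits)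
  qed
  have point: "(if ?P x then ennreal (max 0 ((g x + t * f x) - (g (x + h) + t * f (x + h)) + h \<bullet> \<nu>)) else 0)
      + (if ?P x then ennreal (max 0 ((gs x - t * f x) - (gs (x + h) - t * f (x + h)) + h \<bullet> \<nu>)) else 0)
    \<le> (if ?P x then ennreal (max 0 (g x - g (x + h) + h \<bullet> \<nu>)) else 0) + (if ?P x then ennreal (max 0 (gs x - gs (x + h) + h \<bullet> \<nu>)) else 0)
      + indicator T x * (ennreal (2 * t * Fl * norm h) * (if \<bar>h \<bullet> \<nu> + g x - g (x + h)\<bar> \<le> Lt t * norm h then 1 else 0))" for x
  proof (cases "?P x")
    case True
    let ?a = "g x - g (x + h) + h \<bullet> \<nu>" and ?b = "gs x - gs (x + h) + h \<bullet> \<nu>" and ?u = "t * (f x - f (x + h))"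
    have "\<bar>f x - f (x + h)\<bar> \<le> Fl * norm h" using f_lip[of x "x + h"] by (simp add: Fl_def)
    then have u: "\<bar>?u\<bar> \<le> t * Fl * norm h" using t by (simp add: abs_mult mult.assoc mult_left_mono)
    have "\<bar>?a - ?b\<bar> \<le> L * norm (perp \<nu> h)" using lipG[of "x + h" x] True by (simp add: T_def perp_lin)
    also have "\<dots> \<le> L * norm h" using norm_perp_le[OF nu, of h] L by simp
    finally have ab: "\<bar>?a - ?b\<bar> + t * Fl * norm h \<le> Lt t * norm h" by (simp add: Lt_def distrib_right)
    have e1: "(g x + t * f x) - (g (x + h) + t * f (x + h)) + h \<bullet> \<nu> = ?a + ?u"
      "(gs x - t * f x) - (gs (x + h) - t * f (x + h)) + h \<bullet> \<nu> = ?b - ?u" by (simp_all add: algebra_simps)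
    have e2: "h \<bullet> \<nu> + g x - g (x + h) = ?a" by simp
    have e3: "2 * t * Fl * norm h = 2 * (t * Fl * norm h)" by simp
    show ?thesis unfolding e1 e2 e3 using pw[OF u ab] True by simp
  qed auto
  have add: "(\<integral>\<^sup>+x. indicator ?Q x * \<phi> x \<partial>lborel) + (\<integral>\<^sup>+x. indicator ?Q x * \<psi> x \<partial>lborel) = (\<integral>\<^sup>+x. indicator ?Q x * (\<phi> x + \<psi> x) \<partial>lborel)"
    if [measurable]: "\<phi> \<in> borel_measurable borel" "\<psi> \<in> borel_measurable borel" for \<phi> \<psi> :: "'a \<Rightarrow> ennreal"
    by (subst nn_integral_add[symmetric]) (auto simp: distrib_left)
  have "Lam (\<lambda>x. g x + t * f x) h + Lam (\<lambda>x. gs x - t * f x) h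
    = (\<integral>\<^sup>+x. indicator ?Q x * ((if ?P x then ennreal (max 0 ((g x + t * f x) - (g (x + h) + t * f (x + h)) + h \<bullet> \<nu>)) else 0)
      + (if ?P x then ennreal (max 0 ((gs x - t * f x) - (gs (x + h) - t * f (x + h)) + h \<bullet> \<nu>)) else 0)) \<partial>lborel)"
    unfolding Lam_def by (rule add) measurable
  also have "\<dots> \<le> (\<integral>\<^sup>+x. indicator ?Q x * ((if ?P x then ennreal (max 0 (g x - g (x + h) + h \<bullet> \<nu>)) else 0) + (if ?P x then ennreal (max 0 (gs x - gs (x + h) + h \<bullet> \<nu>)) else 0)
      + indicator T x * (ennreal (2 * t * Fl * norm h) * (if \<bar>h \<bullet> \<nu> + g x - g (x + h)\<bar> \<le> Lt t * norm h then 1 else 0))) \<partial>lborel)"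
    by (intro nn_integral_mono mult_left_mono point) auto
  also have "\<dots> = (\<integral>\<^sup>+x. indicator ?Q x * ((if ?P x then ennreal (max 0 (g x - g (x + h) + h \<bullet> \<nu>)) else 0) + (if ?P x then ennreal (max 0 (gs x - gs (x + h) + h \<bullet> \<nu>)) else 0)) \<partial>lborel)
     + (\<integral>\<^sup>+x. indicator ?Q x * (indicator T x * (ennreal (2 * t * Fl * norm h) * (if \<bar>h \<bullet> \<nu> + g x - g (x + h)\<bar> \<le> Lt t * norm h then 1 else 0))) \<partial>lborel)"
    by (rule add[symmetric]) measurable
  also have "(\<integral>\<^sup>+x. indicator ?Q x * ((if ?P x then ennreal (max 0 (g x - g (x + h) + h \<bullet> \<nu>)) else 0) + (if ?P x then ennreal (max 0 (gs x - gs (x + h) + h \<bullet> \<nu>)) else 0)) \<partial>lborel)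
     = Lam g h + Lam gs h"
    unfolding Lam_def by (rule add[symmetric]) measurable
  finally show ?thesis by (simp add: Err_def mult.assoc)
qed

text \<open>The displacements h with |h| < r in the indicator set have measure O(Lt r^n), a factor
  \<open>Lt\<close> below that of a ball. One power of |h| from the Lipschitz bound tempers the
  kernel to |h|^(-(n+s-1)), which is integrable as s < 1 and yields \<delta>^(1-s).\<close>

lemma thin_bound:
  assumes t: "0 \<le> t"
  shows "(\<integral>\<^sup>+h. ennreal (Ks (norm h)) * (ennreal (2 * t * Fl * norm h) * (if \<bar>h \<bullet> \<nu> + g x - g (x + h)\<bar> \<le> Lt t * norm h then 1 else 0)) \<partial>lborel)
    \<le> ennreal (2 * t * Fl) * ennreal (2 * Lt t * unit_ball_vol n * 2 powr n * (n / (1 - s)) * \<delta> powr (1 - s))"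
proof -
  define A where "A = {h. \<bar>h \<bullet> \<nu> + g x - g (x + h)\<bar> \<le> Lt t * norm h}"
  have [measurable]: "A \<in> sets borel" unfolding A_def by measurable
  have Lt0: "0 < Lt t" using L t Fl_pos by (simp add: Lt_def add_pos_nonneg)
  define \<omega> where "\<omega> = unit_ball_vol n * 2 ^ DIM('a)"
  have om: "0 \<le> \<omega>" using n1 by (simp add: \<omega>_def)
  \<comment> \<open>The set lies in the layer of thickness 2 Lt r around a translated copy of the
    graph, over a disc of radius r.\<close>
  have thin: "emeasure lborel {h \<in> A. norm h < r} \<le> ennreal (2 * Lt t * \<omega> * r powr n)" if r: "0 < r" for r
  proof -
    define S where "S = {h. norm (perp \<nu> (h - 0)) < r}"
    have [measurable]: "S \<in> sets borel" unfolding S_def by measurable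
    have sh: "x + (y + t *\<^sub>R \<nu>) = (x + y) + t *\<^sub>R \<nu>" for y t by simp
    have "{h \<in> A. norm h < r} \<subseteq> {h \<in> S. g (x + h) - g x - Lt t * r \<le> h \<bullet> \<nu> \<and> h \<bullet> \<nu> < g (x + h) - g x + Lt t * r}"
    proof
      fix h assume h: "h \<in> {h \<in> A. norm h < r}"
      then have "Lt t * norm h < Lt t * r" using Lt0 by simp
      then show "h \<in> {h \<in> S. g (x + h) - g x - Lt t * r \<le> h \<bullet> \<nu> \<and> h \<bullet> \<nu> < g (x + h) - g x + Lt t * r}"
        using h norm_perp_le[OF nu, of h] by (auto simp: A_def S_def abs_le_iff)
    qed
    then have "emeasure lborel {h \<in> A. norm h < r} \<le> emeasure lborel {h \<in> S. g (x + h) - g x - Lt t * r \<le> h \<bullet> \<nu> \<and> h \<bullet> \<nu> < g (x + h) - g x + Lt t * r}"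
      by (rule emeasure_mono) measurable
    also have "\<dots> = (\<integral>\<^sup>+h. indicator {x. 0 \<le> x \<bullet> \<nu> \<and> x \<bullet> \<nu> < 1} h * (indicator S h * ennreal (max 0 ((g (x + h) - g x + Lt t * r) - (g (x + h) - g x - Lt t * r)))) \<partial>lborel)"
      by (rule emeasure_graph_layer[OF nu]) (auto simp: S_def sh g_inv perp_lin perp_self nu)
    also have "\<dots> = (\<integral>\<^sup>+h. ennreal (2 * Lt t * r) * indicator {h. (0 \<le> h \<bullet> \<nu> \<and> h \<bullet> \<nu> < 1) \<and> norm (perp \<nu> (h - 0)) < r} h \<partial>lborel)"
      using Lt0 r by (intro nn_integral_cong) (auto simp: indicator_def S_def)
    also have "\<dots> = ennreal (2 * Lt t * r) * disc \<nu> 0 r"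
      unfolding disc_def by (rule nn_integral_cmult_indicator) measurable
    also have "\<dots> \<le> ennreal (2 * Lt t * r) * ennreal (\<omega> * r ^ (DIM('a) - 1))"
      using disc_upper[OF nu r, of 0] by (intro mult_left_mono) (auto simp: \<omega>_def nD)
    also have "\<dots> = ennreal (2 * Lt t * \<omega> * (r * r ^ (DIM('a) - 1)))"
      using Lt0 r om by (subst ennreal_mult[symmetric]) (auto simp: mult_ac)
    also have "r * r ^ (DIM('a) - 1) = r powr n"
      using power_minus_mult[of "DIM('a)" r] r by (simp add: nD powr_realpow mult.commute)
    finally show ?thesis .
  qed
  have "(\<integral>\<^sup>+h. ennreal (Ks (norm h)) * (ennreal (2 * t * Fl * norm h) * (if \<bar>h \<bullet> \<nu> + g x - g (x + h)\<bar> \<le> Lt t * norm h then 1 else 0)) \<partial>lborel)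
    \<le> (\<integral>\<^sup>+h. ennreal (2 * t * Fl) * (ennreal (norm h powr (- (n + s - 1))) * indicator {h. norm h < \<delta>} h * indicator A h) \<partial>lborel)"
  proof (rule nn_integral_mono)
    fix h :: 'a
    have "ennreal (Ks (norm h)) * ennreal (2 * t * Fl * norm h) \<le> ennreal (2 * t * Fl) * (ennreal (norm h powr (- (n + s - 1))) * indicator {h. norm h < \<delta>} h)"
    proof (cases "0 < norm h \<and> norm h < \<delta>")
      case True
      have "Ks (norm h) * (2 * t * Fl * norm h) \<le> norm h powr (- (n + s)) * (2 * t * Fl * norm h)"
        using ker_sing_bounds(2) t Fl_pos by (intro mult_right_mono) auto
      also have "\<dots> = 2 * t * Fl * (norm h powr (- (n + s)) * norm h powr 1)" using True by simp
      also have "norm h powr (- (n + s)) * norm h powr 1 = norm h powr (- (n + s - 1))"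
        by (subst powr_add[symmetric]) (rule arg_cong[where f="\<lambda>c. norm h powr c"], simp)
      finally have "ennreal (Ks (norm h) * (2 * t * Fl * norm h)) \<le> ennreal (2 * t * Fl * norm h powr (- (n + s - 1)))" by (rule ennreal_leI)
      then show ?thesis using True t Fl_pos ker_sing_bounds(1) by (simp add: ennreal_mult)
    next
      case False
      then have "Ks (norm h) = 0" by (auto simp: ker_sing_def)
      then show ?thesis by simp
    qed
    then have "ennreal (Ks (norm h)) * ennreal (2 * t * Fl * norm h) * indicator A h
       \<le> ennreal (2 * t * Fl) * (ennreal (norm h powr (- (n + s - 1))) * indicator {h. norm h < \<delta>} h) * indicator A h"
      by (rule mult_right_mono) simp
    moreover have "(if \<bar>h \<bullet> \<nu> + g x - g (x + h)\<bar> \<le> Lt t * norm h then 1 else 0) = (indicator A h :: ennreal)" by (simp add: A_def indicator_def)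
    ultimately show "ennreal (Ks (norm h)) * (ennreal (2 * t * Fl * norm h) * (if \<bar>h \<bullet> \<nu> + g x - g (x + h)\<bar> \<le> Lt t * norm h then 1 else 0))
       \<le> ennreal (2 * t * Fl) * (ennreal (norm h powr (- (n + s - 1))) * indicator {h. norm h < \<delta>} h * indicator A h)"
      by (simp only: mult.assoc)
  qed
  also have "\<dots> = ennreal (2 * t * Fl) * (\<integral>\<^sup>+h. ennreal (norm h powr (- (n + s - 1))) * indicator {h. norm h < \<delta>} h * indicator A h \<partial>lborel)"
    by (rule nn_integral_cmult) measurable
  also have "(\<integral>\<^sup>+h. ennreal (norm h powr (- (n + s - 1))) * indicator {h. norm h < \<delta>} h * indicator A h \<partial>lborel)
     = (\<integral>\<^sup>+h. ennreal (norm h powr (- (n + s - 1))) * indicator {h. norm h < \<delta>} h \<partial>restrict_space lborel A)"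
    by (subst nn_integral_restrict_space) auto
  also have "\<dots> \<le> ennreal (2 * Lt t * \<omega> * (n / (n - (n + s - 1))) * \<delta> powr (n - (n + s - 1)))"
  proof (rule nn_integral_powr_small)
    show "sigma_finite_measure (restrict_space lborel A)"
      by (rule sigma_finite_measure_restrict_space[OF lborel.sigma_finite_measure_axioms]) simp
    show "norm \<in> borel_measurable (restrict_space lborel A)" by (rule measurable_restrict_space1) simp
    show "emeasure (restrict_space lborel A) {h \<in> space (restrict_space lborel A). norm h < r} \<le> ennreal (2 * Lt t * \<omega> * r powr n)" if "0 < r" for r
      using thin[OF that] by (subst emeasure_restrict_space) (auto simp: space_restrict_space)
    show "0 \<le> 2 * Lt t * \<omega>" using Lt0 om by simp
  qed (use n1 s dl in auto)
  also have "n - (n + s - 1) = 1 - s" by simp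
  also have "2 * Lt t * \<omega> = 2 * Lt t * unit_ball_vol n * 2 powr n" by (simp add: \<omega>_def nD powr_realpow)
  finally show ?thesis by (simp add: mult_left_mono)
qed

text \<open>With \<open>Fl\<close> of order 1/\<rho>, \<delta> of order \<rho> and the disc of order
  \<rho>^(n-1), the increase is of order t L \<rho>^(-s) \<rho>^(n-1) plus O(t^2): per unit of
  volume moved, a constant times L \<rho>^(-s).\<close>

lemma short_energy_variation:
  assumes t: "0 \<le> t" "t \<le> \<rho> / 2"
  shows "short_energy s \<alpha> \<epsilon> \<delta> (Et t) \<le> short_energy s \<alpha> \<epsilon> \<delta> E +
    ennreal (2 * t * Fl) * ennreal (2 * Lt t * unit_ball_vol n * 2 powr n * (n / (1 - s)) * \<delta> powr (1 - s)) * disc \<nu> c (3 * \<rho>)"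
proof -
  let ?k = "\<lambda>h::'a. ennreal (Ks (norm h))"
  let ?B = "ennreal (2 * t * Fl) * ennreal (2 * Lt t * unit_ball_vol n * 2 powr n * (n / (1 - s)) * \<delta> powr (1 - s))"
  have split: "short_energy s \<alpha> \<epsilon> \<delta> (Et u) = (\<integral>\<^sup>+h. ?k h * Out h \<partial>lborel)
     + (\<integral>\<^sup>+h. ?k h * (Lam (\<lambda>x. g x + u * f x) h + Lam (\<lambda>x. gs x - u * f x) h) \<partial>lborel)" if u: "\<bar>u\<bar> \<le> \<rho> / 2" for u
  proof -
    have "short_energy s \<alpha> \<epsilon> \<delta> (Et u) = (\<integral>\<^sup>+h. ?k h * Out h + ?k h * Lam (\<lambda>x. g x + u * f x) h + ?k h * Lam (\<lambda>x. gs x - u * f x) (refln e 0 h) \<partial>lborel)"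
      unfolding short_energy_def
    proof (rule nn_integral_cong)
      fix h :: 'a
      show "ennreal (ker_sing DIM('a) s \<alpha> \<epsilon> \<delta> (norm h)) * emeasure lborel {x. x \<in> Et u \<and> x + h \<notin> Et u}
        = ?k h * Out h + ?k h * Lam (\<lambda>x. g x + u * f x) h + ?k h * Lam (\<lambda>x. gs x - u * f x) (refln e 0 h)"
      proof (cases "norm h < \<rho> / 2")
        case True
        then show ?thesis unfolding jump_split[OF u True] nD[symmetric] by (simp only: distrib_left add.assoc)
      next
        case False
        then have "\<not> norm h < \<delta>" using del by simp
        then have "Ks (norm h) = 0" by (simp add: ker_sing_def)
        then show ?thesis unfolding nD[symmetric] by simp
      qed
    qed
    also have "\<dots> = (\<integral>\<^sup>+h. ?k h * Out h \<partial>lborel) + (\<integral>\<^sup>+h. ?k h * Lam (\<lambda>x. g x + u * f x) h \<partial>lborel)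
       + (\<integral>\<^sup>+h. ?k h * Lam (\<lambda>x. gs x - u * f x) (refln e 0 h) \<partial>lborel)"
      by (rule nn_integral_add3) measurable
    also have "(\<integral>\<^sup>+h. ?k h * Lam (\<lambda>x. gs x - u * f x) (refln e 0 h) \<partial>lborel) = (\<integral>\<^sup>+h. ?k h * Lam (\<lambda>x. gs x - u * f x) h \<partial>lborel)"
    proof -
      have [measurable]: "Lam (\<lambda>x. gs x - u * f x) \<in> borel_measurable borel" by (rule Lam_meas) measurable
      have "(\<lambda>h. ?k h * Lam (\<lambda>x. gs x - u * f x) h) \<in> borel_measurable borel" by measurable
      from nn_integral_refl[OF e this, of 0] show ?thesis by (simp add: norm_refl_0 e)
    qed
    also have "(\<integral>\<^sup>+h. ?k h * Out h \<partial>lborel) + (\<integral>\<^sup>+h. ?k h * Lam (\<lambda>x. g x + u * f x) h \<partial>lborel) + (\<integral>\<^sup>+h. ?k h * Lam (\<lambda>x. gs x - u * f x) h \<partial>lborel)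
      = (\<integral>\<^sup>+h. ?k h * Out h \<partial>lborel) + (\<integral>\<^sup>+h. ?k h * (Lam (\<lambda>x. g x + u * f x) h + Lam (\<lambda>x. gs x - u * f x) h) \<partial>lborel)"
    proof -
      have "(\<integral>\<^sup>+h. ?k h * Lam (\<lambda>x. g x + u * f x) h + ?k h * Lam (\<lambda>x. gs x - u * f x) h \<partial>lborel)
        = (\<integral>\<^sup>+h. ?k h * Lam (\<lambda>x. g x + u * f x) h \<partial>lborel) + (\<integral>\<^sup>+h. ?k h * Lam (\<lambda>x. gs x - u * f x) h \<partial>lborel)"
        by (rule nn_integral_add) measurable
      then show ?thesis by (simp only: distrib_left add.assoc)
    qed
    finally show ?thesis .
  qed
  have err: "(\<integral>\<^sup>+h. ?k h * Err t h \<partial>lborel) \<le> ?B * disc \<nu> c (3 * \<rho>)"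
  proof -
    let ?a = "\<lambda>x. indicator {x. 0 \<le> x \<bullet> \<nu> \<and> x \<bullet> \<nu> < 1} x * indicator T x :: ennreal"
    let ?b = "\<lambda>x h. ennreal (2 * t * Fl * norm h) * (if \<bar>h \<bullet> \<nu> + g x - g (x + h)\<bar> \<le> Lt t * norm h then 1 else 0) :: ennreal"
    have "(\<integral>\<^sup>+h. ?k h * Err t h \<partial>lborel) = (\<integral>\<^sup>+h. (\<integral>\<^sup>+x. ?k h * (?a x * ?b x h) \<partial>lborel) \<partial>lborel)"
      unfolding Err_def by (intro nn_integral_cong nn_integral_cmult[symmetric]) measurable
    also have "\<dots> = (\<integral>\<^sup>+x. (\<integral>\<^sup>+h. ?k h * (?a x * ?b x h) \<partial>lborel) \<partial>lborel)"
      by (rule lborel_pair.Fubini') measurable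
    also have "\<dots> = (\<integral>\<^sup>+x. ?a x * (\<integral>\<^sup>+h. ?k h * ?b x h \<partial>lborel) \<partial>lborel)"
    proof (rule nn_integral_cong)
      fix x
      have "(\<integral>\<^sup>+h. ?k h * (?a x * ?b x h) \<partial>lborel) = (\<integral>\<^sup>+h. ?a x * (?k h * ?b x h) \<partial>lborel)"
        by (intro nn_integral_cong) (simp only: mult.left_commute)
      also have "\<dots> = ?a x * (\<integral>\<^sup>+h. ?k h * ?b x h \<partial>lborel)" by (rule nn_integral_cmult) measurable
      finally show "(\<integral>\<^sup>+h. ?k h * (?a x * ?b x h) \<partial>lborel) = ?a x * (\<integral>\<^sup>+h. ?k h * ?b x h \<partial>lborel)" .
    qed
    also have "\<dots> \<le> (\<integral>\<^sup>+x. ?a x * ?B \<partial>lborel)"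
      by (intro nn_integral_mono mult_left_mono thin_bound[OF t(1)]) auto
    also have "\<dots> = (\<integral>\<^sup>+x. ?B * indicator {x. (0 \<le> x \<bullet> \<nu> \<and> x \<bullet> \<nu> < 1) \<and> norm (perp \<nu> (x - c)) < 3 * \<rho>} x \<partial>lborel)"
      by (intro nn_integral_cong) (auto simp: indicator_def T_def)
    also have "\<dots> = ?B * disc \<nu> c (3 * \<rho>)" unfolding disc_def by (rule nn_integral_cmult_indicator) measurable
    finally show ?thesis .
  qed
  have tt: "\<bar>t\<bar> \<le> \<rho> / 2" "\<bar>0::real\<bar> \<le> \<rho> / 2" using t rho by auto
  have "short_energy s \<alpha> \<epsilon> \<delta> (Et t) \<le> (\<integral>\<^sup>+h. ?k h * Out h \<partial>lborel) + (\<integral>\<^sup>+h. ?k h * (Lam g h + Lam gs h + Err t h) \<partial>lborel)"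
    unfolding split[OF tt(1)] by (intro add_left_mono nn_integral_mono mult_left_mono Lam_pair[OF t(1)]) auto
  also have "(\<integral>\<^sup>+h. ?k h * (Lam g h + Lam gs h + Err t h) \<partial>lborel) = (\<integral>\<^sup>+h. ?k h * (Lam g h + Lam gs h) + ?k h * Err t h \<partial>lborel)"
    by (simp only: distrib_left)
  also have "\<dots> = (\<integral>\<^sup>+h. ?k h * (Lam g h + Lam gs h) \<partial>lborel) + (\<integral>\<^sup>+h. ?k h * Err t h \<partial>lborel)"
    by (rule nn_integral_add) measurable
  also have "(\<integral>\<^sup>+h. ?k h * Out h \<partial>lborel) + ((\<integral>\<^sup>+h. ?k h * (Lam g h + Lam gs h) \<partial>lborel) + (\<integral>\<^sup>+h. ?k h * Err t h \<partial>lborel))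
     = short_energy s \<alpha> \<epsilon> \<delta> E + (\<integral>\<^sup>+h. ?k h * Err t h \<partial>lborel)"
    using split[OF tt(2)] by (simp add: Et_0 add.assoc)
  also have "\<dots> \<le> short_energy s \<alpha> \<epsilon> \<delta> E + ?B * disc \<nu> c (3 * \<rho>)" by (rule add_left_mono[OF err])
  finally show ?thesis .
qed

end

section \<open>The energy inequality\<close>

text \<open>\<open>F_eps\<close> in displacement variables and on any Euclidean space;
  \<open>F_eps_energy\<close> identifies the two on Borel sets.\<close>

definition energy :: "real \<Rightarrow> real \<Rightarrow> real \<Rightarrow> 'a::euclidean_space set \<Rightarrow> ennreal" where
  "energy s \<alpha> \<epsilon> A =
     (\<integral>\<^sup>+h. ennreal (norm h powr (- (real DIM('a) + s))) * emeasure lborel {x. x \<in> A \<and> x + h \<notin> A} \<partial>lborel)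
     + ennreal \<epsilon> * (\<integral>\<^sup>+h. ennreal (norm h powr (- \<alpha>)) * emeasure lborel {x. x \<in> A \<and> x + h \<in> A} \<partial>lborel)"

text \<open>The first term is a rounded-up bound for the Lipschitz loss of the potential over a
  displacement 10 \<rho> L, the second one for the increase of the singular part divided by the
  lower bound for the flux. What counts is that \<rho> does not enter.\<close>

definition "patch_const n s = 20 * kernel.lip_const n s * 2 powr (1 + s) +
  32 * patch.lf * 2 powr n * unit_ball_vol n * (n / (1 - s)) * 2 powr (s - 1) * 4 powr n * 3 powr n"

context patch
begin

text \<open>Match every point x of the added layer with a point of the removed one: slide x along
  \<nu> to y in the layer under \<open>gs\<close>, then reflect. The slide costs at most the
  Lipschitz constant of the potential times 10 \<rho> L + t, the reflection gains by
  \<open>potential_gain\<close>, and both maps preserve measure.\<close>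

lemma exchange_gain:
  assumes t: "0 \<le> t" "t \<le> \<rho> / 8" and L8: "10 * \<rho> * L \<le> \<rho> / 8"
    and near: "\<And>x. x \<in> T \<Longrightarrow> \<bar>g x - gs x\<bar> \<le> 10 * \<rho> * L"
    and refl_half: "\<And>y. y \<in> E \<Longrightarrow> R y \<notin> E \<Longrightarrow> y \<bullet> e \<le> l"
    and D: "\<And>x y. norm (x - c) \<le> 6 * \<rho> \<Longrightarrow> y \<in> E \<Longrightarrow> norm (x - y) \<le> D \<and> norm (R x - y) \<le> D"
    and A: "A \<in> sets borel" "\<And>y. y \<in> A \<Longrightarrow> y \<in> E \<and> R y \<notin> E \<and> \<kappa> \<le> l - y \<bullet> e \<and> 7 * \<rho> \<le> norm (y - c)" and ka: "0 \<le> \<kappa>"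
    and d0: "\<And>x. x \<in> W \<Longrightarrow> d\<^sub>0 \<le> l - x \<bullet> e"
    and G: "G = slope * D powr (- (n + s + 1)) * (2 * \<kappa> / D) * measure lborel A * d\<^sub>0
        - lip_const * \<delta> powr (- (1 + s)) * (10 * \<rho> * L + t)" "0 \<le> G"
  shows "reg_pair s \<alpha> \<epsilon> \<delta> (Nt t) E + ennreal G * emeasure lborel (Mt t) \<le> reg_pair s \<alpha> \<epsilon> \<delta> (Mt t) E"
proof -
  let ?pot = "reg_potential s \<alpha> \<epsilon> \<delta> E"
  \<comment> \<open>The slide by - a takes the heights from g to g + t f onto those from gs - t f to
    gs.\<close>
  define a where "a x = g x + t * f x - gs x" for x
  have [measurable]: "a \<in> borel_measurable borel" unfolding a_def[abs_def] by measurable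
  have ainv: "- a (x + u *\<^sub>R \<nu>) = - a x" for x u by (simp add: a_def g_inv f_inv)
  have finv: "g (x - a x *\<^sub>R \<nu>) = g x" "gs (x - a x *\<^sub>R \<nu>) = gs x" "f (x - a x *\<^sub>R \<nu>) = f x" for x
    using g_inv[of x "- a x"] f_inv[of x "- a x"] by simp_all
  have pos: "0 \<le> ?pot x" for x by (rule reg_pair_potential(2)[OF nD _ _ E_finite, of "{}"]) auto
  have Tsh: "x - a x *\<^sub>R \<nu> \<in> T \<longleftrightarrow> x \<in> T" for x using T_inv[of x "- a x"] by simp
  have htsh: "ht (x - a x *\<^sub>R \<nu>) = ht x - a x" for x using nunu by (simp add: inner_diff_left)
  have tr: "\<bar>t\<bar> \<le> \<rho> / 2" using t rho by simp
  have layer_T: "x \<in> layer u v \<longleftrightarrow> x \<in> T \<and> u x \<le> ht x \<and> ht x < v x"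
    if "x \<in> T \<Longrightarrow> \<bar>u x\<bar> \<le> \<rho>" "x \<in> T \<Longrightarrow> \<bar>v x\<bar> \<le> \<rho>" for u v x
    using that rho by (auto simp: layer_def W_def abs_le_iff abs_less_iff)
  have xM: "x \<in> Mt t \<longleftrightarrow> x \<in> T \<and> g x \<le> ht x \<and> ht x < g x + t * f x" for x
    unfolding Mt_def by (rule layer_T) (auto intro: g_bound gt_bound tr)
  have xN: "x \<in> layer (\<lambda>x. gs x - t * f x) gs \<longleftrightarrow> x \<in> T \<and> gs x - t * f x \<le> ht x \<and> ht x < gs x" for x
    by (rule layer_T) (auto intro: g_bound gt_bound tr)
  have shift: "x - a x *\<^sub>R \<nu> \<in> layer (\<lambda>x. gs x - t * f x) gs \<longleftrightarrow> x \<in> Mt t" for x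
    unfolding xM xN Tsh htsh finv by (auto simp: a_def)
  have potm [measurable]: "?pot \<in> borel_measurable borel"
    unfolding reg_potential_def[abs_def] by measurable
  let ?N = "layer (\<lambda>x. gs x - t * f x) gs"
  have "reg_pair s \<alpha> \<epsilon> \<delta> (Nt t) E = (\<integral>\<^sup>+x. indicator (Nt t) x * ennreal (?pot x) \<partial>lborel)"
    by (rule reg_pair_potential(1)[OF nD _ _ E_finite]) measurable
  also have "\<dots> = (\<integral>\<^sup>+x. indicator ?N (R x) * ennreal (?pot (R (R x))) \<partial>lborel)"
    using e by (intro nn_integral_cong) (auto simp: Nt_def indicator_def)
  also have "\<dots> = (\<integral>\<^sup>+x. indicator ?N x * ennreal (?pot (R x)) \<partial>lborel)"
    by (rule nn_integral_refl[OF e, of "\<lambda>x. indicator ?N x * ennreal (?pot (R x))"]) measurable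
  also have "\<dots> = (\<integral>\<^sup>+x. indicator ?N (x + (- a x) *\<^sub>R \<nu>) * ennreal (?pot (R (x + (- a x) *\<^sub>R \<nu>))) \<partial>lborel)"
    by (rule nn_integral_shear[OF nu _ _ ainv, symmetric]) measurable
  also have "\<dots> = (\<integral>\<^sup>+x. indicator (Mt t) x * ennreal (?pot (R (x - a x *\<^sub>R \<nu>))) \<partial>lborel)"
    using shift by (intro nn_integral_cong) (simp add: indicator_def)
  finally have N: "reg_pair s \<alpha> \<epsilon> \<delta> (Nt t) E = (\<integral>\<^sup>+x. indicator (Mt t) x * ennreal (?pot (R (x - a x *\<^sub>R \<nu>))) \<partial>lborel)" .
  have M: "reg_pair s \<alpha> \<epsilon> \<delta> (Mt t) E = (\<integral>\<^sup>+x. indicator (Mt t) x * ennreal (?pot x) \<partial>lborel)"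
    by (rule reg_pair_potential(1)[OF nD _ _ E_finite]) measurable
  have point: "?pot (R (x - a x *\<^sub>R \<nu>)) + G \<le> ?pot x" if x: "x \<in> Mt t" for x
  proof -
    let ?y = "x - a x *\<^sub>R \<nu>"
    have xW: "x \<in> W" using x by (simp add: Mt_def layer_def)
    have yW: "?y \<in> W" using shift[of x] x by (simp add: layer_def)
    have cW: "norm (z - c) \<le> 6 * \<rho>" if "z \<in> W" for z
      using norm_le_perp[OF nu, of "z - c"] that by (simp add: W_def T_def)
    have tf: "0 \<le> t * f x" "t * f x \<le> t" using t f_bounds[of x] by (auto simp: mult_left_le)
    have "x \<in> T" using xW by (simp add: W_def)
    then have ax: "\<bar>a x\<bar> \<le> 10 * \<rho> * L + t" using near[of x] tf by (simp add: a_def abs_le_iff)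
    have nxy: "norm (x - ?y) = \<bar>a x\<bar>" using nu by simp
    have "\<bar>?pot x - ?pot ?y\<bar> \<le> lip_const * \<delta> powr (- (1 + s)) * norm (x - ?y)"
    proof (rule potential_lipschitz[OF nD E_meas E_finite])
      show "norm (x - ?y) \<le> \<delta> / 2" unfolding nxy using ax t L8 del by linarith
      show "norm (x - z) \<le> D" "norm (?y - z) \<le> D" if "z \<in> E" for z
        using D[OF cW[OF xW] that] D[OF cW[OF yW] that] by auto
    qed
    also have "\<dots> \<le> lip_const * \<delta> powr (- (1 + s)) * (10 * \<rho> * L + t)"
      unfolding nxy using ax lip_const_nonneg by (intro mult_left_mono) auto
    finally have 1: "?pot ?y - lip_const * \<delta> powr (- (1 + s)) * (10 * \<rho> * L + t) \<le> ?pot x" by (simp add: abs_le_iff)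
    have "slope * D powr (- (n + s + 1)) * (2 * \<kappa> / D) * measure lborel A * (l - ?y \<bullet> e) \<le> ?pot ?y - ?pot (R ?y)"
    proof (rule potential_gain[OF nD e E_meas A(1) E_finite refl_half _ _ _ _ ka])
      show "?y \<bullet> e \<le> l" using W_half[OF yW] by simp
      show "norm (?y - z) \<le> D" "norm (R ?y - z) \<le> D" if "z \<in> E" for z using D[OF cW[OF yW] that] by auto
      show "z \<in> E \<and> R z \<notin> E \<and> \<kappa> \<le> l - z \<bullet> e \<and> \<delta> \<le> norm (?y - z)" if z: "z \<in> A" for z
      proof -
        have "norm (z - c) \<le> norm (?y - z) + norm (?y - c)"
          using norm_triangle_ineq4[of "?y - c" "?y - z"] by (simp add: algebra_simps)
        then show ?thesis using A(2)[OF z] cW[OF yW] del rho by linarith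
      qed
    qed
    moreover have "slope * D powr (- (n + s + 1)) * (2 * \<kappa> / D) * measure lborel A * d\<^sub>0
       \<le> slope * D powr (- (n + s + 1)) * (2 * \<kappa> / D) * measure lborel A * (l - ?y \<bullet> e)"
      using d0[OF yW] slope_pos ka dl by (intro mult_left_mono) auto
    ultimately show ?thesis using 1 G(1) by linarith
  qed
  have "reg_pair s \<alpha> \<epsilon> \<delta> (Nt t) E + ennreal G * emeasure lborel (Mt t)
    = (\<integral>\<^sup>+x. indicator (Mt t) x * ennreal (?pot (R (x - a x *\<^sub>R \<nu>))) \<partial>lborel) + (\<integral>\<^sup>+x. ennreal G * indicator (Mt t) x \<partial>lborel)"
    unfolding N by (subst nn_integral_cmult_indicator) auto
  also have "\<dots> = (\<integral>\<^sup>+x. indicator (Mt t) x * ennreal (?pot (R (x - a x *\<^sub>R \<nu>))) + ennreal G * indicator (Mt t) x \<partial>lborel)"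
    by (rule nn_integral_add[symmetric]) measurable
  also have "\<dots> \<le> (\<integral>\<^sup>+x. indicator (Mt t) x * ennreal (?pot x) \<partial>lborel)"
  proof (rule nn_integral_mono)
    fix x
    show "indicator (Mt t) x * ennreal (?pot (R (x - a x *\<^sub>R \<nu>))) + ennreal G * indicator (Mt t) x \<le> indicator (Mt t) x * ennreal (?pot x)"
    proof (cases "x \<in> Mt t")
      case True
      then show ?thesis using ennreal_leI[OF point[OF True]] unfolding ennreal_plus[OF pos G(2)] by simp
    qed simp
  qed
  finally show ?thesis unfolding M .
qed

definition "m\<^sub>f = enn2real flux"

lemma flux_real: "flux = ennreal m\<^sub>f"
  "unit_ball_vol n / 2 powr n * \<rho> powr (n - 1) \<le> m\<^sub>f"
  "disc \<nu> c (3 * \<rho>) \<le> ennreal (unit_ball_vol n * 2 powr n * (3 * \<rho>) powr (n - 1))"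
proof -
  have pw: "r ^ (DIM('a) - 1) = r powr (n - 1)" if "0 < r" for r :: real
    using that by (simp add: nD powr_realpow[symmetric] of_nat_diff)
  have p2: "2 ^ DIM('a) = (2::real) powr n" by (simp add: nD powr_realpow)
  show u: "disc \<nu> c (3 * \<rho>) \<le> ennreal (unit_ball_vol n * 2 powr n * (3 * \<rho>) powr (n - 1))"
    using disc_upper[OF nu, of "3 * \<rho>" c] rho pw[of "3 * \<rho>"] unfolding p2 nD[symmetric] by (simp del: One_nat_def)
  have "flux < \<infinity>" using le_less_trans[OF order_trans[OF flux_bounds(2) u] ennreal_less_top] by simp
  then show f: "flux = ennreal m\<^sub>f" by (simp add: m\<^sub>f_def)
  have "ennreal (unit_ball_vol n / 2 powr n * \<rho> powr (n - 1)) \<le> ennreal m\<^sub>f"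
    using order_trans[OF disc_lower[OF nu rho, of c] flux_bounds(1)] unfolding p2 pw[OF rho] nD[symmetric] f .
  then show "unit_ball_vol n / 2 powr n * \<rho> powr (n - 1) \<le> m\<^sub>f"
    by (simp add: ennreal_le_iff m\<^sub>f_def)
qed

text \<open>By \<open>energy_identity\<close> for \<open>E\<close> and \<open>Et t\<close>, which
  have the same volume, the volume terms cancel. What remains is the increase of the short energy
  minus that of the regular self-interaction. Since all terms are finite, the estimates pass to real
  numbers.\<close>

lemma energy_variation:
  assumes t: "0 \<le> t" "t \<le> \<rho> / 8" and fin: "short_energy s \<alpha> \<epsilon> \<delta> E < \<infinity>" and G: "0 \<le> G"
    and gain: "reg_pair s \<alpha> \<epsilon> \<delta> (Nt t) E + ennreal G * emeasure lborel (Mt t) \<le> reg_pair s \<alpha> \<epsilon> \<delta> (Mt t) E"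
  shows "enn2real (energy s \<alpha> \<epsilon> (Et t)) - enn2real (energy s \<alpha> \<epsilon> E) \<le>
     t * (- 2 * G * m\<^sub>f + 2 * (\<delta> powr (- (n + s)) + \<epsilon> * \<delta> powr (- \<alpha>)) * t * m\<^sub>f\<^sup>2
      + 4 * Fl * Lt t * (unit_ball_vol n * 2 powr n * (n / (1 - s)) * \<delta> powr (1 - s)) * (unit_ball_vol n * 2 powr n * (3 * \<rho>) powr (n - 1)))"
proof -
  let ?r = "reg_pair s \<alpha> \<epsilon> \<delta>" and ?b = "\<delta> powr (- (n + s)) + \<epsilon> * \<delta> powr (- \<alpha>)"
  let ?V = "2 * t * Fl * (2 * Lt t * unit_ball_vol n * 2 powr n * (n / (1 - s)) * \<delta> powr (1 - s)) * (unit_ball_vol n * 2 powr n * (3 * \<rho>) powr (n - 1))"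
  have tt: "\<bar>t\<bar> \<le> \<rho> / 2" "t \<le> \<rho> / 2" using t rho by auto
  have m0: "0 \<le> m\<^sub>f" by (simp add: m\<^sub>f_def)
  have b0: "0 \<le> ?b" using eps by simp
  have Lt0: "0 \<le> Lt t" using L t Fl_pos by (simp add: Lt_def)
  have om: "0 \<le> unit_ball_vol n" using n1 by simp
  have mM: "emeasure lborel (Mt t) = ennreal (t * m\<^sub>f)" "emeasure lborel (Nt t) = ennreal (t * m\<^sub>f)"
  proof -
    show "emeasure lborel (Mt t) = ennreal (t * m\<^sub>f)" unfolding Mt_def flux_layers(1)[OF t(1) tt(2)] flux_real(1) using t m0 by (simp add: ennreal_mult)
    have "emeasure lborel (Nt t) = ennreal t * flux"
      unfolding Nt_def using flux_layers(2)[OF t(1) tt(2)] by (subst emeasure_refl_vimage[OF e]) auto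
    then show "emeasure lborel (Nt t) = ennreal (t * m\<^sub>f)" unfolding flux_real(1) using t m0 by (simp add: ennreal_mult)
  qed
  have vol: "emeasure lborel (Et t) = emeasure lborel E" by (rule Et_volume[OF tt(1)])
  have SN: "E - Nt t \<union> Nt t = E" using Et_exchange(2)[OF t(1)] by blast
  have ex: "?r E E + 2 * (ennreal G * ennreal (t * m\<^sub>f)) \<le> ?r (Et t) (Et t) + 2 * (ennreal ?b * (ennreal (t * m\<^sub>f) * ennreal (t * m\<^sub>f)))"
  proof -
    have "?r (E - Nt t \<union> Nt t) (E - Nt t \<union> Nt t) + 2 * (ennreal G * emeasure lborel (Mt t)) \<le> ?r (E - Nt t \<union> Mt t) (E - Nt t \<union> Mt t)
       + 2 * (ennreal ?b * (emeasure lborel (Mt t) * emeasure lborel (Nt t)))"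
    proof (rule reg_pair_exchange[OF nD _ _ _ _ _ _ _ refl])
      show "(E - Nt t) \<inter> Mt t = {}" "(E - Nt t) \<inter> Nt t = {}" using Et_exchange(3)[OF t(1)] by auto
      show "emeasure lborel (E - Nt t \<union> Nt t) < \<infinity>" unfolding SN by (rule E_finite)
      show "?r (Nt t) (E - Nt t \<union> Nt t) + ennreal G * emeasure lborel (Mt t) \<le> ?r (Mt t) (E - Nt t \<union> Nt t)"
        unfolding SN by (rule gain)
    qed measurable
    then show ?thesis unfolding SN Et_exchange(1)[OF t(1), symmetric] mM .
  qed
  define k where "k = (\<integral>\<^sup>+h. ennreal (rest (norm (h::'a))) \<partial>lborel) * emeasure lborel E + ennreal (\<epsilon> * \<delta> powr (- \<alpha>)) * (emeasure lborel E * emeasure lborel E)"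
  have kfin: "k < \<infinity>" unfolding k_def using rest_integrable[OF nD] E_finite by (simp add: ennreal_mult_less_top)
  have id: "energy s \<alpha> \<epsilon> A + ?r A A = short_energy s \<alpha> \<epsilon> \<delta> A + k" if "A \<in> sets borel" "emeasure lborel A = emeasure lborel E" for A :: "'a set"
    using energy_identity[OF nD that(1)] that(2) E_finite unfolding energy_def k_def nD[symmetric] by (simp add: add.assoc)
  have rfin: "?r A A < \<infinity>" if "A \<in> sets borel" "emeasure lborel A = emeasure lborel E" for A :: "'a set"
  proof -
    have "ennreal ?b * (emeasure lborel A * emeasure lborel A) < \<infinity>" unfolding that(2) using E_finite by (simp add: ennreal_mult_less_top)
    then show ?thesis using reg_pair_finite[OF nD that(1) that(1)] by (rule le_less_trans[rotated])
  qed
  have sv: "short_energy s \<alpha> \<epsilon> \<delta> (Et t) \<le> short_energy s \<alpha> \<epsilon> \<delta> E + ennreal ?V"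
  proof -
    let ?X = "2 * t * Fl" and ?Y = "2 * Lt t * unit_ball_vol n * 2 powr n * (n / (1 - s)) * \<delta> powr (1 - s)" and ?Z = "unit_ball_vol n * 2 powr n * (3 * \<rho>) powr (n - 1)"
    have XYZ: "0 \<le> ?X" "0 \<le> ?Y" "0 \<le> ?Z" using t Fl_pos Lt0 om n1 s by auto
    have "ennreal ?X * ennreal ?Y * disc \<nu> c (3 * \<rho>) \<le> ennreal ?X * ennreal ?Y * ennreal ?Z"
      by (rule mult_left_mono[OF flux_real(3)]) simp
    also have "\<dots> = ennreal ?V" unfolding ennreal_mult'[OF XYZ(1), symmetric] by (rule ennreal_mult'[OF mult_nonneg_nonneg[OF XYZ(1,2)], symmetric])
    finally have F: "ennreal ?X * ennreal ?Y * disc \<nu> c (3 * \<rho>) \<le> ennreal ?V" .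
    show ?thesis by (rule order_trans[OF short_energy_variation[OF t(1) tt(2)] add_left_mono[OF F]])
  qed
  have V0: "0 \<le> ?V" using t Fl_pos Lt0 om n1 s by auto
  have f1: "energy s \<alpha> \<epsilon> E < \<infinity>" "?r E E < \<infinity>" "?r (Et t) (Et t) < \<infinity>" "short_energy s \<alpha> \<epsilon> \<delta> (Et t) < \<infinity>" "energy s \<alpha> \<epsilon> (Et t) < \<infinity>"
  proof -
    have "energy s \<alpha> \<epsilon> E + ?r E E < \<infinity>" unfolding id[OF E_meas refl] using fin kfin by simp
    then show "energy s \<alpha> \<epsilon> E < \<infinity>" by simp
    show "?r E E < \<infinity>" "?r (Et t) (Et t) < \<infinity>" by (rule rfin[OF E_meas refl], rule rfin[OF Et_meas vol])
    have "short_energy s \<alpha> \<epsilon> \<delta> E + ennreal ?V < \<infinity>" using fin by simp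
    then show sf: "short_energy s \<alpha> \<epsilon> \<delta> (Et t) < \<infinity>" using sv by (rule le_less_trans[rotated])
    have "energy s \<alpha> \<epsilon> (Et t) + ?r (Et t) (Et t) < \<infinity>" unfolding id[OF Et_meas vol] using sf kfin by simp
    then show "energy s \<alpha> \<epsilon> (Et t) < \<infinity>" by simp
  qed
  have re: "\<exists>r\<ge>0. x = ennreal r" if "x < \<infinity>" for x :: ennreal using that by (cases x) auto
  obtain e0 e1 r0 r1 s0 s1 k' where v: "energy s \<alpha> \<epsilon> E = ennreal e0" "energy s \<alpha> \<epsilon> (Et t) = ennreal e1" "?r E E = ennreal r0"
    "?r (Et t) (Et t) = ennreal r1" "short_energy s \<alpha> \<epsilon> \<delta> E = ennreal s0" "short_energy s \<alpha> \<epsilon> \<delta> (Et t) = ennreal s1" "k = ennreal k'"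
    and nn: "0 \<le> e0" "0 \<le> e1" "0 \<le> r0" "0 \<le> r1" "0 \<le> s0" "0 \<le> s1" "0 \<le> k'"
    using re[OF f1(1)] re[OF f1(2)] re[OF f1(3)] re[OF f1(4)] re[OF f1(5)] re[OF fin] re[OF kfin] by blast
  have tm: "0 \<le> t * m\<^sub>f" using t m0 by simp
  have "e0 + r0 = s0 + k'" using id[OF E_meas refl] nn unfolding v by (simp add: ennreal_plus[symmetric] del: ennreal_plus)
  moreover have "e1 + r1 = s1 + k'" using id[OF Et_meas vol] nn unfolding v by (simp add: ennreal_plus[symmetric] del: ennreal_plus)
  moreover have "s1 \<le> s0 + ?V" using sv nn V0 unfolding v by (simp add: ennreal_plus[symmetric] del: ennreal_plus)
  moreover have "r0 + 2 * (G * (t * m\<^sub>f)) \<le> r1 + 2 * (?b * ((t * m\<^sub>f) * (t * m\<^sub>f)))"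
  proof -
    have two: "(2::ennreal) * ennreal x = ennreal (2 * x)" if "0 \<le> x" for x using that by (simp add: ennreal_mult)
    have "ennreal (r0 + 2 * (G * (t * m\<^sub>f))) \<le> ennreal (r1 + 2 * (?b * ((t * m\<^sub>f) * (t * m\<^sub>f))))"
      using ex nn tm b0 G unfolding v by (simp add: ennreal_mult'[symmetric] ennreal_plus[symmetric] two del: ennreal_plus)
    then show ?thesis using nn tm b0 by (subst (asm) ennreal_le_iff) auto
  qed
  moreover have "enn2real (energy s \<alpha> \<epsilon> (Et t)) = e1" "enn2real (energy s \<alpha> \<epsilon> E) = e0" using nn by (simp_all add: v)
  ultimately have "enn2real (energy s \<alpha> \<epsilon> (Et t)) - enn2real (energy s \<alpha> \<epsilon> E) \<le> ?V + 2 * (?b * ((t * m\<^sub>f) * (t * m\<^sub>f))) - 2 * (G * (t * m\<^sub>f))" by linarith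
  also have "\<dots> = t * (- 2 * G * m\<^sub>f + 2 * ?b * t * m\<^sub>f\<^sup>2
      + 4 * Fl * Lt t * (unit_ball_vol n * 2 powr n * (n / (1 - s)) * \<delta> powr (1 - s)) * (unit_ball_vol n * 2 powr n * (3 * \<rho>) powr (n - 1)))"
    by (simp add: algebra_simps power2_eq_square)
  finally show ?thesis .
qed

text \<open>Divide \<open>energy_variation\<close> by t and let t decrease to 0: the left side tends
  to 0 by criticality, the quadratic terms disappear, and the gain times \<open>m\<^sub>f\<close> is
  at most the singular error. The lower bound for \<open>m\<^sub>f\<close> cancels the factor
  \<rho>^(n-1).\<close>

lemma patch_inequality:
  assumes L8: "80 * L \<le> 1" and fin: "short_energy s \<alpha> \<epsilon> \<delta> E < \<infinity>"
    and crit: "((\<lambda>t. enn2real (energy s \<alpha> \<epsilon> (\<Phi> t ` E))) has_real_derivative 0) (at 0)"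
    and near: "\<And>x. x \<in> T \<Longrightarrow> \<bar>g x - gs x\<bar> \<le> 10 * \<rho> * L"
    and refl_half: "\<And>y. y \<in> E \<Longrightarrow> R y \<notin> E \<Longrightarrow> y \<bullet> e \<le> l"
    and D: "\<And>x y. norm (x - c) \<le> 6 * \<rho> \<Longrightarrow> y \<in> E \<Longrightarrow> norm (x - y) \<le> D \<and> norm (R x - y) \<le> D"
    and A: "A \<in> sets borel" "\<And>y. y \<in> A \<Longrightarrow> y \<in> E \<and> R y \<notin> E \<and> \<kappa> \<le> l - y \<bullet> e \<and> 7 * \<rho> \<le> norm (y - c)" and ka: "0 \<le> \<kappa>"
    and d0: "\<And>x. x \<in> W \<Longrightarrow> d\<^sub>0 \<le> l - x \<bullet> e"
  shows "slope * D powr (- (n + s + 1)) * (2 * \<kappa> / D) * measure lborel A * d\<^sub>0 \<le> patch_const n s * L * \<rho> powr (- s)"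
proof -
  let ?c = "slope * D powr (- (n + s + 1)) * (2 * \<kappa> / D) * measure lborel A * d\<^sub>0"
  let ?l = "lip_const * \<delta> powr (- (1 + s))"
  let ?b = "\<delta> powr (- (n + s)) + \<epsilon> * \<delta> powr (- \<alpha>)"
  let ?w = "unit_ball_vol n * 2 powr n * (n / (1 - s)) * \<delta> powr (1 - s)" and ?z = "unit_ball_vol n * 2 powr n * (3 * \<rho>) powr (n - 1)"
  define G where "G t = ?c - ?l * (10 * \<rho> * L + t)" for t
  have om: "0 < unit_ball_vol n" using n1 by simp
  have q1: "\<delta> powr (- (1 + s)) * \<rho> = 2 powr (1 + s) * \<rho> powr (- s)"
  proof -
    have "\<delta> powr (- (1 + s)) = \<rho> powr (- (1 + s)) / 2 powr (- (1 + s))" unfolding del using rho by (simp add: powr_divide)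
    also have "\<dots> = 2 powr (1 + s) * \<rho> powr (- (1 + s))" by (simp add: powr_minus_divide del: minus_add_distrib)
    finally have "\<delta> powr (- (1 + s)) * \<rho> = 2 powr (1 + s) * (\<rho> powr (- (1 + s)) * \<rho> powr 1)" using rho by simp
    also have "\<rho> powr (- (1 + s)) * \<rho> powr 1 = \<rho> powr (- s)" by (subst powr_add[symmetric]) simp
    finally show ?thesis .
  qed
  define X where "X = 32 * lf * 2 powr n * unit_ball_vol n * (n / (1 - s)) * 2 powr (s - 1) * 4 powr n * 3 powr n"
  have lc: "0 \<le> lip_const" by (rule lip_const_nonneg)
  have lf0: "0 < lf" by (rule lf)
  have X0: "0 \<le> X" unfolding X_def using om lf0 n1 s by auto
  have PC: "patch_const n s = 20 * lip_const * 2 powr (1 + s) + X" unfolding patch_const_def X_def ..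
  have R0: "?l * (10 * \<rho> * L) = 10 * lip_const * 2 powr (1 + s) * L * \<rho> powr (- s)"
    using q1 by (simp add: mult_ac)
  have G0: "G 0 = ?c - 10 * lip_const * 2 powr (1 + s) * L * \<rho> powr (- s)"
    unfolding G_def add_0_right R0 ..
  show ?thesis
  \<comment> \<open>If the net gain is not positive, the Lipschitz loss already dominates, as
    claimed. Otherwise \<open>G t\<close> stays positive for small t, so that it may enter
    \<open>exchange_gain\<close> as a nonnegative quantity.\<close>
  proof (cases "G 0 \<le> 0")
    case True
    then have "?c \<le> 10 * lip_const * 2 powr (1 + s) * L * \<rho> powr (- s)" unfolding G0 by linarith
    also have "\<dots> = (10 * lip_const * 2 powr (1 + s)) * (L * \<rho> powr (- s))" by simp
    also have "\<dots> \<le> patch_const n s * (L * \<rho> powr (- s))"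
      unfolding PC using L lc X0 by (intro mult_right_mono) auto
    finally show ?thesis by (simp only: mult.assoc)
  next
    case False
    have "((\<lambda>t. (enn2real (energy s \<alpha> \<epsilon> (\<Phi> t ` E)) - enn2real (energy s \<alpha> \<epsilon> (\<Phi> 0 ` E))) / (t - 0)) \<longlongrightarrow> 0) (at 0)"
      using crit by (simp add: has_field_derivative_iff)
    then have lim1: "((\<lambda>t. (enn2real (energy s \<alpha> \<epsilon> (\<Phi> t ` E)) - enn2real (energy s \<alpha> \<epsilon> (\<Phi> 0 ` E))) / (t - 0)) \<longlongrightarrow> 0) (at_right 0)"
      by (rule filterlim_mono) (auto simp: at_le)
    let ?U = "\<lambda>t. - 2 * G t * m\<^sub>f + 2 * ?b * t * m\<^sub>f\<^sup>2 + 4 * Fl * Lt t * ?w * ?z"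
    have lim2: "(?U \<longlongrightarrow> ?U 0) (at_right 0)"
      unfolding G_def Lt_def by (intro tendsto_intros)
    have Gc: "(G \<longlongrightarrow> G 0) (at_right 0)" unfolding G_def by (intro tendsto_intros)
    have ev: "\<forall>\<^sub>F t in at_right 0. (enn2real (energy s \<alpha> \<epsilon> (\<Phi> t ` E)) - enn2real (energy s \<alpha> \<epsilon> (\<Phi> 0 ` E))) / (t - 0) \<le> ?U t"
    proof -
      have "\<forall>\<^sub>F t in at_right 0. 0 < G t" using order_tendstoD(1)[OF Gc] False by simp
      moreover have "\<forall>\<^sub>F t in at_right 0. t \<in> {0<..<\<rho> / 8}" using rho by (intro eventually_at_right_real) simp
      ultimately show ?thesis
      proof eventually_elim
        case (elim t)
        then have t: "0 < t" "t \<le> \<rho> / 8" and Gt: "0 \<le> G t" by auto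
        have im: "\<Phi> t ` E = Et t" "\<Phi> 0 ` E = E" using flow_image[of t] flow_image[of 0] t rho by (auto simp: Et_0)
        have L8': "10 * \<rho> * L \<le> \<rho> / 8" using L8 rho mult_left_mono[of "80 * L" 1 \<rho>] by simp
        have "reg_pair s \<alpha> \<epsilon> \<delta> (Nt t) E + ennreal (G t) * emeasure lborel (Mt t) \<le> reg_pair s \<alpha> \<epsilon> \<delta> (Mt t) E"
          by (rule exchange_gain[OF _ t(2) L8' near refl_half D A ka d0 G_def Gt]) (use t in auto)
        from energy_variation[OF _ t(2) fin Gt this]
        have "enn2real (energy s \<alpha> \<epsilon> (Et t)) - enn2real (energy s \<alpha> \<epsilon> E) \<le> t * ?U t" using t by simp
        then show ?case unfolding im using t by (simp only: diff_zero pos_divide_le_eq mult.commute)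
      qed
    qed
    have "0 \<le> ?U 0" by (rule tendsto_le[OF _ lim2 lim1 ev]) simp
    then have 1: "G 0 * m\<^sub>f \<le> 2 * Fl * L * ?w * ?z" by (simp add: Lt_def)
    let ?v = "unit_ball_vol n / 2 powr n * \<rho> powr (n - 1)"
    have v0: "0 < ?v" using om rho by simp
    have "G 0 * ?v \<le> G 0 * m\<^sub>f" using False flux_real(2) by (intro mult_left_mono) auto
    also note 1
    \<comment> \<open>\<open>Fl\<close> is of order 1/\<rho>, \<open>?w\<close> of order
      \<rho>^(1-s), and \<open>?z\<close> of order \<rho>^(n-1) like \<open>?v\<close>; what remains
      is L \<rho>^(-s).\<close>
    also have "2 * Fl * L * ?w * ?z \<le> (X * (L * \<rho> powr (- s))) * ?v"
    proof -
      have d1: "\<delta> powr (1 - s) = 2 powr (s - 1) * \<rho> * \<rho> powr (- s)"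
      proof -
        have "\<delta> powr (1 - s) = \<rho> powr (1 - s) / 2 powr (1 - s)" unfolding del using rho by (simp add: powr_divide)
        also have "\<dots> = 2 powr (- (1 - s)) * \<rho> powr (1 + (- s))" by (simp add: powr_minus_divide del: minus_diff_eq)
        also have "\<rho> powr (1 + (- s)) = \<rho> * \<rho> powr (- s)" using rho by (simp only: powr_add) simp
        finally show ?thesis by simp
      qed
      have z1: "?z \<le> unit_ball_vol n * 2 powr n * (3 powr n * \<rho> powr (n - 1))"
      proof -
        have "(3 * \<rho>) powr (n - 1) = 3 powr (n - 1) * \<rho> powr (n - 1)" using rho by (simp add: powr_mult)
        also have "\<dots> \<le> 3 powr n * \<rho> powr (n - 1)" by (intro mult_right_mono powr_mono) auto
        finally show ?thesis using om by (intro mult_left_mono) auto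
      qed
      have four: "4 powr n = 2 powr n * (2::real) powr n" by (simp add: powr_mult[symmetric])
      have "0 \<le> 2 * Fl * L * ?w" using Fl_pos L om n1 s by auto
      then have "2 * Fl * L * ?w * ?z \<le> 2 * Fl * L * ?w * (unit_ball_vol n * 2 powr n * (3 powr n * \<rho> powr (n - 1)))"
        by (rule mult_left_mono[OF z1])
      also have "\<dots> = (8 * lf * 2 powr n * unit_ball_vol n * (n / (1 - s)) * 2 powr (s - 1) * 4 powr n * 3 powr n * (L * \<rho> powr (- s))) * ?v"
        unfolding d1 four Fl_def using rho by (simp add: field_simps)
      also have "\<dots> \<le> (X * (L * \<rho> powr (- s))) * ?v"
      proof -
        have "8 * lf * 2 powr n * unit_ball_vol n * (n / (1 - s)) * 2 powr (s - 1) * 4 powr n * 3 powr n = X / 4"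
        proof -
          have "8 * a * b * c' * w * d * e' * f' = (32 * a * b * c' * w * d * e' * f') / 4" for a b c' w d e' f' :: real by simp
          then show ?thesis unfolding X_def .
        qed
        then show ?thesis using X0 v0 L by (simp only:) (intro mult_right_mono, auto)
      qed
      finally show ?thesis .
    qed
    finally have "G 0 \<le> X * (L * \<rho> powr (- s))" using v0 by (simp only: mult_le_cancel_right_pos)
    then have "?c \<le> 10 * lip_const * 2 powr (1 + s) * L * \<rho> powr (- s) + X * (L * \<rho> powr (- s))"
      unfolding G0 by linarith
    also have "\<dots> = (10 * lip_const * 2 powr (1 + s) + X) * (L * \<rho> powr (- s))" by (simp add: distrib_right)
    also have "\<dots> \<le> patch_const n s * (L * \<rho> powr (- s))"
      unfolding PC using L lc by (intro mult_right_mono) auto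
    finally show ?thesis by (simp only: mult.assoc)
  qed
qed

end

section \<open>Boundary charts\<close>

text \<open>\<open>k\<close> and \<open>\<nu>\<close> are length and direction of the gradient at p,
  so \<open>\<nu>\<close> is the outer unit normal; \<open>B\<close> is the second derivative at p,
  and one constant \<open>M\<close> serves all remainders.\<close>

definition chart where
  "chart E p \<rho> \<nu> k M B r \<longleftrightarrow> norm \<nu> = 1 \<and> 0 < k \<and> 0 \<le> M \<and> 0 < r \<and> (\<forall>z\<in>ball p r. \<rho> differentiable (at z)) \<and>
    (\<forall>z\<in>ball p r. \<forall>w. \<bar>fd \<rho> z w - fd \<rho> p w\<bar> \<le> M * norm (z - p) * norm w) \<and>
    (\<forall>w. linear (B w)) \<and> (\<forall>v. linear (\<lambda>w. B w v)) \<and> (\<forall>w v. \<bar>B w v\<bar> \<le> M * norm w * norm v) \<and>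
    (\<forall>z\<in>ball p r. \<forall>w. \<bar>fd \<rho> z w - fd \<rho> p w - B w (z - p)\<bar> \<le> M * (norm (z - p))\<^sup>2 * norm w) \<and>
    (\<forall>w. fd \<rho> p w = k * (w \<bullet> \<nu>)) \<and> \<rho> p = (0::real) \<and>
    (\<forall>z\<in>ball p r. (z \<in> E \<longleftrightarrow> \<rho> z < 0) \<and> (z \<in> frontier E \<longleftrightarrow> \<rho> z = 0))"

lemma boundary_chart:
  fixes E :: "'a::euclidean_space set"
  assumes "smooth_boundary E" "p \<in> frontier E"
  obtains \<rho> \<nu> k M B r where "chart E p \<rho> \<nu> k M B r"
proof -
  obtain U and \<rho> :: "'a \<Rightarrow> real" where U: "open U" "p \<in> U" and sm: "smooth_on U \<rho>"
    and nz: "\<forall>y\<in>U. frechet_derivative \<rho> (at y) \<noteq> (\<lambda>_. 0)" and EU: "E \<inter> U = {y \<in> U. \<rho> y < 0}" "frontier E \<inter> U = {y \<in> U. \<rho> y = 0}"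
    using assms(1)[unfolded smooth_boundary_def, rule_format, OF assms(2)] by (elim exE conjE) (rule that)
  have C: "Ck_on (Suc (Suc (Suc 0))) U \<rho>" "Ck_on (Suc (Suc 0)) U \<rho>" using sm unfolding smooth_on_def by blast+
  have diff: "\<rho> differentiable (at z)" if "z \<in> U" for z using C(2) that unfolding Ck_on.simps(2) by blast
  obtain M1 r1 where 1: "0 \<le> M1" "0 < r1" "ball p r1 \<subseteq> U" "\<And>z w. z \<in> ball p r1 \<Longrightarrow> \<bar>fd \<rho> z w - fd \<rho> p w\<bar> \<le> M1 * norm (z - p) * norm w"
    by (rule fd_first_order[OF U C(2)]) (rule that)
  obtain B M2 r2 where 2: "0 \<le> M2" "0 < r2" "ball p r2 \<subseteq> U"
    "\<And>w. linear (B w)" "\<And>v. linear (\<lambda>w. B w v)" "\<And>w v. \<bar>B w v\<bar> \<le> M2 * norm w * norm v"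
    "\<And>z w. z \<in> ball p r2 \<Longrightarrow> \<bar>fd \<rho> z w - fd \<rho> p w - B w (z - p)\<bar> \<le> M2 * (norm (z - p))\<^sup>2 * norm w"
    by (rule fd_second_order[OF U C(1)]) (rule that)
  define M r where "M = max M1 M2" and "r = min r1 r2"
  define G where "G = (\<Sum>b\<in>Basis. fd \<rho> p b *\<^sub>R b)"
  have fG: "fd \<rho> p w = w \<bullet> G" for w
    unfolding fd_basis_sum[OF diff[OF U(2)], of w] G_def by (simp add: inner_sum_right mult.commute)
  have G0: "G \<noteq> 0"
  proof
    assume "G = 0"
    then have "frechet_derivative \<rho> (at p) = (\<lambda>_. 0)" using fG by (intro ext) simp
    then show False using nz U(2) by blast
  qed
  have br: "ball p r \<subseteq> ball p r1" "ball p r \<subseteq> ball p r2" by (auto simp: r_def)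
  have "\<bar>fd \<rho> z w - fd \<rho> p w\<bar> \<le> M * norm (z - p) * norm w" if "z \<in> ball p r" for z w
  proof -
    have "M1 * norm (z - p) * norm w \<le> M * norm (z - p) * norm w" by (intro mult_right_mono) (auto simp: M_def)
    then show ?thesis using 1(4)[of z w] that br by force
  qed
  moreover have "\<bar>B w v\<bar> \<le> M * norm w * norm v" for w v
  proof -
    have "M2 * norm w * norm v \<le> M * norm w * norm v" by (intro mult_right_mono) (auto simp: M_def)
    then show ?thesis using 2(6)[of w v] by linarith
  qed
  moreover have "\<bar>fd \<rho> z w - fd \<rho> p w - B w (z - p)\<bar> \<le> M * (norm (z - p))\<^sup>2 * norm w" if "z \<in> ball p r" for z w
  proof -
    have "M2 * (norm (z - p))\<^sup>2 * norm w \<le> M * (norm (z - p))\<^sup>2 * norm w" by (intro mult_right_mono) (auto simp: M_def)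
    then show ?thesis using 2(7)[of z w] that br by force
  qed
  moreover have "(z \<in> E \<longleftrightarrow> \<rho> z < 0) \<and> (z \<in> frontier E \<longleftrightarrow> \<rho> z = 0)" if "z \<in> ball p r" for z
  proof -
    have "z \<in> U" using that br 1(3) by blast
    then show ?thesis using EU by blast
  qed
  moreover have "fd \<rho> p w = norm G * (w \<bullet> (inverse (norm G) *\<^sub>R G))" for w using G0 by (simp add: fG)
  moreover have "\<rho> p = 0" using EU(2) U(2) assms(2) by blast
  moreover have "\<rho> differentiable (at z)" if "z \<in> ball p r" for z using that br 1(3) diff by blast
  moreover have "norm (inverse (norm G) *\<^sub>R G) = 1" "0 < norm G" "0 \<le> M" "0 < r" using G0 1(1,2) 2(2) by (auto simp: M_def r_def)
  ultimately have "chart E p \<rho> (inverse (norm G) *\<^sub>R G) (norm G) M B r" unfolding chart_def using 2(4,5) by simp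
  then show ?thesis by (rule that)
qed

text \<open>The derivative-free part of a chart, with a Lipschitz constant proportional to the
  distance m from p. It suffices at an interior contact; a tangential one also uses the second
  derivative in \<open>chart\<close>.\<close>

definition graph_at where
  "graph_at E p \<nu> \<delta> g C \<longleftrightarrow> norm \<nu> = 1 \<and> 0 < \<delta> \<and> 0 \<le> C \<and> C * \<delta> \<le> 1 / 2 \<and> g \<in> borel_measurable borel \<and>
    (\<forall>x t. g (x + t *\<^sub>R \<nu>) = g x) \<and> (\<forall>x. norm (perp \<nu> (x - p)) < \<delta> \<longrightarrow> \<bar>g x\<bar> \<le> C * (norm (perp \<nu> (x - p)))\<^sup>2) \<and>
    (\<forall>x. norm (perp \<nu> (x - p)) < \<delta> \<longrightarrow> \<bar>(x - p) \<bullet> \<nu>\<bar> < \<delta> \<longrightarrow> (x \<in> E \<longleftrightarrow> (x - p) \<bullet> \<nu> < g x)) \<and>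
    (\<forall>x y m. norm (perp \<nu> (x - p)) \<le> m \<longrightarrow> norm (perp \<nu> (y - p)) \<le> m \<longrightarrow> m < \<delta> \<longrightarrow>
      \<bar>g y - g x\<bar> \<le> 2 * C * m * norm (perp \<nu> (y - x)))"

lemma chart_graph:
  fixes E :: "'a::euclidean_space set"
  assumes ch: "chart E p \<rho> \<nu> k M B r"
  obtains \<delta> g C where "graph_at E p \<nu> \<delta> g C" "2 * \<delta> < r"
    "\<And>x. norm (perp \<nu> (x - p)) < \<delta> \<Longrightarrow> \<rho> (p + perp \<nu> (x - p) + g x *\<^sub>R \<nu>) = 0"
    "\<And>x y. norm (perp \<nu> (x - p)) < \<delta> \<Longrightarrow> norm (perp \<nu> (y - p)) < \<delta> \<Longrightarrow>
      \<exists>z\<in>closed_segment (p + perp \<nu> (x - p) + g x *\<^sub>R \<nu>) (p + perp \<nu> (y - p) + g y *\<^sub>R \<nu>).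
        k / 2 \<le> fd \<rho> z \<nu> \<and> (g y - g x) * fd \<rho> z \<nu> = - fd \<rho> z (perp \<nu> (y - x))"
proof -
  have c: "norm \<nu> = 1" "0 < k" "0 < r" "0 \<le> M" "\<And>z. z \<in> ball p r \<Longrightarrow> \<rho> differentiable (at z)"
    "\<And>z w. z \<in> ball p r \<Longrightarrow> \<bar>fd \<rho> z w - fd \<rho> p w\<bar> \<le> M * norm (z - p) * norm w"
    "\<And>w. fd \<rho> p w = k * (w \<bullet> \<nu>)" "\<rho> p = 0" and side: "\<And>z. z \<in> ball p r \<Longrightarrow> z \<in> E \<longleftrightarrow> \<rho> z < 0"
    using ch unfolding chart_def by auto
  show ?thesis
  proof (rule local_graph[OF c])
    fix \<delta> g C
    assume l: "0 < \<delta>" "2 * \<delta> < r" "0 \<le> C" "C * \<delta> \<le> 1 / 2" "g \<in> borel_measurable borel"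
    "\<And>x t. g (x + t *\<^sub>R \<nu>) = g x"
    "\<And>x. norm (perp \<nu> (x - p)) < \<delta> \<Longrightarrow> \<bar>g x\<bar> \<le> C * (norm (perp \<nu> (x - p)))\<^sup>2"
    "\<And>x. norm (perp \<nu> (x - p)) < \<delta> \<Longrightarrow> \<rho> (p + perp \<nu> (x - p) + g x *\<^sub>R \<nu>) = 0"
    "\<And>x. norm (perp \<nu> (x - p)) < \<delta> \<Longrightarrow> \<bar>(x - p) \<bullet> \<nu>\<bar> < \<delta> \<Longrightarrow> \<rho> x < 0 \<longleftrightarrow> (x - p) \<bullet> \<nu> < g x"
    "\<And>x y. norm (perp \<nu> (x - p)) < \<delta> \<Longrightarrow> norm (perp \<nu> (y - p)) < \<delta> \<Longrightarrow>
      \<exists>z\<in>closed_segment (p + perp \<nu> (x - p) + g x *\<^sub>R \<nu>) (p + perp \<nu> (y - p) + g y *\<^sub>R \<nu>).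
        k / 2 \<le> fd \<rho> z \<nu> \<and> (g y - g x) * fd \<rho> z \<nu> = - fd \<rho> z (perp \<nu> (y - x))"
    "\<And>x y m. norm (perp \<nu> (x - p)) \<le> m \<Longrightarrow> norm (perp \<nu> (y - p)) \<le> m \<Longrightarrow> m < \<delta> \<Longrightarrow>
      \<bar>g y - g x\<bar> \<le> 2 * C * m * norm (perp \<nu> (y - x))"
    have "x \<in> E \<longleftrightarrow> (x - p) \<bullet> \<nu> < g x" if "norm (perp \<nu> (x - p)) < \<delta>" "\<bar>(x - p) \<bullet> \<nu>\<bar> < \<delta>" for x
    proof -
      have "norm (x - p) < r" using norm_le_perp[OF c(1), of "x - p"] that l(2) by linarith
      then have "x \<in> ball p r" by (simp add: dist_norm norm_minus_commute)
      then show ?thesis using side l(9)[OF that] by blast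
    qed
    then have "graph_at E p \<nu> \<delta> g C" unfolding graph_at_def using c(1) l(1,3-7,11) by blast
    then show ?thesis by (rule that[OF _ l(2) l(8) l(10)])
  qed
qed

lemma boundary_graph:
  fixes E :: "'a::euclidean_space set"
  assumes "smooth_boundary E" "p \<in> frontier E"
  obtains \<nu> \<delta> g C where "graph_at E p \<nu> \<delta> g C"
proof -
  obtain \<rho> \<nu> k M B r where ch: "chart E p \<rho> \<nu> k M B r" by (rule boundary_chart[OF assms])
  show ?thesis by (rule chart_graph[OF ch]) (rule that)
qed

lemma graph_atD:
  assumes "graph_at E p \<nu> \<delta> g C"
  shows "norm \<nu> = 1" "0 < \<delta>" "0 \<le> C" "C * \<delta> \<le> 1 / 2" "g \<in> borel_measurable borel" "\<And>x t. g (x + t *\<^sub>R \<nu>) = g x"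
    "\<And>x. norm (perp \<nu> (x - p)) < \<delta> \<Longrightarrow> \<bar>g x\<bar> \<le> C * (norm (perp \<nu> (x - p)))\<^sup>2"
    "\<And>x. norm (perp \<nu> (x - p)) < \<delta> \<Longrightarrow> \<bar>(x - p) \<bullet> \<nu>\<bar> < \<delta> \<Longrightarrow> x \<in> E \<longleftrightarrow> (x - p) \<bullet> \<nu> < g x"
    "\<And>x y m. norm (perp \<nu> (x - p)) \<le> m \<Longrightarrow> norm (perp \<nu> (y - p)) \<le> m \<Longrightarrow> m < \<delta> \<Longrightarrow>
      \<bar>g y - g x\<bar> \<le> 2 * C * m * norm (perp \<nu> (y - x))"
  using assms unfolding graph_at_def by auto

text \<open>Slightly outside p along the normal there is an open set disjoint from \<open>E\<close>.
  This excludes slits and upgrades statements about the closure, which limits and null sets provide,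
  to statements about \<open>E\<close> itself.\<close>

lemma frontier_not_interior_closure:
  fixes E :: "'a::euclidean_space set"
  assumes "smooth_boundary E" "p \<in> frontier E"
  shows "p \<notin> interior (closure E)"
proof
  assume "p \<in> interior (closure E)"
  then obtain \<eta> where \<eta>: "0 < \<eta>" "ball p \<eta> \<subseteq> closure E" by (auto simp: mem_interior)
  obtain \<nu> \<delta> g C where "graph_at E p \<nu> \<delta> g C" by (rule boundary_graph[OF assms])
  note g = graph_atD[OF this]
  define \<tau> where "\<tau> = min \<delta> \<eta> / 2"
  have \<tau>: "0 < \<tau>" "\<tau> < \<delta>" "\<tau> < \<eta>" using g(2) \<eta> by (auto simp: \<tau>_def)
  let ?U = "{x. norm (perp \<nu> (x - p)) < \<tau> \<and> \<tau> / 2 < (x - p) \<bullet> \<nu> \<and> (x - p) \<bullet> \<nu> < \<delta>}"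
  have "open ?U" unfolding perp_def by (intro open_Collect_conj open_Collect_less continuous_intros)
  moreover have "?U \<inter> E = {}"
  proof -
    have "x \<notin> E" if x: "x \<in> ?U" for x
    proof -
      have "\<bar>g x\<bar> \<le> C * (norm (perp \<nu> (x - p)))\<^sup>2" using g(7)[of x] x \<tau> by simp
      also have "\<dots> \<le> C * (\<delta> * \<tau>)" unfolding power2_eq_square using x \<tau> g(3) by (intro mult_left_mono mult_mono) auto
      also have "\<dots> = (C * \<delta>) * \<tau>" by simp
      also have "\<dots> \<le> 1 / 2 * \<tau>" using g(4) \<tau> by (intro mult_right_mono) auto
      finally show ?thesis using g(8)[of x] x \<tau> by auto
    qed
    then show ?thesis by blast
  qed
  ultimately have "?U \<inter> closure E = {}" using open_Int_closure_eq_empty by blast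
  moreover have "p + \<tau> *\<^sub>R \<nu> \<in> ?U" using g(1) \<tau> by (simp add: perp_lin perp_self dot_square_norm)
  moreover have "p + \<tau> *\<^sub>R \<nu> \<in> closure E" using \<eta> \<tau> g(1) by (auto simp: dist_norm subset_eq)
  ultimately show False by blast
qed

text \<open>Within radius 3 \<delta>/4 the graph has Lipschitz constant at most 1, so a point of
  \<open>E\<close> that h carries out of \<open>E\<close> lies at most 2 |h| below the
  graph.\<close>

lemma graph_jump_linear:
  fixes E :: "'a::euclidean_space set"
  assumes E: "open E" and ga: "graph_at E p \<nu> \<delta> g C" and h: "norm h < \<delta> / 4"
  shows "emeasure lborel {x \<in> ball p (\<delta> / 2). x \<in> E \<and> x + h \<notin> E} \<le> ennreal (2 * norm h) * disc \<nu> p \<delta>"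
proof -
  note g = graph_atD[OF ga]
  have [measurable]: "g \<in> borel_measurable borel" by (rule g(5))
  define S where "S = {x. norm (perp \<nu> (x - p)) < \<delta>}"
  have [measurable]: "S \<in> sets borel" unfolding S_def by measurable
  have psh: "perp \<nu> (x + t *\<^sub>R \<nu> - p) = perp \<nu> (x - p)" for x t using g(1) by (simp add: perp_lin perp_self)
  have "{x \<in> ball p (\<delta> / 2). x \<in> E \<and> x + h \<notin> E} \<subseteq> {x \<in> S. p \<bullet> \<nu> + g x - 2 * norm h \<le> x \<bullet> \<nu> \<and> x \<bullet> \<nu> < p \<bullet> \<nu> + g x}"
  proof
    fix x assume x: "x \<in> {x \<in> ball p (\<delta> / 2). x \<in> E \<and> x + h \<notin> E}"
    then have xp: "norm (x - p) < \<delta> / 2" by (simp add: dist_norm norm_minus_commute)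
    then have xhp: "norm (x + h - p) < 3 * \<delta> / 4" using norm_triangle_ineq[of "x - p" h] h by (simp add: algebra_simps)
    have n: "norm (perp \<nu> (x - p)) \<le> 3 * \<delta> / 4" "norm (perp \<nu> (x + h - p)) \<le> 3 * \<delta> / 4" "\<bar>(x - p) \<bullet> \<nu>\<bar> < \<delta>" "\<bar>(x + h - p) \<bullet> \<nu>\<bar> < \<delta>"
      using norm_perp_le[OF g(1), of "x - p"] norm_perp_le[OF g(1), of "x + h - p"]
        inner_le_norm1[OF g(1), of "x - p"] inner_le_norm1[OF g(1), of "x + h - p"] xp xhp g(2) by linarith+
    have "\<bar>g (x + h) - g x\<bar> \<le> 2 * C * (3 * \<delta> / 4) * norm (perp \<nu> (x + h - x))"
      by (rule g(9)[OF n(1,2)]) (use g(2) in simp)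
    also have "\<dots> = (C * \<delta>) * (3 / 2) * norm (perp \<nu> h)" by simp
    also have "\<dots> \<le> (1 / 2) * (3 / 2) * norm (perp \<nu> h)" using g(4) by (intro mult_right_mono) auto
    also have "\<dots> \<le> norm h" using norm_perp_le[OF g(1), of h] norm_ge_zero[of h] by linarith
    finally have gg: "\<bar>g (x + h) - g x\<bar> \<le> norm h" .
    have "(x - p) \<bullet> \<nu> < g x" using g(8)[of x] n x g(2) by auto
    moreover have "g (x + h) \<le> (x + h - p) \<bullet> \<nu>" using g(8)[of "x + h"] n x g(2) by auto
    moreover have "\<bar>h \<bullet> \<nu>\<bar> \<le> norm h" by (rule inner_le_norm1[OF g(1)])
    moreover have "norm (perp \<nu> (x - p)) < \<delta>" using n(1) g(2) by linarith
    ultimately show "x \<in> {x \<in> S. p \<bullet> \<nu> + g x - 2 * norm h \<le> x \<bullet> \<nu> \<and> x \<bullet> \<nu> < p \<bullet> \<nu> + g x}"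
      using gg unfolding S_def by (simp add: inner_diff_left inner_add_left abs_le_iff)
  qed
  then have "emeasure lborel {x \<in> ball p (\<delta> / 2). x \<in> E \<and> x + h \<notin> E}
      \<le> emeasure lborel {x \<in> S. p \<bullet> \<nu> + g x - 2 * norm h \<le> x \<bullet> \<nu> \<and> x \<bullet> \<nu> < p \<bullet> \<nu> + g x}"
    by (rule emeasure_mono) measurable
  also have "\<dots> = (\<integral>\<^sup>+x. indicator {x. 0 \<le> x \<bullet> \<nu> \<and> x \<bullet> \<nu> < 1} x * (indicator S x * ennreal (max 0 ((p \<bullet> \<nu> + g x) - (p \<bullet> \<nu> + g x - 2 * norm h)))) \<partial>lborel)"
    by (rule emeasure_graph_layer[OF g(1)]) (auto simp: S_def g(6) psh)
  also have "\<dots> = (\<integral>\<^sup>+x. ennreal (2 * norm h) * indicator {x. (0 \<le> x \<bullet> \<nu> \<and> x \<bullet> \<nu> < 1) \<and> norm (perp \<nu> (x - p)) < \<delta>} x \<partial>lborel)"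
    by (intro nn_integral_cong) (auto simp: indicator_def S_def)
  also have "\<dots> = ennreal (2 * norm h) * disc \<nu> p \<delta>"
    unfolding disc_def by (rule nn_integral_cmult_indicator) measurable
  finally show ?thesis .
qed

text \<open>Finite perimeter in displacement form. A segment leaving \<open>E\<close> meets the
  frontier, so crossing points lie within |h| of it, and compactness reduces the bound to finitely
  many graphs.\<close>

lemma jump_linear:
  fixes E :: "'a::euclidean_space set"
  assumes E: "open E" "bounded E" "smooth_boundary E"
  obtains \<eta> C where "0 < \<eta>" "0 \<le> C" "\<And>h. norm h < \<eta> \<Longrightarrow> emeasure lborel {x. x \<in> E \<and> x + h \<notin> E} \<le> ennreal (C * norm h)"
proof -
  have loc: "\<exists>d c. 0 < d \<and> 0 \<le> c \<and> (\<forall>h. norm h < d \<longrightarrow> emeasure lborel {x \<in> ball p d. x \<in> E \<and> x + h \<notin> E} \<le> ennreal (c * norm h))"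
    if p: "p \<in> frontier E" for p
  proof -
    obtain \<nu> \<delta> g C where ga: "graph_at E p \<nu> \<delta> g C" by (rule boundary_graph[OF E(3) p])
    note g = graph_atD[OF ga]
    have "disc \<nu> p \<delta> < \<infinity>" using le_less_trans[OF disc_upper[OF g(1,2)] ennreal_less_top] by simp
    then have d: "disc \<nu> p \<delta> = ennreal (enn2real (disc \<nu> p \<delta>))" by simp
    have "emeasure lborel {x \<in> ball p (\<delta> / 4). x \<in> E \<and> x + h \<notin> E} \<le> ennreal (2 * enn2real (disc \<nu> p \<delta>) * norm h)" if "norm h < \<delta> / 4" for h
    proof -
      have [measurable]: "E \<in> sets borel" using E by simp
      have "emeasure lborel {x \<in> ball p (\<delta> / 4). x \<in> E \<and> x + h \<notin> E} \<le> emeasure lborel {x \<in> ball p (\<delta> / 2). x \<in> E \<and> x + h \<notin> E}"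
        by (rule emeasure_mono) (use g(2) in auto)
      also have "\<dots> \<le> ennreal (2 * norm h) * disc \<nu> p \<delta>" by (rule graph_jump_linear[OF E(1) ga that])
      also have "\<dots> = ennreal (2 * norm h) * ennreal (enn2real (disc \<nu> p \<delta>))" using d by simp
      also have "\<dots> = ennreal (2 * enn2real (disc \<nu> p \<delta>) * norm h)" by (simp add: ennreal_mult[symmetric] mult_ac)
      finally show ?thesis .
    qed
    then show ?thesis using g(2) by (intro exI[of _ "\<delta> / 4"] exI[of _ "2 * enn2real (disc \<nu> p \<delta>)"]) auto
  qed
  have meet: "\<exists>z\<in>frontier E. dist x z \<le> norm h" if x: "x \<in> E" "x + h \<notin> E" for x h
  proof -
    have "closed_segment x (x + h) \<inter> frontier E \<noteq> {}"
      using x by (intro connected_Int_frontier) auto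
    then obtain z where z: "z \<in> closed_segment x (x + h)" "z \<in> frontier E" by blast
    then show ?thesis using segment_bound(1)[OF z(1)] by (auto simp: dist_norm norm_minus_commute)
  qed
  show ?thesis
  proof (cases "frontier E = {}")
    case True
    then have emp: "{x. x \<in> E \<and> x + h \<notin> E} = {}" for h using meet by blast
    show ?thesis
    proof (rule that[of 1 0])
      show "emeasure lborel {x. x \<in> E \<and> x + h \<notin> E} \<le> ennreal (0 * norm h)" for h unfolding emp by simp
    qed auto
  next
    case False
    obtain d c where dc: "\<And>p. p \<in> frontier E \<Longrightarrow> 0 < d p \<and> 0 \<le> c p \<and> (\<forall>h. norm h < d p \<longrightarrow> emeasure lborel {x \<in> ball p (d p). x \<in> E \<and> x + h \<notin> E} \<le> ennreal (c p * norm h))"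
    proof -
      have "\<forall>p\<in>frontier E. \<exists>z. 0 < fst z \<and> 0 \<le> snd z \<and> (\<forall>h. norm h < fst z \<longrightarrow> emeasure lborel {x \<in> ball p (fst z). x \<in> E \<and> x + h \<notin> E} \<le> ennreal (snd z * norm h))"
      proof
        fix p assume "p \<in> frontier E"
        from loc[OF this] obtain d c where "0 < d \<and> 0 \<le> c \<and> (\<forall>h. norm h < d \<longrightarrow> emeasure lborel {x \<in> ball p d. x \<in> E \<and> x + h \<notin> E} \<le> ennreal (c * norm h))" by (elim exE) (rule that)
        then show "\<exists>z. 0 < fst z \<and> 0 \<le> snd z \<and> (\<forall>h. norm h < fst z \<longrightarrow> emeasure lborel {x \<in> ball p (fst z). x \<in> E \<and> x + h \<notin> E} \<le> ennreal (snd z * norm h))"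
          by (intro exI[of _ "(d, c)"]) simp
      qed
      from bchoice[OF this] obtain z where z: "\<forall>p\<in>frontier E. 0 < fst (z p) \<and> 0 \<le> snd (z p) \<and> (\<forall>h. norm h < fst (z p) \<longrightarrow> emeasure lborel {x \<in> ball p (fst (z p)). x \<in> E \<and> x + h \<notin> E} \<le> ennreal (snd (z p) * norm h))" ..
      show ?thesis by (rule that[of "\<lambda>p. fst (z p)" "\<lambda>p. snd (z p)"]) (rule z[rule_format])
    qed
    have comp: "compact (frontier E)" using E(2) by (rule compact_frontier_bounded)
    have cover: "frontier E \<subseteq> (\<Union>p\<in>frontier E. ball p (d p))" using dc by (auto intro!: bexI)
    obtain F where F: "F \<subseteq> frontier E" "finite F" "frontier E \<subseteq> (\<Union>p\<in>F. ball p (d p))"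
      by (rule compactE_image[OF comp _ cover]) auto
    obtain \<eta>1 where \<eta>1: "0 < \<eta>1" "{x. infdist x (frontier E) \<le> \<eta>1} \<subseteq> (\<Union>p\<in>F. ball p (d p))"
      by (rule compact_in_open_separated[OF False comp _ F(3)]) auto
    have "\<exists>r>0. \<forall>p\<in>F. r \<le> d p" by (rule common_radius[OF F(2)]) (use dc F(1) in auto)
    then obtain \<eta>2 where \<eta>2: "0 < \<eta>2" "\<And>p. p \<in> F \<Longrightarrow> \<eta>2 \<le> d p" by blast
    have "emeasure lborel {x. x \<in> E \<and> x + h \<notin> E} \<le> ennreal ((\<Sum>p\<in>F. c p) * norm h)" if h: "norm h < min \<eta>1 \<eta>2" for h
    proof -
      have [measurable]: "E \<in> sets borel" using E by simp
      have "{x. x \<in> E \<and> x + h \<notin> E} \<subseteq> (\<Union>p\<in>F. {x \<in> ball p (d p). x \<in> E \<and> x + h \<notin> E})"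
      proof
        fix x assume x: "x \<in> {x. x \<in> E \<and> x + h \<notin> E}"
        then obtain z where "z \<in> frontier E" "dist x z \<le> norm h" using meet by blast
        then have "infdist x (frontier E) \<le> \<eta>1" using infdist_le2[of z "frontier E" x "norm h"] h by simp
        then have "x \<in> (\<Union>p\<in>F. ball p (d p))" using \<eta>1(2) by blast
        then show "x \<in> (\<Union>p\<in>F. {x \<in> ball p (d p). x \<in> E \<and> x + h \<notin> E})" using x by blast
      qed
      then have "emeasure lborel {x. x \<in> E \<and> x + h \<notin> E} \<le> emeasure lborel (\<Union>p\<in>F. {x \<in> ball p (d p). x \<in> E \<and> x + h \<notin> E})"
        by (rule emeasure_mono) (use F(2) in auto)
      also have "\<dots> \<le> (\<Sum>p\<in>F. emeasure lborel {x \<in> ball p (d p). x \<in> E \<and> x + h \<notin> E})"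
        by (rule emeasure_subadditive_finite[OF F(2)]) auto
      also have "\<dots> \<le> (\<Sum>p\<in>F. ennreal (c p * norm h))"
      proof (rule sum_mono)
        fix p assume p: "p \<in> F"
        then show "emeasure lborel {x \<in> ball p (d p). x \<in> E \<and> x + h \<notin> E} \<le> ennreal (c p * norm h)"
          using dc[of p] F(1) \<eta>2(2)[OF p] h by (simp add: subset_eq)
      qed
      also have "\<dots> = ennreal (\<Sum>p\<in>F. c p * norm h)" by (rule sum_ennreal) (use dc F(1) in auto)
      finally show ?thesis by (simp add: sum_distrib_right)
    qed
    moreover have "0 \<le> (\<Sum>p\<in>F. c p)" using dc F(1) by (intro sum_nonneg) auto
    ultimately show ?thesis using \<eta>1(1) \<eta>2(1) by (intro that[of "min \<eta>1 \<eta>2" "\<Sum>p\<in>F. c p"]) auto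
  qed
qed

text \<open>The linear bound on crossing pairs leaves the kernel |h|^(-(n+s-1)), which is integrable
  near 0 as s < 1.\<close>

lemma (in kernel) short_energy_finite:
  fixes E :: "'a::euclidean_space set"
  assumes nD: "n = DIM('a)" and E: "open E" and \<eta>: "\<delta> \<le> \<eta>" and C: "0 \<le> C"
    and J: "\<And>h. norm h < \<eta> \<Longrightarrow> emeasure lborel {x. x \<in> E \<and> x + h \<notin> E} \<le> ennreal (C * norm h)"
  shows "short_energy s \<alpha> \<epsilon> \<delta> E < \<infinity>"
proof -
  have "short_energy s \<alpha> \<epsilon> \<delta> E \<le> (\<integral>\<^sup>+h. ennreal C * (ennreal (norm (h::'a) powr (- (n + s - 1))) * indicator {h. norm h < \<delta>} h) \<partial>lborel)"
    unfolding short_energy_def nD[symmetric]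
  proof (rule nn_integral_mono)
    fix h :: 'a
    show "ennreal (Ks (norm h)) * emeasure lborel {x. x \<in> E \<and> x + h \<notin> E} \<le> ennreal C * (ennreal (norm h powr (- (n + s - 1))) * indicator {h. norm h < \<delta>} h)"
    proof (cases "0 < norm h \<and> norm h < \<delta>")
      case True
      have "ennreal (Ks (norm h)) * emeasure lborel {x. x \<in> E \<and> x + h \<notin> E} \<le> ennreal (norm h powr (- (n + s))) * ennreal (C * norm h)"
        using True \<eta> by (intro mult_mono J ennreal_leI ker_sing_bounds) auto
      also have "\<dots> = ennreal (C * (norm h powr (- (n + s)) * norm h powr 1))"
        using C True by (simp add: ennreal_mult[symmetric] mult_ac)
      also have "norm h powr (- (n + s)) * norm h powr 1 = norm h powr (- (n + s - 1))"
        by (subst powr_add[symmetric]) (rule arg_cong[where f="\<lambda>c. norm h powr c"], simp)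
      finally show ?thesis using True C by (simp add: ennreal_mult)
    next
      case False
      then have "Ks (norm h) = 0" by (auto simp: ker_sing_def)
      then show ?thesis by simp
    qed
  qed
  also have "\<dots> = ennreal C * (\<integral>\<^sup>+h. ennreal (norm (h::'a) powr (- (n + s - 1))) * indicator {h. norm h < \<delta>} h \<partial>lborel)"
    by (rule nn_integral_cmult) measurable
  also have "\<dots> \<le> ennreal C * ennreal (unit_ball_vol DIM('a) * (DIM('a) / (DIM('a) - (n + s - 1))) * \<delta> powr (DIM('a) - (n + s - 1)))"
  proof (rule mult_left_mono[OF norm_powr_small])
    show "0 < n + s - 1" "n + s - 1 < real DIM('a)" using s n1 nD by linarith+
  qed (use dl in auto)
  also have "\<dots> < \<infinity>" by (simp add: ennreal_mult_less_top)
  finally show ?thesis .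
qed

section \<open>Moving planes\<close>

definition "flips E e l \<longleftrightarrow> (\<forall>x\<in>E. l < x \<bullet> e \<longrightarrow> refln e l x \<in> E)"

text \<open>Take the infimum \<open>l\<close> of the levels above which all reflections of caps stay
  in \<open>E\<close>. Violations at levels tending to \<open>l\<close> have a limit point q: beyond
  the plane it gives an interior contact with near-side point refln e l q, on the plane a tangential
  one. The latter is recorded through the approximating pairs, from which the sign of the derivative
  in direction e is read off later.\<close>

lemma moving_plane:
  fixes E :: "'a::euclidean_space set"
  assumes E: "open E" "bounded E" "E \<noteq> {}" and ic: "\<And>p. p \<in> frontier E \<Longrightarrow> p \<notin> interior (closure E)" and e: "norm e = 1"
  obtains l where "\<And>\<mu>. l \<le> \<mu> \<Longrightarrow> flips E e \<mu>"
    "(\<exists>p\<in>frontier E. p \<bullet> e < l \<and> refln e l p \<in> frontier E) \<or>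
     (\<exists>q\<in>frontier E. q \<bullet> e = l \<and> (\<forall>\<eta>>0. \<exists>x\<in>E. \<exists>\<tau>>0. x - \<tau> *\<^sub>R e \<notin> E \<and> norm (x - q) < \<eta> \<and> norm (x - \<tau> *\<^sub>R e - q) < \<eta>))"
proof -
  have int: "interior E = E" using E(1) by (rule interior_open)
  have rcont: "continuous_on UNIV (\<lambda>\<mu>. refln e \<mu> x)" for x unfolding refln_def by (intro continuous_intros)
  have reg: "x \<in> E" if "x \<in> interior (closure E)" for x
  proof (rule ccontr)
    assume "x \<notin> E"
    then have "x \<in> frontier E" using that interior_subset by (auto simp: frontier_def int)
    then show False using ic that by blast
  qed
  obtain b where b: "0 < b" "\<And>x. x \<in> E \<Longrightarrow> norm x \<le> b" using E(2) bounded_pos by blast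
  have be: "\<bar>x \<bullet> e\<bar> \<le> b" if "x \<in> E" for x using inner_le_norm1[OF e, of x] b(2)[OF that] by linarith
  define S where "S = {\<mu>. \<forall>\<mu>'>\<mu>. flips E e \<mu>'}"
  have Sne: "b \<in> S" using be by (force simp: S_def flips_def abs_le_iff)
  have Sbd: "- b - 1 \<le> \<mu>" if "\<mu> \<in> S" for \<mu>
  proof (rule ccontr)
    assume "\<not> - b - 1 \<le> \<mu>"
    then have "flips E e (- b - 1)" using that by (auto simp: S_def)
    moreover obtain x where x: "x \<in> E" using E(3) by blast
    moreover have "- b - 1 < x \<bullet> e" using be[OF x] by (simp add: abs_le_iff)
    ultimately have "refln e (- b - 1) x \<in> E" by (auto simp: flips_def)
    from be[OF this] be[OF x] show False using b(1) by (simp add: refl_inner_self e abs_le_iff)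
  qed
  have bdd: "bdd_below S" using Sbd by (rule bdd_belowI)
  define l where "l = Inf S"
  have above: "flips E e \<mu>" if lm: "l < \<mu>" for \<mu>
  proof -
    have "\<exists>\<theta>\<in>S. \<theta> < \<mu>" using cInf_less_iff[of S \<mu>] Sne bdd lm unfolding l_def[symmetric] by auto
    then obtain \<theta> where "\<theta> \<in> S" "\<theta> < \<mu>" by blast
    then show ?thesis by (auto simp: S_def)
  qed
  have weak: "refln e l x \<in> closure E" if x: "x \<in> E" "l < x \<bullet> e" for x
  proof -
    have "((\<lambda>\<mu>. refln e \<mu> x) \<longlongrightarrow> refln e l x) (at_right l)"
      unfolding refln_def by (intro tendsto_intros)
    moreover have "\<forall>\<^sub>F \<mu> in at_right l. \<mu> \<in> {l<..<x \<bullet> e}" unfolding eventually_at_right[OF x(2)] using x(2) by (intro exI[of _ "x \<bullet> e"]) auto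
    then have "\<forall>\<^sub>F \<mu> in at_right l. refln e \<mu> x \<in> closure E"
      by (rule eventually_mono) (use above x closure_subset in \<open>auto simp: flips_def subset_eq\<close>)
    ultimately show ?thesis by (rule Lim_in_closed_set[OF closed_closure, rotated -1]) auto
  qed
  have refl_cont: "continuous_on UNIV (refln e \<mu>)" for \<mu> unfolding refln_def by (intro continuous_intros)
  \<comment> \<open>The limit of reflections only lands in the closure; the reflected open cap is
    open, hence inside the interior of the closure, which is \<open>E\<close> by
    \<open>reg\<close>.\<close>
  have good: "flips E e l"
    unfolding flips_def
  proof (intro ballI impI)
    fix x assume x: "x \<in> E" "l < x \<bullet> e"
    let ?U = "{y. refln e l y \<in> E \<inter> {y. l < y \<bullet> e}}"
    have "open (E \<inter> {y. l < y \<bullet> e})" by (intro open_Int E open_Collect_less continuous_intros)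
    from open_vimage[OF this refl_cont, of l] have "open ?U" by (simp only: vimage_def)
    moreover have "?U \<subseteq> closure E"
    proof
      fix y assume "y \<in> ?U"
      then have "refln e l (refln e l y) \<in> closure E" by (intro weak) auto
      then show "y \<in> closure E" using e by simp
    qed
    moreover have "refln e l x \<in> ?U" using x e by simp
    ultimately show "refln e l x \<in> E" using reg interiorI by blast
  qed
  have all: "flips E e \<mu>" if "l \<le> \<mu>" for \<mu> using that good above by (cases "l = \<mu>") auto
  \<comment> \<open>Levels below the infimum are not in \<open>S\<close>, so violations occur
    arbitrarily close to \<open>l\<close>.\<close>
  have "\<exists>\<mu> x. l - 1 / real (Suc k) < \<mu> \<and> \<mu> \<le> l \<and> x \<in> E \<and> \<mu> < x \<bullet> e \<and> refln e \<mu> x \<notin> E" for k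
  proof -
    have "l - 1 / real (Suc k) \<notin> S" using cInf_lower[OF _ bdd, of "l - 1 / real (Suc k)"] by (auto simp: l_def[symmetric])
    then obtain \<mu> where "l - 1 / real (Suc k) < \<mu>" "\<not> flips E e \<mu>" by (auto simp: S_def)
    moreover have "\<mu> \<le> l" using above calculation(2) by (meson not_le)
    ultimately show ?thesis unfolding flips_def by blast
  qed
  then obtain \<mu> x where lx: "\<And>k. l - 1 / real (Suc k) < \<mu> k \<and> \<mu> k \<le> l \<and> x k \<in> E \<and> \<mu> k < x k \<bullet> e \<and> refln e (\<mu> k) (x k) \<notin> E" by metis
  have "compact (closure E)" using E(2) by simp
  moreover have "\<forall>k. x k \<in> closure E" using lx closure_subset by blast
  ultimately obtain q \<phi> where q: "q \<in> closure E" "strict_mono \<phi>" "(x \<circ> \<phi>) \<longlonglongrightarrow> q" unfolding compact_def by metis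
  have \<mu>l: "\<mu> \<longlonglongrightarrow> l"
  proof (rule tendsto_sandwich[OF _ _ _ tendsto_const])
    show "(\<lambda>k. l - 1 / real (Suc k)) \<longlonglongrightarrow> l" using tendsto_diff[OF tendsto_const LIMSEQ_inverse_real_of_nat, of l] by (simp add: inverse_eq_divide)
    show "\<forall>\<^sub>F k in sequentially. l - 1 / real (Suc k) \<le> \<mu> k" "\<forall>\<^sub>F k in sequentially. \<mu> k \<le> l"
      using lx by (auto intro!: always_eventually less_imp_le simp del: of_nat_Suc)
  qed
  define X where "X k = x (\<phi> k)" for k
  define \<Lambda> where "\<Lambda> k = \<mu> (\<phi> k)" for k
  have X: "X \<longlonglongrightarrow> q" using q(3) by (simp add: X_def[abs_def] o_def)
  have \<Lambda>: "\<Lambda> \<longlonglongrightarrow> l" using LIMSEQ_subseq_LIMSEQ[OF \<mu>l q(2)] by (simp add: \<Lambda>_def[abs_def] o_def)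
  have XL: "X k \<in> E" "\<Lambda> k < X k \<bullet> e" "refln e (\<Lambda> k) (X k) \<notin> E" for k using lx by (auto simp: X_def \<Lambda>_def)
  have RX: "(\<lambda>k. refln e (\<Lambda> k) (X k)) \<longlonglongrightarrow> refln e l q" unfolding refln_def by (intro tendsto_intros X \<Lambda>)
  have Rq: "refln e l q \<notin> E"
  proof -
    have cl: "closed (- E)" using E(1) by (simp add: closed_Compl)
    have "refln e l q \<in> - E" by (rule closed_sequentially[OF cl _ RX]) (use XL(3) in auto)
    then show ?thesis by simp
  qed
  have "l \<le> q \<bullet> e" by (rule LIMSEQ_le[OF \<Lambda> tendsto_inner[OF X tendsto_const]]) (use XL(2) less_imp_le in blast)
  then consider "l < q \<bullet> e" | "q \<bullet> e = l" by linarith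
  then show ?thesis
  proof cases
    case 1
    have "\<forall>\<^sub>F k in sequentially. l < X k \<bullet> e" by (rule order_tendstoD(1)[OF tendsto_inner[OF X tendsto_const] 1])
    then have "\<forall>\<^sub>F k in sequentially. refln e l (X k) \<in> closure E"
      by (rule eventually_mono) (use good XL(1) closure_subset in \<open>auto simp: flips_def subset_eq\<close>)
    moreover have "(\<lambda>k. refln e l (X k)) \<longlonglongrightarrow> refln e l q" unfolding refln_def by (intro tendsto_intros X)
    ultimately have Rc: "refln e l q \<in> closure E" by (intro Lim_in_closed_set[OF closed_closure]) auto
    have "q \<notin> E" using good Rq 1 by (auto simp: flips_def)
    then have "q \<in> frontier E" "refln e l q \<in> frontier E" using q(1) Rc Rq by (auto simp: frontier_def int)
    moreover have "refln e l q \<bullet> e < l" using 1 e by (simp add: refl_inner_self)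
    ultimately show ?thesis using e by (intro that[OF all]) (auto intro!: bexI[of _ "refln e l q"])
  next
    case 2
    then have "refln e l q = q" by (simp add: refln_def)
    then have qf: "q \<in> frontier E" using q(1) Rq by (simp add: frontier_def int)
    have "\<exists>x\<in>E. \<exists>\<tau>>0. x - \<tau> *\<^sub>R e \<notin> E \<and> norm (x - q) < \<eta> \<and> norm (x - \<tau> *\<^sub>R e - q) < \<eta>" if \<eta>: "0 < \<eta>" for \<eta>
    proof -
      have "\<forall>\<^sub>F k in sequentially. norm (X k - q) < \<eta>" using tendstoD[OF X \<eta>] by (simp add: dist_norm)
      moreover have "\<forall>\<^sub>F k in sequentially. norm (refln e (\<Lambda> k) (X k) - q) < \<eta>"
        using tendstoD[OF RX \<eta>] \<open>refln e l q = q\<close> by (simp add: dist_norm)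
      ultimately have "\<forall>\<^sub>F k in sequentially. norm (X k - q) < \<eta> \<and> norm (refln e (\<Lambda> k) (X k) - q) < \<eta>" by (rule eventually_conj)
      from eventually_happens'[OF sequentially_bot this]
      obtain k where k: "norm (X k - q) < \<eta>" "norm (refln e (\<Lambda> k) (X k) - q) < \<eta>" by blast
      show ?thesis using k XL[of k] unfolding refln_def
        by (intro bexI[of _ "X k"] exI[of _ "2 * (X k \<bullet> e - \<Lambda> k)"]) auto
    qed
    then show ?thesis using qf 2 by (intro that[OF all]) blast+
  qed
qed

text \<open>Every plane of symmetry passes through the barycentre. If x is in \<open>E\<close> and y
  is closer to the barycentre, the plane bisecting x and y lies on the far side of the plane of
  symmetry parallel to it; \<open>flips\<close> at that level sends x to y. So membership depends on
  the distance from the barycentre only.\<close>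

lemma ball_of_symmetries:
  fixes E :: "'a::euclidean_space set"
  assumes E: "open E" "bounded E" "E \<noteq> {}"
    and sym: "\<And>e. norm e = 1 \<Longrightarrow> \<exists>l. (\<forall>\<mu>\<ge>l. flips E e \<mu>) \<and> (\<forall>x. refln e l x \<in> E \<longleftrightarrow> x \<in> E)"
  shows "is_ball E"
proof -
  have Em [measurable]: "E \<in> sets borel" using E(1) by simp
  have fin: "emeasure lborel E < \<infinity>" using emeasure_bounded_finite[OF E(2)] by (simp add: top.not_eq_extremum)
  obtain b where b: "0 < b" "\<And>x. x \<in> E \<Longrightarrow> norm x \<le> b" using E(2) bounded_pos by blast
  have i1: "integrable lborel (indicator E :: 'a \<Rightarrow> real)" using fin by (simp add: integrable_indicator_iff)
  have i2: "integrable lborel (\<lambda>x. indicator E x *\<^sub>R x)"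
  proof (rule Bochner_Integration.integrable_bound)
    show "integrable lborel (\<lambda>x. b * indicator E x :: real)" using i1 by simp
    show "AE x in lborel. norm (indicator E x *\<^sub>R x) \<le> norm (b * indicator E x :: real)" using b by (auto simp: indicator_def)
  qed measurable
  have mpos: "0 < measure lborel E"
  proof -
    have "\<not> emeasure lborel E = 0" using E open_not_negligible[of E] by (auto simp: negligible_iff_null_sets null_sets_def emeasure_completion)
    then show ?thesis using fin by (simp add: measure_def enn2real_positive_iff top.not_eq_extremum zero_less_iff_neq_zero)
  qed
  define o' where "o' = inverse (measure lborel E) *\<^sub>R (LINT x|lborel. indicator E x *\<^sub>R x)"
  have center: "o' \<bullet> e = l" if e: "norm e = 1" and s: "\<And>x. refln e l x \<in> E \<longleftrightarrow> x \<in> E" for e l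
  proof -
    let ?\<phi> = "\<lambda>x. indicator E x * (x \<bullet> e - l)"
    have "(LINT x|lborel. ?\<phi> (refln e l x)) = (LINT x|lborel. ?\<phi> x)" by (rule integral_refl[OF e]) measurable
    moreover have "?\<phi> (refln e l x) = - ?\<phi> x" for x using s[of x] e by (simp add: indicator_def refl_inner_self)
    ultimately have z: "(LINT x|lborel. ?\<phi> x) = 0" by simp
    have i3: "integrable lborel (\<lambda>x. (indicator E x *\<^sub>R x) \<bullet> e)" "integrable lborel (\<lambda>x. l * indicator E x :: real)"
      by (rule integrable_inner_left, rule i2) (rule integrable_mult_right, rule i1)
    have eq: "?\<phi> x = (indicator E x *\<^sub>R x) \<bullet> e - l * indicator E x" for x by (simp add: algebra_simps)
    have "(LINT x|lborel. ?\<phi> x) = (LINT x|lborel. (indicator E x *\<^sub>R x) \<bullet> e) - (LINT x|lborel. l * indicator E x)"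
      unfolding eq by (rule Bochner_Integration.integral_diff[OF i3])
    also have "(LINT x|lborel. (indicator E x *\<^sub>R x) \<bullet> e) = (LINT x|lborel. indicator E x *\<^sub>R x) \<bullet> e" by (rule integral_inner_left) (rule i2)
    finally have "(LINT x|lborel. indicator E x *\<^sub>R x) \<bullet> e = l * measure lborel E" unfolding z by simp
    then show ?thesis using mpos by (simp add: o'_def)
  qed
  have closer: "y \<in> E" if x: "x \<in> E" and y: "norm (y - o') < norm (x - o')" for x y
  proof -
    have xy: "x \<noteq> y" using y by auto
    define e where "e = inverse (norm (x - y)) *\<^sub>R (x - y)"
    have e: "norm e = 1" using xy by (simp add: e_def)
    obtain l where l: "\<forall>\<mu>\<ge>l. flips E e \<mu>" "\<forall>x. refln e l x \<in> E \<longleftrightarrow> x \<in> E" using sym[OF e] by blast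
    have ol: "o' \<bullet> e = l" using center[OF e] l(2) by blast
    \<comment> \<open>Level of the bisecting hyperplane, whose reflection exchanges x and y.\<close>
    define \<mu> where "\<mu> = (x + y) \<bullet> e / 2"
    have "(norm (y - o'))\<^sup>2 < (norm (x - o'))\<^sup>2" using y by (intro power_strict_mono) auto
    moreover have "(x + y) \<bullet> (x - y) - 2 * (o' \<bullet> (x - y)) = (norm (x - o'))\<^sup>2 - (norm (y - o'))\<^sup>2"
      unfolding power2_norm_eq_inner by (simp add: inner_add_left inner_diff_left inner_diff_right inner_commute algebra_simps)
    ultimately have "2 * (o' \<bullet> (x - y)) < (x + y) \<bullet> (x - y)" by linarith
    then have "inverse (norm (x - y)) * (2 * (o' \<bullet> (x - y))) < inverse (norm (x - y)) * ((x + y) \<bullet> (x - y))"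
      using xy by (intro mult_strict_left_mono) auto
    then have "o' \<bullet> e < \<mu>" by (simp add: e_def \<mu>_def)
    then have fl: "flips E e \<mu>" using l(1) ol by simp
    have xe: "(x - y) \<bullet> e = norm (x - y)"
    proof -
      have "(x - y) \<bullet> e = inverse (norm (x - y)) * (norm (x - y))\<^sup>2" unfolding e_def power2_norm_eq_inner by (rule inner_scaleR_right)
      then show ?thesis using xy by (simp add: power2_eq_square)
    qed
    have m2: "2 * \<mu> = x \<bullet> e + y \<bullet> e" by (simp only: \<mu>_def inner_add_left) simp
    have "2 * (x \<bullet> e - \<mu>) = 2 * (x \<bullet> e) - 2 * \<mu>" by (rule right_diff_distrib)
    also have "\<dots> = x \<bullet> e - y \<bullet> e" unfolding m2 by (simp only: mult_2 add_diff_cancel_left)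
    also have "\<dots> = norm (x - y)" unfolding xe[symmetric] by (simp only: inner_diff_left)
    finally have 2: "2 * (x \<bullet> e - \<mu>) = norm (x - y)" .
    have "refln e \<mu> x = y" unfolding refln_def 2 using xy by (simp add: e_def)
    moreover have "\<mu> < x \<bullet> e"
    proof -
      have "0 < 2 * (x \<bullet> e - \<mu>)" unfolding 2 using xy by simp
      then have "0 < x \<bullet> e - \<mu>" by (rule zero_less_mult_pos) simp
      then show ?thesis by (simp only: diff_gt_0_iff_gt)
    qed
    ultimately show ?thesis using fl x unfolding flips_def by metis
  qed
  define r where "r = Sup ((\<lambda>x. norm (x - o')) ` E)"
  have bd: "bdd_above ((\<lambda>x. norm (x - o')) ` E)"
  proof (rule bdd_aboveI2)
    show "norm (x - o') \<le> b + norm o'" if "x \<in> E" for x using norm_triangle_ineq4[of x o'] b(2)[OF that] by linarith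
  qed
  \<comment> \<open>As \<open>E\<close> is open, the supremum of the distances is not attained,
    which makes the ball open.\<close>
  have strict: "norm (x - o') < r" if x: "x \<in> E" for x
  proof -
    obtain \<eta> where \<eta>: "0 < \<eta>" "ball x \<eta> \<subseteq> E" using E(1) x openE by blast
    define u where "u = (if x = o' then (SOME i. i \<in> Basis) else inverse (norm (x - o')) *\<^sub>R (x - o'))"
    have u: "norm u = 1" by (auto simp: u_def intro: norm_Basis[OF SOME_Basis])
    have "x + (\<eta> / 2) *\<^sub>R u \<in> E" using \<eta> u by (auto simp: dist_norm subset_eq)
    moreover have "norm (x + (\<eta> / 2) *\<^sub>R u - o') = norm (x - o') + \<eta> / 2"
    proof (cases "x = o'")
      case False
      then have "x + (\<eta> / 2) *\<^sub>R u - o' = (1 + \<eta> / 2 * inverse (norm (x - o'))) *\<^sub>R (x - o')" by (simp add: u_def algebra_simps)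
      moreover have "0 \<le> 1 + \<eta> / 2 * inverse (norm (x - o'))" using \<eta> by simp
      ultimately have "norm (x + (\<eta> / 2) *\<^sub>R u - o') = (1 + \<eta> / 2 * inverse (norm (x - o'))) * norm (x - o')" by (simp only: norm_scaleR abs_of_nonneg)
      then show ?thesis using False by (simp add: distrib_right)
    qed (use u \<eta> in simp)
    ultimately show ?thesis using cSup_upper[OF imageI bd, of "x + (\<eta> / 2) *\<^sub>R u"] \<eta>(1) by (simp add: r_def)
  qed
  obtain x0 where x0: "x0 \<in> E" using E(3) by blast
  have "E = ball o' r"
  proof (intro set_eqI iffI)
    fix y assume "y \<in> ball o' r"
    then have "norm (y - o') < r" by (simp add: dist_norm norm_minus_commute)
    then obtain x where "x \<in> E" "norm (y - o') < norm (x - o')"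
      unfolding r_def using less_cSup_iff[of "(\<lambda>x. norm (x - o')) ` E" "norm (y - o')"] E(3) bd by auto
    then show "y \<in> E" using closer by blast
  qed (use strict in \<open>auto simp: dist_norm norm_minus_commute\<close>)
  moreover have "0 < r" using strict[OF x0] norm_ge_zero[of "x0 - o'"] by linarith
  ultimately show ?thesis unfolding is_ball_def by blast
qed

section \<open>Contact points\<close>

lemma mem_ball_normI: "norm (z - q) < r \<Longrightarrow> z \<in> ball q r" for q :: "'a::real_normed_vector"
  by (simp add: dist_norm norm_minus_commute)

lemma (in patch) patch_const_nonneg: "0 \<le> patch_const n s"
proof -
  have "0 \<le> unit_ball_vol n" using n1 by simp
  then show ?thesis unfolding patch_const_def using lip_const_nonneg lf(1) n1 s by simp
qed

text \<open>\<open>A\<close> is a piece of positive measure of the asymmetric part of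
  \<open>E\<close>, at distance at least \<kappa> from the plane. As D/2 bounds the diameter, D
  still bounds the distances from \<open>E\<close> of points within D/2 of the contact point or of
  its mirror image.\<close>

locale contact =
  fixes s \<alpha> \<epsilon> D \<kappa> l :: real and E A :: "'a::euclidean_space set" and e :: 'a
  assumes s: "0 < s" "s < 1" and al: "0 < \<alpha>" "\<alpha> < DIM('a)" and eps: "0 < \<epsilon>" and D: "0 < D"
    and mono: "\<epsilon> * \<alpha> * D powr (DIM('a) + s - \<alpha>) < DIM('a) + s"
    and E: "open E" "bounded E" "smooth_boundary E"
    and crit: "\<And>X \<Phi>. test_field X \<Longrightarrow> flow_of X \<Phi> \<Longrightarrow>
      (\<forall>\<^sub>F t in nhds 0. \<Phi> t ` E \<in> sets borel \<and> emeasure lborel (\<Phi> t ` E) = emeasure lborel E) \<Longrightarrow>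
      ((\<lambda>t. enn2real (energy s \<alpha> \<epsilon> (\<Phi> t ` E))) has_real_derivative 0) (at 0)"
    and e: "norm e = 1" and fl: "flips E e l"
    and dm: "\<And>y z. y \<in> closure E \<Longrightarrow> z \<in> closure E \<Longrightarrow> norm (y - z) \<le> D / 2"
    and A: "A \<in> sets borel" "\<And>y. y \<in> A \<Longrightarrow> y \<in> E \<and> refln e l y \<notin> E \<and> \<kappa> \<le> l - y \<bullet> e"
    and ka: "0 < \<kappa>" and Apos: "0 < measure lborel A"
begin

text \<open>The factor of the distance to the plane in \<open>potential_gain\<close>. It does not
  involve the scale \<rho>, so any bound by a positive power of \<rho> is contradictory.\<close>

definition "gain = (DIM('a) + s - \<epsilon> * \<alpha> * D powr (DIM('a) + s - \<alpha>)) * D powr (- (DIM('a) + s + 1)) * (2 * \<kappa> / D) * measure lborel A"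

lemma gain_pos: "0 < gain"
  using mono D ka Apos by (simp add: gain_def)

text \<open>Common form of the two kinds of contact: it remains to exhibit graphs with L \<le> C d
  \<rho>, where d is the distance of the cylinder from the plane. Then d cancels from the inequality
  and \<rho>^(1-s) is left.\<close>

lemma patch_step:
  assumes p: "p \<in> closure E" "refln e l p \<in> closure E" and far: "\<And>y. y \<in> A \<Longrightarrow> \<kappa> \<le> norm (y - p)"
    and \<rho>: "0 < \<rho>" "24 * \<rho> \<le> D" "13 * \<rho> \<le> \<kappa>" and c: "norm (c - p) \<le> 6 * \<rho>" and nu: "norm \<nu> = 1"
    and Lb: "0 < L" "80 * L \<le> 1" "L \<le> C * d\<^sub>0 * \<rho>" and d0p: "0 < d\<^sub>0" and fin: "short_energy s \<alpha> \<epsilon> (\<rho> / 2) E < \<infinity>"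
    and g_meas: "g \<in> borel_measurable borel" "gs \<in> borel_measurable borel"
    and g_inv: "\<And>x t. g (x + t *\<^sub>R \<nu>) = g x" "\<And>x t. gs (x + t *\<^sub>R \<nu>) = gs x"
    and graph: "\<And>x. norm (perp \<nu> (x - c)) < 3 * \<rho> \<Longrightarrow> \<bar>(x - c) \<bullet> \<nu>\<bar> < 3 * \<rho> \<Longrightarrow> x \<in> E \<longleftrightarrow> (x - c) \<bullet> \<nu> < g x"
      "\<And>x. norm (perp \<nu> (x - c)) < 3 * \<rho> \<Longrightarrow> \<bar>(x - c) \<bullet> \<nu>\<bar> < 3 * \<rho> \<Longrightarrow> refln e l x \<in> E \<longleftrightarrow> (x - c) \<bullet> \<nu> < gs x"
    and small: "\<And>x. norm (perp \<nu> (x - c)) < 3 * \<rho> \<Longrightarrow> \<bar>g x\<bar> \<le> \<rho> / 2" "\<And>x. norm (perp \<nu> (x - c)) < 3 * \<rho> \<Longrightarrow> \<bar>gs x\<bar> \<le> \<rho> / 2"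
    and lipG: "\<And>x y. norm (perp \<nu> (x - c)) < 3 * \<rho> \<Longrightarrow> norm (perp \<nu> (y - c)) < 3 * \<rho> \<Longrightarrow>
       \<bar>(g y - gs y) - (g x - gs x)\<bar> \<le> L * norm (perp \<nu> (y - x))"
    and near: "\<And>x. norm (perp \<nu> (x - c)) < 3 * \<rho> \<Longrightarrow> \<bar>g x - gs x\<bar> \<le> 10 * \<rho> * L"
    and d0: "\<And>x. norm (perp \<nu> (x - c)) < 3 * \<rho> \<Longrightarrow> \<bar>(x - c) \<bullet> \<nu>\<bar> < 3 * \<rho> \<Longrightarrow> d\<^sub>0 \<le> l - x \<bullet> e"
  shows "gain \<le> patch_const DIM('a) s * C * \<rho> powr (1 - s)"
proof -
  have half: "x \<bullet> e < l" if "norm (perp \<nu> (x - c)) < 3 * \<rho>" "\<bar>(x - c) \<bullet> \<nu>\<bar> < 3 * \<rho>" for x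
    using d0[OF that] d0p by linarith
  have n1: "1 \<le> real DIM('a)" by (metis DIM_positive One_nat_def Suc_leI of_nat_1 of_nat_le_iff)
  have d2: "0 < \<rho> / 2" "\<rho> / 2 < D" using \<rho> D by linarith+
  interpret patch "real DIM('a)" s \<alpha> \<epsilon> D "\<rho> / 2" E e \<nu> c l \<rho> L g gs
    by (intro patch.intro kernel.intro patch_axioms.intro)
      (fact s al eps n1 d2 mono e nu \<rho> E Lb half graph small lipG g_meas g_inv refl)+
  have ev: "\<forall>\<^sub>F t in nhds 0. \<Phi> t ` E \<in> sets borel \<and> emeasure lborel (\<Phi> t ` E) = emeasure lborel E"
  proof -
    have "\<Phi> t ` E \<in> sets borel \<and> emeasure lborel (\<Phi> t ` E) = emeasure lborel E" if "dist t 0 < \<rho> / 2" for t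
    proof -
      have t: "\<bar>t\<bar> \<le> \<rho> / 2" using that by simp
      show ?thesis unfolding flow_image[OF t] using Et_volume[OF t] by simp
    qed
    then show ?thesis unfolding eventually_nhds_metric using \<rho>(1) by (intro exI[of _ "\<rho> / 2"]) auto
  qed
  have ineq: "slope * D powr (- (DIM('a) + s + 1)) * (2 * \<kappa> / D) * measure lborel A * d\<^sub>0 \<le> patch_const DIM('a) s * L * \<rho> powr (- s)"
  proof (rule patch_inequality[OF Lb(2) fin crit[OF field_test flow ev] _ _ _ A(1)])
    show "\<bar>g x - gs x\<bar> \<le> 10 * \<rho> * L" if "x \<in> T" for x using near[of x] that by (simp add: T_def)
    show "y \<bullet> e \<le> l" if "y \<in> E" "refln e l y \<notin> E" for y using fl that by (auto simp: flips_def not_less[symmetric])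
    show "norm (x - y) \<le> D \<and> norm (refln e l x - y) \<le> D" if x: "norm (x - c) \<le> 6 * \<rho>" and y: "y \<in> E" for x y
    proof -
      have xp: "norm (x - p) \<le> 12 * \<rho>" using norm_triangle_ineq[of "x - c" "c - p"] x c by simp
      have yc: "y \<in> closure E" using y closure_subset by blast
      have "norm (x - y) \<le> norm (x - p) + norm (p - y)" using norm_triangle_ineq[of "x - p" "p - y"] by simp
      then have 1: "norm (x - y) \<le> D" using xp dm[OF p(1) yc] \<rho>(2) by linarith
      have "norm (refln e l x - refln e l p) \<le> 12 * \<rho>" using dist_refl[OF e, of l x p] xp by (simp add: dist_norm)
      moreover have "norm (refln e l x - y) \<le> norm (refln e l x - refln e l p) + norm (refln e l p - y)"
        using norm_triangle_ineq[of "refln e l x - refln e l p" "refln e l p - y"] by simp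
      ultimately have 2: "norm (refln e l x - y) \<le> D" using dm[OF p(2) yc] \<rho>(2) by linarith
      show ?thesis using 1 2 by blast
    qed
    show "y \<in> E \<and> refln e l y \<notin> E \<and> \<kappa> \<le> l - y \<bullet> e \<and> 7 * \<rho> \<le> norm (y - c)" if y: "y \<in> A" for y
    proof -
      have "norm (y - p) \<le> norm (y - c) + norm (c - p)" using norm_triangle_ineq[of "y - c" "c - p"] by simp
      \<comment> \<open>13 \<rho> minus the 6 \<rho> between c and p. Points of the cylinder are
        within 6 \<rho> of c, so at least \<rho> separates them from \<open>A\<close>, more than the
        splitting radius \<rho>/2.\<close>
      then have "7 * \<rho> \<le> norm (y - c)" using far[OF y] c \<rho>(3) by linarith
      then show ?thesis using A(2)[OF y] by blast
    qed
    show "0 \<le> \<kappa>" using ka by simp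
    show "d\<^sub>0 \<le> l - x \<bullet> e" if "x \<in> W" for x using d0[of x] that by (simp add: W_def T_def)
  qed
  have "gain * d\<^sub>0 \<le> patch_const DIM('a) s * L * \<rho> powr (- s)"
    using ineq unfolding slope_def gain_def .
  also have "\<dots> \<le> patch_const DIM('a) s * (C * d\<^sub>0 * \<rho>) * \<rho> powr (- s)"
    using Lb(3) patch_const_nonneg by (intro mult_right_mono mult_left_mono) auto
  also have "\<dots> = patch_const DIM('a) s * C * (\<rho> powr 1 * \<rho> powr (- s)) * d\<^sub>0" using \<rho>(1) by simp
  also have "\<rho> powr 1 * \<rho> powr (- s) = \<rho> powr (1 - s)" by (simp only: diff_conv_add_uminus powr_add)
  finally show ?thesis using d0p by (simp only: mult_le_cancel_right_pos)
qed

lemma no_small_scale: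
  assumes "0 < \<rho>0" "\<And>\<rho>. 0 < \<rho> \<Longrightarrow> \<rho> \<le> \<rho>0 \<Longrightarrow> gain \<le> K * \<rho> powr (1 - s)"
  shows False
proof -
  define d where "d = 2 * (\<bar>K\<bar> + 1)"
  have d: "0 < d" "\<bar>K\<bar> < d" by (auto simp: d_def add_nonneg_pos)
  define a where "a = gain / d"
  have a: "0 < a" using gain_pos d by (simp add: a_def)
  define \<rho> where "\<rho> = min \<rho>0 (a powr (1 / (1 - s)))"
  have \<rho>: "0 < \<rho>" "\<rho> \<le> \<rho>0" using assms(1) a by (auto simp: \<rho>_def)
  have "\<rho> powr (1 - s) \<le> (a powr (1 / (1 - s))) powr (1 - s)" using s \<rho>(1) by (intro powr_mono2) (auto simp: \<rho>_def)
  also have "\<dots> = a" using s a by (simp add: powr_powr)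
  finally have "K * \<rho> powr (1 - s) \<le> \<bar>K\<bar> * a" by (intro order_trans[OF mult_right_mono[OF abs_ge_self] mult_left_mono]) auto
  also have "\<dots> < d * a" using a d(2) by (intro mult_strict_right_mono)
  also have "\<dots> = gain" using d(1) by (simp add: a_def)
  finally show False using assms(2)[OF \<rho>] by simp
qed

lemma short_energy_small:
  obtains \<eta> where "0 < \<eta>" "\<And>\<delta>. 0 < \<delta> \<Longrightarrow> \<delta> \<le> \<eta> \<Longrightarrow> \<delta> < D \<Longrightarrow> short_energy s \<alpha> \<epsilon> \<delta> E < \<infinity>"
proof (rule jump_linear[OF E])
  fix \<eta> C assume j: "0 < \<eta>" "0 \<le> C" "\<And>h. norm h < \<eta> \<Longrightarrow> emeasure lborel {x. x \<in> E \<and> x + h \<notin> E} \<le> ennreal (C * norm h)"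
  have n1: "1 \<le> real DIM('a)" by (metis DIM_positive One_nat_def Suc_leI of_nat_1 of_nat_le_iff)
  show thesis
  proof (rule that[OF j(1)])
    fix \<delta> assume d: "0 < \<delta>" "\<delta> \<le> \<eta>" "\<delta> < D"
    interpret kernel "real DIM('a)" s \<alpha> \<epsilon> D \<delta> by (intro kernel.intro) (fact s al eps n1 d mono)+
    show "short_energy s \<alpha> \<epsilon> \<delta> E < \<infinity>" by (rule short_energy_finite[OF refl E(1) d(2) j(2,3)])
  qed
qed

text \<open>At p the set \<open>E\<close> and its mirror image are both subgraphs. The latter lies
  inside the former on this side of the plane, so they touch at p and share the normal. Over this
  common axis each graph has Lipschitz constant O(\<rho>), while the distance to the plane stays
  fixed.\<close>

lemma contact_interior:
  assumes p: "p \<in> frontier E" "p \<bullet> e < l" "refln e l p \<in> frontier E" and far: "\<And>y. y \<in> A \<Longrightarrow> \<kappa> \<le> norm (y - p)"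
  shows False
proof -
  let ?S = "refln e 0"
  obtain \<nu> \<delta>1 g C1 where "graph_at E p \<nu> \<delta>1 g C1" by (rule boundary_graph[OF E(3) p(1)])
  note g = graph_atD[OF this]
  obtain \<nu>' \<delta>2 g2 C2 where "graph_at E (refln e l p) \<nu>' \<delta>2 g2 C2" by (rule boundary_graph[OF E(3) p(3)])
  note h = graph_atD[OF this]
  define \<nu>2 where "\<nu>2 = ?S \<nu>'"
  define gs where "gs x = g2 (refln e l x)" for x
  have n2: "norm \<nu>2 = 1" using h(1) e by (simp add: \<nu>2_def norm_refl_0)
  have Sn: "?S \<nu>2 = \<nu>'" using e by (simp add: \<nu>2_def)
  have Sin: "?S v \<bullet> \<nu>' = v \<bullet> \<nu>2" for v using inner_refl_0[OF e, of v \<nu>2] by (simp add: Sn)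
  have Rd: "refln e l x - refln e l y = ?S (x - y)" for x y by (rule refl_diff)
  have Sperp: "perp \<nu>' (?S v) = ?S (perp \<nu>2 v)" for v
  proof -
    have "?S (perp \<nu>2 v) = ?S v - (v \<bullet> \<nu>2) *\<^sub>R ?S \<nu>2" by (simp add: perp_def refl_0)
    then show ?thesis by (simp add: perp_def Sin Sn)
  qed
  have np: "norm (perp \<nu>' (refln e l x - refln e l y)) = norm (perp \<nu>2 (x - y))" for x y
    using e by (simp add: Rd Sperp norm_refl_0)
  have hin: "(refln e l x - refln e l p) \<bullet> \<nu>' = (x - p) \<bullet> \<nu>2" for x by (simp add: Rd Sin)
  have gs_bd: "\<bar>gs x\<bar> \<le> C2 * (norm (perp \<nu>2 (x - p)))\<^sup>2" if "norm (perp \<nu>2 (x - p)) < \<delta>2" for x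
    using h(7)[of "refln e l x"] that by (simp add: gs_def np)
  have gs_side: "refln e l x \<in> E \<longleftrightarrow> (x - p) \<bullet> \<nu>2 < gs x" if "norm (perp \<nu>2 (x - p)) < \<delta>2" "\<bar>(x - p) \<bullet> \<nu>2\<bar> < \<delta>2" for x
    using h(8)[of "refln e l x"] that by (simp add: gs_def np hin)
  have gs_lip: "\<bar>gs y - gs x\<bar> \<le> 2 * C2 * m * norm (perp \<nu>2 (y - x))"
    if "norm (perp \<nu>2 (x - p)) \<le> m" "norm (perp \<nu>2 (y - p)) \<le> m" "m < \<delta>2" for x y m
    using h(9)[of "refln e l x" m "refln e l y"] that by (simp add: gs_def np)
  have gs_inv: "gs (x + t *\<^sub>R \<nu>2) = gs x" for x t
  proof -
    have "refln e l (x + t *\<^sub>R \<nu>2) = refln e l x + t *\<^sub>R \<nu>'" using refl_add[of e l x "t *\<^sub>R \<nu>2"] by (simp add: refl_0 Sn)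
    then show ?thesis by (simp add: gs_def h(6))
  qed
  have gs_meas: "gs \<in> borel_measurable borel" unfolding gs_def[abs_def] using h(5) by measurable
  define c where "c = C1 + C2 + 1"
  have c: "1 \<le> c" "C1 \<le> c" "C2 \<le> c" using g(3) h(3) by (auto simp: c_def)
  \<comment> \<open>If the normals differed, a small step from p along \<nu> - \<nu>2 would leave
    \<open>E\<close> but enter its mirror image, against \<open>flips\<close>.\<close>
  have same: "\<nu>2 = \<nu>"
  proof (rule ccontr)
    assume ne: "\<nu>2 \<noteq> \<nu>"
    define v where "v = \<nu> - \<nu>2"
    define a where "a = 1 - \<nu> \<bullet> \<nu>2"
    have nn: "\<nu> \<bullet> \<nu> = 1" "\<nu>2 \<bullet> \<nu>2 = 1" using g(1) n2 by (simp_all add: dot_square_norm)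
    have vv: "(norm v)\<^sup>2 = 2 * a" unfolding power2_norm_eq_inner v_def a_def by (simp add: inner_diff_left inner_diff_right nn inner_commute)
    have "0 < (norm v)\<^sup>2" using ne by (simp add: v_def)
    then have a: "0 < a" using vv by simp
    have vn: "v \<bullet> \<nu> = a" "v \<bullet> \<nu>2 = - a" unfolding v_def a_def inner_diff_left nn by (simp_all add: inner_commute[of \<nu>2 \<nu>])
    have v2: "norm v \<le> 2" using norm_triangle_ineq4[of \<nu> \<nu>2] g(1) n2 by (simp add: v_def)
    define m where "m = min (min \<delta>1 \<delta>2) (l - p \<bullet> e)"
    have m: "0 < m" "m \<le> \<delta>1" "m \<le> \<delta>2" "m \<le> l - p \<bullet> e" using g(2) h(2) p(2) by (auto simp: m_def)
    \<comment> \<open>Small enough that the quadratic deviation c (\<tau> |v|)^2 = 2 c \<tau>^2 a of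
      the graphs is at most half of the linear displacement \<tau> a.\<close>
    define \<tau> where "\<tau> = min (m / 4) (1 / (4 * c))"
    have \<tau>: "0 < \<tau>" "\<tau> \<le> m / 4" "\<tau> \<le> 1 / (4 * c)" using m c by (auto simp: \<tau>_def)
    have \<tau>c: "\<tau> * c \<le> 1 / 4" using mult_right_mono[OF \<tau>(3), of c] c by simp
    have "\<tau> * norm v \<le> \<tau> * 2" using \<tau>(1) v2 by (intro mult_left_mono) auto
    then have tv: "\<tau> * norm v < m" using \<tau>(2) m(1) by linarith
    have nv: "norm (\<tau> *\<^sub>R v) = \<tau> * norm v" using \<tau>(1) by simp
    define x where "x = p + \<tau> *\<^sub>R v"
    have xp: "x - p = \<tau> *\<^sub>R v" by (simp add: x_def)
    have b: "norm (perp \<nu> (x - p)) \<le> \<tau> * norm v" "\<bar>(x - p) \<bullet> \<nu>\<bar> \<le> \<tau> * norm v" "norm (perp \<nu>2 (x - p)) \<le> \<tau> * norm v" "\<bar>(x - p) \<bullet> \<nu>2\<bar> \<le> \<tau> * norm v"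
      unfolding nv[symmetric] xp by (intro norm_perp_le inner_le_norm1 g(1) n2)+
    have quad: "K * w\<^sup>2 < \<tau> * a" if "0 \<le> w" "w \<le> \<tau> * norm v" "0 \<le> K" "K \<le> c" for w K :: real
    proof -
      have "K * w\<^sup>2 \<le> c * (\<tau> * norm v)\<^sup>2" using that c by (intro mult_mono power_mono) auto
      also have "\<dots> = (\<tau> * c) * \<tau> * (norm v)\<^sup>2" by (simp add: power2_eq_square)
      also have "\<dots> = (\<tau> * c) * (2 * (\<tau> * a))" unfolding vv by simp
      also have "\<dots> \<le> (1 / 4) * (2 * (\<tau> * a))" using \<tau>c \<tau>(1) a by (intro mult_right_mono) auto
      also have "\<dots> < \<tau> * a" using \<tau>(1) a by simp
      finally show ?thesis .
    qed
    have "\<bar>gs x\<bar> < \<tau> * a" using gs_bd[of x] quad[OF norm_ge_zero b(3) h(3) c(3)] b(3) tv m by linarith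
    moreover have "(x - p) \<bullet> \<nu>2 = - (\<tau> * a)" by (simp add: xp vn)
    ultimately have "refln e l x \<in> E" using gs_side[of x] b tv m by linarith
    moreover have "x \<bullet> e < l"
    proof -
      have "(x - p) \<bullet> e \<le> \<tau> * norm v" using inner_le_norm1[OF e, of "x - p"] unfolding xp nv by simp
      then show ?thesis using tv m by (simp add: inner_diff_left)
    qed
    ultimately have "refln e l (refln e l x) \<in> E" using fl e by (auto simp: flips_def refl_inner_self)
    then have "x \<in> E" using e by simp
    then have "(x - p) \<bullet> \<nu> < g x" using g(8)[of x] b tv m by linarith
    moreover have "\<bar>g x\<bar> < \<tau> * a" using g(7)[of x] quad[OF norm_ge_zero b(1) g(3) c(2)] b(1) tv m by linarith
    moreover have "(x - p) \<bullet> \<nu> = \<tau> * a" by (simp add: xp vn)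
    ultimately show False by linarith
  qed
  note gs = gs_bd[unfolded same] gs_side[unfolded same] gs_lip[unfolded same] gs_inv[unfolded same]
  define d\<^sub>0 where "d\<^sub>0 = (l - p \<bullet> e) / 2"
  have d0: "0 < d\<^sub>0" using p(2) by (simp add: d\<^sub>0_def)
  obtain \<eta> where \<eta>: "0 < \<eta>" "\<And>\<delta>. 0 < \<delta> \<Longrightarrow> \<delta> \<le> \<eta> \<Longrightarrow> \<delta> < D \<Longrightarrow> short_energy s \<alpha> \<epsilon> \<delta> E < \<infinity>"
    by (rule short_energy_small) (rule that)
  \<comment> \<open>The last entry is the condition 80 L \<le> 1 for L = 6 c \<rho>; the others keep
    the cylinder in both graph neighbourhoods and away from the plane, and the distances within D
    and \<kappa>.\<close>
  define \<rho>0 where "\<rho>0 = min (\<delta>1 / 4) (min (\<delta>2 / 4) (min (d\<^sub>0 / 6) (min (D / 24) (min (\<kappa> / 13) (min \<eta> (1 / (480 * c)))))))"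
  have \<rho>0: "0 < \<rho>0" unfolding \<rho>0_def min_less_iff_conj
    by (intro conjI divide_pos_pos mult_pos_pos g(2) h(2) d0 D ka \<eta>(1)) (use c(1) in auto)
  show False
  proof (rule no_small_scale[OF \<rho>0])
    fix \<rho> assume \<rho>: "0 < \<rho>" "\<rho> \<le> \<rho>0"
    have r: "\<rho> \<le> \<delta>1 / 4" "\<rho> \<le> \<delta>2 / 4" "\<rho> \<le> d\<^sub>0 / 6" "\<rho> \<le> D / 24" "\<rho> \<le> \<kappa> / 13" "\<rho> \<le> \<eta>" "\<rho> \<le> 1 / (480 * c)"
      using \<rho>(2) unfolding \<rho>0_def min.bounded_iff by blast+
    have \<rho>c: "\<rho> * c \<le> 1 / 480" using mult_right_mono[OF r(7), of c] c by simp
    \<comment> \<open>The two graphs have Lipschitz constants 2 C1 (3 \<rho>) and 2 C2 (3 \<rho>)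
      over the cylinder, with sum at most 6 c \<rho>; the summand 1 in c keeps L positive.\<close>
    define L where "L = 6 * c * \<rho>"
    have quad: "K * w\<^sup>2 \<le> 9 * c * \<rho>\<^sup>2" if "0 \<le> w" "w < 3 * \<rho>" "0 \<le> K" "K \<le> c" for w K :: real
    proof -
      have "K * w\<^sup>2 \<le> c * (3 * \<rho>)\<^sup>2" using that c by (intro mult_mono power_mono) auto
      then show ?thesis by (simp add: power2_eq_square)
    qed
    have q9: "9 * c * \<rho>\<^sup>2 \<le> \<rho> / 2"
    proof -
      have "9 * c * \<rho>\<^sup>2 = 9 * (\<rho> * c) * \<rho>" by (simp add: power2_eq_square)
      also have "\<dots> \<le> 9 * (1 / 480) * \<rho>" using \<rho>c \<rho>(1) by (intro mult_right_mono) auto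
      finally show ?thesis using \<rho>(1) by simp
    qed
    have s1: "\<bar>g x\<bar> \<le> 9 * c * \<rho>\<^sup>2" "\<bar>gs x\<bar> \<le> 9 * c * \<rho>\<^sup>2" if "norm (perp \<nu> (x - p)) < 3 * \<rho>" for x
    proof -
      have "norm (perp \<nu> (x - p)) < \<delta>1" "norm (perp \<nu> (x - p)) < \<delta>2" using that r \<rho>(1) by linarith+
      then show "\<bar>g x\<bar> \<le> 9 * c * \<rho>\<^sup>2" "\<bar>gs x\<bar> \<le> 9 * c * \<rho>\<^sup>2"
        using g(7) gs(1) quad[OF norm_ge_zero that g(3) c(2)] quad[OF norm_ge_zero that h(3) c(3)] by (meson order_trans)+
    qed
    show "gain \<le> (patch_const DIM('a) s * (6 * c / d\<^sub>0)) * \<rho> powr (1 - s)"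
    proof (rule patch_step[where p = p and c = p and \<nu> = \<nu> and L = L and d\<^sub>0 = d\<^sub>0 and g = g and gs = gs])
      show "p \<in> closure E" "refln e l p \<in> closure E" using p by (auto simp: frontier_def)
      show "24 * \<rho> \<le> D" "13 * \<rho> \<le> \<kappa>" using r by auto
      show "norm (p - p) \<le> 6 * \<rho>" using \<rho> by simp
      show "0 < L" "80 * L \<le> 1" using \<rho>(1) c(1) \<rho>c by (auto simp: L_def mult.commute)
      show "L \<le> 6 * c / d\<^sub>0 * d\<^sub>0 * \<rho>" using d0 by (simp add: L_def)
      show "short_energy s \<alpha> \<epsilon> (\<rho> / 2) E < \<infinity>" using \<rho>(1) r D by (intro \<eta>(2)) auto
      show "x \<in> E \<longleftrightarrow> (x - p) \<bullet> \<nu> < g x" if "norm (perp \<nu> (x - p)) < 3 * \<rho>" "\<bar>(x - p) \<bullet> \<nu>\<bar> < 3 * \<rho>" for x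
        by (rule g(8)) (use that r \<rho>(1) in linarith)+
      show "refln e l x \<in> E \<longleftrightarrow> (x - p) \<bullet> \<nu> < gs x" if "norm (perp \<nu> (x - p)) < 3 * \<rho>" "\<bar>(x - p) \<bullet> \<nu>\<bar> < 3 * \<rho>" for x
        by (rule gs(2)) (use that r \<rho>(1) in linarith)+
      show "\<bar>g x\<bar> \<le> \<rho> / 2" "\<bar>gs x\<bar> \<le> \<rho> / 2" if "norm (perp \<nu> (x - p)) < 3 * \<rho>" for x
        using s1[OF that] q9 by linarith+
      show "\<bar>(g y - gs y) - (g x - gs x)\<bar> \<le> L * norm (perp \<nu> (y - x))"
        if "norm (perp \<nu> (x - p)) < 3 * \<rho>" "norm (perp \<nu> (y - p)) < 3 * \<rho>" for x y
      proof -
        let ?w = "norm (perp \<nu> (y - x))"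
        have "\<bar>g y - g x\<bar> \<le> 2 * C1 * (3 * \<rho>) * ?w" by (rule g(9)) (use that r \<rho>(1) in linarith)+
        moreover have "\<bar>gs y - gs x\<bar> \<le> 2 * C2 * (3 * \<rho>) * ?w" by (rule gs(3)) (use that r \<rho>(1) in linarith)+
        moreover have "L * ?w = 2 * C1 * (3 * \<rho>) * ?w + 2 * C2 * (3 * \<rho>) * ?w + 6 * \<rho> * ?w" by (simp add: L_def c_def algebra_simps)
        moreover have "0 \<le> 6 * \<rho> * ?w" using \<rho> by simp
        ultimately show ?thesis by linarith
      qed
      show "\<bar>g x - gs x\<bar> \<le> 10 * \<rho> * L" if "norm (perp \<nu> (x - p)) < 3 * \<rho>" for x
      proof -
        have "\<bar>g x - gs x\<bar> \<le> 18 * (c * \<rho>\<^sup>2)" using s1[OF that] by linarith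
        also have "\<dots> \<le> 60 * (c * \<rho>\<^sup>2)" using c(1) by (intro mult_right_mono) auto
        also have "\<dots> = 10 * \<rho> * L" by (simp add: L_def power2_eq_square)
        finally show ?thesis .
      qed
      show "d\<^sub>0 \<le> l - x \<bullet> e" if "norm (perp \<nu> (x - p)) < 3 * \<rho>" "\<bar>(x - p) \<bullet> \<nu>\<bar> < 3 * \<rho>" for x
      proof -
        have "norm (x - p) < 6 * \<rho>" using norm_le_perp[OF g(1), of "x - p"] that by linarith
        then have "(x - p) \<bullet> e \<le> d\<^sub>0" using inner_le_norm1[OF e, of "x - p"] r(3) by linarith
        then show ?thesis by (simp add: d\<^sub>0_def inner_diff_left field_simps)
      qed
    qed (use far \<rho> g(1,5,6) d0 gs_meas gs(4) in auto)
  qed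
qed

text \<open>Along the boundary inside the plane, the derivative of the defining function in
  direction e is nonnegative by \<open>flips\<close>, and it vanishes at q. So q is a minimum and
  its first variation, the mixed second derivative B e t, vanishes. This feeds
  \<open>graph_odd_lipschitz\<close> and gives L = O(\<rho>^2) against a distance of order
  \<rho>.\<close>

lemma contact_tangent:
  assumes q: "q \<in> frontier E" "q \<bullet> e = l" and far: "\<And>y. y \<in> A \<Longrightarrow> \<kappa> \<le> norm (y - q)"
    and seq: "\<And>\<eta>. 0 < \<eta> \<Longrightarrow> \<exists>x\<in>E. \<exists>\<tau>>0. x - \<tau> *\<^sub>R e \<notin> E \<and> norm (x - q) < \<eta> \<and> norm (x - \<tau> *\<^sub>R e - q) < \<eta>"
  shows False
proof -
  let ?S = "refln e 0" and ?R = "refln e l"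
  obtain \<sigma> \<nu> k M B r where ch: "chart E q \<sigma> \<nu> k M B r" by (rule boundary_chart[OF E(3) q(1)])
  then have c: "norm \<nu> = 1" "0 < k" "0 \<le> M" "0 < r" and diff: "\<And>z. z \<in> ball q r \<Longrightarrow> \<sigma> differentiable (at z)"
    and M1: "\<And>z w. z \<in> ball q r \<Longrightarrow> \<bar>fd \<sigma> z w - fd \<sigma> q w\<bar> \<le> M * norm (z - q) * norm w"
    and lin: "\<And>w. linear (B w)" "\<And>v. linear (\<lambda>w. B w v)" and BM: "\<And>w v. \<bar>B w v\<bar> \<le> M * norm w * norm v"
    and M2: "\<And>z w. z \<in> ball q r \<Longrightarrow> \<bar>fd \<sigma> z w - fd \<sigma> q w - B w (z - q)\<bar> \<le> M * (norm (z - q))\<^sup>2 * norm w"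
    and grad: "\<And>w. fd \<sigma> q w = k * (w \<bullet> \<nu>)" and q0: "\<sigma> q = 0"
    and side: "\<And>z. z \<in> ball q r \<Longrightarrow> z \<in> E \<longleftrightarrow> \<sigma> z < 0"
    unfolding chart_def by auto
  obtain \<delta> g C where ga: "graph_at E q \<nu> \<delta> g C" and dr: "2 * \<delta> < r"
    and zero: "\<And>x. norm (perp \<nu> (x - q)) < \<delta> \<Longrightarrow> \<sigma> (q + perp \<nu> (x - q) + g x *\<^sub>R \<nu>) = 0"
    and mvt: "\<And>x y. norm (perp \<nu> (x - q)) < \<delta> \<Longrightarrow> norm (perp \<nu> (y - q)) < \<delta> \<Longrightarrow>
      \<exists>z\<in>closed_segment (q + perp \<nu> (x - q) + g x *\<^sub>R \<nu>) (q + perp \<nu> (y - q) + g y *\<^sub>R \<nu>).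
        k / 2 \<le> fd \<sigma> z \<nu> \<and> (g y - g x) * fd \<sigma> z \<nu> = - fd \<sigma> z (perp \<nu> (y - x))"
    by (rule chart_graph[OF ch]) (rule that)
  note g = graph_atD[OF ga]
  have qb: "q \<in> ball q r" using c by simp
  have fdlin: "linear (fd \<sigma> z)" if "z \<in> ball q r" for z using linear_frechet_derivative[OF diff[OF that]] .
  \<comment> \<open>With a positive derivative the function would increase along e near q, so x in
    \<open>E\<close> would force x - \<tau> e into \<open>E\<close>, against the approximating
    pairs.\<close>
  have le: "fd \<sigma> q e \<le> 0"
  proof (rule ccontr)
    assume "\<not> fd \<sigma> q e \<le> 0"
    then have b: "0 < fd \<sigma> q e" by simp
    define \<eta> where "\<eta> = min r (fd \<sigma> q e / (M + 1))"
    have \<eta>: "0 < \<eta>" "\<eta> \<le> r" "\<eta> \<le> fd \<sigma> q e / (M + 1)" using b c by (auto simp: \<eta>_def)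
    obtain x \<tau> where x: "x \<in> E" "0 < \<tau>" "x - \<tau> *\<^sub>R e \<notin> E" "norm (x - q) < \<eta>" "norm (x - \<tau> *\<^sub>R e - q) < \<eta>" using seq[OF \<eta>(1)] by blast
    let ?y = "x - \<tau> *\<^sub>R e"
    have inb: "x \<in> ball q \<eta>" "?y \<in> ball q \<eta>" using x by (simp_all add: dist_norm norm_minus_commute)
    have sub: "closed_segment ?y x \<subseteq> ball q \<eta>" by (rule closed_segment_subset[OF inb(2,1) convex_ball])
    have br: "ball q \<eta> \<subseteq> ball q r" using \<eta> by (intro subset_ball)
    obtain z where z: "z \<in> closed_segment ?y x" "\<sigma> x - \<sigma> ?y = fd \<sigma> z (x - ?y)"
      by (rule mvt_segment[of ?y x \<sigma>]) (use diff sub br in blast)+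
    have zb: "z \<in> ball q \<eta>" "z \<in> ball q r" using z sub br by blast+
    have "\<bar>fd \<sigma> z e - fd \<sigma> q e\<bar> \<le> M * norm (z - q)" using M1[OF zb(2), of e] e by simp
    also have "\<dots> \<le> M * \<eta>" using zb(1) c(3) by (intro mult_left_mono) (auto simp: dist_norm norm_minus_commute)
    also have "\<dots> \<le> M * (fd \<sigma> q e / (M + 1))" using \<eta>(3) c(3) by (intro mult_left_mono)
    also have "\<dots> < fd \<sigma> q e" using b c(3) by (simp add: field_simps)
    finally have "0 < fd \<sigma> z e" by linarith
    moreover have "fd \<sigma> z (x - ?y) = \<tau> * fd \<sigma> z e" using linear_cmul[OF fdlin[OF zb(2)], of \<tau> e] by simp
    ultimately have "0 < \<sigma> x - \<sigma> ?y" unfolding z(2) using x(2) by simp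
    moreover have "\<sigma> x < 0" "0 \<le> \<sigma> ?y" using side[of x] side[of ?y] inb br x by (auto simp: not_less[symmetric])
    ultimately show False by linarith
  qed
  \<comment> \<open>With a negative derivative b + h e would lie in \<open>E\<close> and its mirror
    image b - h e outside, against \<open>flips\<close>.\<close>
  have ge: "0 \<le> fd \<sigma> b e" if b: "b \<in> ball q r" "\<sigma> b = 0" "b \<bullet> e = l" for b
  proof (rule ccontr)
    assume neg: "\<not> 0 \<le> fd \<sigma> b e"
    have D1: "(\<sigma> has_derivative fd \<sigma> b) (at (b + 0 *\<^sub>R e))" using diff[OF b(1)] by (simp add: frechet_derivative_works)
    have D2: "((\<lambda>t. b + t *\<^sub>R e) has_derivative (\<lambda>t. t *\<^sub>R e)) (at 0)" by (auto intro!: derivative_eq_intros)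
    have "((\<lambda>t. \<sigma> (b + t *\<^sub>R e)) has_derivative (\<lambda>t. fd \<sigma> b (t *\<^sub>R e))) (at 0)"
      using diff_chain_at[OF D2] D1 by (simp add: o_def)
    then have "((\<lambda>t. \<sigma> (b + t *\<^sub>R e)) has_real_derivative fd \<sigma> b e) (at 0)"
      unfolding has_field_derivative_def by (rule has_derivative_eq_rhs) (simp add: linear_cmul[OF fdlin[OF b(1)]] fun_eq_iff)
    from DERIV_neg_dec_right[OF this] DERIV_neg_dec_left[OF this] neg
    obtain d1 d2 where d: "0 < d1" "\<And>h. 0 < h \<Longrightarrow> h < d1 \<Longrightarrow> \<sigma> (b + (0 + h) *\<^sub>R e) < \<sigma> (b + 0 *\<^sub>R e)"
      "0 < d2" "\<And>h. 0 < h \<Longrightarrow> h < d2 \<Longrightarrow> \<sigma> (b + 0 *\<^sub>R e) < \<sigma> (b + (0 - h) *\<^sub>R e)" by (auto simp: not_le)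
    define m where "m = min d1 (min d2 (r - norm (b - q)))"
    have "norm (b - q) < r" using b(1) by (simp add: dist_norm norm_minus_commute)
    then have m: "0 < m" "m \<le> d1" "m \<le> d2" "m \<le> r - norm (b - q)" using d(1,3) by (simp_all add: m_def)
    define h where "h = m / 2"
    have "0 < h" "h < m" using m(1) by (simp_all add: h_def)
    then have h: "0 < h" "h < d1" "h < d2" "norm (b - q) + h < r" using m by linarith+
    have inb: "b + h *\<^sub>R e \<in> ball q r" "b - h *\<^sub>R e \<in> ball q r"
      using norm_triangle_ineq[of "b - q" "h *\<^sub>R e"] norm_triangle_ineq4[of "b - q" "h *\<^sub>R e"] h e
      by (simp_all add: dist_norm norm_minus_commute algebra_simps)
    have "\<sigma> (b + h *\<^sub>R e) < 0" using d(2)[OF h(1,2)] b(2) by simp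
    then have "b + h *\<^sub>R e \<in> E" using side[OF inb(1)] by blast
    moreover have be: "(b + h *\<^sub>R e) \<bullet> e = l + h" using b(3) e by (simp add: inner_add_left dot_square_norm)
    ultimately have "?R (b + h *\<^sub>R e) \<in> E" using fl h(1) by (auto simp: flips_def)
    moreover have "?R (b + h *\<^sub>R e) = b - h *\<^sub>R e" unfolding refln_def be by (simp add: algebra_simps scaleR_2[symmetric])
    ultimately have "\<sigma> (b - h *\<^sub>R e) < 0" using side[OF inb(2)] by simp
    then show False using d(4)[OF h(1,3)] b(2) by simp
  qed
  have fe: "fd \<sigma> q e = 0" using le ge[OF qb q0 q(2)] by simp
  then have en: "e \<bullet> \<nu> = 0" using grad[of e] c(2) by simp
  then have ne0: "\<nu> \<bullet> e = 0" using inner_commute[of \<nu> e] by simp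
  \<comment> \<open>Evaluate \<open>ge\<close> at the boundary point over q + u t: the result is u B
    e t + O(u^2) and must be nonnegative for both signs of u.\<close>
  have Bet: "B e t = 0" if t: "t \<bullet> e = 0" "t \<bullet> \<nu> = 0" for t
  proof (rule ccontr)
    assume ne: "B e t \<noteq> 0"
    define K where "K = (C * M + 4 * M) * (norm t)\<^sup>2"
    have K0: "0 \<le> K" using c(3) g(3) by (simp add: K_def)
    have key: "0 \<le> u * B e t + K * u\<^sup>2" if u: "\<bar>u\<bar> * norm t < \<delta>" for u
    proof -
      let ?x = "q + u *\<^sub>R t"
      have px: "perp \<nu> (?x - q) = u *\<^sub>R t" using t(2) by (simp add: perp_def)
      have nx: "norm (u *\<^sub>R t) = \<bar>u\<bar> * norm t" by simp
      let ?b = "q + u *\<^sub>R t + g ?x *\<^sub>R \<nu>"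
      have gx: "\<bar>g ?x\<bar> \<le> C * (\<bar>u\<bar> * norm t)\<^sup>2" using g(7)[of ?x] u unfolding px nx by blast
      have "C * (\<bar>u\<bar> * norm t)\<^sup>2 = (C * (\<bar>u\<bar> * norm t)) * (\<bar>u\<bar> * norm t)" by (simp add: power2_eq_square)
      also have "\<dots> \<le> (C * \<delta>) * (\<bar>u\<bar> * norm t)" using u g(3) by (intro mult_right_mono mult_left_mono) auto
      also have "\<dots> \<le> (1 / 2) * (\<bar>u\<bar> * norm t)" using g(4) by (intro mult_right_mono) auto
      finally have g2: "\<bar>g ?x\<bar> \<le> (1 / 2) * (\<bar>u\<bar> * norm t)" using gx by linarith
      have bq: "?b - q = u *\<^sub>R t + g ?x *\<^sub>R \<nu>" by simp
      have "norm (?b - q) \<le> \<bar>u\<bar> * norm t + \<bar>g ?x\<bar>" unfolding bq using norm_triangle_ineq[of "u *\<^sub>R t" "g ?x *\<^sub>R \<nu>"] c(1) by simp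
      then have nb: "norm (?b - q) \<le> 2 * (\<bar>u\<bar> * norm t)" using g2 by linarith
      have "norm (?b - q) < r" using nb u dr by linarith
      then have bb: "?b \<in> ball q r" by (rule mem_ball_normI)
      have "\<sigma> ?b = 0" using zero[of ?x] u unfolding px nx by blast
      moreover have "?b \<bullet> e = l" unfolding inner_add_left inner_scaleR_left q(2) t(1) ne0 by simp
      ultimately have "0 \<le> fd \<sigma> ?b e" by (rule ge[OF bb])
      moreover have "fd \<sigma> ?b e \<le> B e (?b - q) + M * (norm (?b - q))\<^sup>2" using M2[OF bb, of e] fe e by (simp add: abs_le_iff)
      moreover have "B e (?b - q) = u * B e t + g ?x * B e \<nu>" unfolding bq using lin(1)[of e] by (simp add: linear_add linear_cmul)
      moreover have "g ?x * B e \<nu> \<le> C * M * (norm t)\<^sup>2 * u\<^sup>2"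
      proof -
        have "g ?x * B e \<nu> \<le> \<bar>g ?x\<bar> * \<bar>B e \<nu>\<bar>" by (simp add: abs_mult[symmetric])
        also have "\<dots> \<le> (C * (\<bar>u\<bar> * norm t)\<^sup>2) * M" using gx BM[of e \<nu>] e c(1) g(3) by (intro mult_mono) auto
        finally show ?thesis by (simp add: power_mult_distrib mult_ac)
      qed
      moreover have "M * (norm (?b - q))\<^sup>2 \<le> 4 * M * (norm t)\<^sup>2 * u\<^sup>2"
      proof -
        have "M * (norm (?b - q))\<^sup>2 \<le> M * (2 * (\<bar>u\<bar> * norm t))\<^sup>2" using nb c(3) by (intro mult_left_mono power_mono) auto
        also have "\<dots> = 4 * M * (norm t)\<^sup>2 * u\<^sup>2" by (simp add: power_mult_distrib mult_ac)
        finally show ?thesis .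
      qed
      moreover have "K * u\<^sup>2 = C * M * (norm t)\<^sup>2 * u\<^sup>2 + 4 * M * (norm t)\<^sup>2 * u\<^sup>2" unfolding K_def by (simp add: algebra_simps)
      ultimately show ?thesis by linarith
    qed
    have halve: "x / (2 * y) * y = x / 2" if "0 < y" for x y :: real using that by simp
    \<comment> \<open>The first bound stays in the range of the chart, the second makes the
      quadratic term at most half of the linear one; the sign of u below makes the linear term
      negative.\<close>
    define w where "w = min (\<delta> / (2 * (norm t + 1))) (\<bar>B e t\<bar> / (2 * (K + 1)))"
    have w: "0 < w" "w \<le> \<delta> / (2 * (norm t + 1))" "w \<le> \<bar>B e t\<bar> / (2 * (K + 1))"
      using g(2) ne K0 by (auto simp: w_def add_nonneg_pos)
    define u where "u = (if 0 < B e t then - w else w)"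
    have uB: "u * B e t = - (w * \<bar>B e t\<bar>)" "\<bar>u\<bar> = w" "u\<^sup>2 = w * w" using w(1) by (auto simp: u_def power2_eq_square)
    have "w * norm t \<le> \<delta> / (2 * (norm t + 1)) * (norm t + 1)" using w by (intro mult_mono) auto
    also have "\<dots> = \<delta> / 2" by (rule halve) (intro add_nonneg_pos norm_ge_zero zero_less_one)
    finally have "\<bar>u\<bar> * norm t < \<delta>" unfolding uB using g(2) by linarith
    from key[OF this] have "w * \<bar>B e t\<bar> \<le> w * (K * w)" unfolding uB by (simp add: mult_ac)
    then have "\<bar>B e t\<bar> \<le> K * w" using w(1) by (simp only: mult_le_cancel_left_pos)
    also have "\<dots> \<le> (K + 1) * (\<bar>B e t\<bar> / (2 * (K + 1)))" using w K0 by (intro mult_mono) auto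
    also have "\<dots> = \<bar>B e t\<bar> / 2" unfolding mult.commute[of "K + 1"] by (rule halve) (intro add_nonneg_pos K0 zero_less_one)
    finally show False using ne by simp
  qed
  have Bte: "B t e = 0" if "t \<bullet> e = 0" "t \<bullet> \<nu> = 0" for t
    using Bet[OF that] second_derivative_sym[OF c(4) diff c(3) lin(1) M2, of e t] by simp
  obtain K where K: "0 \<le> K"
    "\<And>x y m. norm (perp \<nu> (x - q)) \<le> m \<Longrightarrow> norm (perp \<nu> (y - q)) \<le> m \<Longrightarrow> m < \<delta> \<Longrightarrow> m \<le> 1 \<Longrightarrow>
      \<bar>(g y - g (?R y)) - (g x - g (?R x))\<bar> \<le> K * m\<^sup>2 * norm (perp \<nu> (y - x))"
    by (rule graph_odd_lipschitz[OF c(1) e en q(2) c(2,3) g(3,2) dr g(4) grad M1 M2 lin BM Bet Bte g(7) mvt]) (assumption | rule that)+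
  \<comment> \<open>324 = 18^2, since the odd part is compared at radius 18 \<rho>; C covers the
    height of the graph, and the summand 1 keeps L positive.\<close>
  define a where "a = 324 * K + C + 1"
  have a: "1 \<le> a" "324 * K \<le> a" "C \<le> a" using K(1) g(3) by (auto simp: a_def)
  obtain \<eta> where \<eta>: "0 < \<eta>" "\<And>\<delta>. 0 < \<delta> \<Longrightarrow> \<delta> \<le> \<eta> \<Longrightarrow> \<delta> < D \<Longrightarrow> short_energy s \<alpha> \<epsilon> \<delta> E < \<infinity>"
    by (rule short_energy_small) (rule that)
  have Rq: "?R q = q" using q(2) by (simp add: refln_def)
  have Rd: "?R x - q = ?S (x - q)" for x using refl_diff[of e l x q] by (simp add: Rq)
  have S\<nu>: "?S \<nu> = \<nu>" using ne0 by (simp add: refln_def)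
  have Sin: "?S v \<bullet> \<nu> = v \<bullet> \<nu>" for v using inner_refl_0[OF e, of v \<nu>] by (simp add: S\<nu>)
  have Rp: "norm (perp \<nu> (?R x - q)) = norm (perp \<nu> (x - q))" "(?R x - q) \<bullet> \<nu> = (x - q) \<bullet> \<nu>" for x
    unfolding Rd perp_refl_0[OF en] Sin using e by (simp_all add: norm_refl_0)
  \<comment> \<open>18 \<rho> must stay below \<delta> and 1 for the bound on the odd part, and 162,
    twice 81, makes C (9 \<rho>)^2 at most \<rho>/2.\<close>
  define \<rho>0 where "\<rho>0 = min (\<delta> / 19) (min (1 / 18) (min (D / 24) (min (\<kappa> / 13) (min \<eta> (1 / (162 * a))))))"
  have \<rho>0: "0 < \<rho>0" unfolding \<rho>0_def min_less_iff_conj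
    by (intro conjI divide_pos_pos mult_pos_pos g(2) D ka \<eta>(1)) (use a(1) in auto)
  show False
  proof (rule no_small_scale[OF \<rho>0])
    fix \<rho> assume \<rho>: "0 < \<rho>" "\<rho> \<le> \<rho>0"
    have r: "\<rho> \<le> \<delta> / 19" "\<rho> \<le> 1 / 18" "\<rho> \<le> D / 24" "\<rho> \<le> \<kappa> / 13" "\<rho> \<le> \<eta>" "\<rho> \<le> 1 / (162 * a)"
      using \<rho>(2) unfolding \<rho>0_def min.bounded_iff by blast+
    have \<rho>a: "\<rho> * a \<le> 1 / 162" using mult_right_mono[OF r(6), of a] a by simp
    \<comment> \<open>Moving the centre 6 \<rho> away from the plane keeps the cylinder of radius 3
      \<rho> at distance at least 3 \<rho> from it. The graph is still the one centred at q, now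
      used up to radius 9 \<rho>.\<close>
    define c' where "c' = q - (6 * \<rho>) *\<^sub>R e"
    define L where "L = a * \<rho>\<^sup>2"
    have pe: "perp \<nu> e = e" using en by (simp add: perp_def)
    have pq: "norm (perp \<nu> (x - q)) < 9 * \<rho>" if "norm (perp \<nu> (x - c')) < 3 * \<rho>" for x
    proof -
      have "perp \<nu> (x - q) = perp \<nu> (x - c') - (6 * \<rho>) *\<^sub>R e" by (simp add: c'_def perp_lin pe)
      then have "norm (perp \<nu> (x - q)) \<le> norm (perp \<nu> (x - c')) + 6 * \<rho>"
        using norm_triangle_ineq4[of "perp \<nu> (x - c')" "(6 * \<rho>) *\<^sub>R e"] e \<rho> by simp
      then show ?thesis using that by linarith
    qed
    have hq: "(x - c') \<bullet> \<nu> = (x - q) \<bullet> \<nu>" for x using en by (simp add: c'_def inner_diff_left)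
    have quad: "C * w\<^sup>2 \<le> \<rho> / 2" if "0 \<le> w" "w < 9 * \<rho>" for w
    proof -
      have "C * w\<^sup>2 \<le> a * (9 * \<rho>)\<^sup>2" using that a g(3) by (intro mult_mono power_mono) auto
      also have "\<dots> = 81 * (\<rho> * a) * \<rho>" by (simp add: power2_eq_square)
      also have "\<dots> \<le> 81 * (1 / 162) * \<rho>" using \<rho>a \<rho>(1) by (intro mult_right_mono) auto
      finally show ?thesis by simp
    qed
    show "gain \<le> (patch_const DIM('a) s * (a / 3)) * \<rho> powr (1 - s)"
    proof (rule patch_step[where p = q and c = c' and \<nu> = \<nu> and L = L and d\<^sub>0 = "3 * \<rho>" and g = g and gs = "\<lambda>x. g (?R x)"])
      show "q \<in> closure E" "?R q \<in> closure E" using q(1) Rq by (auto simp: frontier_def)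
      show "24 * \<rho> \<le> D" "13 * \<rho> \<le> \<kappa>" using r by auto
      show "norm (c' - q) \<le> 6 * \<rho>" using \<rho> e by (simp add: c'_def)
      show "0 < L" using \<rho>(1) a(1) by (simp add: L_def)
      have "80 * L = 80 * ((\<rho> * a) * \<rho>)" by (simp add: L_def power2_eq_square)
      also have "\<dots> \<le> 80 * ((1 / 162) * (1 / 18))" using \<rho>a r(2) \<rho>(1) by (intro mult_left_mono mult_mono) auto
      finally show "80 * L \<le> 1" by simp
      show "L \<le> a / 3 * (3 * \<rho>) * \<rho>" by (simp add: L_def power2_eq_square)
      show "short_energy s \<alpha> \<epsilon> (\<rho> / 2) E < \<infinity>" using \<rho>(1) r D by (intro \<eta>(2)) auto
      show "(\<lambda>x. g (?R x)) \<in> borel_measurable borel" using g(5) by measurable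
      show "g (?R (x + t *\<^sub>R \<nu>)) = g (?R x)" for x t
      proof -
        have "?R (x + t *\<^sub>R \<nu>) = ?R x + t *\<^sub>R \<nu>" using refl_add[of e l x "t *\<^sub>R \<nu>"] by (simp add: refl_0 S\<nu>)
        then show ?thesis by (simp add: g(6))
      qed
      show "x \<in> E \<longleftrightarrow> (x - c') \<bullet> \<nu> < g x" if "norm (perp \<nu> (x - c')) < 3 * \<rho>" "\<bar>(x - c') \<bullet> \<nu>\<bar> < 3 * \<rho>" for x
        using pq[OF that(1)] that(2) r(1) \<rho>(1) unfolding hq by (intro g(8)) linarith+
      show "?R x \<in> E \<longleftrightarrow> (x - c') \<bullet> \<nu> < g (?R x)" if "norm (perp \<nu> (x - c')) < 3 * \<rho>" "\<bar>(x - c') \<bullet> \<nu>\<bar> < 3 * \<rho>" for x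
        using pq[OF that(1)] that(2) r(1) \<rho>(1) g(8)[of "?R x"] unfolding hq Rp by linarith
      show "\<bar>g x\<bar> \<le> \<rho> / 2" "\<bar>g (?R x)\<bar> \<le> \<rho> / 2" if "norm (perp \<nu> (x - c')) < 3 * \<rho>" for x
      proof -
        have 1: "norm (perp \<nu> (x - q)) < 9 * \<rho>" by (rule pq[OF that])
        then have 2: "norm (perp \<nu> (x - q)) < \<delta>" using r(1) \<rho>(1) by linarith
        show "\<bar>g x\<bar> \<le> \<rho> / 2" using g(7)[OF 2] quad[OF norm_ge_zero 1] by linarith
        show "\<bar>g (?R x)\<bar> \<le> \<rho> / 2" using g(7)[of "?R x"] 2 quad[OF norm_ge_zero 1] unfolding Rp by linarith
      qed
      show lipG: "\<bar>(g y - g (?R y)) - (g x - g (?R x))\<bar> \<le> L * norm (perp \<nu> (y - x))"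
        if "norm (perp \<nu> (x - c')) < 3 * \<rho>" "norm (perp \<nu> (y - c')) < 3 * \<rho>" for x y
      proof -
        have "\<bar>(g y - g (?R y)) - (g x - g (?R x))\<bar> \<le> K * (9 * \<rho>)\<^sup>2 * norm (perp \<nu> (y - x))"
          using pq[OF that(1)] pq[OF that(2)] r(1,2) \<rho>(1) by (intro K(2)) linarith+
        also have "\<dots> \<le> L * norm (perp \<nu> (y - x))"
        proof (rule mult_right_mono)
          have "K * (9 * \<rho>)\<^sup>2 = 81 * K * \<rho>\<^sup>2" by (simp add: power2_eq_square)
          also have "\<dots> \<le> a * \<rho>\<^sup>2" using a(2) K(1) by (intro mult_right_mono) auto
          finally show "K * (9 * \<rho>)\<^sup>2 \<le> L" by (simp add: L_def)
        qed simp
        finally show ?thesis .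
      qed
      show "\<bar>g x - g (?R x)\<bar> \<le> 10 * \<rho> * L" if "norm (perp \<nu> (x - c')) < 3 * \<rho>" for x
      proof -
        \<comment> \<open>The projection of x to the plane, where g and its mirror image coincide;
          so the Lipschitz bound of their difference bounds the difference itself.\<close>
        define x0 where "x0 = x + (l - x \<bullet> e) *\<^sub>R e"
        have "x0 \<bullet> e = l" using e by (simp add: x0_def inner_add_left dot_square_norm)
        then have R0: "?R x0 = x0" by (simp add: refln_def)
        have 1: "norm (perp \<nu> (x - q)) < 9 * \<rho>" by (rule pq[OF that])
        have "l - x \<bullet> e = - (perp \<nu> (x - q) \<bullet> e)" using q(2) ne0 by (simp add: perp_def inner_diff_left)
        then have le: "\<bar>l - x \<bullet> e\<bar> < 9 * \<rho>" using inner_le_norm1[OF e, of "perp \<nu> (x - q)"] 1 by simp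
        have d: "perp \<nu> (x - x0) = - ((l - x \<bullet> e) *\<^sub>R e)" by (simp add: x0_def perp_lin pe)
        then have nd: "norm (perp \<nu> (x - x0)) = \<bar>l - x \<bullet> e\<bar>" using e by simp
        have "perp \<nu> (x0 - q) = perp \<nu> (x - q) - perp \<nu> (x - x0)" by (simp add: perp_lin)
        then have "norm (perp \<nu> (x0 - q)) \<le> norm (perp \<nu> (x - q)) + norm (perp \<nu> (x - x0))"
          using norm_triangle_ineq4[of "perp \<nu> (x - q)" "perp \<nu> (x - x0)"] by simp
        then have 2: "norm (perp \<nu> (x0 - q)) \<le> 18 * \<rho>" using 1 le nd by linarith
        have "\<bar>(g x - g (?R x)) - (g x0 - g (?R x0))\<bar> \<le> K * (18 * \<rho>)\<^sup>2 * norm (perp \<nu> (x - x0))"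
          using 1 2 r(1,2) \<rho>(1) by (intro K(2)) linarith+
        also have "\<dots> \<le> K * (18 * \<rho>)\<^sup>2 * (9 * \<rho>)" using le nd K(1) by (intro mult_left_mono) auto
        also have "\<dots> = 9 * ((324 * K) * \<rho>\<^sup>2 * \<rho>)" by (simp add: power2_eq_square)
        also have "\<dots> \<le> 10 * (a * \<rho>\<^sup>2 * \<rho>)" using a K(1) \<rho>(1) by (intro mult_mono) auto
        also have "\<dots> = 10 * \<rho> * L" by (simp add: L_def)
        finally show ?thesis using R0 by simp
      qed
      show "3 * \<rho> \<le> l - x \<bullet> e" if "norm (perp \<nu> (x - c')) < 3 * \<rho>" "\<bar>(x - c') \<bullet> \<nu>\<bar> < 3 * \<rho>" for x
      proof -
        have "perp \<nu> (x - c') \<bullet> e = (x - c') \<bullet> e" using ne0 by (simp add: perp_def inner_diff_left)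
        then have "(x - c') \<bullet> e < 3 * \<rho>" using inner_le_norm1[OF e, of "perp \<nu> (x - c')"] that(1) by linarith
        moreover have "(x - c') \<bullet> e = x \<bullet> e - l + 6 * \<rho>" using q(2) e by (simp add: c'_def inner_diff_left dot_square_norm)
        ultimately show ?thesis by linarith
      qed
    qed (use far \<rho> c(1) g(5,6) in auto)
  qed
qed

end

section \<open>Critical points are balls\<close>

lemma open_null_empty: "open U \<Longrightarrow> emeasure lborel U = 0 \<Longrightarrow> U = {}" for U :: "'a::euclidean_space set"
  using open_not_negligible[of U] by (auto simp: negligible_iff_null_sets null_sets_def emeasure_completion)

text \<open>If the asymmetric part had positive measure, either kind of contact would be impossible;
  so it is null. For an open set with smooth boundary, symmetry up to a null set is
  symmetry.\<close>

lemma critical_ball: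
  fixes E :: "'a::euclidean_space set" and s \<alpha> \<epsilon> D :: real
  assumes s: "0 < s" "s < 1" and al: "0 < \<alpha>" "\<alpha> < DIM('a)" and eps: "0 < \<epsilon>" and D: "0 < D"
    and mono: "\<epsilon> * \<alpha> * D powr (DIM('a) + s - \<alpha>) < DIM('a) + s"
    and E: "open E" "bounded E" "E \<noteq> {}" "smooth_boundary E"
    and crit: "\<And>X \<Phi>. test_field X \<Longrightarrow> flow_of X \<Phi> \<Longrightarrow>
      (\<forall>\<^sub>F t in nhds 0. \<Phi> t ` E \<in> sets borel \<and> emeasure lborel (\<Phi> t ` E) = emeasure lborel E) \<Longrightarrow>
      ((\<lambda>t. enn2real (energy s \<alpha> \<epsilon> (\<Phi> t ` E))) has_real_derivative 0) (at 0)"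
    and dm: "\<And>y z. y \<in> closure E \<Longrightarrow> z \<in> closure E \<Longrightarrow> norm (y - z) \<le> D / 2"
  shows "is_ball E"
proof (rule ball_of_symmetries[OF E(1-3)])
  fix e :: 'a assume e: "norm e = 1"
  have [measurable]: "E \<in> sets borel" using E(1) by simp
  have fin: "emeasure lborel E < \<infinity>" using emeasure_bounded_finite[OF E(2)] by (simp add: top.not_eq_extremum)
  note ic = frontier_not_interior_closure[OF E(4)]
  obtain l where l: "\<And>\<mu>. l \<le> \<mu> \<Longrightarrow> flips E e \<mu>"
    and con: "(\<exists>p\<in>frontier E. p \<bullet> e < l \<and> refln e l p \<in> frontier E) \<or>
     (\<exists>q\<in>frontier E. q \<bullet> e = l \<and> (\<forall>\<eta>>0. \<exists>x\<in>E. \<exists>\<tau>>0. x - \<tau> *\<^sub>R e \<notin> E \<and> norm (x - q) < \<eta> \<and> norm (x - \<tau> *\<^sub>R e - q) < \<eta>))"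
    by (rule moving_plane[OF E(1-3) ic e]) (assumption | rule that)+
  let ?R = "refln e l"
  define N where "N = {y. y \<in> E \<and> ?R y \<notin> E}"
  have [measurable]: "N \<in> sets borel" unfolding N_def by measurable
  have Nl: "y \<bullet> e < l" if y: "y \<in> N" for y
  proof (rule ccontr)
    assume "\<not> y \<bullet> e < l"
    then consider "l < y \<bullet> e" | "y \<bullet> e = l" by linarith
    then show False
    proof cases
      case 1 then show False using l[OF order_refl] y by (auto simp: flips_def N_def)
    next
      case 2 then show False using y by (auto simp: N_def refln_def)
    qed
  qed
  have null: "emeasure lborel N = 0"
  proof (rule ccontr)
    assume nz: "emeasure lborel N \<noteq> 0"
    have main: False if p: "p \<in> frontier E"
      and P: "\<And>\<kappa> A. contact s \<alpha> \<epsilon> D \<kappa> l E A e \<Longrightarrow> (\<And>y. y \<in> A \<Longrightarrow> \<kappa> \<le> norm (y - p)) \<Longrightarrow> False" for p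
    proof -
      have pE: "p \<notin> E" using p E(1) by (simp add: frontier_def interior_open)
      \<comment> \<open>Exhausts the asymmetric part by pieces away from the plane and from the
        contact point, which is not in \<open>E\<close>; one of them has positive measure.\<close>
      define A where "A k = {y. y \<in> N \<and> 1 / real (Suc k) \<le> l - y \<bullet> e \<and> 1 / real (Suc k) \<le> norm (y - p)}" for k
      have [measurable]: "A k \<in> sets borel" for k unfolding A_def by measurable
      have "N \<subseteq> (\<Union>k. A k)"
      proof
        fix y assume y: "y \<in> N"
        then have "y \<noteq> p" using pE by (auto simp: N_def)
        then have "0 < min (l - y \<bullet> e) (norm (y - p))" using Nl[OF y] by simp
        from reals_Archimedean[OF this] obtain k where "inverse (real (Suc k)) < min (l - y \<bullet> e) (norm (y - p))" ..
        then have "y \<in> A k" using y by (simp add: A_def inverse_eq_divide)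
        then show "y \<in> (\<Union>k. A k)" by blast
      qed
      then have NA: "N = (\<Union>k. A k)" by (auto simp: A_def)
      have "\<exists>k. emeasure lborel (A k) \<noteq> 0"
      proof (rule ccontr)
        assume "\<nexists>k. emeasure lborel (A k) \<noteq> 0"
        then have "emeasure lborel (\<Union>k. A k) = 0" by (intro emeasure_UN_eq_0) auto
        then show False using nz NA by simp
      qed
      then obtain k where k: "emeasure lborel (A k) \<noteq> 0" ..
      have "emeasure lborel (A k) \<le> emeasure lborel E" by (rule emeasure_mono) (auto simp: A_def N_def)
      then have "emeasure lborel (A k) < \<infinity>" using fin by (rule le_less_trans)
      then have pos: "0 < measure lborel (A k)" using k by (simp add: measure_def enn2real_positive_iff top.not_eq_extremum zero_less_iff_neq_zero)
      show False
      proof (rule P[of "1 / real (Suc k)" "A k"])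
        show "contact s \<alpha> \<epsilon> D (1 / real (Suc k)) l E (A k) e"
        proof (rule contact.intro)
          show "flips E e l" by (rule l) simp
          show "A k \<in> sets borel" by measurable
          show "y \<in> E \<and> ?R y \<notin> E \<and> 1 / real (Suc k) \<le> l - y \<bullet> e" if "y \<in> A k" for y using that by (auto simp: A_def N_def)
          show "0 < 1 / real (Suc k)" by simp
        qed (fact s al eps D mono E(1,2,4) crit e dm pos)+
        show "1 / real (Suc k) \<le> norm (y - p)" if "y \<in> A k" for y using that by (simp add: A_def)
      qed
    qed
    from con show False
    proof (elim disjE bexE conjE)
      fix p assume p: "p \<in> frontier E" "p \<bullet> e < l" "?R p \<in> frontier E"
      show False by (rule main[OF p(1)], erule contact.contact_interior[OF _ p]) blast
    next
      fix q assume q: "q \<in> frontier E" "q \<bullet> e = l"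
        and sq: "\<forall>\<eta>>0. \<exists>x\<in>E. \<exists>\<tau>>0. x - \<tau> *\<^sub>R e \<notin> E \<and> norm (x - q) < \<eta> \<and> norm (x - \<tau> *\<^sub>R e - q) < \<eta>"
      show False
      proof (rule main[OF q(1)])
        fix \<kappa> A assume c: "contact s \<alpha> \<epsilon> D \<kappa> l E A e" and far: "\<And>y. y \<in> A \<Longrightarrow> \<kappa> \<le> norm (y - q)"
        show False by (rule contact.contact_tangent[OF c q far sq[rule_format]])
      qed
    qed
  qed
  have rcont: "continuous_on UNIV ?R" unfolding refln_def by (intro continuous_intros)
  have oV: "open {y. ?R y \<in> E}" using open_vimage[OF E(1) rcont] by (simp only: vimage_def)
  \<comment> \<open>The points of \<open>E\<close> reflected outside the closure form an open subset
    of the null set \<open>N\<close>, hence there are none.\<close>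
  have V: "y \<in> closure E" if y: "?R y \<in> E" for y
  proof (rule ccontr)
    assume ny: "y \<notin> closure E"
    let ?U = "E \<inter> {x. ?R x \<in> - closure E}"
    have "open {x. ?R x \<in> - closure E}" using open_vimage[OF open_Compl[OF closed_closure] rcont] by (simp only: vimage_def)
    then have oU: "open ?U" using E(1) by (rule open_Int[rotated])
    have "?U \<subseteq> N" using closure_subset by (auto simp: N_def)
    then have "emeasure lborel ?U \<le> emeasure lborel N" by (rule emeasure_mono) measurable
    then have "?U = {}" using null by (intro open_null_empty[OF oU]) simp
    moreover have "?R y \<in> ?U" using y ny e by simp
    ultimately show False by blast
  qed
  have "x \<in> E" if "?R x \<in> E" for x
  proof (rule ccontr)
    assume "x \<notin> E"
    have xi: "x \<in> interior (closure E)" using V that oV by (intro interiorI[of "{y. ?R y \<in> E}"]) auto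
    then have "x \<in> frontier E" using \<open>x \<notin> E\<close> interior_subset[of "closure E"] E(1) by (auto simp: frontier_def interior_open)
    then show False using ic xi by blast
  qed
  then have "?R x \<in> E \<longleftrightarrow> x \<in> E" for x using refl_refl[OF e, of l x] by metis
  then show "\<exists>l. (\<forall>\<mu>\<ge>l. flips E e \<mu>) \<and> (\<forall>x. refln e l x \<in> E \<longleftrightarrow> x \<in> E)" using l by blast
qed

lemma F_eps_energy:
  fixes A :: "(real ^ 'n::finite) set"
  assumes A: "A \<in> sets borel"
  shows "F_eps s \<alpha> \<epsilon> A = energy s \<alpha> \<epsilon> A"
proof -
  have "frac_perimeter s A = (\<integral>\<^sup>+h. ennreal (1 / norm h powr (real CARD('n) + s)) * emeasure lborel {x. x \<in> A \<and> x + h \<in> - A} \<partial>lborel)"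
    unfolding frac_perimeter_def
    by (rule double_lebesgue[of A "- A" "\<lambda>r. ennreal (1 / r powr (real CARD('n) + s))"]) (use A in measurable)
  moreover have "riesz_energy \<alpha> A = (\<integral>\<^sup>+h. ennreal (1 / norm h powr \<alpha>) * emeasure lborel {x. x \<in> A \<and> x + h \<in> A} \<partial>lborel)"
    unfolding riesz_energy_def
    by (rule double_lebesgue[of A A "\<lambda>r. ennreal (1 / r powr \<alpha>)"]) (use A in measurable)
  ultimately show ?thesis
    by (simp only: F_eps_def energy_def powr_minus_divide Compl_iff) simp
qed

text \<open>With D twice the diameter, the factor 2^(n+s-\<alpha>) is less than 2^(n+1) and is
  absorbed by the assumed bound; the monotonicity condition then reduces to \<alpha> < n +
  s.\<close>

lemma small_critical_ball:
  fixes E :: "(real ^ 'n::finite) set"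
  assumes s: "0 < s" "s < 1" and al: "0 < \<alpha>" "\<alpha> < real CARD('n)" and eps: "0 < \<epsilon>"
    and E: "bounded_smooth_set E" and crit: "vol_critical (F_eps s \<alpha> \<epsilon>) E"
    and small: "\<epsilon> * diameter E powr (real CARD('n) + s - \<alpha>) \<le> 2 powr (- (real CARD('n) + 1))"
  shows "is_ball E"
proof -
  let ?n = "real CARD('n)" and ?g = "real CARD('n) + s - \<alpha>"
  have E': "open E" "bounded E" "E \<noteq> {}" "smooth_boundary E" using E by (auto simp: bounded_smooth_set_def)
  have dim: "real DIM(real ^ 'n) = ?n" by simp
  have dpos: "0 < diameter E"
  proof -
    obtain x where "x \<in> E" using E'(3) by blast
    then obtain r where r: "0 < r" "ball x r \<subseteq> E" using E'(1) openE by blast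
    obtain i :: "real ^ 'n" where i: "norm i = 1" using norm_Basis[OF SOME_Basis] by blast
    have "x + (r / 2) *\<^sub>R i \<in> E" using r i by (auto simp: dist_norm subset_eq)
    from diameter_bounded_bound[OF E'(2) this \<open>x \<in> E\<close>] show ?thesis using r i by (simp add: dist_norm)
  qed
  have g: "0 < ?g" "?g < ?n + 1" using al s by linarith+
  have "\<epsilon> * \<alpha> * (2 * diameter E) powr ?g = \<alpha> * (2 powr ?g * (\<epsilon> * diameter E powr ?g))"
    using dpos by (simp add: powr_mult mult_ac)
  also have "\<dots> \<le> \<alpha> * (2 powr (?n + 1) * 2 powr (- (?n + 1)))"
    using small g al eps by (intro mult_left_mono mult_mono powr_mono) auto
  also have "2 powr (?n + 1) * 2 powr (- (?n + 1)) = (1 :: real)" by (subst powr_add[symmetric]) simp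
  finally have mono: "\<epsilon> * \<alpha> * (2 * diameter E) powr ?g < ?n + s" using al s by linarith
  show ?thesis
  proof (rule critical_ball[where s = s and \<alpha> = \<alpha> and \<epsilon> = \<epsilon> and D = "2 * diameter E"])
    show "\<epsilon> * \<alpha> * (2 * diameter E) powr (real DIM(real ^ 'n) + s - \<alpha>) < real DIM(real ^ 'n) + s" unfolding dim by (rule mono)
    show "\<alpha> < real DIM(real ^ 'n)" unfolding dim by (rule al)
    show "norm (y - z) \<le> 2 * diameter E / 2" if "y \<in> closure E" "z \<in> closure E" for y z
      using diameter_bounded_bound[OF bounded_closure[OF E'(2)] that] unfolding diameter_closure[OF E'(2)] by (simp add: dist_norm)
    fix X :: "real ^ 'n \<Rightarrow> real ^ 'n" and \<Phi>
    assume X: "test_field X" "flow_of X \<Phi>" and ev: "\<forall>\<^sub>F t in nhds 0. \<Phi> t ` E \<in> sets borel \<and> emeasure lborel (\<Phi> t ` E) = emeasure lborel E"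
    have Eb: "E \<in> sets borel" using E'(1) by simp
    have "\<forall>\<^sub>F t in nhds 0. emeasure lebesgue (\<Phi> t ` E) = emeasure lebesgue E"
      using ev by (rule eventually_mono) (use Eb in simp)
    then have d: "((\<lambda>t. enn2real (F_eps s \<alpha> \<epsilon> (\<Phi> t ` E))) has_real_derivative 0) (at 0)"
      using crit X unfolding vol_critical_def by blast
    have eq: "\<forall>\<^sub>F t in nhds 0. enn2real (F_eps s \<alpha> \<epsilon> (\<Phi> t ` E)) = enn2real (energy s \<alpha> \<epsilon> (\<Phi> t ` E))"
      using ev by (rule eventually_mono) (simp add: F_eps_energy)
    show "((\<lambda>t. enn2real (energy s \<alpha> \<epsilon> (\<Phi> t ` E))) has_real_derivative 0) (at 0)"
      by (rule iffD1[OF DERIV_cong_ev[OF refl eq refl] d])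
  qed (use s al eps dpos E' in auto)
qed

lemma volume_le_diameter:
  fixes E :: "(real ^ 'n::finite) set"
  assumes E: "open E" "bounded E" "E \<noteq> {}"
  shows "measure lebesgue E \<le> unit_ball_vol CARD('n) * diameter E powr CARD('n)" "0 < measure lebesgue E" "0 < diameter E"
proof -
  have fin: "emeasure lborel E < \<infinity>" using emeasure_bounded_finite[OF E(2)] by (simp add: top.not_eq_extremum)
  have Eb: "E \<in> sets borel" using E(1) by simp
  have "emeasure lborel E \<noteq> 0" using open_null_empty[OF E(1)] E(3) by blast
  then have "0 < measure lborel E" using fin by (simp add: measure_def enn2real_positive_iff top.not_eq_extremum zero_less_iff_neq_zero)
  then show mpos: "0 < measure lebesgue E" using Eb by (simp add: measure_def)
  obtain x where x: "x \<in> E" using E(3) by blast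
  have sub: "E \<subseteq> cball x (diameter E)" using diameter_bounded_bound[OF E(2) x] by auto
  have d0: "0 \<le> diameter E" by (rule diameter_ge_0[OF E(2)])
  have "measure lebesgue E \<le> measure lebesgue (cball x (diameter E))"
    using sub Eb by (intro measure_mono_fmeasurable) auto
  also have "\<dots> = unit_ball_vol CARD('n) * diameter E ^ CARD('n)" using content_cball[OF d0, of x] by simp
  finally have v: "measure lebesgue E \<le> unit_ball_vol CARD('n) * diameter E ^ CARD('n)" .
  then have "diameter E \<noteq> 0" using mpos by (auto simp: zero_power)
  then show d: "0 < diameter E" using d0 by linarith
  then show "measure lebesgue E \<le> unit_ball_vol CARD('n) * diameter E powr CARD('n)" using v by (simp add: powr_realpow)
qed

text \<open>The exponent splits as 2n + s + 1 = g + q with g = n + s - \<alpha> and q = n + 1 +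
  \<alpha>. Raising the smallness condition to this power leaves a factor m^(q/n), or 1 in the
  normalised case, and the volume bound m \<le> \<omega> d^n compares it with d^q. Both forms lead
  to the same constant.\<close>

lemma scale_bound:
  fixes n s \<alpha> c d \<epsilon> \<omega> :: real
  assumes n: "0 < n" "0 < \<alpha>" "0 < s" "\<alpha> < n" and c: "0 < c" and d: "0 < d" and \<omega>: "0 < \<omega>"
  shows "0 < m \<Longrightarrow> m \<le> \<omega> * d powr n \<Longrightarrow> m powr ((n + s - \<alpha>) / ((2 * n + s + 1) * n)) \<le> c * (m powr (1 / n) / d) \<Longrightarrow>
      d powr (n + s - \<alpha>) \<le> c powr (2 * n + s + 1) * \<omega> powr ((n + 1 + \<alpha>) / n)"
    "0 < \<epsilon> \<Longrightarrow> 1 \<le> \<omega> * d powr n \<Longrightarrow> d \<le> c * \<epsilon> powr (- 1 / (2 * n + s + 1)) \<Longrightarrow>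
      \<epsilon> * d powr (n + s - \<alpha>) \<le> c powr (2 * n + s + 1) * \<omega> powr ((n + 1 + \<alpha>) / n)"
proof -
  define N q g where "N = 2 * n + s + 1" and "q = n + 1 + \<alpha>" and "g = n + s - \<alpha>"
  have pos: "0 < N" "0 < q" "0 < g" unfolding N_def q_def g_def using n by linarith+
  have Ng: "N = g + q" by (simp add: N_def q_def g_def)
  have dN: "d powr N = d powr g * d powr q" unfolding Ng by (rule powr_add)
  have pw: "(\<omega> * d powr n) powr (q / n) = \<omega> powr (q / n) * d powr q" using \<omega> d n by (simp add: powr_mult powr_powr)
  {
    assume m: "0 < m" "m \<le> \<omega> * d powr n" "m powr ((n + s - \<alpha>) / ((2 * n + s + 1) * n)) \<le> c * (m powr (1 / n) / d)"
    let ?b = "g / (N * n)"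
    have "m powr ?b * d \<le> c * m powr (1 / n)" using m(3) d unfolding N_def[symmetric] g_def[symmetric] by (simp add: pos_le_divide_eq)
    then have "d \<le> c * (m powr (1 / n) / m powr ?b)" using m(1) by (simp add: pos_le_divide_eq mult.commute)
    also have "m powr (1 / n) / m powr ?b = m powr (1 / n - ?b)" by (rule powr_diff[symmetric])
    finally have "d powr N \<le> (c * m powr (1 / n - ?b)) powr N" using d pos by (intro powr_mono2) auto
    also have "\<dots> = c powr N * m powr ((1 / n - ?b) * N)" using c by (simp add: powr_mult powr_powr)
    also have "(1 / n - ?b) * N = q / n"
    proof -
      have "(1 / n - ?b) * N = (N - g) / n" using n pos by (simp add: left_diff_distrib diff_divide_distrib)
      then show ?thesis by (simp add: Ng)
    qed
    also have "c powr N * m powr (q / n) \<le> c powr N * (\<omega> * d powr n) powr (q / n)"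
      using m(1,2) n pos by (intro mult_left_mono powr_mono2) auto
    finally have "d powr g * d powr q \<le> (c powr N * \<omega> powr (q / n)) * d powr q" unfolding pw dN by (simp only: mult.assoc)
    then show "d powr (n + s - \<alpha>) \<le> c powr (2 * n + s + 1) * \<omega> powr ((n + 1 + \<alpha>) / n)"
      using d unfolding N_def[symmetric] g_def[symmetric] q_def[symmetric] by simp
  next
    assume e: "0 < \<epsilon>" "1 \<le> \<omega> * d powr n" "d \<le> c * \<epsilon> powr (- 1 / (2 * n + s + 1))"
    have "d powr N \<le> (c * \<epsilon> powr (- 1 / N)) powr N" using e(3) d pos unfolding N_def[symmetric] by (intro powr_mono2) auto
    also have "\<dots> = c powr N * \<epsilon> powr (- 1)" using c pos by (simp add: powr_mult powr_powr)
    finally have 1: "\<epsilon> * d powr N \<le> c powr N" using e(1) by (simp add: powr_minus_divide pos_le_divide_eq mult.commute)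
    have "1 powr (q / n) \<le> (\<omega> * d powr n) powr (q / n)" using e(2) n pos by (intro powr_mono2) auto
    then have 2: "1 \<le> \<omega> powr (q / n) * d powr q" unfolding pw by simp
    have "\<epsilon> * d powr g * 1 \<le> \<epsilon> * d powr g * (\<omega> powr (q / n) * d powr q)" using 2 e(1) by (intro mult_left_mono) auto
    also have "\<dots> = (\<epsilon> * d powr N) * \<omega> powr (q / n)" unfolding dN by (simp add: mult_ac)
    also have "\<dots> \<le> c powr N * \<omega> powr (q / n)" using 1 by (intro mult_right_mono) auto
    finally show "\<epsilon> * d powr (n + s - \<alpha>) \<le> c powr (2 * n + s + 1) * \<omega> powr ((n + 1 + \<alpha>) / n)"
      unfolding N_def g_def q_def by simp
  }
qed

theorem theorem1:
  fixes s \<alpha> :: real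
  assumes "CARD('n::finite) \<ge> 2"
    and "0 < s" "s < 1"
    and "0 < \<alpha>" "\<alpha> < real CARD('n) - 1"
  shows "\<exists>c\<^sub>o > 0.
    (\<forall>E :: (real ^ 'n) set.
       bounded_smooth_set E \<and> vol_critical (F s \<alpha>) E \<and>
       measure lebesgue E powr
         ((real CARD('n) + s - \<alpha>) / ((2 * real CARD('n) + s + 1) * real CARD('n)))
         \<le> c\<^sub>o * iso_ratio E
       \<longrightarrow> is_ball E) \<and>
    (\<forall>\<epsilon> > 0. \<forall>E :: (real ^ 'n) set.
       bounded_smooth_set E \<and> vol_critical (F_eps s \<alpha> \<epsilon>) E \<and>
       measure lebesgue E = 1 \<and>
       diameter E \<le> c\<^sub>o * \<epsilon> powr (- 1 / (2 * real CARD('n) + s + 1))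
       \<longrightarrow> is_ball E)"
proof -
  let ?n = "real CARD('n)"
  let ?\<omega> = "unit_ball_vol ?n" and ?N = "2 * real CARD('n) + s + 1" and ?k = "2 powr (- (real CARD('n) + 1)) :: real"
  have n: "0 < ?n" "\<alpha> < ?n" using assms by linarith+
  have \<omega>: "0 < ?\<omega>" by simp
  \<comment> \<open>Solves c^(2n+s+1) \<omega>^((n+1+\<alpha>)/n) = 2^(-(n+1)), which links
    \<open>scale_bound\<close> to \<open>small_critical_ball\<close>; only n, s and \<alpha>
    enter.\<close>
  define c where "c = (?k * ?\<omega> powr (- ((?n + 1 + \<alpha>) / ?n))) powr (1 / ?N)"
  have c: "0 < c" by (simp add: c_def less_imp_neq[OF \<omega>, symmetric])
  have cN: "c powr ?N * ?\<omega> powr ((?n + 1 + \<alpha>) / ?n) = ?k"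
  proof -
    have "c powr ?N = ?k * ?\<omega> powr (- ((?n + 1 + \<alpha>) / ?n))" using \<omega> n assms(2) unfolding c_def by (simp add: powr_powr)
    then have "c powr ?N * ?\<omega> powr ((?n + 1 + \<alpha>) / ?n) = ?k * (?\<omega> powr (- ((?n + 1 + \<alpha>) / ?n)) * ?\<omega> powr ((?n + 1 + \<alpha>) / ?n))" by simp
    also have "?\<omega> powr (- ((?n + 1 + \<alpha>) / ?n)) * ?\<omega> powr ((?n + 1 + \<alpha>) / ?n) = 1"
      by (subst powr_add[symmetric]) (simp add: less_imp_neq[OF \<omega>, symmetric])
    finally show ?thesis by simp
  qed
  have F1: "F s \<alpha> = (F_eps s \<alpha> 1 :: (real ^ 'n) set \<Rightarrow> ennreal)" by (rule ext) (simp add: F_def F_eps_def)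
  have vol: "measure lebesgue E \<le> ?\<omega> * diameter E powr ?n" "0 < measure lebesgue E" "0 < diameter E"
    if "bounded_smooth_set E" for E :: "(real ^ 'n) set"
    using volume_le_diameter[of E] that by (auto simp: bounded_smooth_set_def)
  show ?thesis
  proof (rule exI[of _ c], intro conjI allI impI c)
    fix E :: "(real ^ 'n) set"
    assume E: "bounded_smooth_set E \<and> vol_critical (F s \<alpha>) E \<and>
      measure lebesgue E powr ((?n + s - \<alpha>) / (?N * ?n)) \<le> c * iso_ratio E"
    then have b: "bounded_smooth_set E" by blast
    have "diameter E powr (?n + s - \<alpha>) \<le> c powr ?N * ?\<omega> powr ((?n + 1 + \<alpha>) / ?n)"
      by (rule scale_bound(1)[OF n(1) assms(4,2) n(2) c vol(3)[OF b] \<omega> vol(2,1)[OF b]]) (use E in \<open>simp add: iso_ratio_def\<close>)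
    then have "1 * diameter E powr (?n + s - \<alpha>) \<le> ?k" unfolding cN by simp
    then show "is_ball E" using E unfolding F1 by (intro small_critical_ball[OF assms(2-4) n(2) zero_less_one b]) auto
  next
    fix \<epsilon> :: real and E :: "(real ^ 'n) set"
    assume e: "0 < \<epsilon>" and E: "bounded_smooth_set E \<and> vol_critical (F_eps s \<alpha> \<epsilon>) E \<and>
      measure lebesgue E = 1 \<and> diameter E \<le> c * \<epsilon> powr (- 1 / ?N)"
    then have b: "bounded_smooth_set E" by blast
    have "\<epsilon> * diameter E powr (?n + s - \<alpha>) \<le> c powr ?N * ?\<omega> powr ((?n + 1 + \<alpha>) / ?n)"
      by (rule scale_bound(2)[OF n(1) assms(4,2) n(2) c vol(3)[OF b] \<omega> e]) (use E vol(1)[OF b] in auto)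
    then show "is_ball E" using E unfolding cN by (intro small_critical_ball[OF assms(2-4) n(2) e b]) auto
  qed
qed

end
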